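(* Let $k=s+\frac12$, $s\in\mathbb Z$, let $m$ be an admissible index for weight $k$, let $\theta\in(\frac\pi3,\frac{2\pi}3)$ and $z=-\frac14+\frac14e^{i\theta}$. Put $v=0.2125$ if $\theta\in[\frac{5\pi}{12},\frac{7\pi}{12}]$ and $v=0.1375$ otherwise. Then $$e^{\frac{ik\theta}2}e^{-\frac{\pi m}2\sin\theta}\int_{-\frac12+iv}^{\frac12+iv}B_k(z;\tau)e(-m\tau)\,d\tau = e^{\frac{ik\theta}2}e^{-\frac{\pi m}2\sin\theta}f_{k,m}(z)-2\cos\!\Big(\tfrac{k\theta}2+\tfrac{\pi m}2-\tfrac{\pi m\cos\theta}2\Big)+\mathcal E,$$ where $\mathcal E=0$ if $\theta\in[\frac{5\pi}{12},\frac{7\pi}{12}]$, $\mathcal E=\mathcal C_{m,k}(\theta)$ if $\theta\in(\frac\pi3,\frac{5\pi}{12})$, and $\mathcal E=\mathcal D_{m,k}(\theta)$ if $\theta\in(\frac{7\pi}{12},\frac{2\pi}3)$. The integral is along the horizontal segment.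
   Context: Let $q=e^{2\pi i\tau}$, $e(x)=e^{2\pi i x}$, $\vartheta(\tau)=\sum_{n\in\mathbb Z}q^{n^2}$, and $j$ the modular $j$-invariant. For $k=s+\frac12$, $M_k^!$ is the space of holomorphic functions on the upper half plane, possibly with poles at the cusps, transforming like $\vartheta^{2k}$ under $\Gamma_0(4)$ and with Fourier expansion $\sum_{(-1)^sn\equiv0,1\,(4)}a(n)q^n$. Write $s=6\ell+\frac{k'}2$, $k'\in\{0,4,6,8,10,14\}$, $N=2\ell$ if $\ell$ even, $N=2\ell-(-1)^s$ if $\ell$ odd. An integer $m$ is admissible for weight $k$ if $m\ge -N$ and $(-1)^{s-1}m\equiv0,1\pmod4$; the canonical basis element is $f_{k,m}(\tau)=q^{-m}+\sum_{n>N,\,(-1)^sn\equiv0,1\,(4)}a_k(m,n)q^n\in M^!_k$. Let $f_k$ and $f_k^*$ be the first two elements of the canonical basis of $M_k^!$ (those with the two smallest admissible indices), and similarly $f_{2-k},f^*_{2-k}$ for $M^!_{2-k}$. Define $B_k(z;\tau)=\dfrac{f_k(z)f^*_{2-k}(\tau)+f_k^*(z)f_{2-k}(\tau)}{j(4\tau)-j(4z)}$, which for $\mathrm{Im}\,\tau$ large equals $\sum_m f_{k,m}(z)q^m$. Define $c_{m,k}=1+i$ if $m\equiv0\ (4)$ and $k+\frac12$ odd; $c_{m,k}=1-i$ if $m\equiv0\ (4)$ and $k+\frac12$ even; $c_{m,k}=0$ if $m\equiv1\ (4)$ and $k+\frac12$ even, or $m\equiv3\ (4)$ and $k+\frac12$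 odd. Define $d_{m,k}=1-i$ if $m\equiv1\ (4)$ and $k+\frac12$ even; $d_{m,k}=1+i$ if $m\equiv3\ (4)$ and $k+\frac12$ odd; $d_{m,k}=0$ if $m\equiv0\ (4)$. Set $\mathcal C_{m,k}(\theta)=-c_{m,k}(2i)^{-k}(\sin\frac\theta2)^{-k}e^{-\frac{\pi im}4}e^{\frac{\pi m}2\left(\frac1{2\tan(\theta/2)}-\sin\theta\right)}$ and $\mathcal D_{m,k}(\theta)=-d_{m,k}2^{-k}(\cos\frac\theta2)^{-k}e^{\frac{\pi im}4}e^{\frac{\pi m}2\left(\frac{\tan(\theta/2)}2-\sin\theta\right)}$, with principal branches of complex powers. *)

theory Defs
  imports "HOL-Complex_Analysis.Complex_Analysis"
begin

text \<open>Weights are encoded by the integer s, with k = s + 1/2.\<close>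

definition wt :: "int \<Rightarrow> real" where
  "wt s = real_of_int s + 1/2"

definition HH :: "complex set" where
  "HH = {\<tau>. Im \<tau> > 0}"

definition qexp :: "int \<Rightarrow> complex \<Rightarrow> complex" where
  "qexp n \<tau> = exp (2 * of_real pi * \<i> * of_int n * \<tau>)"

definition theta :: "complex \<Rightarrow> complex" where
  "theta \<tau> = (\<Sum>\<^sub>\<infinity>n::int. exp (2 * of_real pi * \<i> * of_int (n^2) * \<tau>))"

definition divsum :: "nat \<Rightarrow> nat \<Rightarrow> nat" where
  "divsum r n = (\<Sum>d\<in>{d. d dvd n}. d ^ r)"

definition E4 :: "complex \<Rightarrow> complex" where
  "E4 \<tau> = 1 + 240 * (\<Sum>n. of_nat (divsum 3 (Suc n)) * exp (2 * of_real pi * \<i> * of_nat (Suc n) * \<tau>))"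

definition E6 :: "complex \<Rightarrow> complex" where
  "E6 \<tau> = 1 - 504 * (\<Sum>n. of_nat (divsum 5 (Suc n)) * exp (2 * of_real pi * \<i> * of_nat (Suc n) * \<tau>))"

definition Delta :: "complex \<Rightarrow> complex" where
  "Delta \<tau> = (E4 \<tau> ^ 3 - E6 \<tau> ^ 2) / 1728"

definition jinv :: "complex \<Rightarrow> complex" where
  "jinv \<tau> = E4 \<tau> ^ 3 / Delta \<tau>"

definition mob :: "int \<Rightarrow> int \<Rightarrow> int \<Rightarrow> int \<Rightarrow> complex \<Rightarrow> complex" where
  "mob a b c d \<tau> = (of_int a * \<tau> + of_int b) / (of_int c * \<tau> + of_int d)"

definition plus_cond :: "int \<Rightarrow> int \<Rightarrow> bool" where
  "plus_cond s n \<longleftrightarrow> ((if even s then n else - n) mod 4 \<in> {0, 1})"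

text \<open>M^!_k for k = s + 1/2: holomorphic on the upper half plane, transforming like
  theta^(2k) = theta^(2s+1) under Gamma_0(4), meromorphic at all cusps (moderate growth),
  with Fourier expansion at infinity supported on the plus-space indices.\<close>
definition wh_mod :: "int \<Rightarrow> (complex \<Rightarrow> complex) \<Rightarrow> bool" where
  "wh_mod s f \<longleftrightarrow>
     f holomorphic_on HH \<and>
     (\<forall>a b c d. a * d - b * c = 1 \<and> 4 dvd c \<longrightarrow>
        (\<forall>\<tau>\<in>HH. f (mob a b c d \<tau>) = (theta (mob a b c d \<tau>) / theta \<tau>) powi (2 * s + 1) * f \<tau>)) \<and>
     (\<forall>a b c d. a * d - b * c = 1 \<longrightarrow>
        (\<forall>R::real. \<exists>C c0 y0::real. \<forall>\<tau>. \<bar>Re \<tau>\<bar> \<le> R \<and> Im \<tau> \<ge> y0 \<longrightarrow>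
            norm (f (mob a b c d \<tau>)) \<le> C * exp (c0 * Im \<tau>))) \<and>
     (\<exists>a::int \<Rightarrow> complex. (\<exists>n0. \<forall>n<n0. a n = 0) \<and> (\<forall>n. a n \<noteq> 0 \<longrightarrow> plus_cond s n) \<and>
        (\<forall>\<tau>\<in>HH. ((\<lambda>n. a n * qexp n \<tau>) has_sum f \<tau>) UNIV))"

definition ell :: "int \<Rightarrow> int" where
  "ell s = (THE l::int. \<exists>kp\<in>{0,4,6,8,10,14::int}. 2 * s = 12 * l + kp)"

definition Nw :: "int \<Rightarrow> int" where
  "Nw s = (if even (ell s) then 2 * ell s else 2 * ell s - (if even s then 1 else -1))"

definition admissible :: "int \<Rightarrow> int \<Rightarrow> bool" where
  "admissible s m \<longleftrightarrow> m \<ge> - Nw s \<and> plus_cond (s - 1) m"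

definition canonical_basis :: "int \<Rightarrow> (int \<Rightarrow> complex \<Rightarrow> complex) \<Rightarrow> bool" where
  "canonical_basis s F \<longleftrightarrow>
     (\<forall>m. admissible s m \<longrightarrow> wh_mod s (F m) \<and>
        (\<exists>a::int \<Rightarrow> complex. (\<forall>n. a n \<noteq> 0 \<longrightarrow> n > Nw s \<and> plus_cond s n) \<and>
           (\<forall>\<tau>\<in>HH. ((\<lambda>n. a n * qexp n \<tau>) has_sum (F m \<tau> - qexp (- m) \<tau>)) UNIV)))"

definition adm0 :: "int \<Rightarrow> int" where
  "adm0 s = (LEAST m. admissible s m)"

definition adm1 :: "int \<Rightarrow> int" where
  "adm1 s = (LEAST m. admissible s m \<and> m > adm0 s)"

text \<open>B_k(z;tau), with F the canonical basis of weight k = s+1/2 and G that of weight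
  2-k = (1-s)+1/2.\<close>
definition Bk :: "int \<Rightarrow> (int \<Rightarrow> complex \<Rightarrow> complex) \<Rightarrow> (int \<Rightarrow> complex \<Rightarrow> complex)
                  \<Rightarrow> complex \<Rightarrow> complex \<Rightarrow> complex" where
  "Bk s F G z \<tau> =
     (F (adm0 s) z * G (adm1 (1 - s)) \<tau> + F (adm1 s) z * G (adm0 (1 - s)) \<tau>)
       / (jinv (4 * \<tau>) - jinv (4 * z))"

text \<open>k + 1/2 = s + 1; "k+1/2 odd" iff s even.\<close>
definition cmk :: "int \<Rightarrow> int \<Rightarrow> complex" where
  "cmk m s = (if m mod 4 = 0 \<and> even s then 1 + \<i>
              else if m mod 4 = 0 \<and> odd s then 1 - \<i>
              else 0)"

definition dmk :: "int \<Rightarrow> int \<Rightarrow> complex" where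
  "dmk m s = (if m mod 4 = 1 \<and> odd s then 1 - \<i>
              else if m mod 4 = 3 \<and> even s then 1 + \<i>
              else 0)"

definition CC :: "int \<Rightarrow> int \<Rightarrow> real \<Rightarrow> complex" where
  "CC m s \<theta> = - cmk m s * (2 * \<i>) powr (- of_real (wt s))
       * of_real (sin (\<theta>/2) powr (- wt s))
       * exp (- of_real pi * \<i> * of_int m / 4)
       * of_real (exp (pi * m / 2 * (1 / (2 * tan (\<theta>/2)) - sin \<theta>)))"

definition DD :: "int \<Rightarrow> int \<Rightarrow> real \<Rightarrow> complex" where
  "DD m s \<theta> = - dmk m s * of_real (2 powr (- wt s))
       * of_real (cos (\<theta>/2) powr (- wt s))
       * exp (of_real pi * \<i> * of_int m / 4)
       * of_real (exp (pi * m / 2 * (tan (\<theta>/2) / 2 - sin \<theta>)))"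

end

theory Submission
  imports Defs "HOL-Probability.Probability"
begin

text \<open>
  Put \<open>T = 4 \<tau>\<close>. A form in the plus space of weight \<open>s + 1/2\<close> is the same thing as a pair \<open>(h\<^sub>0, h\<^sub>1)\<close> of
  functions of \<open>T\<close>, its even and odd part, that transforms under the full modular group by a two-dimensional
  multiplier. The pairing \<open>h\<^sub>0 g\<^sub>0 + h\<^sub>1 g\<^sub>1\<close> of weight \<open>k\<close> with weight \<open>2 - k\<close> is an ordinary form of weight 2,
  and a holomorphic form of weight 2 has mean value zero over a horizontal unit segment. Comparing leading
  terms, the first two basis elements of the two weights pair to \<open>0\<close> or to \<open>- j' / (2 \<pi> \<i>)\<close>, which makes the
  numerator of \<open>B\<^sub>k(z; \<tau>)\<close> equal to \<open>- j' / (2 \<pi> \<i>)\<close> on the diagonal \<open>T = 4 z\<close>.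

  Only the component of the kernel with the parity of \<open>m\<close> contributes to the integral. High up its integral
  is \<open>f\<^sub>k\<^sub>,\<^sub>m(z)\<close>: pairing the vector of \<open>f\<^sub>k\<^sub>,\<^sub>m\<close> with the numerator, subtracting \<open>f\<^sub>k\<^sub>,\<^sub>m(z)\<close> times the diagonal value and
  dividing by \<open>j(T) - j(4 z)\<close> leaves a holomorphic form of weight 2. Moving the segment down to \<open>Im T = 4 v\<close> picks up
  residues at the points \<open>T\<close> with \<open>j(T) = j(e\<^sup>i\<^sup>\<theta>)\<close>; with \<open>Z = e\<^sup>i\<^sup>\<theta>\<close> these are, up to translation, \<open>Z\<close> and
  \<open>- 1 / Z\<close>, which give the cosine, and on the outer arcs one of \<open>- 1 / (Z + 1)\<close>, \<open>- 1 / (Z - 1)\<close>, which gives the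
  error term. The finitely many angles where \<open>j'\<close> vanishes or the poles sit on the sides of the rectangle
  follow by continuity.
\<close>

section \<open>Periodic contour integrals\<close>

text \<open>The definitions shape the work. \<open>wh_mod\<close> expresses modularity by quotients
  of \<open>theta\<close>, so the branch of the half-integral automorphy factor has to be recovered
  from the inversion formula of \<open>theta\<close>; \<open>E4\<close> and \<open>E6\<close> are
  bare q-series, so their modularity comes from lattice sums and the Lipschitz formula. Two
  classical tools are replaced. \<open>Delta\<close> is zero-free by a numerical estimate on the
  fundamental domain instead of a product formula. The fibre of j over a point of the arc is found
  without the valence formula: j is real on the boundary of half the fundamental domain, strictly
  monotone along it, and non-real inside.

  In the middle range the poles Z and - 1 / Z have height sin \<theta> > 0.86, and all others lie
  below 0.7. In each outer range exactly one further pole per period lies above 0.55, and every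
  other one is at height 1/2 or lower.\<close>

text \<open>Near \<open>a\<close> the second factor has no zero, so the first vanishes on a disc and
  hence, by the identity theorem, on \<open>S\<close>. This cancels a factor known to be nonzero at
  a single point, such as \<open>theta\<close> at \<i> or j(T) - j(Z).\<close>

lemma holomorphic_mult_zero_imp_zero:
  assumes "f holomorphic_on S" "g holomorphic_on S" "open S" "connected S"
    and "\<And>z. z \<in> S \<Longrightarrow> f z * g z = 0" and "a \<in> S" "g a \<noteq> 0" and "w \<in> S"
  shows "f w = 0"
proof -
  have "continuous_on S g" using assms(2) holomorphic_on_imp_continuous_on by blast
  then obtain e1 where e1: "e1 > 0" "\<And>z. z \<in> S \<Longrightarrow> dist a z < e1 \<Longrightarrow> g z \<noteq> 0"
    using continuous_on_avoid[of S g a 0] assms by blast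
  obtain e2 where e2: "e2 > 0" "ball a e2 \<subseteq> S"
    using openE[OF \<open>open S\<close> \<open>a \<in> S\<close>] by blast
  define e where "e = min e1 e2"
  have e: "e > 0" "\<And>z. z \<in> ball a e \<Longrightarrow> z \<in> S \<and> g z \<noteq> 0"
    using e1 e2 by (auto simp: e_def)
  show ?thesis
  proof (rule analytic_continuation[of f S "ball a e" a w])
    show "a islimpt ball a e"
      using e(1) by (simp add: open_ball islimpt_ball mem_ball)
  qed (use assms e in \<open>auto\<close>)
qed

lemma contour_integral_linepath_shift:
  "contour_integral (linepath (a + c) (b + c)) f = contour_integral (linepath a b) (\<lambda>z. f (z + c))"
proof -
  have "linepath (a + c) (b + c) t = linepath a b t + c" for t
    by (simp add: linepath_def algebra_simps)
  then show ?thesis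
    by (simp add: contour_integral_integral vector_derivative_linepath_at fun_eq_iff)
qed

text \<open>Periodicity makes the vertical sides cancel, so the residue theorem compares two
  horizontal unit segments. All poles must lie strictly inside the rectangle, which is what makes
  some angles exceptional later.\<close>

lemma rectangle_residues_periodic:
  assumes hol: "f holomorphic_on S - pts" and S: "open S" "connected S" and fin: "finite pts"
    and box: "cbox (Complex x0 y1) (Complex (x0 + 1) y2) \<subseteq> S"
    and pts: "pts \<subseteq> box (Complex x0 y1) (Complex (x0 + 1) y2)"
    and y: "y1 < y2"
    and per: "\<And>t. y1 \<le> Im t \<Longrightarrow> Im t \<le> y2 \<Longrightarrow> f (t + 1) = f t"
  shows "contour_integral (linepath (Complex x0 y1) (Complex x0 y1 + 1)) f
        - contour_integral (linepath (Complex x0 y2) (Complex x0 y2 + 1)) f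
        = 2 * of_real pi * \<i> * (\<Sum>p\<in>pts. residue f p)"
proof -
  let ?a = "Complex x0 y1" and ?b = "Complex (x0 + 1) y2"
  let ?a2 = "Complex (x0 + 1) y1" and ?a4 = "Complex x0 y2"
  have le: "Re ?a \<le> Re ?b" "Im ?a \<le> Im ?b" using y by auto
  have pim: "path_image (rectpath ?a ?b) \<subseteq> S - pts"
    using path_image_rectpath_cbox_minus_box[OF le] box pts by blast
  have "contour_integral (rectpath ?a ?b) f
      = 2 * pi * \<i> * (\<Sum>p\<in>pts. winding_number (rectpath ?a ?b) p * residue f p)"
  proof (rule Residue_theorem[OF S fin hol])
    show "\<forall>z. z \<notin> S \<longrightarrow> winding_number (rectpath ?a ?b) z = 0"
      using winding_number_rectpath_outside[OF le] box by blast
  qed (use pim in auto)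
  also have "(\<Sum>p\<in>pts. winding_number (rectpath ?a ?b) p * residue f p) = (\<Sum>p\<in>pts. residue f p)"
    by (intro sum.cong refl) (use winding_number_rectpath pts in auto)
  finally have res: "contour_integral (rectpath ?a ?b) f = 2 * pi * \<i> * (\<Sum>p\<in>pts. residue f p)" .
  have cont: "continuous_on (path_image (rectpath ?a ?b)) f"
    using holomorphic_on_imp_continuous_on[OF hol] pim continuous_on_subset by blast
  have pi_eq: "path_image (rectpath ?a ?b) = closed_segment ?a ?a2 \<union> closed_segment ?a2 ?b
      \<union> closed_segment ?b ?a4 \<union> closed_segment ?a4 ?a"
    by (simp add: rectpath_def Let_def path_image_join Un_assoc)
  have int: "f contour_integrable_on linepath ?a ?a2" "f contour_integrable_on linepath ?a2 ?b"
      "f contour_integrable_on linepath ?b ?a4" "f contour_integrable_on linepath ?a4 ?a"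
    by (rule contour_integrable_continuous_linepath, rule continuous_on_subset[OF cont], use pi_eq in blast)+
  have "contour_integral (rectpath ?a ?b) f = contour_integral (linepath ?a ?a2) f
     + (contour_integral (linepath ?a2 ?b) f
     + (contour_integral (linepath ?b ?a4) f + contour_integral (linepath ?a4 ?a) f))"
    using int by (simp add: rectpath_def Let_def)
  also have "contour_integral (linepath ?a2 ?b) f = contour_integral (linepath (?a + 1) (?a4 + 1)) f"
    by (simp add: Complex_eq algebra_simps)
  also have "\<dots> = contour_integral (linepath ?a ?a4) f"
  proof (subst contour_integral_linepath_shift, rule contour_integral_eq)
    fix t assume "t \<in> path_image (linepath ?a ?a4)"
    then have "y1 \<le> Im t" "Im t \<le> y2"
      using y by (auto simp: closed_segment_same_Re closed_segment_eq_real_ivl)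
    then show "f (t + 1) = f t" by (rule per)
  qed
  also have "\<dots> = - contour_integral (linepath ?a4 ?a) f"
    by (rule contour_integral_reverse_linepath, rule continuous_on_subset[OF cont])
      (use pi_eq closed_segment_commute in blast)
  also have "contour_integral (linepath ?b ?a4) f = - contour_integral (linepath ?a4 ?b) f"
    by (rule contour_integral_reverse_linepath, rule continuous_on_subset[OF cont]) (use pi_eq in blast)
  finally show ?thesis
    using res by (simp add: Complex_eq algebra_simps)
qed

lemma open_HH [simp, intro]: "open HH"
  unfolding HH_def by (rule open_halfspace_Im_gt)

lemma convex_HH [simp, intro]: "convex HH"
  unfolding HH_def by (rule convex_halfspace_Im_gt)

lemma connected_HH [simp, intro]: "connected HH"
  by (simp add: convex_connected)

lemma ii_in_HH [simp]: "\<i> \<in> HH"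
  by (simp add: HH_def)

section \<open>The theta function\<close>

lemma holomorphic_on_infsum:
  fixes f :: "'a \<Rightarrow> complex \<Rightarrow> complex"
  assumes hol: "\<And>n. n \<in> I \<Longrightarrow> f n holomorphic_on S"
    and bnd: "\<And>z. z \<in> S \<Longrightarrow> \<exists>r>0. cball z r \<subseteq> S \<and>
                (\<exists>M. M summable_on I \<and> (\<forall>n\<in>I. \<forall>w\<in>cball z r. norm (f n w) \<le> M n))"
  shows "(\<lambda>z. \<Sum>\<^sub>\<infinity>n\<in>I. f n z) holomorphic_on S"
proof -
  have "(\<lambda>z. \<Sum>\<^sub>\<infinity>n\<in>I. f n z) field_differentiable at z" if "z \<in> S" for z
  proof -
    obtain r M where r: "r > 0" "cball z r \<subseteq> S" "M summable_on I"
      "\<And>n w. n \<in> I \<Longrightarrow> w \<in> cball z r \<Longrightarrow> norm (f n w) \<le> M n"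
      using bnd[OF \<open>z \<in> S\<close>] by blast
    have ul: "uniform_limit (cball z r) (\<lambda>X y. \<Sum>x\<in>X. f x y) (\<lambda>y. \<Sum>\<^sub>\<infinity>x\<in>I. f x y)
                (finite_subsets_at_top I)"
      by (rule Weierstrass_m_test_general) (use r in auto)
    have ev: "eventually (\<lambda>X. continuous_on (cball z r) (\<lambda>y. \<Sum>x\<in>X. f x y) \<and>
                (\<lambda>y. \<Sum>x\<in>X. f x y) holomorphic_on ball z r) (finite_subsets_at_top I)"
    proof (rule eventually_finite_subsets_at_top_weakI)
      fix X assume X: "finite X" "X \<subseteq> I"
      have "(\<lambda>y. \<Sum>x\<in>X. f x y) holomorphic_on cball z r"
        by (intro holomorphic_on_sum) (meson X hol r(2) holomorphic_on_subset subsetD)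
      then show "continuous_on (cball z r) (\<lambda>y. \<Sum>x\<in>X. f x y) \<and>
                (\<lambda>y. \<Sum>x\<in>X. f x y) holomorphic_on ball z r"
        using ball_subset_cball holomorphic_on_imp_continuous_on holomorphic_on_subset by blast
    qed
    have "(\<lambda>y. \<Sum>\<^sub>\<infinity>x\<in>I. f x y) holomorphic_on ball z r"
      by (rule holomorphic_uniform_limit[OF ev ul]) auto
    then show ?thesis
      using r(1) holomorphic_on_imp_differentiable_at by force
  qed
  then show ?thesis
    unfolding holomorphic_on_def using field_differentiable_at_within by blast
qed

lemma int_eq_nat_or_neg: "(UNIV :: int set) = range int \<union> range (\<lambda>n. - int n)"
proof -
  have "n \<in> range int \<union> range (\<lambda>n. - int n)" for n
    by (cases n rule: int_cases2) auto
  then show ?thesis by blast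
qed

lemma summable_on_intI:
  fixes f :: "int \<Rightarrow> real"
  assumes "summable (\<lambda>n. f (int n))" "summable (\<lambda>n. f (- int n))" "\<And>n. f n \<ge> 0"
  shows "f summable_on UNIV"
proof -
  have "f summable_on (range int)"
    by (subst summable_on_reindex)
      (use assms in \<open>auto simp: o_def inj_on_def intro!: norm_summable_imp_summable_on\<close>)
  moreover have "f summable_on (range (\<lambda>n. - int n))"
    by (subst summable_on_reindex)
      (use assms in \<open>auto simp: o_def inj_on_def intro!: norm_summable_imp_summable_on\<close>)
  ultimately show ?thesis
    unfolding int_eq_nat_or_neg by (rule summable_on_union)
qed

lemma summable_on_int_exp_neg_square:
  assumes "c > 0"
  shows "(\<lambda>n::int. exp (- (c * real_of_int n ^ 2))) summable_on UNIV"
proof -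
  have le: "exp (- (c * real n ^ 2)) \<le> exp (- c) ^ n" for n :: nat
  proof -
    have "real n \<le> real n ^ 2"
      by (cases "n = 0") (auto simp: power2_eq_square)
    then have "c * real n \<le> c * real n ^ 2" using assms by simp
    then show ?thesis by (simp add: exp_of_nat_mult [symmetric] mult.commute)
  qed
  have "summable (\<lambda>n. exp (- c) ^ n)"
    using assms by (intro summable_geometric) auto
  then have "summable (\<lambda>n. exp (- (c * real n ^ 2)))"
    by (rule summable_comparison_test'[of _ 0]) (use le in auto)
  then show ?thesis
    by (intro summable_on_intI) auto
qed

text \<open>Turns unconditional sums over the integers into limits of sequences. The half-open
  interval consists of M negative and M nonnegative indices, matching the two geometric expansions
  in \<open>gauss_poisson\<close>.\<close>

lemma filterlim_int_interval:
  "filterlim (\<lambda>M::nat. {- int M..<int M}) (finite_subsets_at_top UNIV) sequentially"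
  unfolding filterlim_finite_subsets_at_top
proof (intro allI impI)
  fix X :: "int set" assume X: "finite X \<and> X \<subseteq> UNIV"
  obtain K where K: "\<And>x. x \<in> X \<Longrightarrow> \<bar>x\<bar> \<le> K"
    using X finite_imageI[of X abs] by (metis Max.coboundedI image_eqI)
  show "\<forall>\<^sub>F M in sequentially. finite {- int M..<int M} \<and> X \<subseteq> {- int M..<int M} \<and> {- int M..<int M} \<subseteq> UNIV"
    using eventually_ge_at_top[of "nat K + 1"]
  proof eventually_elim
    case (elim M)
    then have "\<And>x. x \<in> X \<Longrightarrow> x \<in> {- int M..<int M}"
      using K by fastforce
    then show ?case by auto
  qed
qed

section \<open>Poisson summation for the Gaussian\<close>

text \<open>The Gaussian summed over integer translates. It is entire in z; its value at 0 is
  \<open>theta\<close> on the imaginary axis, and the behaviour under z + \<i> / t determines its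
  Fourier coefficients.\<close>

definition gauss_per :: "real \<Rightarrow> complex \<Rightarrow> complex" where
  "gauss_per t z = (\<Sum>\<^sub>\<infinity>n::int. exp (- of_real (pi * t) * (of_int n + z)^2))"

lemma gauss_per_bound:
  fixes z :: complex
  assumes "t > 0" "norm z \<le> R"
  shows "norm (exp (- of_real (pi * t) * (of_int n + z)^2)) \<le>
     exp (2 * pi * t * R^2) * exp (- (pi * t / 2 * real_of_int n ^ 2))"
proof -
  have z: "Re z ^ 2 + Im z ^ 2 \<le> R ^ 2"
    using assms(2) by (metis cmod_power2 norm_ge_zero power_mono)
  have "Re ((of_int n + z)^2) = (real_of_int n + Re z)^2 - Im z ^ 2"
    by (simp add: power2_eq_square)
  also have "\<dots> \<ge> real_of_int n ^ 2 / 2 - 2 * R ^ 2"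
  proof -
    \<comment> \<open>Half of this square is the difference of the two sides of the next
      inequality.\<close>
    have "(real_of_int n + 2 * Re z)^2 \<ge> 0" by simp
    then have "(real_of_int n + Re z)^2 \<ge> real_of_int n ^ 2 / 2 - Re z ^ 2"
      by (simp add: power2_eq_square algebra_simps)
    then show ?thesis using z by (smt (verit) zero_le_power2)
  qed
  finally have "pi * t * Re ((of_int n + z)^2) \<ge> pi * t * (real_of_int n ^ 2 / 2 - 2 * R ^ 2)"
    using assms by (intro mult_left_mono) auto
  then have "- (pi * t) * Re ((of_int n + z)^2) \<le> 2 * pi * t * R^2 - pi * t / 2 * real_of_int n ^ 2"
    by (simp add: algebra_simps)
  then show ?thesis
    by (simp add: norm_exp_eq_Re flip: exp_add)
qed

lemma gauss_per_bound_summable: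
  assumes "t > 0"
  shows "(\<lambda>n::int. exp (2 * pi * t * R^2) * exp (- (pi * t / 2 * real_of_int n ^ 2))) summable_on UNIV"
  by (intro summable_on_cmult_right summable_on_int_exp_neg_square) (use assms in auto)

lemma gauss_per_holomorphic:
  assumes "t > 0"
  shows "gauss_per t holomorphic_on A"
proof -
  have "gauss_per t holomorphic_on UNIV"
    unfolding gauss_per_def
  proof (rule holomorphic_on_infsum)
    fix z :: complex
    have "norm w \<le> norm z + 1" if "w \<in> cball z 1" for w
      using that norm_triangle_ineq2[of w z] by (auto simp: dist_norm norm_minus_commute)
    then show "\<exists>r>0. cball z r \<subseteq> UNIV \<and> (\<exists>M. M summable_on UNIV \<and> (\<forall>n\<in>UNIV. \<forall>w\<in>cball z r.
      norm (exp (- of_real (pi * t) * (of_int n + w)^2)) \<le> M n))"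
      using gauss_per_bound_summable[OF assms, of "norm z + 1"] gauss_per_bound[OF assms]
      by (intro exI[of _ 1] conjI
          exI[of _ "\<lambda>n. exp (2 * pi * t * (norm z + 1)^2) * exp (- (pi * t / 2 * real_of_int n ^ 2))"]) auto
  qed (auto intro!: holomorphic_intros)
  then show ?thesis by (rule holomorphic_on_subset) auto
qed

lemma gauss_per_plus_1: "gauss_per t (z + 1) = gauss_per t z"
  unfolding gauss_per_def
  by (rule infsum_reindex_bij_witness[of _ "\<lambda>n. n - 1" "\<lambda>n. n + 1"]) (auto simp: algebra_simps)

text \<open>Completing the square: the shift changes the n-th exponent by \<pi> / t - 2 \<pi> \<i> z
  - 2 \<pi> \<i> n, and the last summand is a period of the exponential.\<close>

lemma gauss_per_plus_quasi:
  assumes "t > 0"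
  shows "gauss_per t (z + \<i> / of_real t) = exp (of_real (pi / t) - 2 * of_real pi * \<i> * z) * gauss_per t z"
proof -
  have t: "complex_of_real t \<noteq> 0" using assms by simp
  have "exp (- of_real (pi * t) * (of_int n + (z + \<i> / of_real t))^2) =
        exp (of_real (pi / t) - 2 * of_real pi * \<i> * z) * exp (- of_real (pi * t) * (of_int n + z)^2)" for n
  proof -
    have "exp (- of_real (pi * t) * (of_int n + (z + \<i> / of_real t))^2) =
      exp (of_real (pi / t) - 2 * of_real pi * \<i> * z + (- of_real (pi * t) * (of_int n + z)^2)
          - 2 * of_int n * pi * \<i>)"
      using t by (intro arg_cong[where f = exp]) (simp add: field_simps power2_eq_square)
    also have "\<dots> = exp (of_real (pi / t) - 2 * of_real pi * \<i> * z + (- of_real (pi * t) * (of_int n + z)^2))"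
      by (subst exp_diff) (simp add: exp_integer_2pi mult_ac)
    finally show ?thesis by (simp only: exp_add)
  qed
  then show ?thesis
    unfolding gauss_per_def by (simp add: infsum_cmult_right')
qed

text \<open>The lopsided interval is the union of the unit intervals centred at -M, ..., M - 1,
  which is how it arises in \<open>gauss_coeff_0\<close>.\<close>

lemma filterlim_gauss_integral:
  assumes "t > 0"
  shows "(\<lambda>M::nat. integral {- real M - 1/2..real M - 1/2} (\<lambda>x. exp (- (pi * t * x\<^sup>2))))
           \<longlonglongrightarrow> 1 / sqrt t"
proof -
  \<comment> \<open>With this deviation the Gaussian is 1 / sqrt t times a normal density.\<close>
  define \<sigma> where "\<sigma> = 1 / sqrt (2 * pi * t)"
  have \<sigma>: "\<sigma> > 0" "\<sigma>\<^sup>2 = 1 / (2 * pi * t)" using assms by (auto simp: \<sigma>_def power_divide)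
  let ?f = "\<lambda>x::real. exp (- (pi * t * x\<^sup>2))"
  have f: "?f x = (1 / sqrt t) * normal_density 0 \<sigma> x" for x
    using assms unfolding normal_density_def \<sigma>
    by (simp add: real_sqrt_divide field_simps)
  have int: "integrable lborel ?f" "integral\<^sup>L lborel ?f = 1 / sqrt t"
    unfolding f using \<sigma> by auto
  have eq: "integral {- real M - 1/2..real M - 1/2} ?f =
      (LINT x|lborel. indicator {- real M - 1/2..real M - 1/2} x *\<^sub>R ?f x)" for M
  proof -
    have "set_integrable lborel {- real M - 1/2..real M - 1/2} ?f"
      by (rule set_integrable_subset[of _ UNIV]) (use int in \<open>auto simp: set_integrable_def\<close>)
    from set_borel_integral_eq_integral(2)[OF this] show ?thesis
      by (simp add: set_lebesgue_integral_def)
  qed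
  have "(\<lambda>M::nat. (LINT x|lborel. indicator {- real M - 1/2..real M - 1/2} x *\<^sub>R ?f x))
     \<longlonglongrightarrow> (LINT x|lborel. ?f x)"
  proof (rule integral_dominated_convergence[where w = ?f])
    show "AE x in lborel. (\<lambda>M::nat. indicator {- real M - 1/2..real M - 1/2} x *\<^sub>R ?f x) \<longlonglongrightarrow> ?f x"
    proof (intro AE_I2 tendsto_eventually)
      fix x :: real
      obtain K :: nat where "real K \<ge> \<bar>x\<bar> + 1/2" using real_arch_simple by blast
      show "\<forall>\<^sub>F M in sequentially. indicator {- real M - 1/2..real M - 1/2} x *\<^sub>R ?f x = ?f x"
        using eventually_ge_at_top[of K]
      proof eventually_elim
        case (elim M)
        then have "x \<in> {- real M - 1/2..real M - 1/2}"
          using \<open>real K \<ge> \<bar>x\<bar> + 1/2\<close> by (auto simp: abs_if split: if_splits)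
        then show ?case by simp
      qed
    qed
  qed (use int in \<open>auto simp: indicator_def\<close>)
  then show ?thesis using eq int by simp
qed

lemma residue_quotient:
  assumes "open S" "z \<in> S" "f holomorphic_on S" "g holomorphic_on S" "g z = 0"
    and "(g has_field_derivative g') (at z)" "g' \<noteq> 0" and "\<And>w. w \<in> S \<Longrightarrow> w \<noteq> z \<Longrightarrow> g w \<noteq> 0"
  shows "residue (\<lambda>w. f w / g w) z = f z / g'"
proof (rule residue_simple'[OF \<open>open S\<close> \<open>z \<in> S\<close>])
  show "(\<lambda>w. f w / g w) holomorphic_on S - {z}"
    using assms by (intro holomorphic_intros) (auto intro: holomorphic_on_subset)
  have 1: "((\<lambda>w. (g w - g z) / (w - z)) \<longlongrightarrow> g') (at z)"
    using assms(6) by (simp add: has_field_derivative_iff)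
  have 2: "(f \<longlongrightarrow> f z) (at z)"
    using assms(1-3) holomorphic_on_imp_continuous_on continuous_on_eq_continuous_at isCont_def by blast
  have "((\<lambda>w. f w / ((g w - g z) / (w - z))) \<longlongrightarrow> f z / g') (at z)"
    by (intro tendsto_divide 1 2 assms)
  then show "((\<lambda>w. f w / g w * (w - z)) \<longlongrightarrow> f z / g') (at z)"
    using assms(5) by simp
qed

abbreviation unit_seg :: "real \<Rightarrow> real \<Rightarrow> real \<Rightarrow> complex" where
  "unit_seg x y \<equiv> linepath (Complex x y) (Complex x y + 1)"

lemma closed_segment_unit_seg:
  "w \<in> closed_segment (Complex x y) (Complex x y + 1) \<longleftrightarrow> Im w = y \<and> x \<le> Re w \<and> Re w \<le> x + 1"
proof -
  have "closed_segment (Complex x y) (Complex x y + 1) = {w. Im w = y \<and> Re w \<in> closed_segment x (x + 1)}"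
    by (subst closed_segment_same_Im) (auto simp: )
  then show ?thesis by (auto simp: closed_segment_eq_real_ivl)
qed

lemma contour_integral_unit_seg_height:
  assumes hol: "f holomorphic_on {z. Im z > y0}" and per: "\<And>t. Im t > y0 \<Longrightarrow> f (t + 1) = f t" and "y1 > y0" "y2 > y0"
  shows "contour_integral (unit_seg x y1) f = contour_integral (unit_seg x y2) f"
proof -
  have *: "contour_integral (unit_seg x y1) f = contour_integral (unit_seg x y2) f"
    if "y0 < y1" "y1 < y2" for y1 y2
    using rectangle_residues_periodic[of f "{z. Im z > y0}" "{}" x y1 y2] that assms(1,2)
      open_halfspace_Im_gt[of y0] convex_connected[OF convex_halfspace_Im_gt[of y0]]
    by (auto simp: in_cbox_complex_iff subset_iff)
  show ?thesis
    by (cases y1 y2 rule: linorder_cases) (use assms * in auto)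
qed

lemma exp_2pi_int_period: "exp (2 * of_real pi * \<i> * of_int n * (z + 1)) = exp (2 * of_real pi * \<i> * of_int n * z)"
proof -
  have "exp (2 * of_real pi * \<i> * of_int n * (z + 1)) = exp (2 * of_real pi * \<i> * of_int n * z) * exp (2 * of_int n * of_real pi * \<i>)"
    unfolding exp_add[symmetric] by (rule arg_cong[where f = exp]) (simp add: algebra_simps)
  moreover have "exp (2 * of_int n * of_real pi * \<i>) = (1 :: complex)"
    using exp_2pi_1_int[of n] by (simp only: mult_ac)
  ultimately show ?thesis by simp
qed

text \<open>The Fourier coefficient of index - n, written as a contour integral so that the path can
  be moved vertically.\<close>

definition gauss_coeff :: "real \<Rightarrow> int \<Rightarrow> complex" where
  "gauss_coeff t n = contour_integral (unit_seg (-(1/2)) 0) (\<lambda>z. gauss_per t z * exp (2 * of_real pi * \<i> * of_int n * z))"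

lemma gauss_coeff_height:
  assumes "t > 0"
  shows "contour_integral (unit_seg (-(1/2)) y) (\<lambda>z. gauss_per t z * exp (2 * of_real pi * \<i> * of_int n * z))
        = gauss_coeff t n"
  unfolding gauss_coeff_def
  by (rule contour_integral_unit_seg_height[of _ "min y 0 - 1"])
    (auto intro!: holomorphic_intros gauss_per_holomorphic assms simp: gauss_per_plus_1 exp_2pi_int_period)

text \<open>Raising the segment by \<i> / t does not change the integral, while the
  quasi-periodicity factor lowers the frequency by one. This recursion reduces all coefficients to
  the one of index 0, a real Gaussian integral.\<close>

lemma gauss_coeff_step:
  assumes "t > 0"
  shows "gauss_coeff t n = exp (of_real ((1 - 2 * real_of_int n) * pi / t)) * gauss_coeff t (n - 1)"
proof -
  have t: "complex_of_real t \<noteq> 0" using assms by simp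
  have "gauss_coeff t n = contour_integral (linepath (Complex (-(1/2)) 0 + \<i> / of_real t) (Complex (-(1/2)) 0 + 1 + \<i> / of_real t))
     (\<lambda>z. gauss_per t z * exp (2 * of_real pi * \<i> * of_int n * z))"
  proof -
    have "Complex (-(1/2)) 0 + \<i> / of_real t = Complex (-(1/2)) (1/t)"
      by (simp add: complex_eq_iff)
    moreover have "Complex (-(1/2)) 0 + 1 + \<i> / of_real t = Complex (-(1/2)) (1/t) + 1"
      by (simp add: complex_eq_iff)
    ultimately show ?thesis using gauss_coeff_height[OF assms, of "1/t" n] by metis
  qed
  also have "\<dots> = contour_integral (unit_seg (-(1/2)) 0)
     (\<lambda>z. exp (of_real ((1 - 2 * real_of_int n) * pi / t)) *
       (gauss_per t z * exp (2 * of_real pi * \<i> * of_int (n - 1) * z)))"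
  proof (subst contour_integral_linepath_shift, rule arg_cong[where f = "contour_integral _"], rule ext)
    fix z
    have "exp (of_real (pi / t) - 2 * of_real pi * \<i> * z) * exp (2 * of_real pi * \<i> * of_int n * (z + \<i> / of_real t))
       = exp (of_real ((1 - 2 * real_of_int n) * pi / t)) * exp (2 * of_real pi * \<i> * of_int (n - 1) * z)"
      unfolding exp_add[symmetric] using t
      by (intro arg_cong[where f = exp]) (simp add: field_simps)
    then show "gauss_per t (z + \<i> / of_real t) * exp (2 * of_real pi * \<i> * of_int n * (z + \<i> / of_real t)) =
      exp (of_real ((1 - 2 * real_of_int n) * pi / t)) * (gauss_per t z * exp (2 * of_real pi * \<i> * of_int (n - 1) * z))"
      by (simp add: gauss_per_plus_quasi[OF assms] mult_ac)
  qed
  also have "\<dots> = exp (of_real ((1 - 2 * real_of_int n) * pi / t)) * gauss_coeff t (n - 1)"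
    unfolding gauss_coeff_def
    by (rule contour_integral_lmul, rule contour_integrable_continuous_linepath,
        rule holomorphic_on_imp_continuous_on, intro holomorphic_intros gauss_per_holomorphic assms)
  finally show ?thesis .
qed

lemma gauss_coeff_eq:
  assumes "t > 0"
  shows "gauss_coeff t n = exp (- of_real (pi * (1 / t)) * (of_int n)^2) * gauss_coeff t 0"
proof (induction n rule: int_induct[where k = 0])
  case base
  show ?case by simp
next
  case (step1 i)
  have "of_real ((1 - 2 * real_of_int (i + 1)) * pi / t) + (- of_real (pi * (1 / t)) * (of_int i)^2)
     = (- of_real (pi * (1 / t)) * (of_int (i + 1))^2 :: complex)"
    using assms by (simp add: divide_simps power2_eq_square) (simp add: algebra_simps)
  then show ?case
    using gauss_coeff_step[OF assms, of "i + 1"] step1(2) by (simp add: exp_add [symmetric] mult.assoc [symmetric])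
next
  case (step2 i)
  have "of_real ((1 - 2 * real_of_int i) * pi / t) + (- of_real (pi * (1 / t)) * (of_int (i - 1))^2)
     = (- of_real (pi * (1 / t)) * (of_int i)^2 :: complex)"
    using assms by (simp add: divide_simps power2_eq_square) (simp add: algebra_simps)
  then have "exp (of_real ((1 - 2 * real_of_int i) * pi / t)) * exp (- of_real (pi * (1 / t)) * (of_int (i - 1))^2)
     = (exp (- of_real (pi * (1 / t)) * (of_int i)^2) :: complex)"
    by (simp add: exp_add [symmetric])
  then have "exp (of_real ((1 - 2 * real_of_int i) * pi / t)) * gauss_coeff t (i - 1) =
     exp (of_real ((1 - 2 * real_of_int i) * pi / t)) * (exp (- of_real (pi * (1 / t)) * (of_int (i - 1))^2) * gauss_coeff t 0)"
    using gauss_coeff_step[OF assms, of i] step2(2) by (simp add: mult.assoc [symmetric])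
  then show ?case by simp
qed

lemma gauss_coeff_0:
  assumes "t > 0"
  shows "gauss_coeff t 0 = of_real (1 / sqrt t)"
proof -
  let ?g = "\<lambda>n::int. \<lambda>z. exp (- of_real (pi * t) * (of_int n + z)^2) :: complex"
  let ?h = "\<lambda>x::real. exp (- (pi * t * x\<^sup>2))"
  have hc: "continuous_on A ?h" for A by (intro continuous_intros)
  have ul: "uniform_limit (path_image (unit_seg (-(1/2)) 0)) (\<lambda>X z. \<Sum>n\<in>X. ?g n z) (gauss_per t) (finite_subsets_at_top UNIV)"
    unfolding gauss_per_def
  proof (rule Weierstrass_m_test_general[OF gauss_per_bound gauss_per_bound_summable])
    fix z assume "z \<in> path_image (unit_seg (-(1/2)) 0)"
    then have "Im z = 0" "\<bar>Re z\<bar> \<le> 1" by (auto simp: closed_segment_unit_seg)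
    then show "norm z \<le> 1" by (simp add: cmod_eq_Re)
  qed (use assms in auto)
  have int: "?g n contour_integrable_on p" if "p = linepath a b" for n p a b
    unfolding that by (intro contour_integrable_continuous_linepath continuous_intros)
  have "((\<lambda>X. contour_integral (unit_seg (-(1/2)) 0) (\<lambda>z. \<Sum>n\<in>X. ?g n z))
      \<longlongrightarrow> contour_integral (unit_seg (-(1/2)) 0) (gauss_per t)) (finite_subsets_at_top UNIV)"
  proof (rule contour_integral_uniform_limit(2)[OF _ ul])
    show "\<forall>\<^sub>F X in finite_subsets_at_top UNIV. (\<lambda>z. \<Sum>n\<in>X. ?g n z) contour_integrable_on unit_seg (-(1/2)) 0"
      by (intro always_eventually allI contour_integrable_continuous_linepath continuous_intros)
    show "norm (vector_derivative (unit_seg (-(1/2)) 0) (at t)) \<le> 1" for t by simp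
  qed auto
  from filterlim_compose[OF this filterlim_int_interval]
  have lim1: "(\<lambda>M. contour_integral (unit_seg (-(1/2)) 0) (\<lambda>z. \<Sum>n\<in>{- int M..<int M}. ?g n z))
      \<longlonglongrightarrow> gauss_coeff t 0"
    by (simp add: gauss_coeff_def)
  have hi: "?h integrable_on {a..b}" for a b by (intro integrable_continuous_interval hc)
  \<comment> \<open>Unfolding the periodisation: the n-th translate over [-1/2, 1/2] is the Gaussian
    itself over the unit interval around n, and these intervals tile the line.\<close>
  have trm: "contour_integral (unit_seg (-(1/2)) 0) (?g n) = of_real (integral {real_of_int n - 1/2..real_of_int n + 1/2} ?h)" for n
  proof -
    have "contour_integral (unit_seg (-(1/2)) 0) (?g n) =
      contour_integral (linepath (Complex (-(1/2)) 0 + of_int n) (Complex (-(1/2)) 0 + 1 + of_int n)) (\<lambda>z. exp (- of_real (pi * t) * z^2))"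
      by (subst contour_integral_linepath_shift) (simp add: add.commute)
    also have "\<dots> = integral {Re (Complex (-(1/2)) 0 + of_int n)..Re (Complex (-(1/2)) 0 + 1 + of_int n)}
       (\<lambda>x. exp (- of_real (pi * t) * (of_real x)^2))"
      by (rule contour_integral_linepath_Reals_eq) (auto simp: complex_is_Real_iff)
    also have "(\<lambda>x. exp (- of_real (pi * t) * (of_real x)^2)) = (\<lambda>x. complex_of_real (?h x))"
      by (simp add: exp_of_real [symmetric] del: exp_of_real)
    also have "integral {Re (Complex (-(1/2)) 0 + of_int n)..Re (Complex (-(1/2)) 0 + 1 + of_int n)} (\<lambda>x. complex_of_real (?h x))
       = of_real (integral {real_of_int n - 1/2..real_of_int n + 1/2} ?h)"
      using integral_linear[OF hi bounded_linear_of_real[where 'a = complex], of "real_of_int n - 1/2" "real_of_int n + 1/2"]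
      by (simp add: add.commute o_def)
    finally show ?thesis .
  qed
  have "contour_integral (unit_seg (-(1/2)) 0) (\<lambda>z. \<Sum>n\<in>{- int M..<int M}. ?g n z) =
      of_real (integral {- real M - 1/2..real M - 1/2} ?h)" for M
  proof -
    have "(\<Sum>n\<in>{- int M..<int M}. integral {real_of_int n - 1/2..real_of_int n + 1/2} ?h)
       = integral {- real M - 1/2..real M - 1/2} ?h"
    proof (induction M)
      case 0
      show ?case by simp
    next
      case (Suc M)
      have "{- int (Suc M)..<int (Suc M)} = insert (int M) (insert (- int M - 1) {- int M..<int M})"
        by auto
      then have "(\<Sum>n\<in>{- int (Suc M)..<int (Suc M)}. integral {real_of_int n - 1/2..real_of_int n + 1/2} ?h) =
        integral {real M - 1/2..real M + 1/2} ?h + (integral {- real M - 1 - 1/2..- real M - 1 + 1/2} ?h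
          + integral {- real M - 1/2..real M - 1/2} ?h)"
        using Suc by simp
      also have "integral {- real M - 1 - 1/2..- real M - 1 + 1/2} ?h + integral {- real M - 1/2..real M - 1/2} ?h
        = integral {- real M - 1 - 1/2..real M - 1/2} ?h"
        using Henstock_Kurzweil_Integration.integral_combine[OF _ _ hi, of "- real M - 1 - 1/2" "- real M - 1 + 1/2" "real M - 1/2"]
        by (cases "M = 0") (simp_all add: algebra_simps)
      also have "integral {real M - 1/2..real M + 1/2} ?h + \<dots> = integral {- real M - 1 - 1/2..real M + 1/2} ?h"
        using Henstock_Kurzweil_Integration.integral_combine[OF _ _ hi, of "- real M - 1 - 1/2" "real M - 1/2" "real M + 1/2"]
        by simp
      finally show ?case by (simp add: algebra_simps)
    qed
    then show ?thesis
      by (subst contour_integral_sum) (simp_all only: int[OF refl] trm of_real_sum [symmetric] finite_atLeastLessThan_int)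
  qed
  then have "(\<lambda>M. complex_of_real (integral {- real M - 1/2..real M - 1/2} ?h)) \<longlonglongrightarrow> gauss_coeff t 0"
    using lim1 by simp
  moreover have "(\<lambda>M. complex_of_real (integral {- real M - 1/2..real M - 1/2} ?h)) \<longlonglongrightarrow> of_real (1 / sqrt t)"
    by (intro tendsto_of_real filterlim_gauss_integral assms)
  ultimately show ?thesis by (rule LIMSEQ_unique)
qed

lemma sum_int_interval_split:
  fixes d :: "int \<Rightarrow> 'a :: comm_monoid_add"
  shows "(\<Sum>n\<in>{- int M..<int M}. d n) = (\<Sum>k<M. d (- int k - 1)) + (\<Sum>k<M. d (int k))"
proof (induction M)
  case (Suc M)
  have "{- int (Suc M)..<int (Suc M)} = insert (int M) (insert (- int M - 1) {- int M..<int M})"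
    by auto
  then show ?case using Suc by (simp add: add_ac)
qed auto

text \<open>A residue argument in place of a convergence theorem for Fourier series. With e(z) = exp
  (2 \<pi> \<i> z), the function \<open>gauss_per t\<close> / (e - 1) has residue
  \<open>gauss_per t 0\<close> / (2 \<pi> \<i>) at 0. On the line below the axis 1 / (e - 1) is
  expanded in powers of 1 / e, on the line above in powers of e; the terms integrate to the
  coefficients, and the remainders after M terms are O(exp (- \<pi> M)) because both lines have
  distance 1/2 from the axis.\<close>

lemma gauss_poisson:
  assumes "t > 0"
  shows "gauss_per t 0 = of_real (1 / sqrt t) * gauss_per (1 / t) 0"
proof -
  define ee where "ee z = exp (2 * of_real pi * \<i> * z)" for z
  let ?B = "gauss_per t"
  let ?seg = "unit_seg (-(1/2))"
  have ee_hol: "ee holomorphic_on A" for A unfolding ee_def by (intro holomorphic_intros)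
  have ee_1: "ee z = 1 \<longleftrightarrow> (\<exists>n::int. z = of_int n)" for z
  proof -
    have "ee z = 1 \<longleftrightarrow> Im z = 0 \<and> (\<exists>n::int. Re z = of_int n)"
      unfolding ee_def exp_eq_1 by auto
    then show ?thesis by (auto simp: complex_eq_iff)
  qed
  have ee_n: "ee z \<noteq> 1" if "Im z \<noteq> 0" for z using that ee_1 by auto
  have norm_ee: "norm (ee z) = exp (- 2 * pi * Im z)" for z by (simp add: ee_def norm_exp_eq_Re)
  have ee_nz: "ee z \<noteq> 0" for z by (simp add: ee_def)
  have ee_pow: "ee z ^ n = exp (2 * of_real pi * \<i> * of_int (int n) * z)" for n z
    by (simp add: ee_def mult_ac flip: exp_of_nat_mult)
  have ee_npow: "(1 / ee z) ^ Suc n = exp (2 * of_real pi * \<i> * of_int (- int n - 1) * z)" for n z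
  proof -
    have "1 / ee z = exp (- (2 * of_real pi * \<i> * z))"
      by (simp add: ee_def exp_minus divide_inverse)
    then show ?thesis
      by (simp only: exp_of_nat_mult[symmetric])
        (rule arg_cong[where f = exp], simp add: algebra_simps)
  qed
  have ee_per: "ee (z + 1) = ee z" for z
    using exp_2pi_int_period[of 1 z] by (simp add: ee_def)
  have B_cont: "continuous_on A ?B" for A
    using gauss_per_holomorphic[OF assms] holomorphic_on_imp_continuous_on by blast
  have ee_cont: "continuous_on A ee" for A
    using ee_hol holomorphic_on_imp_continuous_on by blast
  have cont: "continuous_on (closed_segment (Complex (-(1/2)) y) (Complex (-(1/2)) y + 1)) (\<lambda>z. ?B z / (ee z - 1))"
    if "y \<noteq> 0" for y
    by (intro continuous_intros B_cont ee_cont) (use ee_n that closed_segment_unit_seg in auto)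

  have res: "contour_integral (?seg (-(1/2))) (\<lambda>z. ?B z / (ee z - 1))
      - contour_integral (?seg (1/2)) (\<lambda>z. ?B z / (ee z - 1)) = ?B 0"
  proof -
    \<comment> \<open>Wide enough to contain the rectangle over [-1/2, 1/2], narrow enough to
      contain no integer but 0.\<close>
    define S where "S = {z. Re z < 3/4} \<inter> {z. Re z > -3/4}"
    have S: "open S" "connected S"
      unfolding S_def
      by (intro open_Int open_halfspace_Re_lt open_halfspace_Re_gt convex_connected convex_Int
          convex_halfspace_Re_lt convex_halfspace_Re_gt)+
    have nz: "ee z - 1 \<noteq> 0" if "z \<in> S" "z \<noteq> 0" for z
    proof
      assume "ee z - 1 = 0"
      then obtain n :: int where n: "z = of_int n" using ee_1[of z] by auto
      then have "\<bar>real_of_int n\<bar> < 1" using that by (auto simp: S_def)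
      then have "n = 0" by linarith
      then show False using n that by simp
    qed
    have d: "((\<lambda>z. ee z - 1) has_field_derivative (2 * of_real pi * \<i>)) (at 0)"
      unfolding ee_def by (auto intro!: derivative_eq_intros)
    have r: "residue (\<lambda>z. ?B z / (ee z - 1)) 0 = ?B 0 / (2 * of_real pi * \<i>)"
      by (rule residue_quotient[OF S(1) _ gauss_per_holomorphic[OF assms] _ _ d])
        (use nz in \<open>auto intro!: holomorphic_intros ee_hol simp: ee_def S_def\<close>)
    have "contour_integral (?seg (-(1/2))) (\<lambda>z. ?B z / (ee z - 1))
      - contour_integral (?seg (1/2)) (\<lambda>z. ?B z / (ee z - 1)) =
      2 * of_real pi * \<i> * (\<Sum>p\<in>{0}. residue (\<lambda>z. ?B z / (ee z - 1)) p)"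
      by (rule rectangle_residues_periodic[OF _ S])
        (use nz in \<open>auto intro!: holomorphic_intros ee_hol gauss_per_holomorphic assms
          simp: gauss_per_plus_1 ee_per S_def in_cbox_complex_iff in_box_complex_iff\<close>)
    then show ?thesis using r by simp
  qed

  have int_c: "(\<lambda>z. c * ?B z * ee z ^ k / (ee z - 1)) contour_integrable_on (?seg y)"
    "(\<lambda>z. c * ?B z * (1 / ee z) ^ k / (ee z - 1)) contour_integrable_on (?seg y)" if "y \<noteq> 0" for y k c
    by (intro contour_integrable_continuous_linepath continuous_intros B_cont ee_cont;
        use ee_n ee_nz that closed_segment_unit_seg in auto)+
  have int_p: "(\<lambda>z. ?B z * ee z ^ k) contour_integrable_on (?seg y)"
    "(\<lambda>z. ?B z * (1 / ee z) ^ k) contour_integrable_on (?seg y)" for y k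
    by (intro contour_integrable_continuous_linepath continuous_intros B_cont ee_cont;
        use ee_nz in auto)+
  define e1 where "e1 M = contour_integral (?seg (-(1/2))) (\<lambda>z. ?B z * (1 / ee z) ^ M / (ee z - 1))" for M
  define e2 where "e2 M = contour_integral (?seg (1/2)) (\<lambda>z. ?B z * ee z ^ M / (ee z - 1))" for M
  have bot: "contour_integral (?seg (-(1/2))) (\<lambda>z. ?B z / (ee z - 1)) =
      (\<Sum>k<M. gauss_coeff t (- int k - 1)) + e1 M" for M
  proof -
    have "contour_integral (?seg (-(1/2))) (\<lambda>z. ?B z / (ee z - 1)) =
      contour_integral (?seg (-(1/2))) (\<lambda>z. (\<Sum>k<M. ?B z * (1 / ee z) ^ Suc k) + ?B z * (1 / ee z) ^ M / (ee z - 1))"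
    proof (rule contour_integral_eq)
      fix z assume "z \<in> path_image (?seg (-(1/2)))"
      then have "ee z \<noteq> 1" using ee_n closed_segment_unit_seg by auto
      then have 1: "ee z - 1 \<noteq> 0" "1 / ee z \<noteq> 1" by auto
      have "(\<Sum>k<M. (1 / ee z) ^ k) = (1 - (1 / ee z) ^ M) / (1 - 1 / ee z)"
        using sum_gp_strict[of "1 / ee z" M] 1 by simp
      then have "(\<Sum>k<M. (1 / ee z) ^ Suc k) = (1 - (1 / ee z) ^ M) / (1 - 1 / ee z) / ee z"
        by (simp add: sum_divide_distrib [symmetric])
      also have "\<dots> = (1 - (1 / ee z) ^ M) / (ee z - 1)"
        using ee_nz[of z] 1 by (simp add: divide_simps)
      finally have sm: "(\<Sum>k<M. ?B z * (1 / ee z) ^ Suc k) = ?B z * ((1 - (1 / ee z) ^ M) / (ee z - 1))"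
        by (simp only: sum_distrib_left [symmetric])
      show "?B z / (ee z - 1) = (\<Sum>k<M. ?B z * (1 / ee z) ^ Suc k) + ?B z * (1 / ee z) ^ M / (ee z - 1)"
        unfolding sm by (simp add: diff_divide_distrib right_diff_distrib)
    qed
    also have "\<dots> = contour_integral (?seg (-(1/2))) (\<lambda>z. (\<Sum>k<M. ?B z * (1 / ee z) ^ Suc k)) + e1 M"
      unfolding e1_def using int_c(2)[of "-(1/2)" 1 M]
      by (subst contour_integral_add) (auto intro!: contour_integrable_sum int_p simp del: power_Suc)
    also have "contour_integral (?seg (-(1/2))) (\<lambda>z. (\<Sum>k<M. ?B z * (1 / ee z) ^ Suc k)) =
       (\<Sum>k<M. gauss_coeff t (- int k - 1))"
      by (subst contour_integral_sum)
        (simp_all only: int_p(2) finite_lessThan, simp only: ee_npow gauss_coeff_height[OF assms])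
    finally show ?thesis .
  qed
  have top: "contour_integral (?seg (1/2)) (\<lambda>z. ?B z / (ee z - 1)) =
      - (\<Sum>k<M. gauss_coeff t (int k)) + e2 M" for M
  proof -
    have "contour_integral (?seg (1/2)) (\<lambda>z. ?B z / (ee z - 1)) =
      contour_integral (?seg (1/2)) (\<lambda>z. ?B z * ee z ^ M / (ee z - 1) - (\<Sum>k<M. ?B z * ee z ^ k))"
    proof (rule contour_integral_eq)
      fix z assume "z \<in> path_image (?seg (1/2))"
      then have "ee z \<noteq> 1" using ee_n closed_segment_unit_seg by auto
      then have 1: "ee z - 1 \<noteq> 0" "1 - ee z \<noteq> 0" by auto
      have "(\<Sum>k<M. ee z ^ k) = (1 - ee z ^ M) / (1 - ee z)"
        using sum_gp_strict[of "ee z" M] \<open>ee z \<noteq> 1\<close> by simp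
      also have "\<dots> = - (1 - ee z ^ M) / (ee z - 1)"
        using 1 by (simp add: divide_simps) (simp add: algebra_simps)
      finally have sm: "(\<Sum>k<M. ?B z * ee z ^ k) = ?B z * (- (1 - ee z ^ M) / (ee z - 1))"
        by (simp only: sum_distrib_left [symmetric])
      show "?B z / (ee z - 1) = ?B z * ee z ^ M / (ee z - 1) - (\<Sum>k<M. ?B z * ee z ^ k)"
        unfolding sm by (simp add: diff_divide_distrib right_diff_distrib)
    qed
    also have "\<dots> = e2 M - contour_integral (?seg (1/2)) (\<lambda>z. (\<Sum>k<M. ?B z * ee z ^ k))"
      unfolding e2_def using int_c(1)[of "1/2" 1 M]
      by (subst contour_integral_diff) (auto intro!: contour_integrable_sum int_p)
    also have "contour_integral (?seg (1/2)) (\<lambda>z. (\<Sum>k<M. ?B z * ee z ^ k)) = (\<Sum>k<M. gauss_coeff t (int k))"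
      by (subst contour_integral_sum)
        (simp_all only: int_p(1) finite_lessThan, simp only: ee_pow gauss_coeff_height[OF assms])
    finally show ?thesis by simp
  qed
  have small: "X \<longlonglongrightarrow> 0" if X: "\<And>M. norm (X M) \<le> K * exp (- pi) ^ M" for X :: "nat \<Rightarrow> complex" and K :: real
  proof (rule Lim_null_comparison[of _ "\<lambda>M. K * exp (- pi) ^ M"])
    have "(\<lambda>M. exp (- pi) ^ M) \<longlonglongrightarrow> 0" by (rule LIMSEQ_power_zero) auto
    from tendsto_mult_left[OF this, of K] show "(\<lambda>M. K * exp (- pi) ^ M) \<longlonglongrightarrow> 0" by simp
  qed (use X in auto)
  have bd: "\<exists>K. \<forall>z\<in>closed_segment (Complex (-(1/2)) y) (Complex (-(1/2)) y + 1). norm (?B z / (ee z - 1)) \<le> K" if "y \<noteq> 0" for y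
    using compact_imp_bounded[OF compact_continuous_image[OF cont[OF that] compact_segment]]
    unfolding bounded_iff by auto
  have e1: "e1 \<longlonglongrightarrow> 0"
  proof -
    obtain K where K: "\<And>z. z\<in>closed_segment (Complex (-(1/2)) (-(1/2))) (Complex (-(1/2)) (-(1/2)) + 1) \<Longrightarrow> norm (?B z / (ee z - 1)) \<le> K"
      using bd[of "-(1/2)"] by auto
    have K0: "K \<ge> 0" using K[of "Complex (-(1/2)) (-(1/2))"] norm_ge_zero order_trans by blast
    have "norm (e1 M) \<le> K * exp (- pi) ^ M * norm (Complex (-(1/2)) (-(1/2)) + 1 - Complex (-(1/2)) (-(1/2)))" for M
      unfolding e1_def
    proof (rule contour_integral_bound_linepath)
      fix z assume z: "z \<in> closed_segment (Complex (-(1/2)) (-(1/2))) (Complex (-(1/2)) (-(1/2)) + 1)"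
      have "norm (?B z * (1 / ee z) ^ M / (ee z - 1)) = norm (?B z / (ee z - 1)) * (1 / norm (ee z)) ^ M"
        by (simp add: norm_mult norm_divide norm_power)
      also have "norm (ee z) = exp pi"
        using z unfolding closed_segment_unit_seg norm_ee by simp
      also have "1 / exp pi = exp (- pi)"
        by (simp only: exp_minus inverse_eq_divide)
      finally show "norm (?B z * (1 / ee z) ^ M / (ee z - 1)) \<le> K * exp (- pi) ^ M"
        using mult_right_mono[OF K[OF z], of "exp (- pi) ^ M"] by simp
    qed (use K0 int_c(2)[of "-(1/2)" 1 M] in auto)
    then show ?thesis by (intro small) auto
  qed
  have e2: "e2 \<longlonglongrightarrow> 0"
  proof -
    obtain K where K: "\<And>z. z\<in>closed_segment (Complex (-(1/2)) (1/2)) (Complex (-(1/2)) (1/2) + 1) \<Longrightarrow> norm (?B z / (ee z - 1)) \<le> K"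
      using bd[of "1/2"] by auto
    have K0: "K \<ge> 0" using K[of "Complex (-(1/2)) (1/2)"] norm_ge_zero order_trans by blast
    have "norm (e2 M) \<le> K * exp (- pi) ^ M * norm (Complex (-(1/2)) (1/2) + 1 - Complex (-(1/2)) (1/2))" for M
      unfolding e2_def
    proof (rule contour_integral_bound_linepath)
      fix z assume z: "z \<in> closed_segment (Complex (-(1/2)) (1/2)) (Complex (-(1/2)) (1/2) + 1)"
      have "norm (?B z * ee z ^ M / (ee z - 1)) = norm (?B z / (ee z - 1)) * norm (ee z) ^ M"
        by (simp add: norm_mult norm_divide norm_power)
      also have "norm (ee z) = exp (- pi)"
        using z unfolding closed_segment_unit_seg norm_ee by simp
      finally show "norm (?B z * ee z ^ M / (ee z - 1)) \<le> K * exp (- pi) ^ M"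
        using mult_right_mono[OF K[OF z], of "exp (- pi) ^ M"] by simp
    qed (use K0 int_c(1)[of "1/2" 1 M] in auto)
    then show ?thesis by (intro small) auto
  qed
  have "(\<Sum>n\<in>{- int M..<int M}. gauss_coeff t n) = ?B 0 - e1 M + e2 M" for M
    unfolding sum_int_interval_split res[symmetric] bot[of M] top[of M] by simp
  moreover have "(\<lambda>M. ?B 0 - e1 M + e2 M) \<longlonglongrightarrow> ?B 0 - 0 + 0"
    by (intro tendsto_intros e1 e2)
  ultimately have lim1: "(\<lambda>M. \<Sum>n\<in>{- int M..<int M}. gauss_coeff t n) \<longlonglongrightarrow> ?B 0" by simp
  have "(\<lambda>n::int. exp (- of_real (pi * (1 / t)) * (of_int n)^2) :: complex) summable_on UNIV"
  proof (rule abs_summable_summable)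
    have "(\<lambda>n::int. exp (- (pi * (1 / t) * real_of_int n ^ 2))) summable_on UNIV"
      by (rule summable_on_int_exp_neg_square) (use assms in auto)
    then show "(\<lambda>n::int. norm (exp (- of_real (pi * (1 / t)) * (of_int n)^2) :: complex)) summable_on UNIV"
      using assms by (simp add: norm_exp_eq_Re Re_divide power2_eq_square)
  qed
  then have "((\<lambda>n::int. exp (- of_real (pi * (1 / t)) * (of_int n)^2)) has_sum gauss_per (1 / t) 0) UNIV"
    by (simp add: gauss_per_def)
  from filterlim_compose[OF this[unfolded has_sum_def] filterlim_int_interval]
  have "(\<lambda>M. (\<Sum>n\<in>{- int M..<int M}. exp (- of_real (pi * (1 / t)) * (of_int n)^2) :: complex)) \<longlonglongrightarrow> gauss_per (1 / t) 0"
    by simp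
  from tendsto_mult_right[OF this, of "gauss_coeff t 0"]
  have "(\<lambda>M. (\<Sum>n\<in>{- int M..<int M}. gauss_coeff t n)) \<longlonglongrightarrow> gauss_per (1 / t) 0 * gauss_coeff t 0"
    unfolding sum_distrib_right gauss_coeff_eq[OF assms, symmetric] .
  then show ?thesis
    using LIMSEQ_unique[OF lim1] gauss_coeff_0[OF assms] by (simp add: mult.commute)
qed

section \<open>Inversion of theta and its transformation under level 4\<close>

lemma theta_holomorphic: "theta holomorphic_on HH"
  unfolding theta_def
proof (rule holomorphic_on_infsum)
  fix z assume z: "z \<in> HH"
  define r where "r = Im z / 2"
  have r: "r > 0" using z by (simp add: r_def HH_def)
  have im: "Im w \<ge> r" if "w \<in> cball z r" for w
    using abs_Im_le_cmod[of "z - w"] that by (auto simp: dist_norm r_def)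
  have sm: "(\<lambda>n::int. exp (- (2 * pi * r * real_of_int n ^ 2))) summable_on UNIV"
    using r by (intro summable_on_int_exp_neg_square) auto
  have "norm (exp (2 * of_real pi * \<i> * of_int (n^2) * w)) \<le> exp (- (2 * pi * r * real_of_int n ^ 2))"
    if "w \<in> cball z r" for n w
    using mult_right_mono[OF im[OF that], of "2 * pi * real_of_int n ^ 2"]
    by (simp add: norm_exp_eq_Re mult_ac)
  moreover have "cball z r \<subseteq> HH"
    using im r by (fastforce simp: HH_def)
  ultimately show "\<exists>r>0. cball z r \<subseteq> HH \<and> (\<exists>M. M summable_on UNIV \<and>
      (\<forall>n\<in>UNIV. \<forall>w\<in>cball z r. norm (exp (2 * of_real pi * \<i> * of_int (n^2) * w)) \<le> M n))"
    using r sm by blast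
qed (auto intro!: holomorphic_intros)

lemma theta_plus_1: "theta (z + 1) = theta z"
  unfolding theta_def exp_2pi_int_period ..

lemma theta_imag_axis: "theta (\<i> * of_real y) = gauss_per (2 * y) 0"
  unfolding theta_def gauss_per_def
  by (rule infsum_cong, rule arg_cong[where f = exp]) (simp add: algebra_simps)

text \<open>The principal roots have argument strictly between - \<pi> / 4 and \<pi> / 4, so their
  product still lies in the right half plane and is principal.\<close>

lemma csqrt_mult_right_half:
  assumes "Re a > 0" "Re b > 0"
  shows "csqrt (a * b) = csqrt a * csqrt b"
proof (rule csqrt_unique)
  have *: "\<bar>Im (csqrt a)\<bar> < Re (csqrt a)" if "Re a > 0" for a
  proof -
    have "Re a = Re (csqrt a) ^ 2 - Im (csqrt a) ^ 2"
      using arg_cong[OF power2_csqrt[of a], of Re] by (simp add: power2_eq_square)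
    then have "\<bar>Im (csqrt a)\<bar> ^ 2 < Re (csqrt a) ^ 2" using that unfolding power2_abs by linarith
    then show ?thesis using power_less_imp_less_base Re_csqrt by blast
  qed
  have "\<bar>Im (csqrt a) * Im (csqrt b)\<bar> < Re (csqrt a) * Re (csqrt b)"
    unfolding abs_mult using *[OF assms(1)] *[OF assms(2)] by (intro mult_strict_mono) linarith+
  then show "0 < Re (csqrt a * csqrt b) \<or> Re (csqrt a * csqrt b) = 0 \<and> 0 \<le> Im (csqrt a * csqrt b)"
    by auto
qed (simp add: power_mult_distrib)

lemma Im_neg_inverse: "Im (- 1 / z) = Im z / norm z ^ 2"
  by (simp add: Im_divide cmod_power2)

lemma HH_neg_inverse: "z \<in> HH \<Longrightarrow> - 1 / z \<in> HH"
  unfolding HH_def mem_Collect_eq Im_neg_inverse by (intro divide_pos_pos) auto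

text \<open>On the imaginary axis this is Poisson summation with t = 2 y, and the identity theorem
  extends it: the argument of the square root has positive real part on all of \<open>HH\<close>, so
  the branch cut is avoided.\<close>

lemma theta_inversion:
  assumes "\<tau> \<in> HH"
  shows "theta (- 1 / (4 * \<tau>)) = csqrt (- 2 * \<i> * \<tau>) * theta \<tau>"
proof -
  let ?f = "\<lambda>\<tau>. theta (- 1 / (4 * \<tau>)) - csqrt (- 2 * \<i> * \<tau>) * theta \<tau>"
  have nz: "z \<noteq> 0" if "z \<in> HH" for z using that by (auto simp: HH_def)
  have inv: "- 1 / (4 * z) \<in> HH" if "z \<in> HH" for z
    using that by (intro HH_neg_inverse) (simp add: HH_def)
  have hol: "?f holomorphic_on HH"
  proof (intro holomorphic_intros theta_holomorphic)
    have "theta \<circ> (\<lambda>z. - 1 / (4 * z)) holomorphic_on HH"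
      by (rule holomorphic_on_compose_gen[OF _ theta_holomorphic])
        (auto intro!: holomorphic_intros simp: nz inv[simplified])
    then show "(\<lambda>z. theta (- 1 / (4 * z))) holomorphic_on HH" by (simp add: o_def)
  qed (auto simp: HH_def complex_nonpos_Reals_iff)
  have "?f \<tau> = 0"
  proof (rule analytic_continuation[OF hol open_HH connected_HH, of "(\<lambda>y. \<i> * of_real y) ` {0<..}" \<i>])
    show "\<i> islimpt (\<lambda>y. \<i> * complex_of_real y) ` {0<..}"
      unfolding islimpt_approachable
    proof (intro allI impI)
      fix e :: real assume "e > 0"
      then show "\<exists>x'\<in>(\<lambda>y. \<i> * complex_of_real y) ` {0<..}. x' \<noteq> \<i> \<and> dist x' \<i> < e"
        by (intro bexI[of _ "\<i> * of_real (1 + e / 2)"])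
          (auto simp: dist_norm complex_eq_iff cmod_def intro!: image_eqI[of _ _ "1 + e / 2"])
    qed
    fix z assume "z \<in> (\<lambda>y. \<i> * complex_of_real y) ` {0<..}"
    then obtain y where y: "y > 0" "z = \<i> * of_real y" by auto
    have 1: "- 1 / (4 * z) = \<i> * of_real (1 / (4 * y))"
      using y by (simp add: complex_eq_iff Re_divide Im_divide power2_eq_square)
    have 2: "- 2 * \<i> * z = of_real (2 * y)" using y by (simp add: complex_eq_iff)
    have 3: "2 * (1 / (4 * y)) = 1 / (2 * y)" by simp
    have "csqrt (- 2 * \<i> * z) = of_real (sqrt (2 * y))"
      unfolding 2 by (rule of_real_sqrt[symmetric]) (use y in auto)
    then show "?f z = 0"
      using gauss_poisson[of "2 * y"] y unfolding 1 unfolding y(2) theta_imag_axis 3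
      by (simp add: field_simps flip: of_real_mult)
  qed (use assms in \<open>auto simp: HH_def\<close>)
  then show ?thesis by simp
qed

text \<open>The map is an inversion, a translation by -1 and another inversion. Both square root
  factors have arguments in the right half plane, so they merge into one principal root. This fixes
  the branch that the quotients of \<open>theta\<close> in \<open>wh_mod\<close> leave
  implicit.\<close>

lemma theta_gamma0_4:
  assumes "\<tau> \<in> HH"
  shows "theta (\<tau> / (4 * \<tau> + 1)) = csqrt (4 * \<tau> + 1) * theta \<tau>"
proof -
  define w where "w = - 1 / (4 * \<tau>) - 1"
  have im: "Im \<tau> > 0" using assms by (simp add: HH_def)
  then have nz: "\<tau> \<noteq> 0" "4 * \<tau> + 1 \<noteq> 0" by (auto simp: complex_eq_iff)
  have w: "w \<in> HH"
    using HH_neg_inverse[of "4 * \<tau>"] im by (simp add: w_def HH_def)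
  have w0: "w \<noteq> 0" using w by (auto simp: HH_def)
  have eq: "\<tau> / (4 * \<tau> + 1) = - 1 / (4 * w)"
    using nz w0 unfolding w_def by (simp add: field_simps)
  have "theta (- 1 / (4 * w)) = csqrt (- 2 * \<i> * w) * theta w"
    by (rule theta_inversion[OF w])
  also have "theta w = theta (- 1 / (4 * \<tau>))"
    using theta_plus_1[of w] by (simp add: w_def)
  also have "\<dots> = csqrt (- 2 * \<i> * \<tau>) * theta \<tau>"
    by (rule theta_inversion[OF assms])
  also have "csqrt (- 2 * \<i> * w) * (csqrt (- 2 * \<i> * \<tau>) * theta \<tau>) =
      csqrt ((- 2 * \<i> * w) * (- 2 * \<i> * \<tau>)) * theta \<tau>"
    by (subst csqrt_mult_right_half) (use w im in \<open>auto simp: HH_def\<close>)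
  also have "(- 2 * \<i> * w) * (- 2 * \<i> * \<tau>) = 4 * \<tau> + 1"
    using nz unfolding w_def by (simp add: field_simps)
  finally show ?thesis using eq by simp
qed

lemma theta_ii_nonzero: "theta \<i> \<noteq> 0"
proof -
  have sm: "(\<lambda>n::int. exp (- (2 * pi * real_of_int n ^ 2))) summable_on UNIV"
    using summable_on_int_exp_neg_square[of "2 * pi"] by simp
  have "theta \<i> = (\<Sum>\<^sub>\<infinity>n::int. of_real (exp (- (2 * pi * real_of_int n ^ 2))))"
    unfolding theta_def exp_of_real[symmetric]
    by (rule infsum_cong, rule arg_cong[where f = exp]) (simp add: algebra_simps)
  also have "\<dots> = of_real (\<Sum>\<^sub>\<infinity>n::int. exp (- (2 * pi * real_of_int n ^ 2)))"
    by (rule infsumI, rule has_sum_of_real, rule has_sum_infsum[OF sm])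
  finally have eq: "theta \<i> = of_real (\<Sum>\<^sub>\<infinity>n::int. exp (- (2 * pi * real_of_int n ^ 2)))" .
  have "(\<Sum>n\<in>{0::int}. exp (- (2 * pi * real_of_int n ^ 2))) \<le> (\<Sum>\<^sub>\<infinity>n::int. exp (- (2 * pi * real_of_int n ^ 2)))"
    by (rule finite_sum_le_infsum[OF sm]) auto
  then show ?thesis unfolding eq of_real_eq_0_iff by (smt (verit) exp_gt_zero sum.insert sum.empty finite.emptyI empty_iff)
qed

section \<open>Eisenstein series\<close>

lemma summable_nat_power_geometric:
  fixes x :: "'a :: {real_normed_field, banach}"
  assumes "norm x < 1"
  shows "summable (\<lambda>r. of_nat r ^ n * x ^ r)"
  using assms
proof (induction n arbitrary: x)
  case 0
  then show ?case by (simp add: summable_geometric)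
next
  case (Suc n)
  have "summable (\<lambda>r. diffs (\<lambda>r. of_nat r ^ n) r * x ^ r)"
    by (rule termdiff_converges[OF Suc.prems Suc.IH])
  then have "summable (\<lambda>r. x * (diffs (\<lambda>r. of_nat r ^ n) r * x ^ r))"
    by (rule summable_mult)
  then have "summable (\<lambda>r. of_nat (Suc r) ^ Suc n * x ^ Suc r)"
    by (simp add: diffs_def mult_ac)
  then show ?case by (subst (asm) summable_Suc_iff)
qed

section \<open>The Lipschitz formula and special zeta values\<close>

text \<open>The sum starts at r = 0: this term is 1 for n = 0, giving 1 / (1 - q), and 0 for
  positive n. Differentiation in z raises n by one.\<close>

definition lipschitz_sum :: "nat \<Rightarrow> complex \<Rightarrow> complex" where
  "lipschitz_sum n z = (\<Sum>r. of_nat r ^ n * exp (2 * of_real pi * \<i> * z) ^ r)"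

lemma norm_exp_HH: "z \<in> HH \<Longrightarrow> norm (exp (2 * of_real pi * \<i> * z)) < 1"
  by (simp add: norm_exp_eq_Re HH_def)

lemma lipschitz_sum_deriv:
  assumes "z \<in> HH"
  shows "(lipschitz_sum n has_field_derivative (2 * of_real pi * \<i> * lipschitz_sum (Suc n) z)) (at z)"
proof -
  let ?q = "\<lambda>z. exp (2 * of_real pi * \<i> * z)"
  let ?c = "\<lambda>r. of_nat r ^ n :: complex"
  have q: "norm (?q z) < 1" using assms by (rule norm_exp_HH)
  have d: "((\<lambda>x. \<Sum>r. ?c r * x ^ r) has_field_derivative (\<Sum>r. diffs ?c r * ?q z ^ r)) (at (?q z))"
    by (rule termdiffs_strong'[OF summable_nat_power_geometric q])
  have sm: "summable (\<lambda>r. diffs ?c r * ?q z ^ r)"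
    by (rule termdiff_converges[OF q]) (rule summable_nat_power_geometric)
  have "lipschitz_sum (Suc n) z = (\<Sum>r. of_nat (Suc r) ^ Suc n * ?q z ^ Suc r)"
    unfolding lipschitz_sum_def
    using suminf_split_head[OF summable_nat_power_geometric[OF q, of "Suc n"]] by simp
  also have "\<dots> = (\<Sum>r. ?q z * (diffs ?c r * ?q z ^ r))"
    by (simp add: diffs_def mult_ac)
  also have "\<dots> = ?q z * (\<Sum>r. diffs ?c r * ?q z ^ r)"
    by (rule suminf_mult[OF sm])
  finally have eq: "lipschitz_sum (Suc n) z = ?q z * (\<Sum>r. diffs ?c r * ?q z ^ r)" .
  have dq: "(?q has_field_derivative (?q z * (2 * of_real pi * \<i>))) (at z)"
    by (auto intro!: derivative_eq_intros)
  have "((\<lambda>z. \<Sum>r. ?c r * ?q z ^ r) has_field_derivative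
     (\<Sum>r. diffs ?c r * ?q z ^ r) * (?q z * (2 * of_real pi * \<i>))) (at z)"
    using DERIV_chain2[OF d dq] .
  moreover have "lipschitz_sum n = (\<lambda>z. \<Sum>r. ?c r * ?q z ^ r)"
    by (rule ext) (simp add: lipschitz_sum_def)
  ultimately show ?thesis
    unfolding eq by (simp only: mult_ac)
qed

lemma open_not_Ints: "open (- (\<int> :: complex set))"
  by (intro open_Compl closed_Ints)

text \<open>The logarithmic derivative of the reflection formula for Gamma, whose product with the
  sine is the constant \<pi>.\<close>

lemma Digamma_reflection:
  fixes z :: complex
  assumes "z \<notin> \<int>"
  shows "Digamma z - Digamma (1 - z) = - of_real pi * cot (of_real pi * z)"
proof -
  let ?f = "\<lambda>z::complex. Gamma z * Gamma (1 - z) * sin (of_real pi * z)"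
  have z1: "z \<notin> \<int>\<^sub>\<le>\<^sub>0" "1 - z \<notin> \<int>\<^sub>\<le>\<^sub>0"
    using assms by (auto simp: nonpos_Ints_def) (metis Ints_1 Ints_diff Ints_of_int diff_diff_eq2 add_diff_cancel_left')
  have sn: "sin (of_real pi * z) \<noteq> 0" if "z \<notin> \<int>" for z :: complex
    using that sin_eq_0[of "of_real pi * z"] by (auto simp: Ints_def)
  have f: "?f z = of_real pi" if "z \<in> - \<int>" for z
    using that sn[of z] Gamma_reflection_complex[of z] by simp
  have d1: "(?f has_field_derivative (Gamma z * Digamma z * Gamma (1 - z) * sin (of_real pi * z)
     - Gamma z * (Gamma (1 - z) * Digamma (1 - z)) * sin (of_real pi * z)
     + Gamma z * Gamma (1 - z) * (of_real pi * cos (of_real pi * z)))) (at z)"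
    using z1 by (auto intro!: derivative_eq_intros simp: algebra_simps)
  have "(?f has_field_derivative 0) (at z)"
    by (rule has_field_derivative_transform_within_open[OF DERIV_const open_not_Ints])
      (use assms f in auto)
  from DERIV_unique[OF d1 this]
  have "Gamma z * Gamma (1 - z) * ((Digamma z - Digamma (1 - z)) * sin (of_real pi * z) + of_real pi * cos (of_real pi * z)) = 0"
    by (simp add: algebra_simps)
  moreover have "Gamma z \<noteq> 0" "Gamma (1 - z) \<noteq> 0" using z1 by (auto simp: Gamma_eq_zero_iff)
  ultimately have "(Digamma z - Digamma (1 - z)) * sin (of_real pi * z) + of_real pi * cos (of_real pi * z) = 0"
    by simp
  then show ?thesis
    using sn[OF assms] by (simp add: cot_def field_simps add_eq_0_iff)
qed

text \<open>One differentiation step, with the sign flipped by the inner derivative of 1 - z. It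
  drives both the Lipschitz formula and the values at 1/2.\<close>

lemma Polygamma_reflection_deriv:
  fixes z :: complex
  assumes "open U" "z \<in> U" "U \<inter> \<int> = {}"
    and eq: "\<And>z. z \<in> U \<Longrightarrow> Polygamma n z + s * Polygamma n (1 - z) = g z"
    and g: "(g has_field_derivative g') (at z)"
  shows "Polygamma (Suc n) z - s * Polygamma (Suc n) (1 - z) = g'"
proof -
  have z: "z \<notin> \<int>" using assms by auto
  then have z1: "z \<notin> \<int>\<^sub>\<le>\<^sub>0" "1 - z \<notin> \<int>\<^sub>\<le>\<^sub>0"
    by (auto simp: nonpos_Ints_def) (metis Ints_1 Ints_diff Ints_of_int diff_diff_eq2 add_diff_cancel_left')
  have "((\<lambda>z. Polygamma n z + s * Polygamma n (1 - z)) has_field_derivative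
     (Polygamma (Suc n) z + s * (Polygamma (Suc n) (1 - z) * (- 1)))) (at z)"
    using z1 by (auto intro!: derivative_eq_intros)
  moreover have "((\<lambda>z. Polygamma n z + s * Polygamma n (1 - z)) has_field_derivative g') (at z)"
    by (rule has_field_derivative_transform_within_open[OF g assms(1,2)]) (use eq in auto)
  ultimately show ?thesis using DERIV_unique by fastforce
qed

lemma HH_not_Ints: "z \<in> HH \<Longrightarrow> z \<notin> \<int>"
  by (auto simp: HH_def elim!: Ints_cases)

text \<open>Induction by differentiation, starting from - \<pi> cot (\<pi> z) = - \<pi> \<i> + 2
  \<pi> \<i> / (1 - q). The two Polygamma values are the halves of a sum over all integer translates
  of z.\<close>

lemma Polygamma_reflection_HH:
  assumes "z \<in> HH"
  shows "Polygamma (Suc n) z + (-1) ^ n * Polygamma (Suc n) (1 - z) =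
     (2 * of_real pi * \<i>) ^ (n + 2) * lipschitz_sum (Suc n) z"
  using assms
proof (induction n arbitrary: z)
  case 0
  have base: "Polygamma 0 z + (- 1) * Polygamma 0 (1 - z) = - of_real pi * \<i> + 2 * of_real pi * \<i> * lipschitz_sum 0 z"
    if "z \<in> HH" for z
  proof -
    define q where "q = exp (2 * of_real pi * \<i> * z)"
    have q: "norm q < 1" using norm_exp_HH[OF that] by (simp add: q_def)
    then have q1: "1 - q \<noteq> 0" "q - 1 \<noteq> 0" by auto
    have l: "lipschitz_sum 0 z = 1 / (1 - q)"
      unfolding lipschitz_sum_def using suminf_geometric[OF q] by (simp add: q_def)
    define e where "e = exp (\<i> * (of_real pi * z))"
    have e: "e \<noteq> 0" "q = e * e" "exp (- (\<i> * (of_real pi * z))) = 1 / e"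
      by (simp_all add: e_def q_def exp_minus divide_inverse mult_ac flip: exp_add)
    have "cot (of_real pi * z) = \<i> * (q + 1) / (q - 1)"
      unfolding cot_def sin_exp_eq cos_exp_eq e(3) e_def[symmetric]
      using e(1) q1 unfolding e(2) by (simp add: field_simps)
    then have "Polygamma 0 z + (- 1) * Polygamma 0 (1 - z) = - of_real pi * (\<i> * (q + 1) / (q - 1))"
      using Digamma_reflection[OF HH_not_Ints[OF that]] by simp
    also have "\<dots> = - of_real pi * \<i> + 2 * of_real pi * \<i> * (1 / (1 - q))"
      using q1 by (simp add: divide_simps) (simp add: algebra_simps)
    finally show ?thesis using l by simp
  qed
  have "Polygamma (Suc 0) z - (- 1) * Polygamma (Suc 0) (1 - z) = 2 * of_real pi * \<i> * (2 * of_real pi * \<i> * lipschitz_sum (Suc 0) z)"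
    by (rule Polygamma_reflection_deriv[OF open_HH _ _ base])
      (use 0 HH_not_Ints in \<open>auto intro!: derivative_eq_intros lipschitz_sum_deriv\<close>)
  then show ?case by (simp add: power2_eq_square mult_ac)
next
  case (Suc n)
  have "Polygamma (Suc (Suc n)) z - (-1) ^ n * Polygamma (Suc (Suc n)) (1 - z) =
     (2 * of_real pi * \<i>) ^ (n + 2) * (2 * of_real pi * \<i> * lipschitz_sum (Suc (Suc n)) z)"
    by (rule Polygamma_reflection_deriv[OF open_HH _ _ Suc.IH])
      (use Suc.prems HH_not_Ints in \<open>auto intro!: derivative_eq_intros lipschitz_sum_deriv\<close>)
  then show ?case by (simp add: mult_ac)
qed

text \<open>At 1/2 the reflection formulas relate Polygamma to itself, and cot (\<pi> / 2) = 0
  leaves only a constant term. The polynomials in the cotangent c arise by repeated differentiation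
  with c' = - \<pi> (1 + c^2).\<close>

lemma Polygamma_one_half:
  "Polygamma 3 (1/2 :: complex) = of_real pi ^ 4" "Polygamma 5 (1/2 :: complex) = 8 * of_real pi ^ 6"
proof -
  define c where "c z = cot (of_real pi * z)" for z :: complex
  let ?p = "of_real pi :: complex"
  have dc: "(c has_field_derivative - ?p * (1 + c z ^ 2)) (at z)" if "z \<notin> \<int>" for z
  proof -
    have sn: "sin (?p * z) \<noteq> 0"
      using that sin_eq_0[of "of_real pi * z"] by (auto simp: Ints_def)
    have "(c has_field_derivative (- sin (?p * z) * ?p * sin (?p * z) - cos (?p * z) * (cos (?p * z) * ?p)) / (sin (?p * z) * sin (?p * z))) (at z)"
      unfolding c_def cot_def using sn by (auto intro!: derivative_eq_intros)
    also have "(- sin (?p * z) * ?p * sin (?p * z) - cos (?p * z) * (cos (?p * z) * ?p)) / (sin (?p * z) * sin (?p * z)) = - ?p * (1 + c z ^ 2)"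
    proof -
      have "(- S * ?p * S - C * (C * ?p)) / (S * S) = - ?p * (1 + (C / S) ^ 2)" if "S \<noteq> 0" for S C
        using that by (simp add: field_simps power2_eq_square)
      from this[OF sn] show ?thesis unfolding c_def cot_def .
    qed
    finally show ?thesis .
  qed
  have dp: "((\<lambda>z. c z ^ n) has_field_derivative (- ?p * of_nat n * (c z ^ (n - 1) + c z ^ (n + 1)))) (at z)"
    if "z \<in> - \<int>" for z n
  proof (cases n)
    case (Suc m)
    have "((\<lambda>z. c z ^ n) has_field_derivative (of_nat n * (- ?p * (1 + c z ^ 2) * c z ^ (n - Suc 0)))) (at z)"
      by (rule DERIV_power) (use dc that in auto)
    also have "of_nat n * (- ?p * (1 + c z ^ 2) * c z ^ (n - Suc 0)) = - ?p * of_nat n * (c z ^ (n - 1) + c z ^ (n + 1))"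
      using Suc by (simp add: algebra_simps power2_eq_square)
    finally show ?thesis .
  qed auto
  note U = open_not_Ints
  have 0: "Polygamma 0 z + (- 1) * Polygamma 0 (1 - z) = - ?p * c z" if "z \<in> - \<int>" for z
    using Digamma_reflection[of z] that by (simp add: c_def)
  have 1: "Polygamma 1 z + 1 * Polygamma 1 (1 - z) = ?p^2 * (1 + c z ^ 2)" if "z \<in> - \<int>" for z
  proof -
    have "((\<lambda>z. - ?p * c z) has_field_derivative ?p^2 * (1 + c z ^ 2)) (at z)"
      using that by (auto intro!: derivative_eq_intros dc simp: power2_eq_square)
    from Polygamma_reflection_deriv[OF U that _ 0 this] show ?thesis by simp
  qed
  have 2: "Polygamma 2 z + (-1) * Polygamma 2 (1 - z) = - 2 * ?p^3 * (c z ^ 1 + c z ^ 3)" if "z \<in> - \<int>" for z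
  proof -
    have "((\<lambda>z. ?p^2 * (1 + c z ^ 2)) has_field_derivative - 2 * ?p^3 * (c z ^ 1 + c z ^ 3)) (at z)"
      by (rule DERIV_cong[OF DERIV_cmult[OF DERIV_add[OF DERIV_const dp[OF that, of 2]]]])
        (simp add: algebra_simps eval_nat_numeral)
    from Polygamma_reflection_deriv[OF U that _ 1 this] show ?thesis by (simp add: numeral_2_eq_2)
  qed
  have 3: "Polygamma 3 z + 1 * Polygamma 3 (1 - z) = 2 * ?p^4 * (1 + 4 * c z ^ 2 + 3 * c z ^ 4)" if "z \<in> - \<int>" for z
  proof -
    have "((\<lambda>z. - 2 * ?p^3 * (c z ^ 1 + c z ^ 3)) has_field_derivative 2 * ?p^4 * (1 + 4 * c z ^ 2 + 3 * c z ^ 4)) (at z)"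
      by (rule DERIV_cong[OF DERIV_cmult[OF DERIV_add[OF dp[OF that, of 1] dp[OF that, of 3]]]])
        (simp add: algebra_simps eval_nat_numeral)
    from Polygamma_reflection_deriv[OF U that _ 2 this] show ?thesis by (simp add: numeral_3_eq_3 numeral_2_eq_2)
  qed
  have 4: "Polygamma 4 z + (-1) * Polygamma 4 (1 - z) = - 2 * ?p^5 * (8 * c z ^ 1 + 20 * c z ^ 3 + 12 * c z ^ 5)" if "z \<in> - \<int>" for z
  proof -
    have "((\<lambda>z. 2 * ?p^4 * (1 + 4 * c z ^ 2 + 3 * c z ^ 4)) has_field_derivative - 2 * ?p^5 * (8 * c z ^ 1 + 20 * c z ^ 3 + 12 * c z ^ 5)) (at z)"
      by (rule DERIV_cong[OF DERIV_cmult[OF DERIV_add[OF DERIV_add[OF DERIV_const DERIV_cmult[OF dp[OF that, of 2]]] DERIV_cmult[OF dp[OF that, of 4]]]]])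
        (simp add: algebra_simps eval_nat_numeral)
    from Polygamma_reflection_deriv[OF U that _ 3 this] show ?thesis by (simp add: eval_nat_numeral)
  qed
  have 5: "Polygamma 5 z + 1 * Polygamma 5 (1 - z) = 2 * ?p^6 * (8 + 60 * c z ^ 2 + 60 * c z ^ 4) * (1 + c z ^ 2)" if "z \<in> - \<int>" for z
  proof -
    have "((\<lambda>z. - 2 * ?p^5 * (8 * c z ^ 1 + 20 * c z ^ 3 + 12 * c z ^ 5)) has_field_derivative 2 * ?p^6 * (8 + 60 * c z ^ 2 + 60 * c z ^ 4) * (1 + c z ^ 2)) (at z)"
      by (rule DERIV_cong[OF DERIV_cmult[OF DERIV_add[OF DERIV_add[OF DERIV_cmult[OF dp[OF that, of 1]] DERIV_cmult[OF dp[OF that, of 3]]] DERIV_cmult[OF dp[OF that, of 5]]]]])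
        (simp add: algebra_simps eval_nat_numeral)
    from Polygamma_reflection_deriv[OF U that _ 4 this] show ?thesis by (simp add: eval_nat_numeral)
  qed
  have half: "(1/2 :: complex) \<in> - \<int>"
    using fraction_not_in_Ints[where 'a = complex, of 2 1] by simp
  have c: "c (1/2) = 0"
    using cos_of_real_pi_half[where 'a = complex] by (simp add: c_def cot_def)
  show "Polygamma 3 (1/2 :: complex) = of_real pi ^ 4" using 3[OF half] c by simp
  show "Polygamma 5 (1/2 :: complex) = 8 * of_real pi ^ 6" using 5[OF half] c by simp
qed

text \<open>Odd and even denominators are separated: the zeta value Z satisfies Z = Polygamma n
  (1/2) / (n! 2^(n+1)) + Z / 2^(n+1), which is solved for Z.\<close>

lemma zeta_from_Polygamma:
  assumes "odd n" "n > 1"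
  shows "(\<lambda>k. 1 / (of_nat (Suc k) :: complex) ^ Suc n) sums
     (Polygamma n (1/2) / (fact n * (2 ^ Suc n - 1)))"
proof -
  define Z where "Z = (\<Sum>k. 1 / (of_nat (Suc k) :: complex) ^ Suc n)"
  have sm: "summable (\<lambda>k. 1 / (of_nat (Suc k) :: complex) ^ Suc n)"
    using Polygamma_converges'[of "1::complex" "Suc n"] assms
    by (simp add: inverse_eq_divide add.commute)
  have Z: "(\<lambda>k. 1 / (of_nat (Suc k) :: complex) ^ Suc n) sums Z"
    unfolding Z_def using sm by (rule summable_sums)
  have half: "(\<lambda>k. inverse (((1/2 :: complex) + of_nat k) ^ Suc n)) sums (Polygamma n (1/2) / fact n)"
    using Polygamma_LIMSEQ[of "1/2 :: complex" n] assms by simp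
  have "(\<lambda>k. \<Sum>i\<in>{k*2..<k*2+2}. 1 / (of_nat (Suc i) :: complex) ^ Suc n) sums Z"
    by (rule sums_group[OF Z]) auto
  also have "(\<lambda>k. \<Sum>i\<in>{k*2..<k*2+2}. 1 / (of_nat (Suc i) :: complex) ^ Suc n) =
     (\<lambda>k. inverse (((1/2 :: complex) + of_nat k) ^ Suc n) / 2 ^ Suc n + 1 / (of_nat (Suc k) :: complex) ^ Suc n / 2 ^ Suc n)"
  proof
    fix k
    have st: "{k*2..<k*2+2} = {k*2, Suc (k*2)}" by auto
    have o1: "(of_nat (Suc (k*2)) :: complex) = 2 * (1/2 + of_nat k)" by (simp add: algebra_simps)
    have o2: "(of_nat (Suc (Suc (k*2))) :: complex) = 2 * of_nat (Suc k)" by (simp add: algebra_simps)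
    have alg: "1 / (2 * a) ^ N + 1 / (2 * b) ^ N = inverse (a ^ N) / 2 ^ N + 1 / b ^ N / 2 ^ N"
      for a b :: complex and N :: nat
      by (simp add: power_mult_distrib divide_inverse)
    have "(\<Sum>i\<in>{k*2..<k*2+2}. 1 / (of_nat (Suc i) :: complex) ^ Suc n) =
       1 / (of_nat (Suc (k*2)) :: complex) ^ Suc n + 1 / (of_nat (Suc (Suc (k*2))) :: complex) ^ Suc n"
      unfolding st by (subst sum.insert) (simp_all only: finite.intros sum.insert sum.empty empty_iff not_False_eq_True add_0_right insert_iff n_not_Suc_n simp_thms)
    then show "(\<Sum>i\<in>{k*2..<k*2+2}. 1 / (of_nat (Suc i) :: complex) ^ Suc n) =
      inverse (((1/2 :: complex) + of_nat k) ^ Suc n) / 2 ^ Suc n + 1 / (of_nat (Suc k) :: complex) ^ Suc n / 2 ^ Suc n"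
      unfolding o1 o2 alg .
  qed
  finally have "(\<lambda>k. inverse (((1/2 :: complex) + of_nat k) ^ Suc n) / 2 ^ Suc n + 1 / (of_nat (Suc k) :: complex) ^ Suc n / 2 ^ Suc n) sums Z" .
  moreover have "(\<lambda>k. inverse (((1/2 :: complex) + of_nat k) ^ Suc n) / 2 ^ Suc n + 1 / (of_nat (Suc k) :: complex) ^ Suc n / 2 ^ Suc n) sums
     (Polygamma n (1/2) / fact n / 2 ^ Suc n + Z / 2 ^ Suc n)"
    by (intro sums_add sums_divide half Z)
  ultimately have "Z = Polygamma n (1/2) / fact n / 2 ^ Suc n + Z / 2 ^ Suc n"
    using sums_unique2 by blast
  then have "Z * 2 ^ Suc n = Polygamma n (1/2) / fact n + Z"
    by (simp add: field_simps)
  then have "Z * (2 ^ Suc n - 1) = Polygamma n (1/2) / fact n" by (simp add: algebra_simps)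
  moreover have "(2 ^ Suc n - 1 :: complex) \<noteq> 0"
  proof -
    have "(2::nat) ^ Suc n \<noteq> 1" by simp
    then have "complex_of_nat (2 ^ Suc n) \<noteq> of_nat 1" by (simp only: of_nat_eq_iff) simp
    then show ?thesis by simp
  qed
  ultimately have "Z = Polygamma n (1/2) / (fact n * (2 ^ Suc n - 1))" by (simp add: field_simps)
  then show ?thesis using Z by simp
qed

section \<open>Lattice sums and the modularity of E4 and E6\<close>

lemma lattice_norm_bound:
  assumes "z \<in> HH"
  obtains C where "C > 0" "\<And>m n :: int. real_of_int (m^2 + n^2) \<le> C * norm (of_int m * z + of_int n) ^ 2"
proof
  define x y where "x = Re z" and "y = Im z"
  have y: "y > 0" using assms by (simp add: y_def HH_def)
  \<comment> \<open>From n^2 \<le> 2 (m x + n)^2 + 2 (m x)^2 and m^2 = (m y)^2 / y^2.\<close>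
  let ?C = "2 + (1 + 2 * x^2) / y^2"
  show "?C > 0" using y by (intro add_pos_nonneg) auto
  fix m n :: int
  define a b where "a = real_of_int m" and "b = real_of_int n"
  have nrm: "norm (of_int m * z + of_int n) ^ 2 = (a * x + b)^2 + (a * y)^2"
    by (simp add: cmod_power2 a_def b_def x_def y_def)
  have 1: "b^2 \<le> 2 * (a * x + b)^2 + 2 * (a * x)^2"
    using zero_le_power2[of "2 * (a * x) + b"] by (simp add: power2_eq_square algebra_simps)
  have 2: "(1 + 2 * x^2) * a^2 = (1 + 2 * x^2) / y^2 * (a * y)^2"
    using y by (simp add: field_simps)
  have "a^2 + b^2 \<le> 2 * (a * x + b)^2 + (1 + 2 * x^2) * a^2"
    using 1 by (simp add: power_mult_distrib algebra_simps)
  also have "\<dots> \<le> ?C * ((a * x + b)^2 + (a * y)^2)"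
  proof -
    have "0 \<le> (1 + 2 * x^2) / y^2 * (a * x + b)^2" by simp
    moreover have "0 \<le> 2 * (a * y)^2" by simp
    ultimately show ?thesis unfolding 2 by (simp only: distrib_right distrib_left)
  qed
  finally show "real_of_int (m^2 + n^2) \<le> ?C * norm (of_int m * z + of_int n) ^ 2"
    unfolding nrm by (simp add: a_def b_def)
qed

lemma summable_on_int_inverse_square: "(\<lambda>n::int. 1 / (1 + real_of_int n ^ 2)) summable_on UNIV"
proof -
  have "summable (\<lambda>n. 1 / (1 + real n ^ 2))"
  proof (rule summable_comparison_test_ev)
    show "\<forall>\<^sub>F n in sequentially. norm (1 / (1 + real n ^ 2)) \<le> inverse (real n ^ 2)"
      using eventually_gt_at_top[of 0] by eventually_elim (auto simp: inverse_eq_divide intro!: divide_left_mono mult_pos_pos add_pos_nonneg)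
    show "summable (\<lambda>n. inverse (real n ^ 2))" by (rule inverse_power_summable) simp
  qed
  then show ?thesis by (intro summable_on_intI) auto
qed

lemma summable_on_real_product:
  fixes f g :: "'a \<Rightarrow> real"
  assumes "f summable_on A" "g summable_on B" "\<And>x. x \<in> A \<Longrightarrow> f x \<ge> 0" "\<And>x. x \<in> B \<Longrightarrow> g x \<ge> 0"
  shows "(\<lambda>(x, y). f x * g y) summable_on A \<times> B"
proof (rule summable_on_SigmaI[where g = "\<lambda>x. f x * infsum g B"])
  fix x
  show "((\<lambda>y. case (x, y) of (x, y) \<Rightarrow> f x * g y) has_sum f x * infsum g B) B"
    using has_sum_cmult_right[OF has_sum_infsum[OF assms(2)], of "f x"] by simp
qed (use assms in \<open>auto intro!: summable_on_cmult_left\<close>)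

text \<open>Exponent 4 permits a crude product majorant: (1 + m^2) (1 + n^2) \<le> 3 (m^2 + n^2)^2,
  and m^2 + n^2 is at most a multiple of |m z + n|^2, so the terms are dominated by a product of two
  convergent one-dimensional series.\<close>

lemma lattice_summable:
  assumes z: "z \<in> HH" and p: "p \<ge> 4"
  shows "(\<lambda>x. norm (case x of (m::int, n::int) \<Rightarrow> 1 / (of_int m * z + of_int n) ^ p)) summable_on UNIV - {(0, 0)}"
proof -
  obtain C where C: "C > 0" "\<And>m n :: int. real_of_int (m^2 + n^2) \<le> C * norm (of_int m * z + of_int n) ^ 2"
    using lattice_norm_bound[OF z] by blast
  \<comment> \<open>A lower bound for |m z + n| on nonzero lattice vectors; it turns the factors
    beyond the fourth into a constant.\<close>
  define c where "c = 1 / sqrt C"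
  have c: "c > 0" "c^2 = 1 / C" using C by (auto simp: c_def power_divide)
  let ?K = "3 * C^2 / c ^ (p - 4)"
  have "(\<lambda>(m, n). 1 / (1 + real_of_int m ^ 2) * (1 / (1 + real_of_int n ^ 2))) summable_on UNIV \<times> UNIV"
    by (rule summable_on_real_product[OF summable_on_int_inverse_square summable_on_int_inverse_square]) auto
  then have "(\<lambda>x. ?K * (case x of (m, n) \<Rightarrow> 1 / (1 + real_of_int m ^ 2) * (1 / (1 + real_of_int n ^ 2)))) summable_on UNIV"
    by (intro summable_on_cmult_right) simp
  then have sm: "(\<lambda>x. ?K * (case x of (m, n) \<Rightarrow> 1 / (1 + real_of_int m ^ 2) * (1 / (1 + real_of_int n ^ 2)))) summable_on UNIV - {(0,0)}"
    by (rule summable_on_subset_banach) auto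
  show ?thesis
  proof (rule Infinite_Sum.abs_summable_on_comparison_test'[OF sm])
    fix x :: "int \<times> int" assume x0: "x \<in> UNIV - {(0, 0)}"
    obtain m n where x: "x = (m, n)" by (cases x)
    from x0 x have "m^2 + n^2 > 0" by (auto simp: sum_power2_gt_zero_iff)
    then have "m^2 + n^2 \<ge> 1" by linarith
    then have "real_of_int (m^2 + n^2) \<ge> 1" by linarith
    define w where "w = norm (of_int m * z + of_int n)"
    define M where "M = real_of_int (m^2 + n^2)"
    have M: "M \<ge> 1" "M \<le> C * w^2" using \<open>real_of_int (m^2 + n^2) \<ge> 1\<close> C(2) by (auto simp: M_def w_def)
    have "w \<ge> c"
    proof -
      have "1 \<le> C * w^2" using M by linarith
      then have "c^2 \<le> w^2" using C(1) unfolding c(2) by (simp add: field_simps)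
      then show ?thesis by (rule power2_le_imp_le) (simp add: w_def)
    qed
    have w0: "w > 0" using \<open>w \<ge> c\<close> c by simp
    have "(1 + real_of_int m ^ 2) * (1 + real_of_int n ^ 2) = 1 + M + real_of_int m ^ 2 * real_of_int n ^ 2"
      by (simp add: M_def algebra_simps)
    also have "\<dots> \<le> 3 * M^2"
    proof -
      have "real_of_int m ^ 2 * real_of_int n ^ 2 \<le> M * M"
        by (intro mult_mono) (auto simp: M_def)
      moreover have "1 \<le> M * M" "M \<le> M * M" using M by (auto intro: mult_ge1_I)
      ultimately show ?thesis by (simp add: power2_eq_square)
    qed
    also have "\<dots> \<le> 3 * (C * w^2)^2"
      using M by (intro mult_left_mono power_mono) auto
    also have "\<dots> = 3 * C^2 * w^4" by (simp add: power_mult_distrib)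
    finally have 1: "(1 + real_of_int m ^ 2) * (1 + real_of_int n ^ 2) \<le> 3 * C^2 * w^4" .
    have 2: "w ^ p \<ge> w^4 * c ^ (p - 4)"
    proof -
      have "w ^ p = w ^ 4 * w ^ (p - 4)" using p by (simp flip: power_add)
      then show ?thesis using \<open>w \<ge> c\<close> c w0 by (auto intro!: mult_left_mono power_mono)
    qed
    have pos: "(1 + real_of_int m ^ 2) * (1 + real_of_int n ^ 2) > 0"
      by (intro mult_pos_pos add_pos_nonneg) auto
    have "1 / w ^ p \<le> 1 / (w^4 * c ^ (p - 4))"
      using 2 w0 c by (intro divide_left_mono) auto
    also have "\<dots> \<le> ?K * (1 / ((1 + real_of_int m ^ 2) * (1 + real_of_int n ^ 2)))"
    proof -
      have "1 / w^4 \<le> 3 * C^2 * (1 / ((1 + real_of_int m ^ 2) * (1 + real_of_int n ^ 2)))"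
        using 1 pos w0 by (simp add: field_simps)
      then have "1 / w^4 / c ^ (p - 4) \<le> 3 * C^2 * (1 / ((1 + real_of_int m ^ 2) * (1 + real_of_int n ^ 2))) / c ^ (p - 4)"
        using c by (intro divide_right_mono) auto
      then show ?thesis by (simp add: mult_ac)
    qed
    finally show "norm (case x of (m, n) \<Rightarrow> 1 / (of_int m * z + of_int n) ^ p) \<le>
        ?K * (case x of (m, n) \<Rightarrow> 1 / (1 + real_of_int m ^ 2) * (1 / (1 + real_of_int n ^ 2)))"
      by (simp add: norm_divide norm_power w_def x)
  qed
qed

definition eis_sum :: "nat \<Rightarrow> complex \<Rightarrow> complex" where
  "eis_sum p z = (\<Sum>\<^sub>\<infinity>(m::int, n::int)\<in>UNIV - {(0, 0)}. 1 / (of_int m * z + of_int n) ^ p)"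

lemma eis_sum_mobius:
  assumes "z \<in> HH" and det: "a * d - b * c = 1"
  shows "eis_sum p (mob a b c d z) = (of_int c * z + of_int d) ^ p * eis_sum p z"
proof -
  have im: "Im z > 0" using assms by (simp add: HH_def)
  have nz: "of_int c * z + of_int d \<noteq> 0"
  proof
    assume "of_int c * z + of_int d = 0"
    then have "c = 0" "d = 0" using im by (auto simp: complex_eq_iff)
    then show False using det by simp
  qed
  \<comment> \<open>The row vector (m, n) times the matrix; the inverse matrix gives the inverse
    map.\<close>
  let ?h = "\<lambda>(m, n). (m * a + n * c, m * b + n * d)"
  let ?h' = "\<lambda>(m, n). (m * d - n * c, n * a - m * b)"
  have inv1: "?h' (?h x) = x" and inv2: "?h (?h' x) = x" for x
  proof -
    obtain m n where x: "x = (m, n)" by (cases x)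
    have "(m * a + n * c) * d - (m * b + n * d) * c = m * (a * d - b * c)"
         "(m * b + n * d) * a - (m * a + n * c) * b = n * (a * d - b * c)"
         "(m * d - n * c) * a + (n * a - m * b) * c = m * (a * d - b * c)"
         "(m * d - n * c) * b + (n * a - m * b) * d = n * (a * d - b * c)" by algebra+
    then show "?h' (?h x) = x" "?h (?h' x) = x" using det x by simp_all
  qed
  have h0: "?h x = (0, 0) \<longleftrightarrow> x = (0, 0)" and h0': "?h' x = (0, 0) \<longleftrightarrow> x = (0, 0)" for x
    using inv1[of x] inv2[of x] by (cases x; force)+
  have "eis_sum p (mob a b c d z) =
     (\<Sum>\<^sub>\<infinity>x\<in>UNIV - {(0, 0)}. (of_int c * z + of_int d) ^ p *
        (case ?h x of (m, n) \<Rightarrow> 1 / (of_int m * z + of_int n) ^ p))"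
    unfolding eis_sum_def
  proof (rule infsum_cong)
    fix x :: "int \<times> int"
    obtain m n where x: "x = (m, n)" by (cases x)
    have "of_int m * mob a b c d z + of_int n =
       (of_int (m * a + n * c) * z + of_int (m * b + n * d)) / (of_int c * z + of_int d)"
      unfolding mob_def using nz by (simp add: field_simps)
    then show "(case x of (m, n) \<Rightarrow> 1 / (of_int m * mob a b c d z + of_int n) ^ p) = (of_int c * z + of_int d) ^ p *
      (case ?h x of (m, n) \<Rightarrow> 1 / (of_int m * z + of_int n) ^ p)"
      by (simp add: power_divide x)
  qed
  also have "\<dots> = (of_int c * z + of_int d) ^ p *
     (\<Sum>\<^sub>\<infinity>x\<in>UNIV - {(0, 0)}. (case ?h x of (m, n) \<Rightarrow> 1 / (of_int m * z + of_int n) ^ p))"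
    by (rule infsum_cmult_right')
  also have "(\<Sum>\<^sub>\<infinity>x\<in>UNIV - {(0, 0)}. (case ?h x of (m, n) \<Rightarrow> 1 / (of_int m * z + of_int n) ^ p)) = eis_sum p z"
    unfolding eis_sum_def
  proof (rule infsum_reindex_bij_betw)
    show "bij_betw ?h (UNIV - {(0, 0)}) (UNIV - {(0, 0)})"
    proof (rule bij_betw_byWitness[of _ ?h'])
      show "\<forall>x\<in>UNIV - {(0, 0)}. ?h' (?h x) = x" using inv1 by blast
      show "\<forall>x\<in>UNIV - {(0, 0)}. ?h (?h' x) = x" using inv2 by blast
      show "?h ` (UNIV - {(0, 0)}) \<subseteq> UNIV - {(0, 0)}"
      proof (rule image_subsetI)
        fix x assume "x \<in> UNIV - {(0::int, 0::int)}"
        then show "?h x \<in> UNIV - {(0, 0)}" using h0[of x] by simp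
      qed
      show "?h' ` (UNIV - {(0, 0)}) \<subseteq> UNIV - {(0, 0)}"
      proof (rule image_subsetI)
        fix x assume "x \<in> UNIV - {(0::int, 0::int)}"
        then show "?h' x \<in> UNIV - {(0, 0)}" using h0'[of x] by simp
      qed
    qed
  qed
  finally show ?thesis .
qed

lemma has_sum_split_int:
  fixes f :: "int \<Rightarrow> 'a :: banach"
  assumes "f summable_on UNIV" "(\<lambda>k. f (int k)) sums a" "(\<lambda>k. f (- int k - 1)) sums b"
  shows "(f has_sum (a + b)) UNIV"
proof -
  have U: "UNIV = range int \<union> range (\<lambda>k. - int k - 1)"
  proof -
    have "n \<in> range int \<union> range (\<lambda>k. - int k - 1)" for n
    proof (cases "n \<ge> 0")
      case False
      then have "n = - int (nat (- n - 1)) - 1" by simp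
      then show ?thesis by blast
    qed (metis UnI1 nat_0_le rangeI)
    then show ?thesis by blast
  qed
  have 1: "(f has_sum a) (range int)"
  proof -
    have "f summable_on (range int)" using assms(1) by (rule summable_on_subset_banach) auto
    then have "((f \<circ> int) has_sum infsum f (range int)) UNIV"
      using has_sum_reindex[of int UNIV f] has_sum_infsum by (fastforce simp: inj_on_def)
    moreover from has_sum_imp_sums[OF this] have "infsum f (range int) = a"
      using assms(2) sums_unique2 by (simp add: o_def) blast
    ultimately show ?thesis using has_sum_reindex[of int UNIV f] by (simp add: inj_on_def)
  qed
  have 2: "(f has_sum b) (range (\<lambda>k. - int k - 1))"
  proof -
    have inj: "inj (\<lambda>k. - int k - 1)" by (simp add: inj_on_def)
    have "f summable_on (range (\<lambda>k. - int k - 1))" using assms(1) by (rule summable_on_subset_banach) auto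
    then have "((f \<circ> (\<lambda>k. - int k - 1)) has_sum infsum f (range (\<lambda>k. - int k - 1))) UNIV"
      using has_sum_reindex[OF inj, of f] has_sum_infsum by blast
    moreover from has_sum_imp_sums[OF this] have "infsum f (range (\<lambda>k. - int k - 1)) = b"
      using assms(3) sums_unique2 by (simp add: o_def) blast
    ultimately show ?thesis using has_sum_reindex[OF inj, of f] by simp
  qed
  show ?thesis unfolding U by (rule has_sum_Un_disjoint[OF 1 2]) auto
qed

lemma lipschitz_formula:
  assumes z: "z \<in> HH" and n: "odd n" "n \<ge> 3"
  shows "((\<lambda>k::int. 1 / (z + of_int k) ^ Suc n) has_sum
           ((2 * of_real pi * \<i>) ^ Suc n / fact n * lipschitz_sum n z)) UNIV"
proof -
  obtain n' where n': "n = Suc n'" "even n'" using n by (cases n) auto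
  have nz: "z \<noteq> 0" "1 - z \<noteq> 0" using z by (auto simp: HH_def complex_eq_iff)
  \<comment> \<open>The translates of z form the row with first coordinate 1 of the absolutely
    convergent lattice sum.\<close>
  have sm: "(\<lambda>k::int. 1 / (z + of_int k) ^ Suc n) summable_on UNIV"
  proof -
    have "(\<lambda>(m::int, n'::int). 1 / (of_int m * z + of_int n') ^ Suc n) summable_on UNIV - {(0, 0)}"
      by (rule abs_summable_summable[OF lattice_summable[OF z]]) (use n in auto)
    then have "(\<lambda>(m::int, n'::int). 1 / (of_int m * z + of_int n') ^ Suc n) summable_on {1} \<times> UNIV"
      by (rule summable_on_subset_banach) auto
    from summable_on_SigmaD1[OF this, of 1] show ?thesis by simp
  qed
  have 1: "(\<lambda>k. 1 / (z + of_int (int k)) ^ Suc n) sums (Polygamma n z / fact n)"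
    using Polygamma_LIMSEQ[OF nz(1), of n] n by (simp add: inverse_eq_divide)
  \<comment> \<open>The exponent n + 1 is even, so z - k - 1 may be replaced by 1 - z + k.\<close>
  have 2: "(\<lambda>k. 1 / (z + of_int (- int k - 1)) ^ Suc n) sums (Polygamma n (1 - z) / fact n)"
  proof -
    have "z + of_int (- int k - 1) = - (1 - z + of_nat k)" for k by simp
    then have "(z + of_int (- int k - 1)) ^ Suc n = (1 - z + of_nat k) ^ Suc n" for k
      using n by (metis even_Suc power_minus_even)
    then show ?thesis
      using Polygamma_LIMSEQ[OF nz(2), of n] n by (simp add: inverse_eq_divide del: power_Suc)
  qed
  have "Polygamma n z / fact n + Polygamma n (1 - z) / fact n =
      (2 * of_real pi * \<i>) ^ Suc n / fact n * lipschitz_sum n z"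
    using Polygamma_reflection_HH[OF z, of n'] n' by (simp add: add_divide_distrib [symmetric])
  then show ?thesis using has_sum_split_int[OF sm 1 2] by simp
qed

lemma summable_divisor_sum:
  assumes "0 \<le> x" "x < (1::real)"
  shows "(\<lambda>N. real (divsum n N) * x ^ N) summable_on {1..}"
proof -
  have le: "real (divsum n N) \<le> real N ^ Suc n" if "N \<ge> 1" for N
  proof -
    have "divsum n N \<le> (\<Sum>d\<in>{d. d dvd N}. N ^ n)"
      unfolding divsum_def using that by (intro sum_mono power_mono) (auto dest: dvd_imp_le)
    also have "\<dots> = card {d. d dvd N} * N ^ n" by simp
    also have "\<dots> \<le> card {1..N} * N ^ n"
      using that by (intro mult_right_mono card_mono) (auto dest: dvd_imp_le intro: Suc_leI Nat.gr0I)
    finally have "divsum n N \<le> N ^ Suc n" by simp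
    then show ?thesis by (metis of_nat_le_iff of_nat_power)
  qed
  have "summable (\<lambda>N. real N ^ Suc n * x ^ N)"
    using assms summable_nat_power_geometric[of x "Suc n"] by simp
  then have "(\<lambda>N. real N ^ Suc n * x ^ N) summable_on UNIV"
    by (intro norm_summable_imp_summable_on) (use assms in \<open>simp add: norm_mult norm_power\<close>)
  then have "(\<lambda>N. real N ^ Suc n * x ^ N) summable_on {1..}"
    by (rule summable_on_subset_banach) auto
  then show ?thesis
    by (rule summable_on_comparison_test) (use le assms in \<open>auto intro!: mult_right_mono\<close>)
qed

text \<open>Reindexing the pairs (m, r) by the product N = m r together with its divisor r.
  Summability is checked on the divisor side, where the inner sums are finite.\<close>

lemma divisor_lambert:
  assumes "norm q < (1::real)"
  shows "(\<Sum>\<^sub>\<infinity>m\<in>{1..}. \<Sum>\<^sub>\<infinity>r\<in>{1..}. of_nat r ^ n * q ^ (m * r)) = (\<Sum>\<^sub>\<infinity>N\<in>{1..}. of_nat (divsum n N) * (q :: complex) ^ N)"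
    and "(\<lambda>(m, r). of_nat r ^ n * (q :: complex) ^ (m * r)) summable_on {1..} \<times> {1..}"
proof -
  let ?D = "Sigma {1..} (\<lambda>N::nat. {d. d dvd N})"
  let ?f = "\<lambda>(N, d). of_nat d ^ n * q ^ N"
  have fin: "finite {d. d dvd N}" if "N \<ge> 1" for N :: nat using that by simp
  have "(\<lambda>x. norm (?f x)) summable_on ?D"
  proof (rule summable_on_SigmaI[where g = "\<lambda>N. real (divsum n N) * norm q ^ N"])
    show "((\<lambda>d. norm (case (N, d) of (N, d) \<Rightarrow> of_nat d ^ n * q ^ N)) has_sum real (divsum n N) * norm q ^ N) {d. d dvd N}"
      if "N \<in> {1..}" for N
      using that fin[of N]
      by (intro has_sum_finiteI) (auto simp: divsum_def norm_mult norm_power sum_distrib_right)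
  qed (use summable_divisor_sum[of "norm q" n] assms in auto)
  then have sm: "?f summable_on ?D" by (rule abs_summable_summable)
  have bij: "bij_betw (\<lambda>(m, r). (m * r, r)) ({1..} \<times> {1..}) ?D"
    by (rule bij_betw_byWitness[of _ "\<lambda>(N, d). (N div d, d)"])
      (auto simp: Suc_le_eq intro: Nat.gr0I elim!: dvdE)
  have sm2: "(\<lambda>x. ?f ((\<lambda>(m, r). (m * r, r)) x)) summable_on {1..} \<times> {1..}"
    using sm summable_on_reindex_bij_betw[OF bij, of ?f] by blast
  then show sm3: "(\<lambda>(m, r). of_nat r ^ n * q ^ (m * r)) summable_on {1..} \<times> {1..}"
    by (simp add: case_prod_unfold)
  have "(\<Sum>\<^sub>\<infinity>m\<in>{1..}. \<Sum>\<^sub>\<infinity>r\<in>{1..}. of_nat r ^ n * q ^ (m * r)) = infsum (\<lambda>(m, r). of_nat r ^ n * q ^ (m * r)) ({1..} \<times> {1..})"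
    by (rule infsum_Sigma'_banach) (use sm3 in simp)
  also have "\<dots> = infsum (\<lambda>x. ?f ((\<lambda>(m, r). (m * r, r)) x)) ({1..} \<times> {1..})"
    by (simp add: case_prod_unfold)
  also have "\<dots> = infsum ?f ?D" by (rule infsum_reindex_bij_betw[OF bij])
  also have "\<dots> = (\<Sum>\<^sub>\<infinity>N\<in>{1..}. \<Sum>\<^sub>\<infinity>d\<in>{d. d dvd N}. of_nat d ^ n * q ^ N)"
    by (rule infsum_Sigma'_banach[symmetric]) (use sm in simp)
  also have "\<dots> = (\<Sum>\<^sub>\<infinity>N\<in>{1..}. of_nat (divsum n N) * q ^ N)"
    by (rule infsum_cong) (use fin in \<open>simp add: divsum_def sum_distrib_right\<close>)
  finally show "(\<Sum>\<^sub>\<infinity>m\<in>{1..}. \<Sum>\<^sub>\<infinity>r\<in>{1..}. of_nat r ^ n * q ^ (m * r)) = (\<Sum>\<^sub>\<infinity>N\<in>{1..}. of_nat (divsum n N) * q ^ N)" .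
qed

lemma lipschitz_sum_infsum:
  assumes "z \<in> HH" "n \<ge> 1"
  shows "lipschitz_sum n z = (\<Sum>\<^sub>\<infinity>r\<in>{1..}. of_nat r ^ n * exp (2 * of_real pi * \<i> * z) ^ r)"
proof -
  let ?q = "exp (2 * of_real pi * \<i> * z)"
  have q: "norm ?q < 1" using assms norm_exp_HH by blast
  have "summable (\<lambda>r. norm (of_nat r ^ n * ?q ^ r))"
    using summable_nat_power_geometric[of "norm ?q" n] q by (simp add: norm_mult norm_power)
  then have "((\<lambda>r. of_nat r ^ n * ?q ^ r) has_sum lipschitz_sum n z) UNIV"
    unfolding lipschitz_sum_def
    by (rule norm_summable_imp_has_sum) (rule summable_sums[OF summable_nat_power_geometric[OF q]])
  then have "lipschitz_sum n z = (\<Sum>\<^sub>\<infinity>r. of_nat r ^ n * ?q ^ r)" by (simp add: infsumI)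
  also have "\<dots> = (\<Sum>\<^sub>\<infinity>r\<in>{1..}. of_nat r ^ n * ?q ^ r)"
    by (rule infsum_cong_neutral) (use assms in \<open>auto simp: Suc_le_eq\<close>)
  finally show ?thesis .
qed

lemma sum_divisors_suminf:
  assumes "z \<in> HH"
  shows "(\<Sum>k. of_nat (divsum n (Suc k)) * exp (2 * of_real pi * \<i> * of_nat (Suc k) * z)) =
     (\<Sum>\<^sub>\<infinity>N\<in>{1..}. of_nat (divsum n N) * exp (2 * of_real pi * \<i> * z) ^ N)"
proof -
  let ?q = "exp (2 * of_real pi * \<i> * z)"
  have q: "norm ?q < 1" using assms norm_exp_HH by blast
  let ?f = "\<lambda>N. of_nat (divsum n N) * ?q ^ N"
  have "(\<lambda>N. norm (?f N)) summable_on {1..}"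
    using summable_divisor_sum[of "norm ?q" n] q by (simp add: norm_mult norm_power)
  then have "(?f has_sum infsum ?f {1..}) {1..}"
    by (rule has_sum_infsum[OF abs_summable_summable])
  moreover have "range Suc = {1..}" by (auto simp: image_iff Suc_le_eq gr0_conv_Suc)
  ultimately have "((?f \<circ> Suc) has_sum infsum ?f {1..}) UNIV"
    using has_sum_reindex[of Suc UNIV ?f] by simp
  from has_sum_imp_sums[OF this] have "(\<Sum>k. ?f (Suc k)) = infsum ?f {1..}"
    by (simp add: sums_iff o_def)
  moreover have "?f (Suc k) = of_nat (divsum n (Suc k)) * exp (2 * of_real pi * \<i> * of_nat (Suc k) * z)" for k
    by (simp only: exp_of_nat_mult[symmetric] mult_ac)
  ultimately show ?thesis by (simp only:)
qed

text \<open>The row m = 0 is twice a zeta value, the rows m and - m agree because the exponent is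
  even, and each row m > 0 is the Lipschitz formula at m z. Collecting equal products m r yields the
  divisor sums.\<close>

lemma eis_sum_fourier:
  assumes z: "z \<in> HH" and n: "odd n" "n \<ge> 3"
  shows "eis_sum (Suc n) z = 2 * (\<Sum>k. 1 / of_nat (Suc k) ^ Suc n) + 2 * ((2 * of_real pi * \<i>) ^ Suc n / fact n) *
     (\<Sum>k. of_nat (divsum n (Suc k)) * exp (2 * of_real pi * \<i> * of_nat (Suc k) * z))"
proof -
  define K where "K = ((2 * of_real pi * \<i>) ^ Suc n / fact n :: complex)"
  define Z where "Z = (\<Sum>k. 1 / (of_nat (Suc k) :: complex) ^ Suc n)"
  let ?q = "exp (2 * of_real pi * \<i> * z)"
  let ?B = "\<lambda>m::int. if m = 0 then UNIV - {0} else UNIV :: int set"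
  let ?g = "\<lambda>m n'. 1 / (of_int m * z + of_int n') ^ Suc n"
  have q: "norm ?q < 1" using z norm_exp_HH by blast
  have set: "UNIV - {(0, 0)} = Sigma UNIV ?B" by (auto split: if_splits)
  have sm: "(\<lambda>(m, n'). ?g m n') summable_on Sigma UNIV ?B"
    using abs_summable_summable[OF lattice_summable[OF z, of "Suc n"]] n unfolding set by simp
  have ev: "(- w) ^ Suc n = w ^ Suc n" for w :: complex using n by (metis even_Suc power_minus_even)
  define R where "R m = infsum (?g m) (?B m)" for m
  have eis: "eis_sum (Suc n) z = infsum R UNIV"
    unfolding eis_sum_def set R_def by (rule infsum_Sigma'_banach[symmetric]) (rule sm)
  have Rsm: "R summable_on UNIV"
    unfolding R_def by (rule summable_on_Sigma_banach[OF sm])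
  have Rpos: "R (int m) = K * lipschitz_sum n (of_nat m * z)" if "m \<ge> 1" for m
  proof -
    have "of_nat m * z \<in> HH" using z that by (simp add: HH_def)
    from lipschitz_formula[OF this n] show ?thesis
      using that by (simp add: R_def K_def infsumI del: power_Suc)
  qed
  have Rneg: "R (- m) = R m" for m
  proof -
    have "bij_betw uminus (?B m) (?B (- m))" by (rule bij_betw_byWitness[of _ uminus]) auto
    from infsum_reindex_bij_betw[OF this, of "?g (- m)"]
    have "R (- m) = (\<Sum>\<^sub>\<infinity>k\<in>?B m. 1 / (of_int (- m) * z + of_int (- k)) ^ Suc n)"
      by (simp add: R_def)
    also have "\<dots> = (\<Sum>\<^sub>\<infinity>k\<in>?B m. 1 / (- (of_int m * z + of_int k)) ^ Suc n)" by (simp del: power_Suc)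
    finally show ?thesis by (simp only: ev R_def)
  qed
  have R0: "R 0 = 2 * Z"
  proof -
    have sm0: "?g 0 summable_on (UNIV - {0})"
      using summable_on_SigmaD1[OF sm, of 0] by simp
    define f where "f k = (if k = 0 then 0 else ?g 0 k)" for k
    have eq: "infsum f UNIV = infsum (?g 0) (UNIV - {0})"
      by (rule infsum_cong_neutral) (auto simp: f_def)
    have fsm: "f summable_on UNIV"
    proof -
      have "f summable_on UNIV \<longleftrightarrow> ?g 0 summable_on (UNIV - {0})"
        by (rule summable_on_cong_neutral) (auto simp: f_def)
      then show ?thesis using sm0 by blast
    qed
    have Zs: "(\<lambda>k. 1 / (of_nat (Suc k) :: complex) ^ Suc n) sums Z"
      unfolding Z_def using zeta_from_Polygamma[of n] n by (intro summable_sums) (auto dest: sums_summable)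
    have "(\<lambda>k. f (int (Suc k))) sums Z" using Zs by (simp add: f_def del: power_Suc)
    then have 1: "(\<lambda>k. f (int k)) sums Z" by (subst (asm) sums_Suc_iff) (simp add: f_def)
    have "f (- int k - 1) = 1 / (of_nat (Suc k) :: complex) ^ Suc n" for k
    proof -
      have "of_int (- int k - 1) = - (of_nat (Suc k) :: complex)" by simp
      then show ?thesis by (simp only: f_def) (simp add: ev del: power_Suc of_nat_Suc)
    qed
    then have 2: "(\<lambda>k. f (- int k - 1)) sums Z" using Zs by (simp only:)
    have "infsum f UNIV = Z + Z" using has_sum_split_int[OF fsm 1 2] by (simp add: infsumI)
    then show ?thesis using eq by (simp add: R_def)
  qed
  have "(\<lambda>m. R (int m)) summable_on {1..}"
    using summable_on_subset_banach[OF Rsm, of "int ` {1..}"] summable_on_reindex[of int "{1..}" R]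
    by (simp add: o_def inj_on_def)
  have "infsum R UNIV = R 0 + 2 * (\<Sum>\<^sub>\<infinity>m\<in>{1..}. R (int m))"
  proof -
    have 1: "(\<Sum>\<^sub>\<infinity>m\<in>int ` {1..}. R m) = (\<Sum>\<^sub>\<infinity>m\<in>{1..}. R (int m))"
      by (subst infsum_reindex) (auto simp: o_def inj_on_def)
    have 2: "(\<Sum>\<^sub>\<infinity>m\<in>(\<lambda>m. - int m) ` {1..}. R m) = (\<Sum>\<^sub>\<infinity>m\<in>{1..}. R (int m))"
      by (subst infsum_reindex) (auto simp: o_def inj_on_def Rneg)
    have s: "R summable_on A" for A by (rule summable_on_subset_banach[OF Rsm]) auto
    have U: "UNIV = {0} \<union> (int ` {1..} \<union> (\<lambda>m. - int m) ` {1..})"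
    proof -
      have "m \<in> {0} \<union> (int ` {1..} \<union> (\<lambda>m. - int m) ` {1..})" for m
        by (cases m rule: int_cases3) (auto simp: Suc_le_eq)
      then show ?thesis by blast
    qed
    have "infsum R UNIV = infsum R {0} + infsum R (int ` {1..} \<union> (\<lambda>m. - int m) ` {1..})"
      by (subst U, rule infsum_Un_disjoint) (use s in auto)
    also have "infsum R (int ` {1..} \<union> (\<lambda>m. - int m) ` {1..}) = infsum R (int ` {1..}) + infsum R ((\<lambda>m. - int m) ` {1..})"
      by (rule infsum_Un_disjoint) (use s in auto)
    finally show ?thesis using 1 2 by simp
  qed
  also have "(\<Sum>\<^sub>\<infinity>m\<in>{1..}. R (int m)) = (\<Sum>\<^sub>\<infinity>m\<in>{1..}. K * (\<Sum>\<^sub>\<infinity>r\<in>{1..}. of_nat r ^ n * ?q ^ (m * r)))"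
  proof (rule infsum_cong)
    fix m :: nat assume m: "m \<in> {1..}"
    then have "of_nat m * z \<in> HH" using z by (simp add: HH_def)
    moreover have "exp (2 * of_real pi * \<i> * (of_nat m * z)) ^ r = ?q ^ (m * r)" for r
      by (simp add: mult_ac flip: exp_of_nat_mult)
    ultimately show "R (int m) = K * (\<Sum>\<^sub>\<infinity>r\<in>{1..}. of_nat r ^ n * ?q ^ (m * r))"
      using Rpos[of m] m lipschitz_sum_infsum[of "of_nat m * z" n] n by simp
  qed
  also have "\<dots> = K * (\<Sum>\<^sub>\<infinity>m\<in>{1..}. \<Sum>\<^sub>\<infinity>r\<in>{1..}. of_nat r ^ n * ?q ^ (m * r))"
    by (rule infsum_cmult_right')
  also have "\<dots> = K * (\<Sum>k. of_nat (divsum n (Suc k)) * exp (2 * of_real pi * \<i> * of_nat (Suc k) * z))"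
    unfolding divisor_lambert(1)[OF q] sum_divisors_suminf[OF z] ..
  finally show ?thesis unfolding eis R0 K_def[symmetric] Z_def[symmetric] by simp
qed

text \<open>The constant is 1 / (2 \<zeta>(4)) with \<zeta>(4) = \<pi>^4 / 90; the weight 6 analogue
  below uses \<zeta>(6) = \<pi>^6 / 945.\<close>

lemma E4_eq_eis_sum:
  assumes "z \<in> HH"
  shows "E4 z = 45 / of_real pi ^ 4 * eis_sum 4 z"
proof -
  have f: "fact 3 = (6::complex)" by (simp add: fact_numeral)
  have "(\<Sum>k. 1 / (of_nat (Suc k) :: complex) ^ Suc 3) = of_real pi ^ 4 / 90"
    using sums_unique[OF zeta_from_Polygamma[of 3]] Polygamma_one_half(1) by (simp add: f)
  moreover define S where "S = (\<Sum>k. of_nat (divsum 3 (Suc k)) * exp (2 * of_real pi * \<i> * of_nat (Suc k) * z))"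
  ultimately have "eis_sum (Suc 3) z = 2 * (of_real pi ^ 4 / 90) + 2 * ((2 * of_real pi * \<i>) ^ Suc 3 / 6) * S"
    using eis_sum_fourier[OF assms, of 3] by (simp only: f) simp
  moreover have "E4 z = 1 + 240 * S" unfolding E4_def S_def ..
  ultimately show ?thesis by (simp add: power_mult_distrib field_simps)
qed

lemma E6_eq_eis_sum:
  assumes "z \<in> HH"
  shows "E6 z = 945 / (2 * of_real pi ^ 6) * eis_sum 6 z"
proof -
  have f: "fact 5 = (120::complex)" by (simp add: fact_numeral)
  have i: "\<i> ^ 6 = -1" by (simp add: eval_nat_numeral)
  have "(\<Sum>k. 1 / (of_nat (Suc k) :: complex) ^ Suc 5) = of_real pi ^ 6 / 945"
    using sums_unique[OF zeta_from_Polygamma[of 5]] Polygamma_one_half(2) by (simp add: f)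
  moreover define S where "S = (\<Sum>k. of_nat (divsum 5 (Suc k)) * exp (2 * of_real pi * \<i> * of_nat (Suc k) * z))"
  ultimately have "eis_sum (Suc 5) z = 2 * (of_real pi ^ 6 / 945) + 2 * ((2 * of_real pi * \<i>) ^ Suc 5 / 120) * S"
    using eis_sum_fourier[OF assms, of 5] by (simp only: f) simp
  moreover have e: "E6 z = 1 - 504 * S" unfolding E6_def S_def ..
  ultimately show ?thesis unfolding e by (simp add: power_mult_distrib field_simps i)
qed

lemma Im_mob:
  assumes "a * d - b * c = 1"
  shows "Im (mob a b c d z) = Im z / norm (of_int c * z + of_int d) ^ 2"
proof -
  have "Im (mob a b c d z) = real_of_int (a * d - b * c) * Im z / norm (of_int c * z + of_int d) ^ 2"
    unfolding mob_def Im_divide by (simp add: cmod_power2 algebra_simps)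
  then show ?thesis using assms by simp
qed

lemma mob_denom_nonzero:
  assumes "a * d - b * c = 1" "z \<in> HH"
  shows "of_int c * z + of_int d \<noteq> 0"
proof
  assume "of_int c * z + of_int d = 0"
  then have "c = 0" "d = 0" using assms(2) by (auto simp: complex_eq_iff HH_def)
  then show False using assms(1) by simp
qed

lemma mob_in_HH:
  assumes "a * d - b * c = 1" "z \<in> HH"
  shows "mob a b c d z \<in> HH"
proof -
  have "0 < Im z / norm (of_int c * z + of_int d) ^ 2"
    using assms(2) mob_denom_nonzero[OF assms] by (intro divide_pos_pos) (auto simp: HH_def)
  then show ?thesis by (simp only: HH_def mem_Collect_eq Im_mob[OF assms(1)])
qed

lemma E4_mobius:
  assumes "a * d - b * c = 1" "z \<in> HH"
  shows "E4 (mob a b c d z) = (of_int c * z + of_int d) ^ 4 * E4 z"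
  unfolding E4_eq_eis_sum[OF mob_in_HH[OF assms]] E4_eq_eis_sum[OF assms(2)] eis_sum_mobius[OF assms(2,1)]
  by (rule mult.left_commute)

lemma E6_mobius:
  assumes "a * d - b * c = 1" "z \<in> HH"
  shows "E6 (mob a b c d z) = (of_int c * z + of_int d) ^ 6 * E6 z"
  unfolding E6_eq_eis_sum[OF mob_in_HH[OF assms]] E6_eq_eis_sum[OF assms(2)] eis_sum_mobius[OF assms(2,1)]
  by (rule mult.left_commute)

lemma Delta_mobius:
  assumes "a * d - b * c = 1" "z \<in> HH"
  shows "Delta (mob a b c d z) = (of_int c * z + of_int d) ^ 12 * Delta z"
proof -
  have "((w ^ 4 * A) ^ 3 - (w ^ 6 * B) ^ 2) / 1728 = w ^ 12 * ((A ^ 3 - B ^ 2) / 1728)" for w A B :: complex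
    by (simp add: power_mult_distrib right_diff_distrib power_mult [symmetric])
  then show ?thesis
    unfolding Delta_def E4_mobius[OF assms] E6_mobius[OF assms] .
qed

lemma jinv_mobius:
  assumes "a * d - b * c = 1" "z \<in> HH"
  shows "jinv (mob a b c d z) = jinv z"
proof -
  have "(w ^ 4 * A) ^ 3 / (w ^ 12 * D) = A ^ 3 / D" if "w \<noteq> 0" for w A D :: complex
    using that by (simp add: power_mult_distrib power_mult [symmetric])
  from this[OF mob_denom_nonzero[OF assms]] show ?thesis
    unfolding jinv_def Delta_mobius[OF assms] E4_mobius[OF assms] .
qed

section \<open>The fundamental domain\<close>

text \<open>Every natural number divides 0, and a sum over an infinite set is 0 by
  convention.\<close>

lemma divsum_0 [simp]: "divsum n 0 = 0"
  by (simp add: divsum_def infinite_UNIV_nat)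

lemma divsum_le: "divsum n N \<le> N ^ Suc n"
proof (cases "N = 0")
  case False
  have "divsum n N \<le> (\<Sum>d\<in>{d. d dvd N}. N ^ n)"
    unfolding divsum_def using False by (intro sum_mono power_mono) (auto dest: dvd_imp_le)
  also have "\<dots> = card {d. d dvd N} * N ^ n" by simp
  also have "\<dots> \<le> card {1..N} * N ^ n"
    using False by (intro mult_right_mono card_mono) (auto dest: dvd_imp_le intro: Suc_leI Nat.gr0I)
  finally show ?thesis by simp
qed simp

section \<open>Estimates in the nome and nonvanishing of Delta near the cusp\<close>

text \<open>The divisor series with one power of q removed. This makes E4 = 1 + 240 q (...), and
  quotients by q become explicit power series that are regular at q = 0.\<close>

definition divsum_series :: "nat \<Rightarrow> complex \<Rightarrow> complex" where
  "divsum_series n q = (\<Sum>k. of_nat (divsum n (Suc k)) * q ^ k)"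

lemma divsum_series_sums:
  assumes "norm q < 1"
  shows "(\<lambda>k. of_nat (divsum n (Suc k)) * q ^ k) sums divsum_series n q"
proof -
  have "summable (\<lambda>k. real (Suc k) ^ Suc n * norm q ^ k)"
  proof (cases "q = 0")
    case True
    then show ?thesis by (intro summable_finite[of "{0}"]) (auto simp: power_0_left)
  next
    case False
    have "summable (\<lambda>k. of_nat (Suc k) ^ Suc n * norm q ^ Suc k)"
      using summable_nat_power_geometric[of "norm q" "Suc n"] assms by (subst summable_Suc_iff) simp
    then have "summable (\<lambda>k. of_nat (Suc k) ^ Suc n * norm q ^ Suc k / norm q)"
      by (rule summable_divide)
    then show ?thesis using False by (simp add: mult_ac)
  qed
  then have "summable (\<lambda>k. norm (of_nat (divsum n (Suc k)) * q ^ k))"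
  proof (rule summable_comparison_test'[of _ 0])
    fix k
    have "real (divsum n (Suc k)) \<le> real (Suc k) ^ Suc n"
      using divsum_le[of n "Suc k"] by (metis of_nat_le_iff of_nat_power)
    then show "norm (norm (of_nat (divsum n (Suc k)) * q ^ k)) \<le> real (Suc k) ^ Suc n * norm q ^ k"
      by (simp add: norm_mult norm_power mult_right_mono del: power_Suc of_nat_Suc)
  qed
  then have "summable (\<lambda>k. of_nat (divsum n (Suc k)) * q ^ k)" by (rule summable_norm_cancel)
  then show ?thesis unfolding divsum_series_def by (rule summable_sums)
qed

lemma divsum_series_holomorphic: "divsum_series n holomorphic_on ball 0 1"
  by (rule power_series_holomorphic[where a = "\<lambda>k. of_nat (divsum n (Suc k))"])
    (use divsum_series_sums in simp)

text \<open>The first two coefficients are 1 and 1 + 2^n; the crude bound N^(n+1) for the others is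
  dominated by a geometric series. The factor 1.04 bounds 1 / (1 - d |q|), since d |q| \<le>
  6/200.\<close>

lemma divsum_series_remainder:
  assumes "norm q \<le> 1 / 200"
    and bnd: "\<And>k. real ((k + 3) ^ Suc n) \<le> c * d ^ k" and "d \<ge> 0" "d \<le> 6"
  shows "norm (divsum_series n q - 1 - of_nat (1 + 2 ^ n) * q) \<le> c * 1.04 * norm q ^ 2"
proof -
  have d1: "divsum n (Suc 0) = 1" by (simp add: divsum_def)
  have "{d. d dvd (2::nat)} = {1, 2}"
  proof (intro equalityI subsetI)
    fix d :: nat assume "d \<in> {d. d dvd 2}"
    then have "d \<le> 2" "d \<noteq> 0" by (auto dest: dvd_imp_le intro: Nat.gr0I)
    then show "d \<in> {1, 2}" by auto
  qed auto
  then have d2: "divsum n (Suc (Suc 0)) = 1 + 2 ^ n" by (simp add: divsum_def numeral_2_eq_2)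
  have q: "norm q < 1" using assms by simp
  have s: "(\<lambda>k. of_nat (divsum n (Suc (k + 2))) * q ^ (k + 2)) sums
     (divsum_series n q - (\<Sum>k<2. of_nat (divsum n (Suc k)) * q ^ k))"
    by (rule sums_split_initial_segment[OF divsum_series_sums[OF q]])
  have "(\<Sum>k<2. of_nat (divsum n (Suc k)) * q ^ k) = 1 + of_nat (1 + 2 ^ n) * q"
    by (simp add: numeral_2_eq_2 d1 d2)
  then have eq: "divsum_series n q - 1 - of_nat (1 + 2 ^ n) * q = (\<Sum>k. of_nat (divsum n (Suc (k + 2))) * q ^ (k + 2))"
    using s by (simp add: sums_iff algebra_simps)
  have c0: "c \<ge> 0" using bnd[of 0] by (simp add: order_trans[rotated])
  have dq: "d * norm q < 1" and dq2: "d * norm q \<le> 6 / 200" using assms mult_mono[of d 6 "norm q" "1/200"] by auto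
  have g: "(\<lambda>k. c * norm q ^ 2 * (d * norm q) ^ k) sums (c * norm q ^ 2 * (1 / (1 - d * norm q)))"
    using assms dq by (intro sums_mult geometric_sums) simp
  have le: "norm (of_nat (divsum n (Suc (k + 2))) * q ^ (k + 2)) \<le> c * norm q ^ 2 * (d * norm q) ^ k" for k
  proof -
    have "real (divsum n (Suc (k + 2))) \<le> real ((k + 3) ^ Suc n)"
      using divsum_le[of n "k + 3"] by (simp only: of_nat_le_iff) (simp add: numeral_3_eq_3)
    also have "\<dots> \<le> c * d ^ k" by (rule bnd)
    finally have "real (divsum n (Suc (k + 2))) * norm q ^ (k + 2) \<le> c * d ^ k * norm q ^ (k + 2)"
      by (rule mult_right_mono) simp
    then show ?thesis by (simp add: norm_mult norm_power power_mult_distrib power_add power2_eq_square mult_ac)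
  qed
  have "norm (\<Sum>k. of_nat (divsum n (Suc (k + 2))) * q ^ (k + 2)) \<le> c * norm q ^ 2 * (1 / (1 - d * norm q))"
    using norm_suminf_le[OF le sums_summable[OF g]] g by (simp add: sums_iff)
  also have "\<dots> \<le> c * norm q ^ 2 * 1.04"
    using dq2 c0 by (intro mult_left_mono) (auto simp: field_simps)
  finally show ?thesis unfolding eq by (simp add: mult_ac)
qed

abbreviation nome :: "complex \<Rightarrow> complex" where
  "nome z \<equiv> exp (2 * of_real pi * \<i> * z)"

lemma nome_shift_series:
  assumes "z \<in> HH"
  shows "(\<Sum>k. of_nat (divsum n (Suc k)) * exp (2 * of_real pi * \<i> * of_nat (Suc k) * z)) = nome z * divsum_series n (nome z)"
proof -
  have "of_nat (divsum n (Suc k)) * exp (2 * of_real pi * \<i> * of_nat (Suc k) * z) =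
      nome z * (of_nat (divsum n (Suc k)) * nome z ^ k)" for k
  proof -
    have "exp (2 * of_real pi * \<i> * of_nat (Suc k) * z) = nome z ^ Suc k"
      by (simp only: exp_of_nat_mult[symmetric] mult_ac)
    then show ?thesis by simp
  qed
  moreover have "(\<lambda>k. nome z * (of_nat (divsum n (Suc k)) * nome z ^ k)) sums (nome z * divsum_series n (nome z))"
    by (intro sums_mult divsum_series_sums norm_exp_HH assms)
  ultimately show ?thesis by (simp only: sums_iff)
qed

text \<open>\<open>Delta\<close> divided by q: in E4^3 - E6^2 the constants cancel, and every
  remaining term carries a factor q that has been removed, so the expression makes sense at q =
  0.\<close>

definition delta_q :: "complex \<Rightarrow> complex" where
  "delta_q q = (720 * divsum_series 3 q + 172800 * q * divsum_series 3 q ^ 2 + 13824000 * q^2 * divsum_series 3 q ^ 3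
     + 1008 * divsum_series 5 q - 254016 * q * divsum_series 5 q ^ 2) / 1728"

lemma E4_nome: "z \<in> HH \<Longrightarrow> E4 z = 1 + 240 * (nome z * divsum_series 3 (nome z))"
  unfolding E4_def by (simp only: nome_shift_series)

lemma E6_nome: "z \<in> HH \<Longrightarrow> E6 z = 1 - 504 * (nome z * divsum_series 5 (nome z))"
  unfolding E6_def by (simp only: nome_shift_series)

lemma Delta_nome: "z \<in> HH \<Longrightarrow> Delta z = nome z * delta_q (nome z)"
proof -
  assume z: "z \<in> HH"
  have "((1 + 240 * (q * a)) ^ 3 - (1 - 504 * (q * b)) ^ 2) / 1728 =
     q * ((720 * a + 172800 * q * a ^ 2 + 13824000 * q^2 * a ^ 3 + 1008 * b - 254016 * q * b ^ 2) / 1728)"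
    for q a b :: complex
    by (simp add: field_simps power2_eq_square power3_eq_cube)
  then show ?thesis
    unfolding Delta_def E4_nome[OF z] E6_nome[OF z] delta_q_def .
qed

text \<open>1728 \<open>delta_q q\<close> equals 1728 minus a remainder that the triangle inequality
  bounds by 1260. The radius 1/200 covers the nomes of the whole fundamental domain.\<close>

lemma delta_q_nonzero_small:
  assumes q: "norm q \<le> 1 / 200"
  shows "delta_q q \<noteq> 0"
proof
  assume zero: "delta_q q = 0"
  define A where "A = divsum_series 3 q - 1 - of_nat (1 + 2 ^ 3) * q"
  define B where "B = divsum_series 5 q - 1 - of_nat (1 + 2 ^ 5) * q"
  have x2: "norm q ^ 2 \<le> 1 / 40000"
    using power_mono[OF q, of 2] by (simp add: power_divide)
  \<comment> \<open>The ratio of consecutive bases is at most 4/3; (4/3)^4 < 4 here, and (4/3)^6 < 6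
    in the next bound. The constants 81 and 729 are the values at k = 0.\<close>
  have b3: "real ((k + 3) ^ Suc 3) \<le> 81 * 4 ^ k" for k
  proof (induction k)
    case (Suc k)
    have "(real k + 4) \<le> 4 / 3 * (real k + 3)" by simp
    then have "(real k + 4) ^ 4 \<le> (4 / 3 * (real k + 3)) ^ 4" by (intro power_mono) auto
    also have "\<dots> = 256 / 81 * (real k + 3) ^ 4" unfolding power_mult_distrib by (simp add: power_divide)
    also have "\<dots> \<le> 4 * (real k + 3) ^ 4" by (intro mult_right_mono) auto
    also have "\<dots> \<le> 4 * (81 * 4 ^ k)" using Suc by simp
    finally show ?case by (simp add: add_ac)
  qed simp
  have b5: "real ((k + 3) ^ Suc 5) \<le> 729 * 6 ^ k" for k
  proof (induction k)
    case (Suc k)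
    have "(real k + 4) \<le> 4 / 3 * (real k + 3)" by simp
    then have "(real k + 4) ^ 6 \<le> (4 / 3 * (real k + 3)) ^ 6" by (intro power_mono) auto
    also have "\<dots> = 4096 / 729 * (real k + 3) ^ 6" unfolding power_mult_distrib by (simp add: power_divide)
    also have "\<dots> \<le> 6 * (real k + 3) ^ 6" by (intro mult_right_mono) auto
    also have "\<dots> \<le> 6 * (729 * 6 ^ k)" using Suc by simp
    finally show ?case by (simp add: add_ac)
  qed simp
  have A: "norm A \<le> 0.0022"
    using divsum_series_remainder[OF q b3] x2 by (simp add: A_def)
  have B: "norm B \<le> 0.019"
    using divsum_series_remainder[OF q b5] x2 by (simp add: B_def)
  define u where "u = 9 * q + A"
  define w where "w = 33 * q + B"
  have u: "norm u \<le> 0.0472" unfolding u_def using A q by (intro norm_triangle_le) (simp add: norm_mult)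
  have w: "norm w \<le> 0.184" unfolding w_def using B q by (intro norm_triangle_le) (simp add: norm_mult)
  have t3: "divsum_series 3 q = 1 + u" and t5: "divsum_series 5 q = 1 + w"
    by (simp_all add: u_def w_def A_def B_def)
  \<comment> \<open>The large linear contributions are combined before norms are taken. What is left
    is 41472 q = 24 * 1728 q, the coefficient -24 of the discriminant; estimating them separately
    would be too lossy.\<close>
  have e1: "(720 * (1 + u) + 172800 * q * (1 + u) ^ 2 + 13824000 * q^2 * (1 + u) ^ 3 + 1008 * (1 + w) - 254016 * q * (1 + w) ^ 2)
     = 1728 - (41472 * q - 720 * A - 1008 * B - 172800 * q * (2 * u + u^2) + 254016 * q * (2 * w + w^2) - 13824000 * q^2 * (1 + u)^3)"
  proof -
    have "(720 * (1 + u) + 172800 * q * (1 + u) ^ 2 + y + 1008 * (1 + w) - 254016 * q * (1 + w) ^ 2)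
     = 1728 - (41472 * q - 720 * A - 1008 * B - 172800 * q * (2 * u + u^2) + 254016 * q * (2 * w + w^2) - y)" for y
    proof -
      have "720 * (1 + u) + 1008 * (1 + w) = 1728 + 39744 * q + 720 * A + 1008 * B"
        by (simp add: u_def w_def)
      moreover have "172800 * q * (1 + u) ^ 2 = 172800 * q + 172800 * q * (2 * u + u^2)"
        by (simp add: power2_eq_square algebra_simps)
      moreover have "254016 * q * (1 + w) ^ 2 = 254016 * q + 254016 * q * (2 * w + w^2)"
        by (simp add: power2_eq_square algebra_simps)
      ultimately show ?thesis by (simp add: algebra_simps)
    qed
    then show ?thesis .
  qed
  have e2: "(720 * (1 + u) + 172800 * q * (1 + u) ^ 2 + 13824000 * q^2 * (1 + u) ^ 3 + 1008 * (1 + w) - 254016 * q * (1 + w) ^ 2) = 0"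
    using zero by (simp add: delta_q_def t3 t5)
  have eq: "1728 = 41472 * q - 720 * A - 1008 * B - 172800 * q * (2 * u + u^2) + 254016 * q * (2 * w + w^2) - 13824000 * q^2 * (1 + u)^3"
    using trans[OF e1[symmetric] e2] by (rule right_minus_eq[THEN iffD1])
  have tri: "norm (a - b - c - d + e - f) \<le> norm a + norm b + norm c + norm d + norm e + norm f" for a b c d e f :: complex
    using norm_triangle_ineq4[of "a - b - c - d + e" f] norm_triangle_ineq[of "a - b - c - d" e]
      norm_triangle_ineq4[of "a - b - c" d] norm_triangle_ineq4[of "a - b" c] norm_triangle_ineq4[of a b] by linarith
  have n1: "norm (41472 * q) \<le> 208" using q by (simp add: norm_mult)
  have n2: "norm (720 * A) \<le> 2" using A by (simp add: norm_mult)
  have n3: "norm (1008 * B) \<le> 20" using B by (simp add: norm_mult)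
  have n4: "norm (172800 * q * (2 * u + u^2)) \<le> 90"
  proof -
    have "norm (u^2) \<le> 0.0472^2" using power_mono[OF u, of 2] by (simp add: norm_power)
    then have "norm (2 * u + u^2) \<le> 0.1" using u by (intro norm_triangle_le) (simp add: norm_mult power2_eq_square)
    then have "norm q * norm (2 * u + u^2) \<le> 1 / 200 * 0.1" using q by (intro mult_mono) auto
    then show ?thesis by (simp add: norm_mult)
  qed
  have n5: "norm (254016 * q * (2 * w + w^2)) \<le> 520"
  proof -
    have "norm (w^2) \<le> 0.184^2" using power_mono[OF w, of 2] by (simp add: norm_power)
    then have "norm (2 * w + w^2) \<le> 0.402" using w by (intro norm_triangle_le) (simp add: norm_mult power2_eq_square)
    then have "norm q * norm (2 * w + w^2) \<le> 1 / 200 * 0.402" using q by (intro mult_mono) auto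
    then show ?thesis by (simp add: norm_mult)
  qed
  have n6: "norm (13824000 * q^2 * (1 + u)^3) \<le> 420"
  proof -
    have "norm (1 + u) \<le> 1.0472" using u by (intro norm_triangle_le) simp
    then have "norm (1 + u) ^ 3 \<le> 1.0472 ^ 3" by (intro power_mono) auto
    also have "\<dots> \<le> (1.15 :: real)" by (simp add: power3_eq_cube)
    finally have "norm q ^ 2 * norm (1 + u) ^ 3 \<le> 1 / 40000 * 1.15" using x2 by (intro mult_mono) auto
    then show ?thesis by (simp add: norm_mult norm_power)
  qed
  have "norm (41472 * q - 720 * A - 1008 * B - 172800 * q * (2 * u + u^2) + 254016 * q * (2 * w + w^2) - 13824000 * q^2 * (1 + u)^3)
    \<le> 208 + 2 + 20 + 90 + 520 + 420"
    using tri[of "41472 * q" "720 * A" "1008 * B" "172800 * q * (2 * u + u^2)" "254016 * q * (2 * w + w^2)" "13824000 * q^2 * (1 + u)^3"]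
      n1 n2 n3 n4 n5 n6 by linarith
  then show False unfolding eq[symmetric] by simp
qed

lemma norm_nome: "norm (nome z) = exp (- 2 * pi * Im z)"
  by (simp add: norm_exp_eq_Re)

text \<open>433/500 is a rational number just below sqrt 3 / 2, the height of the corners.\<close>

lemma fundamental_domain_Im:
  assumes "\<bar>Re z\<bar> \<le> 1 / 2" "norm z \<ge> 1" "z \<in> HH"
  shows "Im z \<ge> 433 / 500"
proof -
  have "1 \<le> norm z ^ 2" using assms by simp
  then have "1 \<le> Re z ^ 2 + Im z ^ 2" by (simp add: cmod_power2)
  moreover have "Re z ^ 2 \<le> (1 / 2) ^ 2" using assms(1) by (metis abs_ge_zero power2_abs power_mono)
  ultimately have "(433 / 500) ^ 2 \<le> Im z ^ 2" by (simp add: power2_eq_square)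
  then show ?thesis by (rule power2_le_imp_le) (use assms in \<open>simp add: HH_def\<close>)
qed

text \<open>2 \<pi> * 433/500 exceeds 5.4, and exp 5.4 = (exp 0.27)^20, where the quadratic Taylor
  bound at 0.27 is sharp enough to reach 200.\<close>

lemma nome_small:
  assumes "Im z \<ge> 433 / 500"
  shows "norm (nome z) \<le> 1 / 200"
proof -
  have "(200::real) \<le> (1 + 0.27 + 0.27\<^sup>2 / 2) ^ 20" by (simp add: power2_eq_square eval_nat_numeral)
  also have "\<dots> \<le> exp 0.27 ^ 20"
    using exp_lower_Taylor_quadratic[of "0.27::real"] by (intro power_mono) auto
  also have "\<dots> = exp (5.4 :: real)" by (simp flip: exp_of_nat_mult)
  also have "\<dots> \<le> exp (2 * pi * Im z)"
  proof -
    have "5.4 \<le> 2 * 3.14 * (433 / 500 :: real)" by simp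
    also have "\<dots> \<le> 2 * pi * Im z" using assms pi_approx by (intro mult_mono) auto
    finally show ?thesis by simp
  qed
  finally have "200 \<le> exp (2 * pi * Im z)" .
  then have "inverse (exp (2 * pi * Im z)) \<le> inverse 200" by (intro le_imp_inverse_le) auto
  then show ?thesis by (simp add: norm_nome exp_minus)
qed

section \<open>Reduction to the fundamental domain\<close>

text \<open>Generated by translations and inversion, so that invariance under the two generators
  transfers by induction; \<open>modular_orbit_mob\<close> supplies a matrix where one is
  wanted.\<close>

inductive_set modular_orbit :: "complex \<Rightarrow> complex set" for z :: complex where
  base: "z \<in> modular_orbit z"
| plus: "w \<in> modular_orbit z \<Longrightarrow> w + of_int n \<in> modular_orbit z"
| inv: "w \<in> modular_orbit z \<Longrightarrow> - 1 / w \<in> modular_orbit z"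

lemma modular_orbit_mob:
  assumes "w \<in> modular_orbit z" "z \<in> HH"
  obtains a b c d where "a * d - b * c = 1" "w = mob a b c d z"
proof -
  have "\<exists>a b c d. a * d - b * c = 1 \<and> w = mob a b c d z"
    using assms(1)
  proof induction
    case base
    show ?case by (rule exI[of _ 1], rule exI[of _ 0], rule exI[of _ 0], rule exI[of _ 1]) (simp add: mob_def)
  next
    case (plus w n)
    then obtain a b c d where abcd: "a * d - b * c = 1" "w = mob a b c d z" by blast
    have "w + of_int n = mob (a + n * c) (b + n * d) c d z"
      using mob_denom_nonzero[OF abcd(1) assms(2)] unfolding abcd(2) mob_def by (simp add: field_simps)
    moreover have "(a + n * c) * d - (b + n * d) * c = 1" using abcd(1) by algebra
    ultimately show ?case by blast
  next
    case (inv w)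
    then obtain a b c d where abcd: "a * d - b * c = 1" "w = mob a b c d z" by blast
    have "- 1 / w = mob (- c) (- d) a b z"
    proof -
      have "- 1 / (A / C) = (- C) / A" for A C :: complex by simp
      then show ?thesis unfolding abcd(2) mob_def by simp
    qed
    moreover have "(- c) * b - (- d) * a = 1" using abcd(1) by algebra
    ultimately show ?case by blast
  qed
  then show ?thesis using that by blast
qed

lemma modular_orbit_HH: "w \<in> modular_orbit z \<Longrightarrow> z \<in> HH \<Longrightarrow> w \<in> HH"
  by (erule modular_orbit_mob) (auto intro: mob_in_HH)

text \<open>A point of maximal height in the orbit, translated into the strip, cannot have norm
  below 1, since inversion would raise it. The maximum exists: height at least Im z forces |c z + d|
  \<le> 1, which leaves finitely many pairs (c, d) and so finitely many heights.\<close>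

lemma modular_orbit_fundamental:
  assumes "z \<in> HH"
  obtains w where "w \<in> modular_orbit z" "\<bar>Re w\<bar> \<le> 1 / 2" "norm w \<ge> 1" "w \<in> HH"
proof -
  obtain C where C: "C > 0" "\<And>m n :: int. real_of_int (m^2 + n^2) \<le> C * norm (of_int m * z + of_int n) ^ 2"
    using lattice_norm_bound[OF assms] by blast
  have im: "Im z > 0" using assms by (simp add: HH_def)
  define B where "B = {w \<in> modular_orbit z. Im w \<ge> Im z}"
  define K where "K = \<lceil>C\<rceil>"
  have "Im ` B \<subseteq> (\<lambda>(c, d). Im z / norm (of_int c * z + of_int d) ^ 2) ` ({-K..K} \<times> {-K..K})"
  proof (intro subsetI, elim imageE)
    fix y w assume w: "y = Im w" "w \<in> B"
    then obtain a b c d where abcd: "a * d - b * c = 1" "w = mob a b c d z"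
      using modular_orbit_mob assms unfolding B_def by (metis (mono_tags, lifting) mem_Collect_eq)
    let ?N = "norm (of_int c * z + of_int d) ^ 2"
    have N: "?N > 0" using mob_denom_nonzero[OF abcd(1) assms] by simp
    have "Im z \<le> Im z / ?N" using w(2) Im_mob[OF abcd(1), of z] by (simp add: B_def abcd(2))
    then have "?N \<le> 1" using im N by (simp add: field_simps)
    then have "C * ?N \<le> C" using C(1) by (simp add: mult_left_le)
    then have "real_of_int (c^2 + d^2) \<le> C" using C(2)[of c d] by linarith
    then have le: "c^2 + d^2 \<le> K" unfolding K_def by linarith
    have sq: "\<bar>k\<bar> \<le> k^2" for k :: int
    proof (cases "k = 0")
      case False
      then have "\<bar>k\<bar> * 1 \<le> \<bar>k\<bar> * \<bar>k\<bar>" by (intro mult_left_mono) auto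
      then show ?thesis by (simp add: power2_eq_square)
    qed simp
    have "\<bar>c\<bar> \<le> K" "\<bar>d\<bar> \<le> K" using le sq[of c] sq[of d] zero_le_power2[of c] zero_le_power2[of d] by linarith+
    then show "y \<in> (\<lambda>(c, d). Im z / norm (of_int c * z + of_int d) ^ 2) ` ({-K..K} \<times> {-K..K})"
      using w(1) Im_mob[OF abcd(1), of z] abcd(2) by (intro image_eqI[of _ _ "(c, d)"]) auto
  qed
  then have fin: "finite (Im ` B)" by (rule finite_subset) auto
  have "z \<in> B" by (simp add: B_def modular_orbit.base)
  then have "Im ` B \<noteq> {}" by blast
  then obtain w0 where w0: "w0 \<in> B" "\<And>w. w \<in> B \<Longrightarrow> Im w \<le> Im w0"
    using Max_in[OF fin] Max_ge[OF fin] by (metis (no_types, lifting) imageE imageI)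
  define w where "w = w0 + of_int (- round (Re w0))"
  have wo: "w \<in> modular_orbit z" unfolding w_def using w0(1) by (intro modular_orbit.plus) (simp add: B_def)
  have re: "\<bar>Re w\<bar> \<le> 1 / 2" using of_int_round_abs_le[of "Re w0"] by (simp add: w_def abs_minus_commute)
  have iw: "Im w = Im w0" by (simp add: w_def)
  have wH: "w \<in> HH" using modular_orbit_HH[OF wo assms] .
  have "norm w \<ge> 1"
  proof (rule ccontr)
    assume "\<not> norm w \<ge> 1"
    then have "norm w ^ 2 < 1 ^ 2" by (intro power_strict_mono) auto
    then have lt: "norm w ^ 2 < 1" by simp
    have w0': "w \<noteq> 0" using wH by (auto simp: HH_def)
    have "Im (- 1 / w) = Im w / norm w ^ 2" by (rule Im_neg_inverse)
    also have "\<dots> > Im w" using lt w0' wH by (simp add: HH_def less_divide_eq)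
    finally have gt: "Im (- 1 / w) > Im w0" using iw by simp
    then have "- 1 / w \<in> B" using modular_orbit.inv[OF wo] w0(1) by (simp add: B_def)
    then show False using w0(2) gt by fastforce
  qed
  then show ?thesis using that wo re wH by blast
qed

lemma mob_T: "mob 1 1 0 1 z = z + 1" and mob_S: "mob 0 (-1) 1 0 z = - 1 / z"
  by (simp_all add: mob_def)

lemma jinv_plus_1: "z \<in> HH \<Longrightarrow> jinv (z + 1) = jinv z"
  using jinv_mobius[of 1 1 1 0 z] by (simp add: mob_T)

lemma jinv_inv: "z \<in> HH \<Longrightarrow> jinv (- 1 / z) = jinv z"
  using jinv_mobius[of 0 0 "-1" 1 z] by (simp only: mob_S)

lemma Delta_nonzero:
  assumes "z \<in> HH"
  shows "Delta z \<noteq> 0"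
proof -
  obtain w where w: "w \<in> modular_orbit z" "\<bar>Re w\<bar> \<le> 1 / 2" "norm w \<ge> 1" "w \<in> HH"
    using modular_orbit_fundamental[OF assms] by blast
  have "Delta w \<noteq> 0"
    using delta_q_nonzero_small[OF nome_small[OF fundamental_domain_Im[OF w(2-4)]]] by (simp add: Delta_nome[OF w(4)])
  moreover obtain a b c d where abcd: "a * d - b * c = 1" "w = mob a b c d z"
    by (rule modular_orbit_mob[OF w(1) assms])
  ultimately show ?thesis using Delta_mobius[OF abcd(1) assms] by (metis mult_zero_right)
qed

section \<open>The j-invariant and forms of weight 2\<close>

lemma divsum_series_at_0: "divsum_series n 0 = 1"
proof -
  have "(\<lambda>k. of_nat (divsum n (Suc k)) * (0::complex) ^ k) sums of_nat (divsum n (Suc 0))"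
    using powser_sums_zero[of "\<lambda>k. of_nat (divsum n (Suc k)) :: complex"] by simp
  moreover have "divsum n (Suc 0) = 1" by (simp add: divsum_def)
  ultimately show ?thesis unfolding divsum_series_def by (simp add: sums_iff)
qed

text \<open>Every nonzero q in the disc is the nome of a point of \<open>HH\<close>, so the
  nonvanishing of \<open>Delta\<close> on \<open>HH\<close> applies; q = 0 is covered by the
  estimate.\<close>

lemma delta_q_nonzero:
  assumes "norm q < 1"
  shows "delta_q q \<noteq> 0"
proof (cases "q = 0")
  case True
  then show ?thesis using delta_q_nonzero_small[of 0] by simp
next
  case False
  define z where "z = Ln q / (2 * of_real pi * \<i>)"
  have nz: "2 * of_real pi * \<i> * z = Ln q" by (simp add: z_def)
  then have q: "nome z = q" using False by simp
  then have "exp (- 2 * pi * Im z) < 1" using assms norm_nome[of z] by simp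
  then have "z \<in> HH" by (simp add: HH_def zero_less_mult_iff)
  then show ?thesis using Delta_nonzero[of z] Delta_nome[of z] q by auto
qed

definition j_nu :: "complex \<Rightarrow> complex" where
  "j_nu q = (1 + 240 * (q * divsum_series 3 q)) ^ 3 / delta_q q"

text \<open>The function j - 1 / q continued through q = 0. As \<open>j_nu\<close> is q j with value
  1 at 0, this is its difference quotient at 0, and the value at 0 is the constant term of
  j.\<close>

definition j_kappa :: "complex \<Rightarrow> complex" where
  "j_kappa q = (if q = 0 then deriv j_nu 0 else (j_nu q - j_nu 0) / (q - 0))"

lemma delta_q_holomorphic: "delta_q holomorphic_on ball 0 1"
  unfolding delta_q_def by (intro holomorphic_intros divsum_series_holomorphic) auto

lemma j_nu_holomorphic: "j_nu holomorphic_on ball 0 1"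
  unfolding j_nu_def
  by (intro holomorphic_intros divsum_series_holomorphic delta_q_holomorphic) (simp add: delta_q_nonzero)

lemma j_kappa_holomorphic: "j_kappa holomorphic_on ball 0 1"
  unfolding j_kappa_def by (rule pole_lemma_open[OF j_nu_holomorphic]) auto

lemma j_nu_0: "j_nu 0 = 1"
  by (simp add: j_nu_def delta_q_def divsum_series_at_0)

lemma jinv_nome:
  assumes "z \<in> HH"
  shows "jinv z = 1 / nome z + j_kappa (nome z)"
proof -
  have "jinv z = j_nu (nome z) / nome z"
    unfolding jinv_def Delta_nome[OF assms] E4_nome[OF assms] j_nu_def by simp
  then show ?thesis by (simp add: j_kappa_def j_nu_0 diff_divide_distrib)
qed

lemma nome_in_ball: "z \<in> HH \<Longrightarrow> nome z \<in> ball 0 1"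
  using norm_exp_HH by simp

lemma has_field_derivative_jinv:
  assumes "z \<in> HH"
  shows "(jinv has_field_derivative (2 * of_real pi * \<i> * (nome z * deriv j_kappa (nome z) - 1 / nome z))) (at z)"
proof -
  have dk: "(j_kappa has_field_derivative deriv j_kappa (nome z)) (at (nome z))"
    using holomorphic_derivI[OF j_kappa_holomorphic open_ball nome_in_ball[OF assms]] .
  have dn: "(nome has_field_derivative (nome z * (2 * of_real pi * \<i>))) (at z)"
    by (auto intro!: derivative_eq_intros)
  have "((\<lambda>z. inverse (nome z) + j_kappa (nome z)) has_field_derivative
     (- (inverse (nome z) * (nome z * (2 * of_real pi * \<i>)) * inverse (nome z))
       + deriv j_kappa (nome z) * (nome z * (2 * of_real pi * \<i>)))) (at z)"
    by (intro DERIV_add DERIV_inverse' DERIV_chain2[of j_kappa _ nome, OF dk] dn) simp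
  also have "(- (inverse (nome z) * (nome z * (2 * of_real pi * \<i>)) * inverse (nome z))
       + deriv j_kappa (nome z) * (nome z * (2 * of_real pi * \<i>))) =
      2 * of_real pi * \<i> * (nome z * deriv j_kappa (nome z) - 1 / nome z)"
    by (simp add: field_simps)
  finally show ?thesis
    by (rule has_field_derivative_transform_within_open[OF _ open_HH assms])
      (simp add: jinv_nome inverse_eq_divide)
qed

lemma jinv_holomorphic: "jinv holomorphic_on HH"
  using has_field_derivative_jinv holomorphic_onI field_differentiable_def field_differentiable_at_within by metis

lemma deriv_jinv: "z \<in> HH \<Longrightarrow> deriv jinv z = 2 * of_real pi * \<i> * (nome z * deriv j_kappa (nome z) - 1 / nome z)"
  using has_field_derivative_jinv DERIV_imp_deriv by blast

lemma deriv_jinv_holomorphic: "deriv jinv holomorphic_on HH"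
  by (rule holomorphic_deriv[OF jinv_holomorphic open_HH])

lemma DERIV_jinv: "z \<in> HH \<Longrightarrow> (jinv has_field_derivative deriv jinv z) (at z)"
  using holomorphic_derivI[OF jinv_holomorphic open_HH] .

lemma j_kappa_bounds:
  obtains M where "M > 0" "\<And>q. norm q \<le> 1 / 2 \<Longrightarrow> norm (j_kappa q) \<le> M"
    "\<And>q. norm q \<le> 1 / 2 \<Longrightarrow> norm (deriv j_kappa q) \<le> M"
proof -
  have sub: "cball 0 (1/2) \<subseteq> ball (0::complex) 1" by auto
  have "continuous_on (cball 0 (1/2)) j_kappa"
    using holomorphic_on_subset[OF j_kappa_holomorphic sub] holomorphic_on_imp_continuous_on by blast
  then have "bounded (j_kappa ` cball 0 (1/2))"
    by (intro compact_imp_bounded compact_continuous_image) auto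
  then obtain M1 where M1: "M1 > 0" "\<And>q. q \<in> cball 0 (1/2) \<Longrightarrow> norm (j_kappa q) \<le> M1"
    unfolding bounded_pos by blast
  have "continuous_on (cball 0 (1/2)) (deriv j_kappa)"
    using holomorphic_on_subset[OF holomorphic_deriv[OF j_kappa_holomorphic open_ball] sub] holomorphic_on_imp_continuous_on by blast
  then have "bounded (deriv j_kappa ` cball 0 (1/2))"
    by (intro compact_imp_bounded compact_continuous_image) auto
  then obtain M2 where M2: "M2 > 0" "\<And>q. q \<in> cball 0 (1/2) \<Longrightarrow> norm (deriv j_kappa q) \<le> M2"
    unfolding bounded_pos by blast
  show ?thesis
    by (rule that[of "max M1 M2"]) (use M1 M2 in \<open>auto simp: le_max_iff_disj\<close>)
qed

lemma nome_le_half: "Im z \<ge> 433/500 \<Longrightarrow> norm (nome z) \<le> 1 / 2"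
  using nome_small[of z] by simp

lemma deriv_jinv_plus_1:
  assumes "z \<in> HH" shows "deriv jinv (z + 1) = deriv jinv z"
proof -
  have z1: "z + 1 \<in> HH" using assms by (simp add: HH_def)
  have "(jinv has_field_derivative deriv jinv (z + 1)) (at (z + 1))" by (rule DERIV_jinv[OF z1])
  then have "((\<lambda>z. jinv (z + 1)) has_field_derivative deriv jinv (z + 1)) (at z)"
    by (simp add: DERIV_shift)
  then have "(jinv has_field_derivative deriv jinv (z + 1)) (at z)"
    by (rule has_field_derivative_transform_within_open[OF _ open_HH assms]) (simp add: jinv_plus_1)
  then show ?thesis by (rule DERIV_imp_deriv[symmetric])
qed

lemma deriv_jinv_inv:
  assumes "z \<in> HH" shows "deriv jinv (- 1 / z) = z ^ 2 * deriv jinv z"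
proof -
  have nz: "z \<noteq> 0" using assms by (auto simp: HH_def)
  have d1: "((\<lambda>z. - 1 / z) has_field_derivative (1 / z ^ 2)) (at z)"
    using nz by (auto intro!: derivative_eq_intros simp: power2_eq_square)
  have "((\<lambda>z. jinv (- 1 / z)) has_field_derivative deriv jinv (- 1 / z) * (1 / z ^ 2)) (at z)"
    by (rule DERIV_chain2[OF DERIV_jinv[OF HH_neg_inverse[OF assms]] d1])
  then have "(jinv has_field_derivative deriv jinv (- 1 / z) * (1 / z ^ 2)) (at z)"
    by (rule has_field_derivative_transform_within_open[OF _ open_HH assms]) (simp only: jinv_inv)
  then have "deriv jinv z = deriv jinv (- 1 / z) * (1 / z ^ 2)" by (rule DERIV_imp_deriv)
  then show ?thesis using nz by simp
qed

lemma modular_orbit_invariant: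
  assumes "w \<in> modular_orbit z" "z \<in> HH"
    and T: "\<And>z. z \<in> HH \<Longrightarrow> f (z + 1) = f z" and S: "\<And>z. z \<in> HH \<Longrightarrow> f (- 1 / z) = f z"
  shows "f w = f z"
  using assms(1)
proof induction
  case (plus w n)
  have "w \<in> HH" by (rule modular_orbit_HH[OF plus.hyps assms(2)])
  have pos: "f (w + of_nat k) = f w" if "w \<in> HH" for w k
    using that
  proof (induction k)
    case (Suc k)
    have "w + of_nat k \<in> HH" using Suc.prems by (simp add: HH_def)
    from T[OF this] Suc show ?case by (simp add: add_ac)
  qed simp
  have "f (w + of_int n) = f w"
  proof (cases "n \<ge> 0")
    case True
    then show ?thesis using pos[OF \<open>w \<in> HH\<close>, of "nat n"] by (simp add: of_nat_nat)
  next
    case False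
    have "w + of_int n \<in> HH" using \<open>w \<in> HH\<close> by (simp add: HH_def)
    from pos[OF this, of "nat (- n)"] False show ?thesis by (simp add: of_nat_nat)
  qed
  then show ?case using plus by simp
next
  case (inv w)
  have "w \<in> HH" by (rule modular_orbit_HH[OF inv.hyps assms(2)])
  then show ?case using S inv by simp
qed simp

section \<open>Vanishing theorems for modular functions and forms of weight 2\<close>

text \<open>Suppose G z is nonzero. Above some height |G| is below |G z|, so on the fundamental
  domain, and by invariance on all of \<open>HH\<close>, |G| attains its maximum in a compact piece.
  Then G is constant, contradicting its decay at the cusp.\<close>

lemma modular_liouville:
  assumes hol: "G holomorphic_on HH"
    and T: "\<And>z. z \<in> HH \<Longrightarrow> G (z + 1) = G z" and S: "\<And>z. z \<in> HH \<Longrightarrow> G (- 1 / z) = G z"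
    and lim: "\<And>e. e > 0 \<Longrightarrow> \<exists>Y. \<forall>z. Im z \<ge> Y \<longrightarrow> norm (G z) < e"
    and "z \<in> HH"
  shows "G z = 0"
proof (rule ccontr)
  assume nz: "G z \<noteq> 0"
  define e where "e = norm (G z)"
  have e: "e > 0" using nz by (simp add: e_def)
  obtain Y where Y: "\<And>z. Im z \<ge> Y \<Longrightarrow> norm (G z) < e" using lim[OF e] by blast
  define K where "K = {w. \<bar>Re w\<bar> \<le> 1 / 2 \<and> norm w \<ge> 1 \<and> Im w \<ge> 433 / 500 \<and> Im w \<le> Y}"
  have "K \<subseteq> cbox (Complex (-(1/2)) 0) (Complex (1/2) Y)" by (auto simp: K_def in_cbox_complex_iff)
  then have "bounded K" using bounded_cbox bounded_subset by blast
  moreover have "closed K"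
    unfolding K_def by (intro closed_Collect_conj closed_Collect_le continuous_intros)
  ultimately have "compact K" by (simp add: compact_eq_bounded_closed)
  have KH: "K \<subseteq> HH" by (auto simp: K_def HH_def)
  have red: "\<exists>w. G w = G z \<and> (w \<in> K \<or> Im w \<ge> Y)" if "z \<in> HH" for z
  proof -
    obtain w where w: "w \<in> modular_orbit z" "\<bar>Re w\<bar> \<le> 1 / 2" "norm w \<ge> 1" "w \<in> HH"
      using modular_orbit_fundamental[OF \<open>z \<in> HH\<close>] by blast
    have "G w = G z" by (rule modular_orbit_invariant[OF w(1) \<open>z \<in> HH\<close> T S])
    moreover have "w \<in> K \<or> Im w \<ge> Y" using w fundamental_domain_Im[OF w(2-4)] by (auto simp: K_def)
    ultimately show ?thesis by blast
  qed
  obtain w1 where w1: "w1 \<in> K" "G w1 = G z"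
    using red[OF \<open>z \<in> HH\<close>] Y by (fastforce simp: e_def)
  have "continuous_on K (\<lambda>w. norm (G w))"
    using holomorphic_on_imp_continuous_on[OF hol] KH continuous_on_subset by (blast intro: continuous_on_norm)
  then obtain p where p: "p \<in> K" "\<And>w. w \<in> K \<Longrightarrow> norm (G w) \<le> norm (G p)"
    using continuous_attains_sup[OF \<open>compact K\<close>, of "\<lambda>w. norm (G w)"] w1(1) by blast
  have max: "norm (G w) \<le> norm (G p)" if wH: "w \<in> HH" for w
  proof -
    obtain w' where w': "G w' = G w" "w' \<in> K \<or> Im w' \<ge> Y" using red[OF wH] by blast
    have "norm (G z) \<le> norm (G p)" using p(2)[OF w1(1)] w1(2) by simp
    then show ?thesis using w' p(2)[of w'] Y[of w'] by (auto simp: e_def)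
  qed
  have "G constant_on HH"
    by (rule maximum_modulus_principle[OF hol open_HH connected_HH open_HH order_refl, of p])
      (use p KH max in auto)
  then obtain c where c: "\<And>w. w \<in> HH \<Longrightarrow> G w = c" unfolding constant_on_def by blast
  have "norm (G (Complex 0 (max Y 1))) < e" by (rule Y) simp
  moreover have "Complex 0 (max Y 1) \<in> HH" by (simp add: HH_def)
  ultimately show False using c[of z] c[of "Complex 0 (max Y 1)"] \<open>z \<in> HH\<close> by (simp add: e_def)
qed

text \<open>The primitive of a weight 2 form is invariant up to constants under both generators; evaluating
  at the fixed points of the elliptic elements shows that these constants vanish.\<close>
lemma weight2_mean_zero:
  assumes hol: "P holomorphic_on HH"
    and T: "\<And>z. z \<in> HH \<Longrightarrow> P (z + 1) = P z" and S: "\<And>z. z \<in> HH \<Longrightarrow> P (- 1 / z) = z ^ 2 * P z"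
    and a: "a \<in> HH"
  shows "contour_integral (linepath a (a + 1)) P = 0"
proof -
  obtain H where "\<And>x. x \<in> HH \<Longrightarrow> (H has_field_derivative P x) (at x within HH)"
    using holomorphic_convex_primitive'[OF convex_HH open_HH hol] by blast
  then have H: "(H has_field_derivative P x) (at x)" if "x \<in> HH" for x
    using that at_within_open[OF that open_HH] by metis
  have const: "f x = f y" if f: "\<And>x. x \<in> HH \<Longrightarrow> (f has_field_derivative 0) (at x)" and "x \<in> HH" "y \<in> HH" for f :: "complex \<Rightarrow> complex" and x y
    using has_field_derivative_zero_constant[OF convex_HH, of f] f that
    by (metis has_field_derivative_at_within)
  have cS: "((\<lambda>z. H (- 1 / z) - H z) has_field_derivative 0) (at x)" if "x \<in> HH" for x
  proof -
    have nz: "x \<noteq> 0" using that by (auto simp: HH_def)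
    have d1: "((\<lambda>z. - 1 / z) has_field_derivative (1 / x ^ 2)) (at x)"
      using nz by (auto intro!: derivative_eq_intros simp: power2_eq_square)
    have "((\<lambda>z. H (- 1 / z)) has_field_derivative P (- 1 / x) * (1 / x ^ 2)) (at x)"
      by (rule DERIV_chain2[OF H[OF HH_neg_inverse[OF that]] d1])
    from DERIV_diff[OF this H[OF that]] show ?thesis using S[OF that] nz by simp
  qed
  have cT: "((\<lambda>z. H (z + 1) - H z) has_field_derivative 0) (at x)" if "x \<in> HH" for x
  proof -
    have "x + 1 \<in> HH" using that by (simp add: HH_def)
    from H[OF this] have "((\<lambda>z. H (z + 1)) has_field_derivative P (x + 1)) (at x)" by (simp add: DERIV_shift)
    from DERIV_diff[OF this H[OF that]] show ?thesis using T[OF that] by simp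
  qed
  define \<rho> where "\<rho> = Complex (-(1/2)) (sqrt 3 / 2)"
  have \<rho>: "\<rho> \<in> HH" "- 1 / \<rho> = \<rho> + 1"
  proof -
    show "\<rho> \<in> HH" by (simp add: \<rho>_def HH_def)
    have "\<rho> * (\<rho> + 1) = - 1" by (simp add: \<rho>_def complex_eq_iff)
    moreover have "\<rho> \<noteq> 0" by (simp add: \<rho>_def complex_eq_iff)
    ultimately show "- 1 / \<rho> = \<rho> + 1" by (subst divide_eq_eq) (simp add: mult.commute)
  qed
  have "H (- 1 / \<rho>) - H \<rho> = H (- 1 / \<i>) - H \<i>" by (rule const[OF cS]) (use \<rho> in auto)
  then have "H (\<rho> + 1) - H \<rho> = 0" using \<rho>(2) by simp
  moreover have "H (a + 1) - H a = H (\<rho> + 1) - H \<rho>" by (rule const[OF cT]) (use \<rho> a in auto)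
  ultimately have eq: "H (a + 1) - H a = 0" by simp
  have "path_image (linepath a (a + 1)) \<subseteq> HH"
    using a closed_segment_unit_seg[of _ "Re a" "Im a"] by (auto simp: HH_def)
  from contour_integral_primitive[OF has_field_derivative_at_within[OF H] valid_path_linepath this]
  have "(P has_contour_integral (H (a + 1) - H a)) (linepath a (a + 1))" by simp
  then show ?thesis using eq contour_integral_unique by simp
qed

section \<open>Leading orders at the cusp\<close>

lemma norm_qexp: "norm (qexp n z) = exp (- 2 * pi * real_of_int n * Im z)"
  by (simp add: qexp_def norm_exp_eq_Re)

lemma qexp_add: "qexp (m + n) z = qexp m z * qexp n z"
  by (simp add: qexp_def algebra_simps flip: exp_add)

text \<open>Leading order at least \<open>c\<close> in powers of \<open>exp (2 \<pi> \<i> T / 4)\<close>.\<close>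
definition leads :: "(complex \<Rightarrow> complex) \<Rightarrow> int \<Rightarrow> complex \<Rightarrow> bool" where
  "leads f c \<kappa> \<longleftrightarrow> (\<exists>C\<ge>0. \<forall>T. Im T \<ge> 1 \<longrightarrow>
     norm (f T - \<kappa> * qexp c (T / 4)) \<le> C * exp (- (pi / 2) * real_of_int (c + 1) * Im T))"

lemma leadsD:
  assumes "leads f c \<kappa>"
  obtains C where "C \<ge> 0" "\<And>T. Im T \<ge> 1 \<Longrightarrow> norm (f T) \<le> C * exp (- (pi / 2) * real_of_int c * Im T)"
proof -
  obtain C where C: "C \<ge> 0" "\<And>T. Im T \<ge> 1 \<Longrightarrow> norm (f T - \<kappa> * qexp c (T / 4)) \<le> C * exp (- (pi / 2) * real_of_int (c + 1) * Im T)"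
    using assms unfolding leads_def by blast
  show ?thesis
  proof
    show "C + norm \<kappa> \<ge> 0" using C by simp
    fix T :: complex assume T: "Im T \<ge> 1"
    have "norm (f T) \<le> norm (f T - \<kappa> * qexp c (T / 4)) + norm (\<kappa> * qexp c (T / 4))"
      using norm_triangle_sub[of "f T" "\<kappa> * qexp c (T / 4)"] by simp
    also have "norm (\<kappa> * qexp c (T / 4)) = norm \<kappa> * exp (- (pi / 2) * real_of_int c * Im T)"
      by (simp add: norm_mult norm_qexp)
    also have "norm (f T - \<kappa> * qexp c (T / 4)) \<le> C * exp (- (pi / 2) * real_of_int c * Im T)"
    proof (rule order_trans[OF C(2)[OF T]], rule mult_left_mono)
      have "pi / 2 * Im T \<ge> 0" using T by simp
      then show "exp (- (pi / 2) * real_of_int (c + 1) * Im T) \<le> exp (- (pi / 2) * real_of_int c * Im T)"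
        by (simp add: algebra_simps)
    qed (use C in simp)
    finally show "norm (f T) \<le> (C + norm \<kappa>) * exp (- (pi / 2) * real_of_int c * Im T)"
      by (simp add: algebra_simps)
  qed
qed

lemma leadsI:
  assumes "C \<ge> 0" "\<And>T. Im T \<ge> 1 \<Longrightarrow> norm (f T - \<kappa> * qexp c (T / 4)) \<le> C * exp (- (pi / 2) * real_of_int (c + 1) * Im T)"
  shows "leads f c \<kappa>"
  using assms unfolding leads_def by blast

lemma leads_higher:
  assumes "leads f c' \<kappa>" "c < c'"
  shows "leads f c 0"
proof -
  obtain C where C: "C \<ge> 0" "\<And>T. Im T \<ge> 1 \<Longrightarrow> norm (f T) \<le> C * exp (- (pi / 2) * real_of_int c' * Im T)"
    using leadsD[OF assms(1)] by blast
  show ?thesis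
  proof (rule leadsI[OF C(1)])
    fix T :: complex assume T: "Im T \<ge> 1"
    have "real_of_int (c + 1) * (pi / 2 * Im T) \<le> real_of_int c' * (pi / 2 * Im T)"
      using assms(2) T by (intro mult_right_mono) auto
    then have "exp (- (pi / 2) * real_of_int c' * Im T) \<le> exp (- (pi / 2) * real_of_int (c + 1) * Im T)"
      by (simp add: algebra_simps)
    then have "C * exp (- (pi / 2) * real_of_int c' * Im T) \<le> C * exp (- (pi / 2) * real_of_int (c + 1) * Im T)"
      using C(1) by (rule mult_left_mono)
    then show "norm (f T - 0 * qexp c (T / 4)) \<le> C * exp (- (pi / 2) * real_of_int (c + 1) * Im T)"
      using C(2)[OF T] by simp
  qed
qed

lemma leads_add:
  assumes "leads f c \<kappa>" "leads g c \<kappa>'"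
  shows "leads (\<lambda>T. f T + g T) c (\<kappa> + \<kappa>')"
proof -
  obtain C where C: "C \<ge> 0" "\<And>T. Im T \<ge> 1 \<Longrightarrow> norm (f T - \<kappa> * qexp c (T / 4)) \<le> C * exp (- (pi / 2) * real_of_int (c + 1) * Im T)"
    using assms(1) unfolding leads_def by blast
  obtain D where D: "D \<ge> 0" "\<And>T. Im T \<ge> 1 \<Longrightarrow> norm (g T - \<kappa>' * qexp c (T / 4)) \<le> D * exp (- (pi / 2) * real_of_int (c + 1) * Im T)"
    using assms(2) unfolding leads_def by blast
  show ?thesis
  proof (rule leadsI[of "C + D"])
    fix T :: complex assume T: "Im T \<ge> 1"
    have "f T + g T - (\<kappa> + \<kappa>') * qexp c (T / 4) = (f T - \<kappa> * qexp c (T / 4)) + (g T - \<kappa>' * qexp c (T / 4))"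
      by (simp add: algebra_simps)
    also have "norm \<dots> \<le> (C + D) * exp (- (pi / 2) * real_of_int (c + 1) * Im T)"
      unfolding distrib_right by (intro norm_triangle_mono C(2)[OF T] D(2)[OF T])
    finally show "norm (f T + g T - (\<kappa> + \<kappa>') * qexp c (T / 4)) \<le> (C + D) * exp (- (pi / 2) * real_of_int (c + 1) * Im T)" .
  qed (use C D in simp)
qed

lemma leads_mult:
  assumes "leads f c \<kappa>" "leads g d \<kappa>'"
  shows "leads (\<lambda>T. f T * g T) (c + d) (\<kappa> * \<kappa>')"
proof -
  obtain C where C: "C \<ge> 0" "\<And>T. Im T \<ge> 1 \<Longrightarrow> norm (f T - \<kappa> * qexp c (T / 4)) \<le> C * exp (- (pi / 2) * real_of_int (c + 1) * Im T)"
    using assms(1) unfolding leads_def by blast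
  obtain D where D: "D \<ge> 0" "\<And>T. Im T \<ge> 1 \<Longrightarrow> norm (g T - \<kappa>' * qexp d (T / 4)) \<le> D * exp (- (pi / 2) * real_of_int (d + 1) * Im T)"
    using assms(2) unfolding leads_def by blast
  obtain B where B: "B \<ge> 0" "\<And>T. Im T \<ge> 1 \<Longrightarrow> norm (g T) \<le> B * exp (- (pi / 2) * real_of_int d * Im T)"
    using leadsD[OF assms(2)] by blast
  show ?thesis
  proof (rule leadsI[of "C * B + norm \<kappa> * D"])
    fix T :: complex assume T: "Im T \<ge> 1"
    have "f T * g T - \<kappa> * \<kappa>' * qexp (c + d) (T / 4) =
        (f T - \<kappa> * qexp c (T / 4)) * g T + \<kappa> * qexp c (T / 4) * (g T - \<kappa>' * qexp d (T / 4))"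
      by (simp add: algebra_simps qexp_add)
    also have "norm \<dots> \<le> norm (f T - \<kappa> * qexp c (T / 4)) * norm (g T) + norm \<kappa> * norm (qexp c (T / 4)) * norm (g T - \<kappa>' * qexp d (T / 4))"
      by (rule norm_triangle_le) (simp add: norm_mult)
    also have "\<dots> \<le> (C * exp (- (pi / 2) * real_of_int (c + 1) * Im T)) * (B * exp (- (pi / 2) * real_of_int d * Im T))
        + norm \<kappa> * exp (- (pi / 2) * real_of_int c * Im T) * (D * exp (- (pi / 2) * real_of_int (d + 1) * Im T))"
      using C B D T by (intro add_mono mult_mono C(2) D(2) B(2)) (auto simp: norm_qexp)
    also have "\<dots> = (C * B + norm \<kappa> * D) * exp (- (pi / 2) * real_of_int (c + d + 1) * Im T)"
    proof -
      have 1: "exp (- (pi / 2) * real_of_int (c + 1) * Im T) * exp (- (pi / 2) * real_of_int d * Im T) = exp (- (pi / 2) * real_of_int (c + d + 1) * Im T)"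
        unfolding exp_add[symmetric] by (rule arg_cong[where f = exp]) (simp add: algebra_simps add_divide_distrib)
      have 2: "exp (- (pi / 2) * real_of_int c * Im T) * exp (- (pi / 2) * real_of_int (d + 1) * Im T) = exp (- (pi / 2) * real_of_int (c + d + 1) * Im T)"
        unfolding exp_add[symmetric] by (rule arg_cong[where f = exp]) (simp add: algebra_simps add_divide_distrib)
      have alg: "(C * x) * (B * y) + k * u * (D * v) = C * B * (x * y) + k * D * (u * v)" for x y u v k :: real
        by (simp add: mult_ac)
      show ?thesis unfolding alg 1 2 by (simp add: distrib_right)
    qed
    finally show "norm (f T * g T - \<kappa> * \<kappa>' * qexp (c + d) (T / 4)) \<le> (C * B + norm \<kappa> * D) * exp (- (pi / 2) * real_of_int (c + d + 1) * Im T)" .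
  qed (use C B D in simp)
qed

lemma leads_qexp: "leads (\<lambda>T. qexp c (T / 4)) c 1"
  by (rule leadsI[of 0]) auto

lemma leads_cmult:
  assumes "leads f c \<kappa>"
  shows "leads (\<lambda>T. a * f T) c (a * \<kappa>)"
proof -
  have "leads (\<lambda>T. a * qexp 0 (T / 4)) 0 a"
    by (rule leadsI[of 0]) auto
  from leads_mult[OF this assms] show ?thesis by (simp add: qexp_def)
qed

lemma tendsto_exp_neg_0:
  fixes c :: real
  assumes "c > 0"
  shows "((\<lambda>y. K * exp (- c * y)) \<longlongrightarrow> 0) at_top"
proof -
  have "filterlim (\<lambda>y. c * y) at_top at_top"
    using assms by (intro filterlim_tendsto_pos_mult_at_top[OF tendsto_const] filterlim_ident) auto
  then have "filterlim (\<lambda>y. - (c * y)) at_bot at_top"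
    by (simp add: filterlim_uminus_at_bot)
  then have "((\<lambda>y. exp (- (c * y))) \<longlongrightarrow> 0) at_top"
    by (rule filterlim_compose[OF exp_at_bot])
  from tendsto_mult_left[OF this, of K] show ?thesis by simp
qed

text \<open>The mean value over high segments tends to \<kappa> and is 0, so \<kappa> = 0 and P
  decays at least like q^(1/4). The sixth power has weight 12 and order at least 6/4, so P^6 /
  \<open>Delta\<close> has weight 0 and still decays; hence it vanishes.\<close>

lemma weight2_bounded_zero:
  assumes hol: "P holomorphic_on HH"
    and T: "\<And>z. z \<in> HH \<Longrightarrow> P (z + 1) = P z" and S: "\<And>z. z \<in> HH \<Longrightarrow> P (- 1 / z) = z ^ 2 * P z"
    and lead: "leads P 0 \<kappa>" and z: "z \<in> HH"
  shows "P z = 0"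
proof -
  obtain C where C: "C \<ge> 0" "\<And>T. Im T \<ge> 1 \<Longrightarrow> norm (P T - \<kappa>) \<le> C * exp (- (pi / 2) * Im T)"
    using lead unfolding leads_def by (auto simp: qexp_def)
  have cont: "continuous_on A P" if "A \<subseteq> HH" for A
    using holomorphic_on_imp_continuous_on[OF hol] that continuous_on_subset by blast
  have le: "norm \<kappa> \<le> C * exp (- (pi / 2) * y)" if y: "y \<ge> 1" for y
  proof -
    have sub: "closed_segment (Complex 0 y) (Complex 0 y + 1) \<subseteq> HH"
      using y by (auto simp: closed_segment_unit_seg HH_def)
    have int: "P contour_integrable_on unit_seg 0 y"
      by (intro contour_integrable_continuous_linepath cont sub)
    have "contour_integral (unit_seg 0 y) (\<lambda>t. P t - \<kappa>) = contour_integral (unit_seg 0 y) P - contour_integral (unit_seg 0 y) (\<lambda>t. \<kappa>)"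
      by (rule contour_integral_diff[OF int]) simp
    also have "contour_integral (unit_seg 0 y) P = 0"
      by (rule weight2_mean_zero[OF hol T S]) (use y in \<open>auto simp: HH_def\<close>)
    finally have eq: "contour_integral (unit_seg 0 y) (\<lambda>t. P t - \<kappa>) = - \<kappa>" by simp
    have "norm (contour_integral (unit_seg 0 y) (\<lambda>t. P t - \<kappa>)) \<le> C * exp (- (pi / 2) * y) * norm (Complex 0 y + 1 - Complex 0 y)"
    proof (rule contour_integral_bound_linepath)
      show "(\<lambda>t. P t - \<kappa>) contour_integrable_on unit_seg 0 y"
        by (intro contour_integrable_diff int) simp
      fix x assume "x \<in> closed_segment (Complex 0 y) (Complex 0 y + 1)"
      then have "Im x = y" by (simp add: closed_segment_unit_seg)
      then show "norm (P x - \<kappa>) \<le> C * exp (- (pi / 2) * y)" using C(2)[of x] y by simp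
    qed (use C in simp)
    then show ?thesis unfolding eq by simp
  qed
  have "norm \<kappa> \<le> 0"
  proof (rule tendsto_lowerbound[OF tendsto_exp_neg_0[of "pi / 2" C]])
    show "\<forall>\<^sub>F y in at_top. norm \<kappa> \<le> C * exp (- (pi / 2) * y)"
      using eventually_ge_at_top[of 1] by eventually_elim (rule le)
  qed auto
  then have P: "norm (P T) \<le> C * exp (- (pi / 2) * Im T)" if "Im T \<ge> 1" for T
    using C(2)[OF that] by simp
  define G where "G z = P z ^ 6 / Delta z" for z
  have D: "Delta (w + 1) = Delta w" "Delta (- 1 / w) = w ^ 12 * Delta w" if "w \<in> HH" for w
    using Delta_mobius[of 1 1 1 0 w] Delta_mobius[of 0 0 "-1" 1 w] that
    by (simp_all only: mob_T mob_S) simp_all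
  have Dhol: "Delta holomorphic_on HH"
  proof -
    have "(\<lambda>z. nome z * delta_q (nome z)) holomorphic_on HH"
      by (intro holomorphic_intros holomorphic_on_compose_gen[OF _ delta_q_holomorphic, unfolded o_def])
        (use nome_in_ball in blast)
    then show ?thesis by (rule holomorphic_transform) (simp add: Delta_nome)
  qed
  \<comment> \<open>Since \<open>delta_q\<close> is 1 at the origin, |\<open>Delta\<close>| is at
    least |q| / 2 near the cusp.\<close>
  obtain r where r: "r > 0" "r < 1" "\<And>q. norm q < r \<Longrightarrow> norm (delta_q q) \<ge> 1 / 2"
  proof -
    have "delta_q 0 = 1" by (simp add: delta_q_def divsum_series_at_0)
    moreover have "isCont delta_q 0"
      using holomorphic_on_imp_continuous_on[OF delta_q_holomorphic] by (simp add: continuous_on_eq_continuous_at)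
    ultimately have "(delta_q \<longlongrightarrow> 1) (at 0)" by (simp add: isCont_def)
    then have "\<forall>\<^sub>F q in at 0. dist (delta_q q) 1 < 1 / 2" by (rule tendstoD) simp
    then obtain d where d: "d > 0" "\<And>q. q \<noteq> 0 \<Longrightarrow> dist q 0 < d \<Longrightarrow> dist (delta_q q) 1 < 1 / 2"
      unfolding eventually_at by blast
    have "norm (delta_q q) \<ge> 1 / 2" if "norm q < min d (1/2)" for q
    proof (cases "q = 0")
      case False
      then have "norm (1 - delta_q q) < 1 / 2" using d(2)[of q] that by (simp add: dist_norm norm_minus_commute)
      then show ?thesis using norm_triangle_ineq2[of 1 "1 - delta_q q"] by simp
    qed (simp add: \<open>delta_q 0 = 1\<close>)
    then show ?thesis using that[of "min d (1/2)"] d(1) by auto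
  qed
  have "G z = 0"
  proof (rule modular_liouville[OF _ _ _ _ z])
    show "G holomorphic_on HH" unfolding G_def by (intro holomorphic_intros hol Dhol) (rule Delta_nonzero)
    show "G (w + 1) = G w" if "w \<in> HH" for w using that by (simp only: G_def T D)
    show "G (- 1 / w) = G w" if "w \<in> HH" for w
    proof -
      have "w \<noteq> 0" using that by (auto simp: HH_def)
      moreover have "(w\<^sup>2 * P w) ^ 6 = w ^ 12 * P w ^ 6" by (simp add: power_mult_distrib flip: power_mult)
      ultimately show ?thesis unfolding G_def S[OF that] D(2)[OF that] by simp
    qed
    fix e :: real assume e: "e > 0"
    have "((\<lambda>y. 2 * C ^ 6 * exp (- pi * y)) \<longlongrightarrow> 0) at_top" by (rule tendsto_exp_neg_0) simp
    then have "\<forall>\<^sub>F y in at_top. 2 * C ^ 6 * exp (- pi * y) < e" using e order_tendstoD(2) by blast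
    moreover have "((\<lambda>y. 1 * exp (- (2 * pi) * y)) \<longlongrightarrow> 0) at_top" by (rule tendsto_exp_neg_0) simp
    then have "\<forall>\<^sub>F y in at_top. 1 * exp (- (2 * pi) * y) < r" using r order_tendstoD(2) by blast
    ultimately have "\<forall>\<^sub>F y in at_top. 2 * C ^ 6 * exp (- pi * y) < e \<and> exp (- (2 * pi) * y) < r \<and> y \<ge> 1"
      using eventually_ge_at_top[of 1] by eventually_elim simp
    then obtain Y where Y: "\<And>y. y \<ge> Y \<Longrightarrow> 2 * C ^ 6 * exp (- pi * y) < e \<and> exp (- (2 * pi) * y) < r \<and> y \<ge> 1"
      unfolding eventually_at_top_linorder by blast
    have "norm (G w) < e" if w: "Im w \<ge> Y" for w
    proof -
      note Yw = Y[OF w]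
      have wH: "w \<in> HH" using Yw by (simp add: HH_def)
      have "norm (nome w) < r" using Yw by (simp add: norm_nome)
      then have "norm (delta_q (nome w)) \<ge> 1 / 2" by (rule r(3))
      then have dl: "norm (Delta w) \<ge> exp (- 2 * pi * Im w) / 2"
        unfolding Delta_nome[OF wH] norm_mult norm_nome by simp
      have "norm (P w) ^ 6 \<le> (C * exp (- (pi / 2) * Im w)) ^ 6"
        using P[of w] Yw by (intro power_mono) auto
      also have "\<dots> = C ^ 6 * exp (- 3 * pi * Im w)"
        by (simp add: power_mult_distrib flip: exp_of_nat_mult)
      finally have "norm (G w) \<le> C ^ 6 * exp (- 3 * pi * Im w) / (exp (- 2 * pi * Im w) / 2)"
        unfolding G_def norm_divide norm_power using dl C by (intro frac_le) auto
      also have "\<dots> = 2 * C ^ 6 * (exp (- 3 * pi * Im w) / exp (- 2 * pi * Im w))" by simp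
      also have "exp (- 3 * pi * Im w) / exp (- 2 * pi * Im w) = exp (- pi * Im w)"
        by (simp flip: exp_diff)
      finally show ?thesis using Yw by simp
    qed
    then show "\<exists>Y. \<forall>z. Y \<le> Im z \<longrightarrow> norm (G z) < e" by blast
  qed
  then show ?thesis using Delta_nonzero[OF z] by (simp add: G_def)
qed

section \<open>Points with the same j-invariant as a point of the arc\<close>

lemma divsum_series_cnj:
  assumes "norm q < 1"
  shows "divsum_series n (cnj q) = cnj (divsum_series n q)"
proof -
  have "(\<lambda>k. cnj (of_nat (divsum n (Suc k)) * q ^ k)) sums cnj (divsum_series n q)"
    using divsum_series_sums[OF assms] by (simp only: sums_cnj)
  then have "(\<lambda>k. of_nat (divsum n (Suc k)) * cnj q ^ k) sums cnj (divsum_series n q)"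
    by (simp only: complex_cnj_mult complex_cnj_power complex_cnj_of_nat)
  moreover have "(\<lambda>k. of_nat (divsum n (Suc k)) * cnj q ^ k) sums divsum_series n (cnj q)"
    using assms by (intro divsum_series_sums) simp
  ultimately show ?thesis using sums_unique2 by blast
qed

lemma j_kappa_cnj:
  assumes "norm q < 1" "q \<noteq> 0"
  shows "j_kappa (cnj q) = cnj (j_kappa q)"
proof -
  have "j_nu (cnj q) = cnj (j_nu q)"
    unfolding j_nu_def delta_q_def using assms by (simp add: divsum_series_cnj)
  then show ?thesis using assms by (simp add: j_kappa_def j_nu_0)
qed

lemma nome_cnj: "nome (- cnj z) = cnj (nome z)"
  by (simp add: exp_cnj)

lemma jinv_cnj:
  assumes "z \<in> HH"
  shows "jinv (- cnj z) = cnj (jinv z)"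
proof -
  have z': "- cnj z \<in> HH" using assms by (simp add: HH_def)
  show ?thesis
    unfolding jinv_nome[OF assms] jinv_nome[OF z'] nome_cnj
    using j_kappa_cnj[OF norm_exp_HH[OF assms]] by simp
qed

text \<open>The q-coefficients are real, so j(- cnj z) = cnj (j z); on these three curves - cnj z is
  equivalent to z under the identity, a translation or the inversion.\<close>

lemma jinv_real_boundary:
  assumes "z \<in> HH" "Re z = 0 \<or> Re z = 1 / 2 \<or> norm z = 1"
  shows "Im (jinv z) = 0"
proof -
  have "jinv (- cnj z) = jinv z"
    using assms(2)
  proof (elim disjE)
    assume "Re z = 0"
    then have "- cnj z = z" by (simp add: complex_eq_iff)
    then show ?thesis by simp
  next
    assume "Re z = 1 / 2"
    then have "- cnj z + 1 = z" by (simp add: complex_eq_iff)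
    then show ?thesis using jinv_plus_1[of "- cnj z"] assms(1) by (simp add: HH_def)
  next
    assume n: "norm z = 1"
    have "z \<noteq> 0" using assms(1) by (auto simp: HH_def)
    moreover have "z * cnj z = 1" using n by (simp add: complex_norm_square[symmetric])
    ultimately have "- cnj z = - 1 / z" by (simp add: field_simps)
    then show ?thesis using jinv_inv[OF assms(1)] by simp
  qed
  then have "cnj (jinv z) = jinv z" using jinv_cnj[OF assms(1)] by simp
  then show ?thesis by (metis Im_complex_of_real complex_cnj_complex_of_real Reals_cnj_iff complex_is_Real_iff)
qed

section \<open>Sign of Im j and monotonicity of j on the boundary of the half domain\<close>

text \<open>The term 1 / q contributes - exp (2 \<pi> y) sin (2 \<pi> x), which vanishes on the
  vertical sides, so boundedness of \<open>j_kappa\<close> would not suffice. Comparing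
  \<open>j_kappa\<close> at q and cnj q bounds its imaginary part by M |Im q|, which carries the
  same sine factor.\<close>

lemma jinv_Im_top:
  obtains Y where "\<And>z. Im z \<ge> Y \<Longrightarrow> 0 \<le> Re z \<Longrightarrow> Re z \<le> 1 / 2 \<Longrightarrow> Im (jinv z) \<le> 0"
proof -
  obtain M where M: "M > 0" "\<And>q. norm q \<le> 1 / 2 \<Longrightarrow> norm (deriv j_kappa q) \<le> M"
    using j_kappa_bounds by metis
  define Y where "Y = max 1 M"
  show ?thesis
  proof (rule that[of Y])
    fix z assume z: "Im z \<ge> Y" "0 \<le> Re z" "Re z \<le> 1 / 2"
    have im: "Im z \<ge> 1" "Im z \<ge> M" using z by (auto simp: Y_def)
    have zH: "z \<in> HH" using im by (simp add: HH_def)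
    define q where "q = nome z"
    have q: "norm q \<le> 1 / 2" unfolding q_def by (rule nome_le_half) (use im in simp)
    have sn: "sin (2 * pi * Re z) \<ge> 0" using z by (intro sin_ge_zero) (auto simp: field_simps)
    have iq: "Im q = exp (- (2 * pi * Im z)) * sin (2 * pi * Re z)"
      by (simp add: q_def Im_exp)
    have i1: "Im (1 / q) = - exp (2 * pi * Im z) * sin (2 * pi * Re z)"
    proof -
      have "1 / q = exp (- (2 * of_real pi * \<i> * z))" by (simp add: q_def exp_minus divide_inverse)
      then show ?thesis by (simp add: Im_exp)
    qed
    have "norm (j_kappa q - j_kappa (cnj q)) \<le> M * norm (q - cnj q)"
    proof (rule field_differentiable_bound[of "cball 0 (1/2)" j_kappa "deriv j_kappa"])
      fix x :: complex assume "x \<in> cball 0 (1/2)"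
      then have "x \<in> ball 0 1" by auto
      from holomorphic_derivI[OF j_kappa_holomorphic open_ball this]
      show "(j_kappa has_field_derivative deriv j_kappa x) (at x within cball 0 (1/2))"
        by (rule has_field_derivative_at_within)
    qed (use M q in auto)
    moreover have "j_kappa (cnj q) = cnj (j_kappa q)" by (rule j_kappa_cnj) (use q in linarith, simp add: q_def)
    ultimately have "norm (j_kappa q - cnj (j_kappa q)) \<le> M * norm (q - cnj q)" by simp
    then have "2 * \<bar>Im (j_kappa q)\<bar> \<le> M * (2 * \<bar>Im q\<bar>)"
      by (simp add: complex_diff_cnj norm_mult)
    moreover have "Im q \<ge> 0" unfolding iq using sn by simp
    ultimately have "Im (j_kappa q) \<le> M * Im q" by (simp add: abs_le_iff)
    also have "\<dots> \<le> exp (2 * pi * Im z) * sin (2 * pi * Re z)"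
    proof -
      have "exp (- (2 * pi * Im z)) * M \<le> 1 * M"
        using M im by (intro mult_right_mono) auto
      also have "M \<le> Im z" using im by simp
      also have "Im z \<le> 2 * pi * Im z" using pi_gt3 im by (simp add: mult_le_cancel_right)
      also have "\<dots> \<le> exp (2 * pi * Im z)" using exp_ge_add_one_self[of "2 * pi * Im z"] by linarith
      finally have "M * exp (- (2 * pi * Im z)) \<le> exp (2 * pi * Im z)" by (simp add: mult.commute)
      from mult_right_mono[OF this sn] show ?thesis by (simp add: iq mult_ac)
    qed
    finally show "Im (jinv z) \<le> 0"
      unfolding jinv_nome[OF zH] q_def[symmetric] using i1 by simp
  qed
qed

lemma jinv_not_constant: "\<not> jinv constant_on HH"
proof
  assume "jinv constant_on HH"
  then obtain c where c: "\<And>z. z \<in> HH \<Longrightarrow> jinv z = c" unfolding constant_on_def by blast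
  obtain M where M: "M > 0" "\<And>q. norm q \<le> 1 / 2 \<Longrightarrow> norm (j_kappa q) \<le> M" using j_kappa_bounds by metis
  define z where "z = Complex 0 (M + norm c + 1)"
  have im: "Im z \<ge> 1" using M by (simp add: z_def)
  have z: "z \<in> HH" using im by (simp add: HH_def)
  have "1 / nome z = c - j_kappa (nome z)" using jinv_nome[OF z] c[OF z] by simp
  then have "norm (1 / nome z) \<le> norm c + M"
    using norm_triangle_ineq4[of c "j_kappa (nome z)"] M(2)[OF nome_le_half, of z] im by simp
  moreover have "norm (1 / nome z) = exp (2 * pi * Im z)"
    unfolding norm_divide norm_nome by (simp add: exp_minus inverse_eq_divide)
  moreover have "exp (2 * pi * Im z) \<ge> 1 + 2 * pi * Im z" by simp
  moreover have "2 * pi * Im z \<ge> 1 * Im z" using pi_gt3 im by (intro mult_right_mono) auto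
  moreover have "Im z = M + norm c + 1" by (simp add: z_def)
  ultimately show False by linarith
qed

lemma fundamental_domain_Im_strict:
  assumes "\<bar>Re z\<bar> \<le> 1 / 2" "norm z \<ge> 1" "Im z > 0"
  shows "Im z > 433 / 500"
proof -
  have "1 \<le> norm z ^ 2" using assms by simp
  then have "1 \<le> Re z ^ 2 + Im z ^ 2" by (simp add: cmod_power2)
  moreover have "Re z ^ 2 \<le> (1 / 2) ^ 2" using assms(1) by (metis abs_ge_zero power2_abs power_mono)
  ultimately have "(433 / 500) ^ 2 < Im z ^ 2" by (simp add: power2_eq_square)
  then show ?thesis by (rule power2_less_imp_less) (use assms in simp)
qed

text \<open>The maximum principle for exp (- \<i> j), whose norm is exp (Im j), on a truncated half
  domain: on the three walls j is real, and the lid is high enough for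
  \<open>jinv_Im_top\<close>.\<close>

lemma jinv_Im_nonpos:
  assumes z: "0 \<le> Re z" "Re z \<le> 1 / 2" "norm z \<ge> 1" "Im z > 0"
  shows "Im (jinv z) \<le> 0"
proof -
  obtain Y where Y: "\<And>z. Im z \<ge> Y \<Longrightarrow> 0 \<le> Re z \<Longrightarrow> Re z \<le> 1 / 2 \<Longrightarrow> Im (jinv z) \<le> 0"
    using jinv_Im_top by blast
  define Y' where "Y' = max Y (Im z)"
  define K where "K = {w. 0 \<le> Re w \<and> Re w \<le> 1 / 2 \<and> norm w \<ge> 1 \<and> Im w \<ge> 433 / 500 \<and> Im w \<le> Y'}"
  have KH: "K \<subseteq> HH" by (auto simp: K_def HH_def)
  have "K \<subseteq> cbox (Complex 0 0) (Complex (1/2) Y')" by (auto simp: K_def in_cbox_complex_iff)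
  then have bK: "bounded K" using bounded_cbox bounded_subset by blast
  have cK: "closed K"
    unfolding K_def by (intro closed_Collect_conj closed_Collect_le continuous_intros)
  let ?f = "\<lambda>w. exp (- \<i> * jinv w)"
  have nf: "norm (?f w) = exp (Im (jinv w))" for w by (simp add: norm_exp_eq_Re)
  have "norm (?f z) \<le> 1"
  proof (rule maximum_modulus_frontier[of ?f K])
    show "?f holomorphic_on interior K"
      by (intro holomorphic_intros holomorphic_on_subset[OF jinv_holomorphic])
        (use KH interior_subset in blast)
    show "continuous_on (closure K) ?f"
      using cK KH by (intro holomorphic_on_imp_continuous_on holomorphic_intros holomorphic_on_subset[OF jinv_holomorphic]) simp
    show "z \<in> K" using z fundamental_domain_Im_strict[of z] by (simp add: K_def Y'_def)
    fix w assume "w \<in> frontier K"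
    then have w: "w \<in> K" "w \<notin> interior K" using cK by (auto simp: frontier_def)
    have "Im (jinv w) \<le> 0"
    proof (cases "Re w = 0 \<or> Re w = 1 / 2 \<or> norm w = 1")
      case True
      then show ?thesis using jinv_real_boundary[of w] w(1) KH by auto
    next
      case False
      \<comment> \<open>The open counterpart of \<open>K\<close>. The floor 433/500 is never
        attained in \<open>K\<close>, so a frontier point off the three walls lies on the lid Im w =
        Y'.\<close>
      define Q where "Q = {w. 0 < Re w \<and> Re w < 1 / 2 \<and> norm w > 1 \<and> Im w > 433 / 500 \<and> Im w < Y'}"
      have "open Q"
        unfolding Q_def by (intro open_Collect_conj open_Collect_less continuous_intros)
      moreover have "Q \<subseteq> K" by (auto simp: Q_def K_def)
      ultimately have "Q \<subseteq> interior K" by (simp add: interior_maximal)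
      moreover have "Im w > 433 / 500"
        using w(1) by (intro fundamental_domain_Im_strict) (auto simp: K_def)
      ultimately have "\<not> (0 < Re w \<and> Re w < 1 / 2 \<and> norm w > 1 \<and> Im w < Y')" using w(2) by (auto simp: Q_def)
      then have "Im w = Y'" using w(1) False unfolding K_def by auto
      then show ?thesis using Y[of w] w(1) by (auto simp: Y'_def K_def)
    qed
    then show "norm (?f w) \<le> 1" by (simp add: nf)
  qed (rule bK)
  then show ?thesis by (simp add: nf)
qed

text \<open>Equality at an interior point would be an interior maximum of |exp (- \<i> j)|, forcing
  j to be constant.\<close>

lemma jinv_Im_neg:
  assumes z: "0 < Re z" "Re z < 1 / 2" "norm z > 1" "Im z > 0"
  shows "Im (jinv z) < 0"
proof (rule ccontr)
  assume "\<not> Im (jinv z) < 0"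
  then have eq: "Im (jinv z) = 0" using jinv_Im_nonpos[of z] z by simp
  define Q where "Q = {w. 0 < Re w \<and> Re w < 1 / 2 \<and> norm w > 1 \<and> Im w > 0}"
  have Q: "open Q" unfolding Q_def by (intro open_Collect_conj open_Collect_less continuous_intros)
  let ?f = "\<lambda>w. exp (- \<i> * jinv w)"
  have nf: "norm (?f w) = exp (Im (jinv w))" for w by (simp add: norm_exp_eq_Re)
  have "?f constant_on HH"
  proof (rule maximum_modulus_principle[of ?f HH Q z])
    show "?f holomorphic_on HH" by (intro holomorphic_intros jinv_holomorphic)
    show "Q \<subseteq> HH" by (auto simp: Q_def HH_def)
    show "norm (?f w) \<le> norm (?f z)" if "w \<in> Q" for w
      using that jinv_Im_nonpos[of w] eq by (simp add: nf Q_def)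
  qed (use Q z in \<open>auto simp: Q_def\<close>)
  then obtain c where c: "\<And>w. w \<in> HH \<Longrightarrow> ?f w = c" unfolding constant_on_def by blast
  have d0: "deriv jinv w = 0" if "w \<in> HH" for w
  proof -
    have "(?f has_field_derivative ?f w * (- \<i> * deriv jinv w)) (at w)"
      by (auto intro!: derivative_eq_intros DERIV_jinv that)
    moreover have "(?f has_field_derivative 0) (at w)"
      by (rule has_field_derivative_transform_within_open[OF DERIV_const open_HH that]) (use c in auto)
    ultimately have "?f w * (- \<i> * deriv jinv w) = 0" using DERIV_unique by blast
    then show ?thesis by simp
  qed
  have "jinv constant_on HH"
    unfolding constant_on_def
    using has_field_derivative_zero_constant[OF convex_HH, of jinv] DERIV_jinv d0
    by (metis has_field_derivative_at_within)
  then show False using jinv_not_constant by blast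
qed

text \<open>On a segment where a holomorphic function is real, its derivative is the one-sided limit of
  \<open>- Im f (x - \<i> \<eta>) / \<eta>\<close>, by the Cauchy-Riemann equations.\<close>
lemma real_boundary_strict_mono:
  fixes f :: "complex \<Rightarrow> complex"
  assumes hol: "f holomorphic_on U" and U: "open U" "connected U" and nc: "\<not> f constant_on U"
    and seg: "\<And>x. a \<le> x \<Longrightarrow> x \<le> b \<Longrightarrow> of_real x \<in> U"
    and re: "\<And>x. a \<le> x \<Longrightarrow> x \<le> b \<Longrightarrow> Im (f (of_real x)) = 0"
    and below: "\<And>x. a < x \<Longrightarrow> x < b \<Longrightarrow> \<forall>\<^sub>F \<eta> in at_right (0::real). Im (f (of_real x - \<i> * of_real \<eta>)) \<le> 0"
    and xy: "a \<le> x" "x < y" "y \<le> b"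
  shows "Re (f (of_real x)) < Re (f (of_real y))"
proof -
  define r where "r t = Re (f (of_real t))" for t
  have df: "(f has_field_derivative deriv f (of_real t)) (at (of_real t))" if "a \<le> t" "t \<le> b" for t
    using holomorphic_derivI[OF hol U(1) seg[OF that]] .
  have dr: "(r has_real_derivative Re (deriv f (of_real t))) (at t)" if "a \<le> t" "t \<le> b" for t
  proof -
    have "((\<lambda>t. f (of_real t)) has_vector_derivative deriv f (of_real t)) (at t)"
      using df[OF that] by (rule has_vector_derivative_real_field)
    then have "((\<lambda>t. Re (f (of_real t))) has_vector_derivative Re (deriv f (of_real t))) (at t)"
      by (rule bounded_linear.has_vector_derivative[OF bounded_linear_Re])
    then show ?thesis by (simp add: r_def[abs_def] has_real_derivative_iff_has_vector_derivative)
  qed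
  have pos: "Re (deriv f (of_real t)) \<ge> 0" if "a < t" "t < b" for t
  proof -
    have "(\<lambda>h. (f (of_real t + h) - f (of_real t)) / h) \<midarrow>0\<rightarrow> deriv f (of_real t)"
      using df[of t] that by (simp add: DERIV_def)
    moreover have "filterlim (\<lambda>\<eta>::real. - (\<i> * of_real \<eta>)) (at 0) (at_right 0)"
    proof (rule filterlim_atI)
      have "((\<lambda>\<eta>::real. - (\<i> * of_real \<eta>)) \<longlongrightarrow> - (\<i> * of_real 0)) (at_right 0)"
        by (intro tendsto_intros)
      then show "((\<lambda>\<eta>::real. - (\<i> * of_real \<eta>)) \<longlongrightarrow> 0) (at_right 0)" by simp
      show "\<forall>\<^sub>F \<eta> in at_right (0::real). - (\<i> * complex_of_real \<eta>) \<noteq> 0"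
        using eventually_at_right_less[of 0] by eventually_elim auto
    qed
    ultimately have "((\<lambda>\<eta>::real. (f (of_real t + - (\<i> * of_real \<eta>)) - f (of_real t)) / (- (\<i> * of_real \<eta>)))
        \<longlongrightarrow> deriv f (of_real t)) (at_right 0)" by (rule filterlim_compose)
    then have lim: "((\<lambda>\<eta>::real. Re ((f (of_real t + - (\<i> * of_real \<eta>)) - f (of_real t)) / (- (\<i> * of_real \<eta>))))
        \<longlongrightarrow> Re (deriv f (of_real t))) (at_right 0)" by (rule tendsto_Re)
    show ?thesis
    proof (rule tendsto_lowerbound[OF lim])
      show "\<forall>\<^sub>F \<eta> in at_right (0::real). 0 \<le> Re ((f (of_real t + - (\<i> * of_real \<eta>)) - f (of_real t)) / (- (\<i> * of_real \<eta>)))"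
        using below[OF that] eventually_at_right_less[of 0]
      proof eventually_elim
        case (elim \<eta>)
        have "Im (f (of_real t)) = 0" using re[of t] that by simp
        have "Re (w / (- (\<i> * of_real \<eta>))) = - Im w / \<eta>" for w
          using elim(2) by (simp add: Re_divide power2_eq_square)
        then show ?case using elim \<open>Im (f (of_real t)) = 0\<close> by (simp add: divide_nonpos_pos)
      qed
    qed simp
  qed
  have mono: "r u \<le> r v" if "a \<le> u" "u \<le> v" "v \<le> b" for u v
  proof (cases "u = v")
    case False
    then have "u < v" using that by simp
    then have "\<exists>t. u < t \<and> t < v \<and> r v - r u = (v - u) * Re (deriv f (of_real t))"
      by (rule MVT2) (use dr that in auto)
    then obtain t where t: "u < t" "t < v" "r v - r u = (v - u) * Re (deriv f (of_real t))" by blast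
    have "Re (deriv f (of_real t)) \<ge> 0" using t that by (intro pos) auto
    then have "(v - u) * Re (deriv f (of_real t)) \<ge> 0" using \<open>u < v\<close> by simp
    then show ?thesis using t(3) by linarith
  qed simp
  have "r x \<noteq> r y"
  proof
    assume eq: "r x = r y"
    have c: "f (of_real t) = f (of_real x)" if "x \<le> t" "t \<le> y" for t
    proof -
      have "r x \<le> r t" "r t \<le> r y" using that xy by (auto intro!: mono)
      then have "r t = r x" using eq by simp
      moreover have "Im (f (of_real t)) = 0" "Im (f (of_real x)) = 0" using that xy by (auto intro!: re)
      ultimately show ?thesis by (simp add: complex_eq_iff r_def)
    qed
    have "f constant_on U"
    proof (rule analytic_continuation'[OF hol U, of "of_real ` {x..y}" "of_real x"])
      show "of_real ` {x..y} \<subseteq> U" using seg xy by auto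
      show "of_real x \<in> U" using seg xy by auto
      show "f constant_on of_real ` {x..y}" unfolding constant_on_def
      proof (intro exI ballI)
        fix w :: complex assume "w \<in> of_real ` {x..y}"
        then obtain t where "w = of_real t" "x \<le> t" "t \<le> y" by auto
        then show "f w = f (of_real x)" using c[of t] by (simp only:)
      qed
      show "complex_of_real x islimpt of_real ` {x..y}"
        unfolding islimpt_approachable
      proof (intro allI impI)
        fix e :: real assume "e > 0"
        define t where "t = min y (x + e / 2)"
        have t: "x < t" "t \<le> y" "t < x + e" using xy \<open>e > 0\<close> by (auto simp: t_def)
        have "dist (complex_of_real t) (of_real x) < e"
          using t by (simp add: dist_norm flip: of_real_diff)
        then show "\<exists>x'\<in>of_real ` {x..y}. x' \<noteq> complex_of_real x \<and> dist x' (of_real x) < e"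
          using t by (intro bexI[of _ "of_real t"]) auto
      qed
    qed
    then show False using nc by blast
  qed
  moreover have "r x \<le> r y" using xy by (intro mono) auto
  ultimately show ?thesis by (simp add: r_def)
qed

lemma jinv_comp_not_constant:
  assumes "HH \<subseteq> g ` U"
  shows "\<not> (\<lambda>\<zeta>. jinv (g \<zeta>)) constant_on U"
proof
  assume "(\<lambda>\<zeta>. jinv (g \<zeta>)) constant_on U"
  then have "jinv constant_on HH" using assms unfolding constant_on_def by blast
  then show False using jinv_not_constant by blast
qed

lemma jinv_comp_holomorphic:
  assumes "g holomorphic_on U" "\<And>\<zeta>. \<zeta> \<in> U \<Longrightarrow> g \<zeta> \<in> HH"
  shows "(\<lambda>\<zeta>. jinv (g \<zeta>)) holomorphic_on U"
  using holomorphic_on_compose_gen[OF assms(1) jinv_holomorphic] assms(2) by (auto simp: o_def)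

text \<open>In the coordinate \<zeta> with z = exp (\<i> \<zeta>) the arc is a real segment, and t -
  \<i> \<eta> becomes exp \<eta> cis t, just outside the unit circle, where Im j \<le> 0.\<close>

lemma jinv_arc_mono:
  assumes "pi / 3 \<le> x" "x < y" "y \<le> pi / 2"
  shows "Re (jinv (cis x)) < Re (jinv (cis y))"
proof -
  define U where "U = {z. 0 < Re z} \<inter> {z. Re z < pi}"
  have U: "open U" "connected U"
    unfolding U_def by (auto intro!: convex_connected convex_Int open_Int open_halfspace_Re_gt open_halfspace_Re_lt
        convex_halfspace_Re_gt convex_halfspace_Re_lt)
  have gH: "exp (\<i> * \<zeta>) \<in> HH" if "\<zeta> \<in> U" for \<zeta>
    using that by (auto simp: U_def HH_def Im_exp intro!: mult_pos_pos sin_gt_zero)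
  have sur: "HH \<subseteq> (\<lambda>\<zeta>. exp (\<i> * \<zeta>)) ` U"
  proof
    fix w assume w: "w \<in> HH"
    then have w0: "w \<noteq> 0" by (auto simp: HH_def)
    have "0 < Im (Ln w)" "Im (Ln w) < pi" using w Im_Ln_pos_lt[OF w0] by (auto simp: HH_def)
    then have "- \<i> * Ln w \<in> U" by (simp add: U_def)
    moreover have "exp (\<i> * (- \<i> * Ln w)) = w" using w0 by simp
    ultimately show "w \<in> (\<lambda>\<zeta>. exp (\<i> * \<zeta>)) ` U" by (metis imageI)
  qed
  have cs: "exp (\<i> * of_real t) = cis t" for t by (simp add: cis_conv_exp)
  have "Re (jinv (exp (\<i> * of_real x))) < Re (jinv (exp (\<i> * of_real y)))"
  proof (rule real_boundary_strict_mono[OF jinv_comp_holomorphic U jinv_comp_not_constant[OF sur], of "pi / 3" "pi / 2"])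
    show "(\<lambda>\<zeta>. exp (\<i> * \<zeta>)) holomorphic_on U" by (intro holomorphic_intros)
    show "of_real t \<in> U" if "pi / 3 \<le> t" "t \<le> pi / 2" for t
      using that pi_gt_zero by (simp add: U_def del: pi_gt_zero)
    show "Im (jinv (exp (\<i> * of_real t))) = 0" if "pi / 3 \<le> t" "t \<le> pi / 2" for t
    proof (rule jinv_real_boundary)
      show "exp (\<i> * of_real t) \<in> HH" using that pi_gt_zero by (intro gH) (simp add: U_def del: pi_gt_zero)
    qed (simp add: cs)
    show "\<forall>\<^sub>F \<eta> in at_right 0. Im (jinv (exp (\<i> * (of_real t - \<i> * of_real \<eta>)))) \<le> 0" if t: "pi / 3 < t" "t < pi / 2" for t
    proof -
      have c: "0 < cos t" "cos t < 1 / 2"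
        using t cos_gt_zero[of t] cos_monotone_0_pi[of "pi / 3" t] by (auto simp: cos_60)
      have s: "sin t > 0" using t by (intro sin_gt_zero) auto
      have "((\<lambda>\<eta>. exp \<eta> * cos t) \<longlongrightarrow> exp 0 * cos t) (at_right 0)" by (intro tendsto_intros)
      then have "\<forall>\<^sub>F \<eta> in at_right 0. exp \<eta> * cos t < 1 / 2"
        using c(2) by (intro order_tendstoD(2)) auto
      then show ?thesis
        using eventually_at_right_less[of 0]
      proof eventually_elim
        case (elim \<eta>)
        have e: "exp (\<i> * (of_real t - \<i> * of_real \<eta>)) = of_real (exp \<eta>) * cis t"
          by (simp add: algebra_simps exp_add cis_conv_exp exp_of_real)
        show ?case unfolding e
          by (rule jinv_Im_nonpos) (use elim c s in \<open>auto simp: norm_mult\<close>)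
      qed
    qed
  qed (use assms gH in auto)
  then show ?thesis by (simp add: cs)
qed

text \<open>Coordinate z = \<i> \<zeta>: the point t - \<i> \<eta> becomes \<eta> + \<i> t, just to
  the right of the imaginary axis.\<close>

lemma jinv_imag_mono:
  assumes "1 \<le> x" "x < y"
  shows "Re (jinv (\<i> * of_real x)) < Re (jinv (\<i> * of_real y))"
proof -
  let ?U = "{z. 0 < Re z}"
  have sur: "HH \<subseteq> (\<lambda>\<zeta>. \<i> * \<zeta>) ` ?U"
  proof
    fix w assume "w \<in> HH"
    then have "- \<i> * w \<in> ?U" "w = \<i> * (- \<i> * w)" by (auto simp: HH_def complex_eq_iff)
    then show "w \<in> (\<lambda>\<zeta>. \<i> * \<zeta>) ` ?U" by blast
  qed
  show ?thesis
  proof (rule real_boundary_strict_mono[OF jinv_comp_holomorphic open_halfspace_Re_gt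
        convex_connected[OF convex_halfspace_Re_gt] jinv_comp_not_constant[OF sur], of 1 y])
    show "(\<lambda>\<zeta>. \<i> * \<zeta>) holomorphic_on ?U" by (intro holomorphic_intros)
    show "Im (jinv (\<i> * of_real t)) = 0" if "1 \<le> t" "t \<le> y" for t
      by (rule jinv_real_boundary) (use that in \<open>auto simp: HH_def\<close>)
    show "\<forall>\<^sub>F \<eta> in at_right 0. Im (jinv (\<i> * (of_real t - \<i> * of_real \<eta>))) \<le> 0" if t: "1 < t" "t < y" for t
      using eventually_at_right_less[of 0] eventually_at_right_real[of 0 "1/2", simplified]
    proof eventually_elim
      case (elim \<eta>)
      have n: "norm (Complex \<eta> t) \<ge> 1" using abs_Im_le_cmod[of "Complex \<eta> t"] t by simp
      have "\<i> * (of_real t - \<i> * of_real \<eta>) = Complex \<eta> t" by (simp add: complex_eq_iff)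
      then show ?case
        using n elim t by (simp add: jinv_Im_nonpos)
    qed
  qed (use assms in \<open>auto simp: HH_def\<close>)
qed

text \<open>Coordinate z = 1/2 - \<i> \<zeta> with \<zeta> running over negative reals: the half
  domain now lies to the left of its wall, so the orientation and hence the direction of growth are
  reversed.\<close>

lemma jinv_half_mono:
  assumes "3 / 4 \<le> x ^ 2" "0 < x" "x < y"
  shows "Re (jinv (Complex (1/2) y)) < Re (jinv (Complex (1/2) x))"
proof -
  let ?U = "{z. Re z < 0}"
  let ?g = "\<lambda>\<zeta>. 1/2 - \<i> * \<zeta>"
  have sur: "HH \<subseteq> ?g ` ?U"
  proof
    fix w assume "w \<in> HH"
    then have "\<i> * (w - 1/2) \<in> ?U" "w = ?g (\<i> * (w - 1/2))" by (auto simp: HH_def complex_eq_iff)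
    then show "w \<in> ?g ` ?U" by blast
  qed
  have c: "?g (of_real (- t)) = Complex (1/2) t" for t by (simp add: complex_eq_iff)
  have "Re (jinv (?g (of_real (- y)))) < Re (jinv (?g (of_real (- x))))"
  proof (rule real_boundary_strict_mono[OF jinv_comp_holomorphic open_halfspace_Re_lt
        convex_connected[OF convex_halfspace_Re_lt] jinv_comp_not_constant[OF sur], of "- y" "- x"])
    show "?g holomorphic_on ?U" by (intro holomorphic_intros)
    show "Im (jinv (?g (of_real t))) = 0" if "- y \<le> t" "t \<le> - x" for t
      by (rule jinv_real_boundary) (use that assms in \<open>auto simp: HH_def\<close>)
    show "\<forall>\<^sub>F \<eta> in at_right 0. Im (jinv (?g (of_real t - \<i> * of_real \<eta>))) \<le> 0" if t: "- y < t" "t < - x" for t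
    proof -
      have "x ^ 2 < (- t) ^ 2" using t assms by (intro power_strict_mono) auto
      then have t2: "t ^ 2 > 3 / 4" using assms by simp
      have "((\<lambda>\<eta>. (1/2 - \<eta>)^2 + t^2) \<longlongrightarrow> (1/2 - 0)^2 + t^2) (at_right (0::real))" by (intro tendsto_intros)
      then have "\<forall>\<^sub>F \<eta> in at_right (0::real). (1/2 - \<eta>)^2 + t^2 > 1"
        by (rule order_tendstoD(1)) (use t2 in \<open>simp add: power2_eq_square\<close>)
      then show ?thesis
        using eventually_at_right_real[of 0 "1/2", simplified]
      proof eventually_elim
        case (elim \<eta>)
        have "norm (Complex (1/2 - \<eta>) (- t)) ^ 2 \<ge> 1 ^ 2" using elim(1) by (simp add: cmod_power2)
        then have n: "norm (Complex (1/2 - \<eta>) (- t)) \<ge> 1" by (rule power2_le_imp_le) simp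
        have "?g (of_real t - \<i> * of_real \<eta>) = Complex (1/2 - \<eta>) (- t)" by (simp add: complex_eq_iff)
        then show ?case
          using n elim t assms by (simp add: jinv_Im_nonpos)
      qed
    qed
  qed (use assms in \<open>auto simp: HH_def\<close>)
  then show ?thesis unfolding c .
qed

text \<open>The value j(cis \<theta>) is real, so w lies on a wall. Along the boundary j is ordered:
  on the imaginary axis it is at least j(\<i>) \<ge> j(cis \<theta>), on the line Re w = 1/2 at most
  j(cis (\<pi> / 3)) < j(cis \<theta>), and on the arc it is strictly increasing in between.\<close>

lemma jinv_arc_injective_half:
  assumes th: "pi / 3 < \<theta>" "\<theta> \<le> pi / 2"
    and w: "0 \<le> Re w" "Re w \<le> 1 / 2" "norm w \<ge> 1" "w \<in> HH" and eq: "jinv w = jinv (cis \<theta>)"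
  shows "w = cis \<theta>"
proof -
  have im: "Im w > 0" using w by (simp add: HH_def)
  have s: "sin \<theta> > 0" using th pi_gt_zero by (intro sin_gt_zero) (auto simp del: pi_gt_zero)
  have "Im (jinv (cis \<theta>)) = 0" by (rule jinv_real_boundary) (use s in \<open>auto simp: HH_def\<close>)
  then have "\<not> Im (jinv w) < 0" using eq by simp
  then have "\<not> (0 < Re w \<and> Re w < 1 / 2 \<and> norm w > 1)" using jinv_Im_neg[of w] im by blast
  then consider "Re w = 0" | "Re w = 1 / 2" | "norm w = 1" using w by linarith
  then show ?thesis
  proof cases
    case 1
    then have wi: "w = \<i> * of_real (Im w)" by (simp add: complex_eq_iff)
    have y: "Im w \<ge> 1" using w(3) 1 im by (simp add: cmod_eq_Im)
    have i: "cis (pi / 2) = \<i> * of_real 1" by simp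
    have a: "Re (jinv (cis \<theta>)) \<le> Re (jinv (\<i> * of_real 1))"
    proof (cases "\<theta> = pi / 2")
      case False
      then show ?thesis using jinv_arc_mono[of \<theta> "pi / 2"] th i by simp
    next
      case True
      show ?thesis unfolding True i ..
    qed
    have b: "Im w = 1"
    proof (rule ccontr)
      assume "Im w \<noteq> 1"
      then have "Re (jinv (\<i> * of_real 1)) < Re (jinv (\<i> * of_real (Im w)))" using y by (intro jinv_imag_mono) auto
      then show False using a eq wi by simp
    qed
    have "\<theta> = pi / 2"
    proof (rule ccontr)
      assume "\<theta> \<noteq> pi / 2"
      then have "Re (jinv (cis \<theta>)) < Re (jinv (cis (pi / 2)))" using th by (intro jinv_arc_mono) auto
      then show False using eq wi b i by simp
    qed
    then have "cis \<theta> = \<i> * of_real 1" by (simp only: i)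
    then show ?thesis using wi b by simp
  next
    case 2
    have "1 \<le> norm w ^ 2" using w(3) by simp
    then have "1 \<le> (1 / 2) ^ 2 + Im w ^ 2" unfolding cmod_power2 2 .
    then have y: "3 / 4 \<le> Im w ^ 2" by (simp add: power2_eq_square)
    define h where "h = sqrt 3 / 2"
    have h: "h ^ 2 = 3 / 4" "h > 0" by (auto simp: h_def power_divide)
    have wc: "w = Complex (1/2) (Im w)" using 2 by (simp add: complex_eq_iff)
    have "h ^ 2 \<le> Im w ^ 2" using y h by linarith
    then have "h \<le> Im w" by (rule power2_le_imp_le) (use im in simp)
    then have "Re (jinv w) \<le> Re (jinv (Complex (1/2) h))"
      using jinv_half_mono[of h "Im w"] h wc by (cases "h = Im w") auto
    also have "Complex (1/2) h = cis (pi / 3)" by (simp add: complex_eq_iff h_def cos_60 sin_60)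
    also have "Re (jinv (cis (pi / 3))) < Re (jinv (cis \<theta>))" using th by (intro jinv_arc_mono) auto
    finally show ?thesis using eq by simp
  next
    case 3
    define t where "t = arccos (Re w)"
    have rw: "\<bar>Re w\<bar> \<le> 1" using w by simp
    have t: "cos t = Re w" "0 \<le> t" "t \<le> pi" using rw by (auto simp: t_def cos_arccos_abs arccos_lbound arccos_ubound)
    have "sin t = Im w"
    proof -
      have "norm w ^ 2 = 1" using 3 by simp
      then have "Im w ^ 2 = 1 - Re w ^ 2" by (simp add: cmod_power2)
      also have "\<dots> = sin t ^ 2" using t(1) sin_squared_eq[of t] by simp
      finally have "Im w ^ 2 = sin t ^ 2" .
      moreover have "sin t \<ge> 0" using t by (intro sin_ge_zero) auto
      ultimately show ?thesis using im by (simp add: power2_eq_iff)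
    qed
    then have wt: "w = cis t" using t by (simp add: complex_eq_iff)
    have tb: "pi / 3 \<le> t" "t \<le> pi / 2"
    proof -
      show "pi / 3 \<le> t"
      proof (rule ccontr)
        assume "\<not> pi / 3 \<le> t"
        then have "cos (pi / 3) < cos t" using t by (intro cos_monotone_0_pi) auto
        then show False using t w by (simp add: cos_60)
      qed
      show "t \<le> pi / 2"
      proof (rule ccontr)
        assume "\<not> t \<le> pi / 2"
        then have "cos t < cos (pi / 2)" using t by (intro cos_monotone_0_pi) auto
        then show False using t w by simp
      qed
    qed
    have "t = \<theta>"
    proof (cases t \<theta> rule: linorder_cases)
      case less
      then have "Re (jinv (cis t)) < Re (jinv (cis \<theta>))" using th tb by (intro jinv_arc_mono) auto
      then show ?thesis using eq wt by simp
    next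
      case greater
      then have "Re (jinv (cis \<theta>)) < Re (jinv (cis t))" using th tb by (intro jinv_arc_mono) auto
      then show ?thesis using eq wt by simp
    qed
    then show ?thesis using wt by simp
  qed
qed

lemma neg_inverse_cis: "- 1 / cis \<theta> = cis (pi - \<theta>)"
  by (simp add: complex_eq_iff Re_divide Im_divide power2_eq_square flip: cis_cnj)

text \<open>The reflection - cnj w folds the fundamental domain onto its right half; as the value is
  real, the equation survives the reflection.\<close>

lemma jinv_arc_injective:
  assumes th: "pi / 3 < \<theta>" "\<theta> < 2 * pi / 3"
    and w: "\<bar>Re w\<bar> \<le> 1 / 2" "norm w \<ge> 1" "w \<in> HH" and eq: "jinv w = jinv (cis \<theta>)"
  shows "w = cis \<theta> \<or> w = - 1 / cis \<theta>"
proof -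
  have s: "sin \<theta> > 0" using th pi_gt_zero by (intro sin_gt_zero) (auto simp del: pi_gt_zero)
  have cH: "cis \<theta> \<in> HH" using s by (simp add: HH_def)
  define \<theta>' where "\<theta>' = (if \<theta> \<le> pi / 2 then \<theta> else pi - \<theta>)"
  have th': "pi / 3 < \<theta>'" "\<theta>' \<le> pi / 2" using th by (auto simp: \<theta>'_def)
  have j': "jinv (cis \<theta>') = jinv (cis \<theta>)"
    using jinv_inv[OF cH] unfolding \<theta>'_def neg_inverse_cis by auto
  have re: "cnj (jinv (cis \<theta>)) = jinv (cis \<theta>)"
    using jinv_real_boundary[OF cH] by (simp add: complex_eq_iff)
  define w' where "w' = (if Re w \<ge> 0 then w else - cnj w)"
  have w': "0 \<le> Re w'" "Re w' \<le> 1 / 2" "norm w' \<ge> 1" "w' \<in> HH" using w by (auto simp: w'_def HH_def)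
  have "jinv w' = jinv (cis \<theta>')"
    using jinv_cnj[OF w(3)] eq re j' by (auto simp: w'_def)
  from jinv_arc_injective_half[OF th' w' this] have "w' = cis \<theta>'" .
  then have "w = cis \<theta>' \<or> - cnj w = cis \<theta>'" by (auto simp: w'_def split: if_splits)
  then have "w = cis \<theta>' \<or> w = cis (pi - \<theta>')"
  proof
    assume "- cnj w = cis \<theta>'"
    then have "w = cis (pi - \<theta>')" by (auto simp: complex_eq_iff)
    then show ?thesis by simp
  qed simp
  then show ?thesis unfolding \<theta>'_def neg_inverse_cis by (auto split: if_splits)
qed

section \<open>Points of large imaginary part in the orbit of an arc point\<close>

text \<open>Four times the form is (2 |c| - |d|)^2 + 3 d^2, and the form is symmetric in c and
  d.\<close>

lemma small_binary_form:
  fixes c d :: int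
  assumes "c^2 - \<bar>c * d\<bar> + d^2 \<le> 1"
  shows "\<bar>c\<bar> \<le> 1" "\<bar>d\<bar> \<le> 1"
proof -
  have *: "\<bar>d\<bar> \<le> 1" if "c^2 - \<bar>c * d\<bar> + d^2 \<le> 1" for c d :: int
  proof (rule ccontr)
    assume "\<not> \<bar>d\<bar> \<le> 1"
    then have "2 ^ 2 \<le> \<bar>d\<bar> ^ 2" by (intro power_mono) auto
    moreover have "(2 * \<bar>c\<bar> - \<bar>d\<bar>)^2 \<ge> 0" by simp
    moreover have "(2 * \<bar>c\<bar> - \<bar>d\<bar>)^2 = 4 * c^2 - 4 * \<bar>c * d\<bar> + \<bar>d\<bar>^2"
      by (simp add: power2_eq_square algebra_simps abs_mult)
    ultimately show False using that by simp
  qed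
  show "\<bar>d\<bar> \<le> 1" using *[OF assms] .
  show "\<bar>c\<bar> \<le> 1" using *[of d c] assms by (simp add: mult.commute)
qed

lemma mob_inverse:
  assumes "a * d - b * c = 1" "z \<in> HH" "w = mob a b c d z"
  shows "z = mob d (- b) (- c) a w"
proof -
  define D where "D = of_int c * z + of_int d"
  have D: "D \<noteq> 0" unfolding D_def by (rule mob_denom_nonzero[OF assms(1,2)])
  have w: "w = (of_int a * z + of_int b) / D" using assms(3) by (simp add: mob_def D_def)
  have det: "of_int a * of_int d - of_int b * of_int c = (1::complex)"
    using arg_cong[OF assms(1), of of_int] by simp
  have "of_int d * w + of_int (- b) = z / D"
  proof -
    have "of_int d * w + of_int (- b) = (of_int d * (of_int a * z + of_int b) - of_int b * D) / D"
      using D by (simp add: w field_simps)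
    also have "of_int d * (of_int a * z + of_int b) - of_int b * D = (of_int a * of_int d - of_int b * of_int c) * z"
      by (simp add: D_def algebra_simps)
    finally show ?thesis using det by simp
  qed
  moreover have "of_int (- c) * w + of_int a = 1 / D"
  proof -
    have "of_int (- c) * w + of_int a = (of_int a * D - of_int c * (of_int a * z + of_int b)) / D"
      using D by (simp add: w field_simps)
    also have "of_int a * D - of_int c * (of_int a * z + of_int b) = of_int a * of_int d - of_int b * of_int c"
      by (simp add: D_def algebra_simps)
    finally show ?thesis using det by simp
  qed
  ultimately show ?thesis using D by (simp add: mob_def)
qed

text \<open>Height above 1/2 means |c Z + d|^2 < 2 sin \<theta> \<le> 2. On the arc |2 cos \<theta>|
  < 1, so |c Z + d|^2 is at least c^2 - |c d| + d^2, an integer that must then be at most 1. Up to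
  translation T depends only on whether c = 0 and on c d.\<close>

lemma arc_orbit_high:
  assumes th: "pi / 3 < \<theta>" "\<theta> < 2 * pi / 3"
    and det: "a * d - b * c = 1" and T: "T = mob a b c d (cis \<theta>)" "Im T > 1 / 2"
  shows "\<exists>n::int. T = cis \<theta> + of_int n \<or> T = - 1 / cis \<theta> + of_int n \<or>
     T = - 1 / (cis \<theta> + 1) + of_int n \<or> T = - 1 / (cis \<theta> - 1) + of_int n"
proof -
  define Z where "Z = cis \<theta>"
  have s: "sin \<theta> > 0" using th pi_gt_zero by (intro sin_gt_zero) (auto simp del: pi_gt_zero)
  have ZH: "Z \<in> HH" using s by (simp add: HH_def Z_def)
  have cb: "\<bar>cos \<theta>\<bar> < 1 / 2"
  proof -
    have "cos \<theta> < cos (pi / 3)" using th by (intro cos_monotone_0_pi) auto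
    moreover have "cos (2 * pi / 3) < cos \<theta>" using th by (intro cos_monotone_0_pi) auto
    ultimately show ?thesis by (simp add: cos_60 cos_120)
  qed
  let ?N = "norm (of_int c * Z + of_int d) ^ 2"
  have N0: "?N > 0" using mob_denom_nonzero[OF det ZH] by simp
  have "Im T = sin \<theta> / ?N" using Im_mob[OF det, of Z] T(1) by (simp add: Z_def)
  then have "?N < 2 * sin \<theta>" using T(2) N0 by (simp add: field_simps)
  then have N2: "?N < 2" using sin_le_one[of \<theta>] by linarith
  have "?N = (c * cos \<theta> + d)^2 + (c * sin \<theta>)^2" by (simp add: cmod_power2 Z_def)
  also have "\<dots> = c^2 * (sin \<theta> ^2 + cos \<theta> ^ 2) + d^2 + 2 * (c * d) * cos \<theta>"
    unfolding of_int_power of_int_mult of_int_numeral by algebra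
  finally have N: "?N = c^2 + d^2 + 2 * (c * d) * cos \<theta>" by simp
  have "\<bar>real_of_int (2 * (c * d)) * cos \<theta>\<bar> \<le> \<bar>real_of_int (2 * (c * d))\<bar> * (1 / 2)"
    unfolding abs_mult using cb by (intro mult_left_mono) auto
  then have "- \<bar>real_of_int (c * d)\<bar> \<le> 2 * (c * d) * cos \<theta>" by (simp add: abs_le_iff)
  then have "real_of_int (c^2 + d^2 - \<bar>c * d\<bar>) < 2" using N N2 by simp
  then have "c^2 - \<bar>c * d\<bar> + d^2 \<le> 1" by linarith
  from small_binary_form[OF this] have cd: "c \<in> {-1, 0, 1}" "d \<in> {-1, 0, 1}" by auto
  \<comment> \<open>Splitting off the integer part a / c = a c of the transformation, using c = 1 /
    c.\<close>
  have sh: "mob a b c d Z = - 1 / (Z + of_int (c * d)) + of_int (a * c)" if c1: "c * c = 1"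
  proof -
    have cc: "of_int c * of_int c = (1::complex)" using arg_cong[OF c1, of "of_int :: int \<Rightarrow> complex"] by simp
    have D: "of_int c * Z + of_int d \<noteq> 0" by (rule mob_denom_nonzero[OF det ZH])
    have D': "Z + of_int (c * d) = of_int c * (of_int c * Z + of_int d)"
      using cc by (simp add: distrib_left mult.assoc [symmetric])
    have c0: "(of_int c :: complex) \<noteq> 0" using cc by auto
    have det': "of_int a * of_int d - of_int b * of_int c = (1::complex)"
      using arg_cong[OF det, of of_int] by simp
    have "- 1 / (Z + of_int (c * d)) + of_int (a * c) = (of_int c * of_int a * (of_int c * (of_int c * Z + of_int d)) - 1) / (of_int c * (of_int c * Z + of_int d))"
    proof -
      have "- 1 / E + x = (x * E - 1) / E" if "E \<noteq> 0" for E x :: complex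
        using that by (simp add: field_simps)
      from this[of "of_int c * (of_int c * Z + of_int d)" "of_int c * of_int a"] show ?thesis
        unfolding D' using D c0 by (simp add: mult.commute)
    qed
    also have "of_int c * of_int a * (of_int c * (of_int c * Z + of_int d)) - 1 = of_int c * (of_int a * Z + of_int b)"
    proof -
      have "of_int c * of_int a * (of_int c * (of_int c * Z + of_int d)) = (of_int c * of_int c) * (of_int a * (of_int c * Z + of_int d))"
        by (simp add: mult_ac)
      also have "\<dots> = of_int c * (of_int a * Z) + of_int a * of_int d" unfolding cc by (simp add: algebra_simps)
      also have "of_int a * of_int d = (1 + of_int b * of_int c :: complex)" using det' by (simp add: algebra_simps)
      finally show ?thesis by (simp add: algebra_simps)
    qed
    finally show ?thesis using c0 by (simp add: mob_def)
  qed
  show ?thesis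
  proof (cases "c = 0")
    case True
    then have "a * d = 1" using det by simp
    then have ad: "a * b * d * d = b * d" "a = d" "d * d = 1" using cd by (auto simp: zmult_eq_1_iff)
    then have "T = Z + of_int (b * d)"
      using T(1) True cd by (auto simp: mob_def Z_def)
    then show ?thesis unfolding Z_def by blast
  next
    case False
    then have "c * c = 1" using cd by auto
    from sh[OF this] have "T = - 1 / (Z + of_int (c * d)) + of_int (a * c)" using T(1) by (simp add: Z_def)
    then have T1: "T = - 1 / (cis \<theta> + of_int e) + of_int (a * c)" if "c * d = e" for e
      using that by (simp only: Z_def)
    have "c * d = - 1 \<or> c * d = 0 \<or> c * d = 1" using cd by auto
    then have "T = - 1 / (cis \<theta> - 1) + of_int (a * c) \<or> T = - 1 / cis \<theta> + of_int (a * c) \<or>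
        T = - 1 / (cis \<theta> + 1) + of_int (a * c)"
      using T1[of "- 1"] T1[of 0] T1[of 1] by auto
    then show ?thesis by blast
  qed
qed

text \<open>The representative of T in the fundamental domain is Z or - 1 / Z = cis (\<pi> -
  \<theta>). In the second case \<open>arc_orbit_high\<close> applies to the mirrored angle, and the
  four families are permuted up to integer translations.\<close>

lemma jinv_eq_arc_high:
  assumes th: "pi / 3 < \<theta>" "\<theta> < 2 * pi / 3" and T: "Im T > 1 / 2" and eq: "jinv T = jinv (cis \<theta>)"
  shows "\<exists>n::int. T = cis \<theta> + of_int n \<or> T = - 1 / cis \<theta> + of_int n \<or>
     T = - 1 / (cis \<theta> + 1) + of_int n \<or> T = - 1 / (cis \<theta> - 1) + of_int n"
proof -
  have TH: "T \<in> HH" using T by (simp add: HH_def)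
  have s: "sin \<theta> > 0" using th pi_gt_zero by (intro sin_gt_zero) (auto simp del: pi_gt_zero)
  have nz: "cis \<theta> + 1 \<noteq> 0" "cis \<theta> - 1 \<noteq> 0" using s by (auto simp: complex_eq_iff)
  obtain w where w: "w \<in> modular_orbit T" "\<bar>Re w\<bar> \<le> 1 / 2" "norm w \<ge> 1" "w \<in> HH"
    using modular_orbit_fundamental[OF TH] by blast
  have "jinv w = jinv T" by (rule modular_orbit_invariant[OF w(1) TH jinv_plus_1 jinv_inv])
  then have cases: "w = cis \<theta> \<or> w = - 1 / cis \<theta>" using jinv_arc_injective[OF th w(2-4)] eq by simp
  obtain a b c d where m: "a * d - b * c = 1" "w = mob a b c d T"
    by (rule modular_orbit_mob[OF w(1) TH])
  have T': "T = mob d (- b) (- c) a w" by (rule mob_inverse[OF m(1) TH m(2)])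
  have det: "d * a - (- b) * (- c) = 1" using m(1) by (simp add: mult.commute)
  show ?thesis
    using cases
  proof
    assume "w = cis \<theta>"
    then show ?thesis using arc_orbit_high[OF th det _ T] T' by blast
  next
    assume w1: "w = - 1 / cis \<theta>"
    have th': "pi / 3 < pi - \<theta>" "pi - \<theta> < 2 * pi / 3" using th by auto
    have T'': "T = mob d (- b) (- c) a (cis (pi - \<theta>))" using T' w1 by (simp only: neg_inverse_cis)
    obtain n :: int where "T = cis (pi - \<theta>) + of_int n \<or> T = - 1 / cis (pi - \<theta>) + of_int n \<or>
     T = - 1 / (cis (pi - \<theta>) + 1) + of_int n \<or> T = - 1 / (cis (pi - \<theta>) - 1) + of_int n"
      using arc_orbit_high[OF th' det T'' T] by blast
    then have n: "T = - 1 / cis \<theta> + of_int n \<or> T = - 1 / (- 1 / cis \<theta>) + of_int n \<or>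
     T = - 1 / (- 1 / cis \<theta> + 1) + of_int n \<or> T = - 1 / (- 1 / cis \<theta> - 1) + of_int n"
      unfolding neg_inverse_cis .
    have 1: "- 1 / (- 1 / cis \<theta>) = cis \<theta>" by simp
    have alg: "- 1 / (- 1 / z + 1) = - 1 / (z - 1) - 1" "- 1 / (- 1 / z - 1) = - 1 / (z + 1) + 1"
      if "z \<noteq> 0" "z + 1 \<noteq> 0" "z - 1 \<noteq> 0" for z :: complex
    proof -
      have e: "- 1 / z + 1 = (z - 1) / z" "- 1 / z - 1 = - (z + 1) / z" using that by (auto simp: field_simps)
      show "- 1 / (- 1 / z + 1) = - 1 / (z - 1) - 1" unfolding e using that by (simp add: field_simps)
      have "- 1 / (- (z + 1) / z) = z / (z + 1)"
        by (metis (no_types) divide_divide_eq_right minus_divide_left minus_divide_right minus_minus mult_1)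
      also have "\<dots> = - 1 / (z + 1) + 1" using that by (simp add: divide_simps)
      finally show "- 1 / (- 1 / z - 1) = - 1 / (z + 1) + 1" unfolding e .
    qed
    note alg' = alg[OF cis_neq_zero nz]
    show ?thesis using n unfolding 1 alg'
    proof (elim disjE)
      assume "T = - 1 / (cis \<theta> - 1) - 1 + of_int n"
      then have "T = - 1 / (cis \<theta> - 1) + of_int (n - 1)" by simp
      then show ?thesis by blast
    next
      assume "T = - 1 / (cis \<theta> + 1) + 1 + of_int n"
      then have "T = - 1 / (cis \<theta> + 1) + of_int (n + 1)" by simp
      then show ?thesis by blast
    qed blast+
  qed
qed

section \<open>Vector-valued forms\<close>

text \<open>The value \<i>^n at the odd plus space exponents n, which are 1 modulo 4 for even s and
  3 modulo 4 for odd s: the multiplier of the odd component under T + 1.\<close>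

definition ieps :: "int \<Rightarrow> complex" where
  "ieps s = (if even s then \<i> else - \<i>)"

lemma ieps_sq: "ieps s * ieps s = - 1" "ieps s ^ 2 = - 1"
  by (simp_all add: ieps_def)

lemma ieps_1_minus: "ieps (1 - s) = - ieps s"
  by (simp add: ieps_def)

lemma plus_cond_iff: "plus_cond s n \<longleftrightarrow> n mod 4 = 0 \<or> n mod 4 = (if even s then 1 else 3)"
proof (cases "even s")
  case True
  then show ?thesis unfolding plus_cond_def by simp
next
  case False
  then show ?thesis unfolding plus_cond_def by simp presburger
qed

lemma qexp_shift: "qexp n (\<tau> + c) = qexp n \<tau> * qexp n c"
  by (simp add: qexp_def algebra_simps flip: exp_add)

lemma qexp_half: "qexp n (1/2) = (if even n then 1 else - 1)"
proof -
  have e: "qexp (2 * k) (1/2) = 1" for k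
  proof -
    have "qexp (2 * k) (1/2) = exp (\<i> * (of_int k * (of_real pi * 2)))"
      unfolding qexp_def by (rule arg_cong[where f = exp]) (simp add: algebra_simps)
    then show ?thesis by simp
  qed
  have o: "qexp 1 (1/2) = - 1" by (simp add: qexp_def exp_pi_i')
  show ?thesis
  proof (cases "even n")
    case True
    then show ?thesis using e[of "n div 2"] by simp
  next
    case False
    then have "n = 2 * (n div 2) + 1" by simp
    then show ?thesis using qexp_add[of "2 * (n div 2)" 1 "1/2"] e[of "n div 2"] o False by simp
  qed
qed

text \<open>Plus space exponents take only two residues modulo 4, so e(n/4) is 1 or
  \<open>ieps s\<close> and hence an affine function of the parity sign e(n/2). Translation by 1/4
  is thereby expressed through translation by 1/2.\<close>

lemma qexp_quarter:
  assumes "plus_cond s n"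
  shows "qexp n (1/4) = (1 + ieps s) / 2 + (1 - ieps s) / 2 * qexp n (1/2)"
proof -
  have q4: "qexp (4 * k) (1/4) = 1" for k
  proof -
    have "qexp (4 * k) (1/4) = exp (\<i> * (of_int k * (of_real pi * 2)))"
      unfolding qexp_def by (rule arg_cong[where f = exp]) (simp add: algebra_simps)
    then show ?thesis by simp
  qed
  have q1: "qexp 1 (1/4) = \<i>"
  proof -
    have "qexp 1 (1/4) = exp (\<i> * of_real (pi / 2))"
      unfolding qexp_def by (rule arg_cong[where f = exp]) (simp add: algebra_simps)
    then show ?thesis by (metis cis_conv_exp cis_pi_half)
  qed
  have q3: "qexp 3 (1/4) = - \<i>"
  proof -
    have "qexp 3 (1/4) = qexp 1 (1/4) * qexp 1 (1/4) * qexp 1 (1/4)"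
      by (simp flip: qexp_add)
    then show ?thesis unfolding q1 by simp
  qed
  have "n = 4 * (n div 4) + n mod 4" by simp
  then have n: "qexp n (1/4) = qexp (n mod 4) (1/4)"
    using qexp_add[of "4 * (n div 4)" "n mod 4" "1/4"] q4[of "n div 4"] by simp
  have q0: "qexp 0 (1/4) = 1" by (simp add: qexp_def)
  from assms consider "n mod 4 = 0" "even n" | "n mod 4 = 1" "even s" "odd n" | "n mod 4 = 3" "odd s" "odd n"
  proof -
    have "even n \<longleftrightarrow> even (n mod 4)" by presburger
    then show ?thesis using that assms unfolding plus_cond_iff by (cases "even s") auto
  qed
  then show ?thesis
    by cases (simp_all add: n q0 q1 q3 qexp_half ieps_def field_simps)
qed

text \<open>The part of the Fourier expansion with even (\<open>True\<close>) or odd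
  (\<open>False\<close>) exponents, as a function of T = 4 \<tau>.\<close>

definition vvc :: "bool \<Rightarrow> (complex \<Rightarrow> complex) \<Rightarrow> complex \<Rightarrow> complex" where
  "vvc p f T = (f (T / 4) + (if p then 1 else - 1) * f (T / 4 + 1/2)) / 2"

text \<open>Inversion acts by the matrix with rows (1, 1), (1, -1) divided by sqrt 2 and times an
  eighth root of unity; (1 - \<open>ieps s\<close>) / 2 combines the two scalars. T^k is written as
  the integer power 2 s + 1 of the principal square root, which avoids complex exponents.\<close>

definition vvmf :: "int \<Rightarrow> (complex \<Rightarrow> complex) \<Rightarrow> (complex \<Rightarrow> complex) \<Rightarrow> bool" where
  "vvmf s h0 h1 \<longleftrightarrow> h0 holomorphic_on HH \<and> h1 holomorphic_on HH \<and>
     (\<forall>T\<in>HH. h0 (T + 1) = h0 T \<and> h1 (T + 1) = ieps s * h1 T \<and>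
        h0 (- 1 / T) = csqrt T powi (2 * s + 1) * ((1 - ieps s) / 2) * (h0 T + h1 T) \<and>
        h1 (- 1 / T) = csqrt T powi (2 * s + 1) * ((1 - ieps s) / 2) * (h0 T - h1 T))"

lemma wh_mod_expansion:
  assumes "wh_mod s f"
  obtains a where "\<And>n. a n \<noteq> 0 \<Longrightarrow> plus_cond s n" "\<And>\<tau>. \<tau> \<in> HH \<Longrightarrow> ((\<lambda>n. a n * qexp n \<tau>) has_sum f \<tau>) UNIV"
  using assms unfolding wh_mod_def by blast

lemma wh_mod_quarter:
  assumes "wh_mod s f" "\<tau> \<in> HH"
  shows "f (\<tau> + 1/4) = (1 + ieps s) / 2 * f \<tau> + (1 - ieps s) / 2 * f (\<tau> + 1/2)" and "f (\<tau> + 1) = f \<tau>"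
proof -
  obtain a where a: "\<And>n. a n \<noteq> 0 \<Longrightarrow> plus_cond s n" "\<And>\<tau>. \<tau> \<in> HH \<Longrightarrow> ((\<lambda>n. a n * qexp n \<tau>) has_sum f \<tau>) UNIV"
    using wh_mod_expansion[OF assms(1)] by blast
  have H: "\<tau> + 1/4 \<in> HH" "\<tau> + 1/2 \<in> HH" "\<tau> + 1 \<in> HH" using assms(2) by (auto simp: HH_def)
  have "((\<lambda>n. (1 + ieps s) / 2 * (a n * qexp n \<tau>) + (1 - ieps s) / 2 * (a n * qexp n (\<tau> + 1/2))) has_sum
     ((1 + ieps s) / 2 * f \<tau> + (1 - ieps s) / 2 * f (\<tau> + 1/2))) UNIV"
    by (intro has_sum_add has_sum_cmult_right a assms H)
  also have "(\<lambda>n. (1 + ieps s) / 2 * (a n * qexp n \<tau>) + (1 - ieps s) / 2 * (a n * qexp n (\<tau> + 1/2))) = (\<lambda>n. a n * qexp n (\<tau> + 1/4))"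
  proof
    fix n
    show "(1 + ieps s) / 2 * (a n * qexp n \<tau>) + (1 - ieps s) / 2 * (a n * qexp n (\<tau> + 1/2)) = a n * qexp n (\<tau> + 1/4)"
    proof (cases "a n = 0")
      case False
      show ?thesis unfolding qexp_shift qexp_quarter[OF a(1)[OF False]] by (simp add: algebra_simps)
    qed simp
  qed
  finally show "f (\<tau> + 1/4) = (1 + ieps s) / 2 * f \<tau> + (1 - ieps s) / 2 * f (\<tau> + 1/2)"
    using a(2)[OF H(1)] has_sum_unique by blast
  have "(\<lambda>n. a n * qexp n (\<tau> + 1)) = (\<lambda>n. a n * qexp n \<tau>)"
    by (simp add: qexp_def exp_2pi_int_period)
  then show "f (\<tau> + 1) = f \<tau>" using a(2)[OF assms(2)] a(2)[OF H(3)] has_sum_unique by metis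
qed

text \<open>The automorphy factor in \<open>wh_mod\<close> is a quotient of \<open>theta\<close>.
  After multiplication by \<open>theta\<close> the transformation formula identifies it with the
  power of csqrt (4 \<tau> + 1), and the identity theorem removes \<open>theta\<close>
  again.\<close>

lemma wh_mod_gamma:
  assumes f: "wh_mod s f" and "\<tau> \<in> HH"
  shows "f (\<tau> / (4 * \<tau> + 1)) = csqrt (4 * \<tau> + 1) powi (2 * s + 1) * f \<tau>"
proof -
  let ?u = "\<lambda>\<tau>. f (\<tau> / (4 * \<tau> + 1)) - csqrt (4 * \<tau> + 1) powi (2 * s + 1) * f \<tau>"
  have fh: "f holomorphic_on HH" using f by (simp add: wh_mod_def)
  have d: "4 * t + 1 \<noteq> 0" "csqrt (4 * t + 1) \<noteq> 0" "4 * t + 1 \<notin> \<real>\<^sub>\<le>\<^sub>0" if "t \<in> HH" for t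
  proof -
    show "4 * t + 1 \<notin> \<real>\<^sub>\<le>\<^sub>0" using that by (simp add: HH_def complex_nonpos_Reals_iff)
    then show "4 * t + 1 \<noteq> 0" by force
    then show "csqrt (4 * t + 1) \<noteq> 0" by simp
  qed
  have mb: "t / (4 * t + 1) = mob 1 0 4 1 t" for t by (simp add: mob_def)
  have gH: "t / (4 * t + 1) \<in> HH" if "t \<in> HH" for t
    unfolding mb by (rule mob_in_HH) (use that in auto)
  have "?u \<tau> = 0"
  proof (rule holomorphic_mult_zero_imp_zero[of ?u HH theta])
    have "(\<lambda>t. f (t / (4 * t + 1))) holomorphic_on HH"
      by (rule holomorphic_on_compose_gen[OF _ fh, of "\<lambda>t. t / (4 * t + 1)" HH, unfolded o_def])
        (use gH d(1) in \<open>auto intro!: holomorphic_intros\<close>)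
    then show "?u holomorphic_on HH"
      by (intro holomorphic_intros fh) (use d in auto)
    show "?u t * theta t = 0" if t: "t \<in> HH" for t
    proof (cases "theta t = 0")
      case False
      have "f (mob 1 0 4 1 t) = (theta (mob 1 0 4 1 t) / theta t) powi (2 * s + 1) * f t"
        using f t unfolding wh_mod_def by (metis (no_types, lifting) dvd_refl mult_1 mult_zero_left diff_zero)
      also have "theta (mob 1 0 4 1 t) / theta t = csqrt (4 * t + 1)"
        using theta_gamma0_4[OF t] False by (simp add: mb)
      finally show ?thesis by (simp add: mb)
    qed simp
  qed (use theta_holomorphic theta_ii_nonzero assms in auto)
  then show ?thesis by simp
qed

text \<open>For T in \<open>HH\<close> the root csqrt T has positive imaginary part, so \<i> / csqrt
  T has positive real part and is the principal root.\<close>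

lemma csqrt_neg_inverse:
  assumes "T \<in> HH"
  shows "csqrt (- 1 / T) = \<i> / csqrt T"
proof (rule csqrt_unique)
  have T0: "T \<noteq> 0" and im: "Im T > 0" using assms by (auto simp: HH_def)
  show "(\<i> / csqrt T)\<^sup>2 = - 1 / T" by (simp add: power_divide)
  have "Im (csqrt T) > 0"
  proof -
    have "2 * Re (csqrt T) * Im (csqrt T) = Im T"
      using arg_cong[OF power2_csqrt[of T], of Im] unfolding Im_power2 .
    moreover have "Re (csqrt T) \<ge> 0" by (rule Re_csqrt)
    ultimately show ?thesis using im by (metis mult_nonneg_nonpos not_less mult_2 add_nonneg_nonneg)
  qed
  then have "0 < Re (\<i> / csqrt T)"
    unfolding Re_divide by (intro divide_pos_pos) (auto simp: sum_power2_gt_zero_iff simp del: csqrt.simps)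
  then show "0 < Re (\<i> / csqrt T) \<or> Re (\<i> / csqrt T) = 0 \<and> 0 \<le> Im (\<i> / csqrt T)" by blast
qed

lemma neg_ii_powi: "(- \<i>) powi (2 * s + 1) = - ieps s"
proof -
  have "(- \<i>) powi (2 * s + 1) = ((- \<i>) powi 2) powi s * (- \<i>)"
    by (simp add: power_int_add power_int_mult)
  also have "(- \<i>) powi 2 = - 1" by (simp add: power_int_def)
  finally show ?thesis by (simp add: ieps_def power_int_def even_nat_iff)
qed

text \<open>The full inversion is obtained from the single level 4 map \<tau> / (4 \<tau> + 1): its
  values at two suitable points give two linear equations for the components at - 1 / T, which are
  then solved.\<close>

lemma wh_mod_vvmf:
  assumes f: "wh_mod s f"
  shows "vvmf s (vvc True f) (vvc False f)"
proof -
  have fh: "f holomorphic_on HH" using f by (simp add: wh_mod_def)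
  let ?e = "ieps s"
  have sum: "vvc True f T + vvc False f T = f (T / 4)" for T by (simp add: vvc_def field_simps)
  have hol: "vvc p f holomorphic_on HH" for p
  proof -
    have 1: "(\<lambda>T. f (T / 4)) holomorphic_on HH"
      by (rule holomorphic_on_compose_gen[OF _ fh, of "\<lambda>t. t / 4" HH, unfolded o_def])
        (auto simp: HH_def intro!: holomorphic_intros)
    have 2: "(\<lambda>T. f (T / 4 + 1/2)) holomorphic_on HH"
      by (rule holomorphic_on_compose_gen[OF _ fh, of "\<lambda>t. t / 4 + 1/2" HH, unfolded o_def])
        (auto simp: HH_def intro!: holomorphic_intros)
    show ?thesis unfolding vvc_def[abs_def] by (intro holomorphic_intros 1 2) auto
  qed
  have t: "vvc True f (T + 1) = vvc True f T" "vvc False f (T + 1) = ?e * vvc False f T" if "T \<in> HH" for T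
  proof -
    define \<tau> where "\<tau> = T / 4"
    have H: "\<tau> \<in> HH" "\<tau> + 1/2 \<in> HH" using that by (auto simp: \<tau>_def HH_def)
    have a: "(T + 1) / 4 = \<tau> + 1/4" "(T + 1) / 4 + 1/2 = \<tau> + 1/2 + 1/4" by (auto simp: \<tau>_def field_simps)
    have a': "\<tau> + 1/4 + 1/2 = \<tau> + 1/2 + 1/4" by simp
    have b: "\<tau> + 1/2 + 1/2 = \<tau> + 1" by simp
    note r = wh_mod_quarter(1)[OF f H(1)] wh_mod_quarter(1)[OF f H(2), unfolded b wh_mod_quarter(2)[OF f H(1)]]
    show "vvc True f (T + 1) = vvc True f T" "vvc False f (T + 1) = ?e * vvc False f T"
      unfolding vvc_def a a' r \<tau>_def[symmetric] by (simp_all add: field_simps)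
  qed
  have tm: "vvc True f (T - 1) = vvc True f T" "vvc False f (T - 1) = - ?e * vvc False f T" if "T \<in> HH" for T
  proof -
    have H: "T - 1 \<in> HH" using that by (simp add: HH_def)
    show "vvc True f (T - 1) = vvc True f T" using t(1)[OF H] by simp
    have "vvc False f T = ?e * vvc False f (T - 1)" using t(2)[OF H] by simp
    then have "- ?e * vvc False f T = - (?e * ?e) * vvc False f (T - 1)" by simp
    then show "vvc False f (T - 1) = - ?e * vvc False f T" by (simp add: ieps_sq)
  qed
  have "vvc True f (- 1 / T) = csqrt T powi (2 * s + 1) * ((1 - ?e) / 2) * (vvc True f T + vvc False f T) \<and>
        vvc False f (- 1 / T) = csqrt T powi (2 * s + 1) * ((1 - ?e) / 2) * (vvc True f T - vvc False f T)"
    if T: "T \<in> HH" for T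
  proof -
    define k where "k = csqrt T powi (2 * s + 1)"
    define h0 h1 h0' h1' where "h0 = vvc True f T" and "h1 = vvc False f T"
      and "h0' = vvc True f (- 1 / T)" and "h1' = vvc False f (- 1 / T)"
    have T0: "T \<noteq> 0" using T by (auto simp: HH_def)
    have SH: "- 1 / T \<in> HH" by (rule HH_neg_inverse[OF T])
    \<comment> \<open>The level 4 map at \<tau> = (T - 1) / 4: there 4 \<tau> + 1 = T, and the image
      is (- 1 / T + 1) / 4.\<close>
    have A: "h0' + ?e * h1' = k * (h0 - ?e * h1)"
    proof -
      have "(T - 1) / 4 \<in> HH" using T by (simp add: HH_def)
      moreover have "4 * ((T - 1) / 4) + 1 = T" by (simp add: field_simps)
      ultimately have "f ((T - 1) / 4 / T) = k * f ((T - 1) / 4)"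
        using wh_mod_gamma[OF f, of "(T - 1) / 4"] by (simp only: k_def)
      also have "(T - 1) / 4 / T = (- 1 / T + 1) / 4" using T0 by (simp add: field_simps)
      finally show ?thesis
        unfolding sum[symmetric] tm[OF T] t[OF SH] h0_def h1_def h0'_def h1'_def by simp
    qed
    \<comment> \<open>The level 4 map at \<tau> = (- 1 / T - 1) / 4: there 4 \<tau> + 1 = - 1 / T,
      and the image is (T + 1) / 4.\<close>
    have B: "h0' - ?e * h1' = - ?e * k * (h0 + ?e * h1)"
    proof -
      define \<tau> where "\<tau> = (- 1 / T - 1) / 4"
      have "\<tau> \<in> HH" using SH by (simp add: HH_def \<tau>_def)
      moreover have "4 * \<tau> + 1 = - 1 / T" using T0 by (simp add: \<tau>_def field_simps)
      ultimately have "f (\<tau> / (4 * \<tau> + 1)) = csqrt (- 1 / T) powi (2 * s + 1) * f \<tau>"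
        using wh_mod_gamma[OF f, of \<tau>] by (simp only:)
      also have "\<tau> / (4 * \<tau> + 1) = (T + 1) / 4" using T0 by (simp add: \<tau>_def field_simps)
      finally have 1: "f ((T + 1) / 4) = (\<i> / csqrt T) powi (2 * s + 1) * f \<tau>"
        unfolding csqrt_neg_inverse[OF T] .
      have 2: "(\<i> / csqrt T) powi (2 * s + 1) = 1 / (- ?e * k)"
      proof -
        have "\<i> / csqrt T = inverse (- \<i> * csqrt T)" by (simp add: divide_inverse)
        then have "(\<i> / csqrt T) powi (2 * s + 1) = inverse ((- \<i>) powi (2 * s + 1) * k)"
          by (simp only: power_int_inverse power_int_mult_distrib k_def)
        then show ?thesis by (simp only: neg_ii_powi inverse_eq_divide)
      qed
      have "- ?e * k \<noteq> 0" using T0 by (simp add: k_def ieps_def)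
      then have "f \<tau> = - ?e * k * f ((T + 1) / 4)" unfolding 1 2 by simp
      then have "f ((- 1 / T - 1) / 4) = - ?e * k * f ((T + 1) / 4)" by (simp only: \<tau>_def)
      then show ?thesis
        unfolding sum[symmetric] tm[OF SH] t[OF T] h0_def h1_def h0'_def h1'_def by simp
    qed
    have "2 * h0' = k * (1 - ?e) * (h0 + h1)"
    proof -
      have "2 * h0' = (h0' + ?e * h1') + (h0' - ?e * h1')" by simp
      also have "\<dots> = k * (1 - ?e) * (h0 + h1) - k * h1 * (1 + ?e * ?e)" unfolding A B by (simp add: algebra_simps)
      finally show ?thesis by (simp add: ieps_sq)
    qed
    moreover have "2 * h1' = k * (1 - ?e) * (h0 - h1)"
    proof -
      have "2 * h1' = - ?e * ((h0' + ?e * h1') - (h0' - ?e * h1')) + 2 * h1' * (1 + ?e * ?e)" by (simp add: algebra_simps)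
      also have "\<dots> = k * (1 - ?e) * (h0 - h1) - (1 + ?e * ?e) * k * (h0 - h1 + ?e * h1) + 2 * h1' * (1 + ?e * ?e)"
        unfolding A B by (simp add: algebra_simps)
      finally show ?thesis by (simp add: ieps_sq)
    qed
    ultimately show ?thesis unfolding h0_def h1_def h0'_def h1'_def k_def by (simp add: mult.commute)
  qed
  then show ?thesis unfolding vvmf_def using hol t by blast
qed

lemma vvmf_linear:
  assumes "vvmf s g0 g1" "vvmf s h0 h1"
  shows "vvmf s (\<lambda>T. a * g0 T + b * h0 T) (\<lambda>T. a * g1 T + b * h1 T)"
proof -
  have l: "a * (k * (x + y)) + b * (k * (x' + y')) = k * ((a * x + b * x') + (a * y + b * y'))"
    "a * (k * (x - y)) + b * (k * (x' - y')) = k * ((a * x + b * x') - (a * y + b * y'))" for k x y x' y' :: complex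
    by (simp_all add: algebra_simps)
  have l3: "a * (e * x) + b * (e * x') = e * (a * x + b * x')" for e x x' :: complex by (simp add: algebra_simps)
  have g: "g0 holomorphic_on HH" "g1 holomorphic_on HH" "\<And>T. T \<in> HH \<Longrightarrow> g0 (T + 1) = g0 T" "\<And>T. T \<in> HH \<Longrightarrow> g1 (T + 1) = ieps s * g1 T"
    "\<And>T. T \<in> HH \<Longrightarrow> g0 (- 1 / T) = csqrt T powi (2 * s + 1) * ((1 - ieps s) / 2) * (g0 T + g1 T)"
    "\<And>T. T \<in> HH \<Longrightarrow> g1 (- 1 / T) = csqrt T powi (2 * s + 1) * ((1 - ieps s) / 2) * (g0 T - g1 T)"
    using assms(1) unfolding vvmf_def by auto
  have h: "h0 holomorphic_on HH" "h1 holomorphic_on HH" "\<And>T. T \<in> HH \<Longrightarrow> h0 (T + 1) = h0 T" "\<And>T. T \<in> HH \<Longrightarrow> h1 (T + 1) = ieps s * h1 T"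
    "\<And>T. T \<in> HH \<Longrightarrow> h0 (- 1 / T) = csqrt T powi (2 * s + 1) * ((1 - ieps s) / 2) * (h0 T + h1 T)"
    "\<And>T. T \<in> HH \<Longrightarrow> h1 (- 1 / T) = csqrt T powi (2 * s + 1) * ((1 - ieps s) / 2) * (h0 T - h1 T)"
    using assms(2) unfolding vvmf_def by auto
  show ?thesis
    unfolding vvmf_def
    by (intro conjI ballI holomorphic_intros g(1,2) h(1,2); (simp only: g h)?; (rule l l3)?)
qed

text \<open>The multipliers of s and 1 - s are dual: \<open>ieps s\<close> and -
  \<open>ieps s\<close> have product 1, the square root powers multiply to T^2, and the two
  inversion matrices cancel in the bilinear sum.\<close>

lemma vvmf_pairing:
  assumes "vvmf s h0 h1" "vvmf (1 - s) g0 g1"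
  defines "P \<equiv> \<lambda>T. h0 T * g0 T + h1 T * g1 T"
  shows "P holomorphic_on HH" "\<And>T. T \<in> HH \<Longrightarrow> P (T + 1) = P T" "\<And>T. T \<in> HH \<Longrightarrow> P (- 1 / T) = T ^ 2 * P T"
proof -
  let ?e = "ieps s"
  show "P holomorphic_on HH" using assms unfolding vvmf_def by (auto intro!: holomorphic_intros)
  show "P (T + 1) = P T" if "T \<in> HH" for T
  proof -
    have "?e * h1 T * (- ?e * g1 T) = - (?e * ?e) * (h1 T * g1 T)" by (simp add: mult_ac)
    then show ?thesis using assms that unfolding vvmf_def by (simp add: ieps_1_minus ieps_sq)
  qed
  show "P (- 1 / T) = T ^ 2 * P T" if T: "T \<in> HH" for T
  proof -
    have T0: "csqrt T \<noteq> 0" using T by (auto simp: HH_def)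
    define k where "k = csqrt T powi (2 * s + 1)"
    define k' where "k' = csqrt T powi (2 * (1 - s) + 1)"
    have "k * k' = csqrt T powi 4"
      unfolding k_def k'_def using T0 by (simp add: power_int_add [symmetric])
    also have "\<dots> = (csqrt T ^ 2) ^ 2" by (simp only: power_mult[symmetric]) simp
    finally have kk: "k * k' = T ^ 2" unfolding power2_csqrt .
    have "P (- 1 / T) = (k * ((1 - ?e) / 2) * (h0 T + h1 T)) * (k' * ((1 + ?e) / 2) * (g0 T + g1 T))
      + (k * ((1 - ?e) / 2) * (h0 T - h1 T)) * (k' * ((1 + ?e) / 2) * (g0 T - g1 T))"
      using assms T unfolding vvmf_def k_def k'_def by (simp only: ieps_1_minus P_def) simp
    also have "\<dots> = (k * k') * ((1 - ?e * ?e) / 2) * P T"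
      unfolding P_def by (simp add: field_simps)
    finally show ?thesis unfolding kk by (simp add: ieps_sq)
  qed
qed

section \<open>The smallest indices and exponents of the two bases\<close>

lemma ell_eq:
  assumes "2 * s = 12 * l + kp" "kp \<in> {0,4,6,8,10,14}"
  shows "ell s = l"
  unfolding ell_def
proof (rule the_equality)
  show "\<exists>kp\<in>{0,4,6,8,10,14}. 2 * s = 12 * l + kp" using assms by blast
  fix l' assume "\<exists>kp\<in>{0,4,6,8,10,14}. 2 * s = 12 * l' + kp"
  then obtain kp' where "kp' \<in> {0,4,6,8,10,14}" "2 * s = 12 * l' + kp'" by blast
  then show "l' = l" using assms by auto presburger+
qed

lemma ell_exists: "\<exists>l kp. 2 * s = 12 * l + kp \<and> kp \<in> {0,4,6,8,10,14::int}"
proof -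
  have "s mod 6 \<in> {0,1,2,3,4,5}" by auto
  then consider "s mod 6 = 1" | "s mod 6 \<in> {0,2,3,4,5}" by auto
  then show ?thesis
  proof cases
    case 1
    then have "2 * s = 12 * (s div 6 - 1) + 14" by presburger
    then show ?thesis by blast
  next
    case 2
    have "2 * s = 12 * (s div 6) + 2 * (s mod 6)" by presburger
    moreover have "2 * (s mod 6) \<in> {0,4,6,8,10,14}" using 2 by auto
    ultimately show ?thesis by blast
  qed
qed

text \<open>The admissible residues are symmetric under k' to 14 - k'.\<close>

lemma ell_dual: "ell (1 - s) = - ell s - 1"
proof -
  obtain l kp where l: "2 * s = 12 * l + kp" "kp \<in> {0,4,6,8,10,14::int}" using ell_exists[of s] by blast
  have "2 * (1 - s) = 12 * (- l - 1) + (14 - kp)" using l(1) by simp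
  moreover have "14 - kp \<in> {0,4,6,8,10,14}" using l(2) by auto
  ultimately show ?thesis using ell_eq[OF l] ell_eq by metis
qed

text \<open>The sign \<delta> merges the cases given by the parities of s and \<open>ell s\<close>:
  the gap between the two smallest indices is 2 + \<delta>, that is 1 or 3, in both weights. The
  last four clauses give, for each parity, a lower bound for the exponents allowed beyond the
  principal term.\<close>

lemma index_facts:
  fixes s :: int
  obtains N \<delta> where "\<delta> = 1 \<or> \<delta> = - 1" "Nw s = N" "Nw (1 - s) = - N - 2 + \<delta>"
    "admissible s (- N)" "admissible s (- N + 2 + \<delta>)" "admissible (1 - s) (N + 2 - \<delta>)" "admissible (1 - s) (N + 4)"
    "adm0 s = - N" "adm1 s = - N + 2 + \<delta>" "adm0 (1 - s) = N + 2 - \<delta>" "adm1 (1 - s) = N + 4"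
    "\<And>n. plus_cond s n \<Longrightarrow> n > N \<Longrightarrow> even n = even N \<Longrightarrow> n \<ge> N + 4"
    "\<And>n. plus_cond s n \<Longrightarrow> n > N \<Longrightarrow> even n \<noteq> even N \<Longrightarrow> n \<ge> N + 2 - \<delta>"
    "\<And>n. plus_cond (1 - s) n \<Longrightarrow> n > - N - 2 + \<delta> \<Longrightarrow> even n = even N \<Longrightarrow> n \<ge> - N"
    "\<And>n. plus_cond (1 - s) n \<Longrightarrow> n > - N - 2 + \<delta> \<Longrightarrow> even n \<noteq> even N \<Longrightarrow> n \<ge> - N + 2 + \<delta>"
proof -
  define N where "N = Nw s"
  define e :: int where "e = (if even s then 1 else - 1)"
  define \<delta> where "\<delta> = (if even (ell s) then e else - e)"
  have e: "e = 1 \<and> even s \<or> e = - 1 \<and> odd s" by (auto simp: e_def)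
  have N: "N = 2 * ell s - (if even (ell s) then 0 else e)" by (simp add: N_def Nw_def e_def)
  have N': "Nw (1 - s) = - N - 2 + \<delta>"
    unfolding N \<delta>_def by (simp add: Nw_def ell_dual e_def)
  have pc: "plus_cond s n \<longleftrightarrow> n mod 4 = 0 \<or> (n - e) mod 4 = 0" for n
    using e unfolding plus_cond_iff by auto presburger+
  have pc': "plus_cond (1 - s) n \<longleftrightarrow> n mod 4 = 0 \<or> (n + e) mod 4 = 0" for n
    using e unfolding plus_cond_iff by auto presburger+
  have pcm: "plus_cond (s - 1) n \<longleftrightarrow> n mod 4 = 0 \<or> (n + e) mod 4 = 0" for n
    using e unfolding plus_cond_iff by auto presburger+
  have pcm': "plus_cond (- s) n \<longleftrightarrow> n mod 4 = 0 \<or> (n - e) mod 4 = 0" for n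
    using e unfolding plus_cond_iff by auto presburger+
  have cases: "e = 1 \<and> \<delta> = 1 \<and> (\<exists>k. N = 4 * k) \<or> e = - 1 \<and> \<delta> = - 1 \<and> (\<exists>k. N = 4 * k) \<or>
     e = 1 \<and> \<delta> = - 1 \<and> (\<exists>k. N = 4 * k + 1) \<or> e = - 1 \<and> \<delta> = 1 \<and> (\<exists>k. N = 4 * k + 3)"
  proof (cases "even (ell s)")
    case True
    then obtain k where "ell s = 2 * k" by (auto elim: evenE)
    then have "N = 4 * k" "\<delta> = e" using True by (auto simp: N \<delta>_def)
    then show ?thesis using e by auto
  next
    case False
    then obtain k where "ell s = 2 * k + 1" by (auto elim: oddE)
    then have "N = 4 * k + 2 - e" "\<delta> = - e" using False by (auto simp: N \<delta>_def)
    then show ?thesis using e by auto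
  qed
  have least: "Least P = x" if "P x" "\<And>y. P y \<Longrightarrow> x \<le> y" for P and x :: int
    using that by (rule Least_equality)
  have s1: "1 - s - 1 = - s" by simp
  have adm1: "admissible s (- N)"
    using cases unfolding admissible_def pcm N_def[symmetric] by (elim disjE conjE exE; simp; presburger)
  have adm2: "admissible s (- N + 2 + \<delta>)"
    using cases unfolding admissible_def pcm N_def[symmetric] by (elim disjE conjE exE; simp; presburger)
  have adm3: "admissible (1 - s) (N + 2 - \<delta>)"
    using cases unfolding admissible_def s1 pcm' N' by (elim disjE conjE exE; simp; presburger)
  have adm4: "admissible (1 - s) (N + 4)"
    using cases unfolding admissible_def s1 pcm' N' by (elim disjE conjE exE; simp; presburger)
  have a0: "adm0 s = - N"
    unfolding adm0_def
  proof (rule least)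
    show "admissible s (- N)"
      using cases unfolding admissible_def pcm N_def[symmetric] by (elim disjE conjE exE; simp; presburger)
    show "- N \<le> y" if "admissible s (y)" for y
      using cases that unfolding admissible_def pcm N_def[symmetric] by (elim disjE conjE exE; simp; presburger)
  qed
  have a1: "adm1 s = - N + 2 + \<delta>"
    unfolding adm1_def a0
  proof (rule least)
    show "admissible s (- N + 2 + \<delta>) \<and> - N < - N + 2 + \<delta>"
      using cases unfolding admissible_def pcm N_def[symmetric] by (elim disjE conjE exE; simp; presburger)
    show "- N + 2 + \<delta> \<le> y" if "admissible s (y) \<and> - N < y" for y
      using cases that unfolding admissible_def pcm N_def[symmetric] by (elim disjE conjE exE; simp; presburger)
  qed
  have b0: "adm0 (1 - s) = N + 2 - \<delta>"
    unfolding adm0_def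
  proof (rule least)
    show "admissible (1 - s) (N + 2 - \<delta>)"
      using cases unfolding admissible_def s1 pcm' N' by (elim disjE conjE exE; simp; presburger)
    show "N + 2 - \<delta> \<le> y" if "admissible (1 - s) (y)" for y
      using cases that unfolding admissible_def s1 pcm' N' by (elim disjE conjE exE; simp; presburger)
  qed
  have b1: "adm1 (1 - s) = N + 4"
    unfolding adm1_def b0
  proof (rule least)
    show "admissible (1 - s) (N + 4) \<and> N + 2 - \<delta> < N + 4"
      using cases unfolding admissible_def s1 pcm' N' by (elim disjE conjE exE; simp; presburger)
    show "N + 4 \<le> y" if "admissible (1 - s) (y) \<and> N + 2 - \<delta> < y" for y
      using cases that unfolding admissible_def s1 pcm' N' by (elim disjE conjE exE; simp; presburger)
  qed
  have ex: "\<exists>j. n = 4 * j \<or> n = 4 * j + d" if "n mod 4 = 0 \<or> (n - d) mod 4 = 0" for n d :: int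
  proof -
    have "n = 4 * (n div 4) \<or> n = 4 * ((n - d) div 4) + d" using that by presburger
    then show ?thesis by blast
  qed
  have pj: "\<exists>j. n = 4 * j \<or> n = 4 * j + e" if "plus_cond s n" for n
    using ex[of n e] that by (simp only: pc)
  have pj': "\<exists>j. n = 4 * j \<or> n = 4 * j - e" if "plus_cond (1 - s) n" for n
    using ex[of n "- e"] that by (simp add: pc')
  show ?thesis
  proof (rule that[of \<delta> N])
    show "\<delta> = 1 \<or> \<delta> = - 1" using cases by blast
    show "n \<ge> N + 4" if "plus_cond s n" "n > N" "even n = even N" for n
      using cases pj[OF that(1)] that(2,3) by (elim disjE conjE exE; simp; presburger)
    show "n \<ge> N + 2 - \<delta>" if "plus_cond s n" "n > N" "even n \<noteq> even N" for n
      using cases pj[OF that(1)] that(2,3) by (elim disjE conjE exE; simp; presburger)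
    show "n \<ge> - N" if "plus_cond (1 - s) n" "n > - N - 2 + \<delta>" "even n = even N" for n
      using cases pj'[OF that(1)] that(2,3) by (elim disjE conjE exE; simp; presburger)
    show "n \<ge> - N + 2 + \<delta>" if "plus_cond (1 - s) n" "n > - N - 2 + \<delta>" "even n \<noteq> even N" for n
      using cases pj'[OF that(1)] that(2,3) by (elim disjE conjE exE; simp; presburger)
  qed (rule N_def[symmetric] N' a0 a1 b0 b1 adm1 adm2 adm3 adm4)+
qed

text \<open>Each tail exponent is at least c + 1, so from height 1 upwards every tail term decays at
  least like exp (- (\<pi> / 2) (c + 1) Im T). Absolute convergence at height 1 then supplies one
  constant for all T.\<close>

lemma expansion_leads:
  assumes exp: "\<And>\<tau>. \<tau> \<in> HH \<Longrightarrow> ((\<lambda>n. b n * qexp n \<tau>) has_sum g \<tau>) UNIV"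
    and low: "\<And>n. b n \<noteq> 0 \<Longrightarrow> n \<ge> c"
  shows "leads (\<lambda>T. g (T / 4)) c (b c)"
proof -
  \<comment> \<open>The reference point of height Im T = 1, in the variable \<tau> = T / 4.\<close>
  define t0 where "t0 = Complex 0 (1/4)"
  have t0: "t0 \<in> HH" by (simp add: t0_def HH_def)
  have sm0: "(\<lambda>n. norm (b n * qexp n t0)) summable_on UNIV"
    by (rule summable_on_iff_abs_summable_on_complex[THEN iffD1, OF has_sum_imp_summable[OF exp[OF t0]]])
  define S where "S = (\<Sum>\<^sub>\<infinity>n. norm (b n * qexp n t0))"
  have S0: "S \<ge> 0" unfolding S_def by (rule infsum_nonneg) simp
  show ?thesis
  proof (rule leadsI[of "S * exp (pi / 2 * real_of_int (c + 1))"])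
    fix T :: complex assume T: "Im T \<ge> 1"
    define \<tau> where "\<tau> = T / 4"
    have tH: "\<tau> \<in> HH" using T by (simp add: \<tau>_def HH_def)
    define b' where "b' n = (if n = c then 0 else b n)" for n
    have "((\<lambda>n. if n = c then - (b c * qexp c \<tau>) else 0) has_sum - (b c * qexp c \<tau>)) UNIV"
      by (rule has_sum_finite_neutralI[of "{c}"]) auto
    from has_sum_add[OF exp[OF tH] this]
    have "((\<lambda>n. b' n * qexp n \<tau>) has_sum (g \<tau> - b c * qexp c \<tau>)) UNIV"
      unfolding add_uminus_conv_diff by (rule has_sum_cong[THEN iffD1, rotated]) (auto simp: b'_def)
    then have eq: "g \<tau> - b c * qexp c \<tau> = (\<Sum>\<^sub>\<infinity>n. b' n * qexp n \<tau>)" by (simp add: infsumI)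
    let ?K = "exp (- (pi / 2) * real_of_int (c + 1) * (Im T - 1))"
    have le: "norm (b' n * qexp n \<tau>) \<le> norm (b n * qexp n t0) * ?K" for n
    proof (cases "b' n = 0")
      case False
      then have n: "n \<ge> c + 1" "b' n = b n" using low[of n] by (auto simp: b'_def split: if_splits)
      have "real_of_int (c + 1) * (pi / 2 * (Im T - 1)) \<le> real_of_int n * (pi / 2 * (Im T - 1))"
        using n T by (intro mult_right_mono) auto
      then have "- 2 * pi * real_of_int n * Im \<tau> \<le> - 2 * pi * real_of_int n * Im t0 + - (pi / 2) * real_of_int (c + 1) * (Im T - 1)"
        by (simp add: \<tau>_def t0_def algebra_simps)
      then have "norm (qexp n \<tau>) \<le> norm (qexp n t0) * ?K"
        unfolding norm_qexp exp_add[symmetric] by simp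
      then show ?thesis unfolding n norm_mult mult.assoc by (rule mult_left_mono) simp
    qed simp
    have smK: "(\<lambda>n. norm (b n * qexp n t0) * ?K) summable_on UNIV" by (rule summable_on_cmult_left[OF sm0])
    have sm1: "(\<lambda>n. norm (b' n * qexp n \<tau>)) summable_on UNIV"
      by (rule summable_on_comparison_test[OF smK]) (use le in auto)
    have "norm (g \<tau> - b c * qexp c \<tau>) \<le> (\<Sum>\<^sub>\<infinity>n. norm (b' n * qexp n \<tau>))"
      unfolding eq by (rule norm_infsum_bound[OF sm1])
    also have "\<dots> \<le> (\<Sum>\<^sub>\<infinity>n. norm (b n * qexp n t0) * ?K)"
      by (rule infsum_mono[OF sm1 smK le])
    also have "\<dots> = S * ?K" unfolding S_def by (rule infsum_cmult_left')
    also have "?K = exp (pi / 2 * real_of_int (c + 1)) * exp (- (pi / 2) * real_of_int (c + 1) * Im T)"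
      unfolding exp_add[symmetric] by (rule arg_cong[where f = exp], simp add: right_diff_distrib)
    finally show "norm (g (T / 4) - b c * qexp c (T / 4)) \<le> S * exp (pi / 2 * real_of_int (c + 1)) * exp (- (pi / 2) * real_of_int (c + 1) * Im T)"
      by (simp add: \<tau>_def mult.assoc)
  qed (use S0 in simp)
qed

lemma vvc_qexp: "vvc p (qexp n) T = (if even n = p then qexp n (T / 4) else 0)"
  by (simp add: vvc_def qexp_shift qexp_half)

lemma vvc_diff: "vvc p (\<lambda>\<tau>. f \<tau> - g \<tau>) T = vvc p f T - vvc p g T"
  by (simp add: vvc_def field_simps)

lemma basis_leads:
  assumes F: "canonical_basis s F" and m: "admissible s m"
    and low: "\<And>n. plus_cond s n \<Longrightarrow> n > Nw s \<Longrightarrow> even n = p \<Longrightarrow> n \<ge> c"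
  shows "\<exists>\<kappa>. leads (\<lambda>T. vvc p (F m) T - (if even m = p then qexp (- m) (T / 4) else 0)) c \<kappa>"
proof -
  define R where "R \<tau> = F m \<tau> - qexp (- m) \<tau>" for \<tau>
  have "\<exists>a. (\<forall>n. a n \<noteq> 0 \<longrightarrow> n > Nw s \<and> plus_cond s n) \<and> (\<forall>\<tau>\<in>HH. ((\<lambda>n. a n * qexp n \<tau>) has_sum R \<tau>) UNIV)"
    using F[unfolded canonical_basis_def, rule_format, OF m] unfolding R_def by (rule conjunct2)
  then obtain a where a0: "(\<forall>n. a n \<noteq> 0 \<longrightarrow> n > Nw s \<and> plus_cond s n) \<and> (\<forall>\<tau>\<in>HH. ((\<lambda>n. a n * qexp n \<tau>) has_sum R \<tau>) UNIV)"
    by (rule exE)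
  have a: "\<And>n. a n \<noteq> 0 \<Longrightarrow> n > Nw s \<and> plus_cond s n" "\<And>\<tau>. \<tau> \<in> HH \<Longrightarrow> ((\<lambda>n. a n * qexp n \<tau>) has_sum R \<tau>) UNIV"
    using a0 by auto
  define b where "b n = (if even n = p then a n else 0)" for n
  have "((\<lambda>n. b n * qexp n \<tau>) has_sum (R \<tau> + (if p then 1 else - 1) * R (\<tau> + 1/2)) / 2) UNIV" if "\<tau> \<in> HH" for \<tau>
  proof -
    have H: "\<tau> + 1/2 \<in> HH" using that by (simp add: HH_def)
    have "((\<lambda>n. 1/2 * (a n * qexp n \<tau> + (if p then 1 else - 1) * (a n * qexp n (\<tau> + 1/2)))) has_sum
       1/2 * (R \<tau> + (if p then 1 else - 1) * R (\<tau> + 1/2))) UNIV"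
      by (intro has_sum_cmult_right has_sum_add a that H)
    moreover have "1/2 * (a n * qexp n \<tau> + (if p then 1 else - 1) * (a n * qexp n (\<tau> + 1/2))) = b n * qexp n \<tau>" for n
      by (simp add: b_def qexp_shift qexp_half)
    ultimately show ?thesis by simp
  qed
  then have "leads (\<lambda>T. (R (T / 4) + (if p then 1 else - 1) * R (T / 4 + 1/2)) / 2) c (b c)"
    by (rule expansion_leads) (use a low in \<open>auto simp: b_def split: if_splits\<close>)
  also have "(\<lambda>T. (R (T / 4) + (if p then 1 else - 1) * R (T / 4 + 1/2)) / 2) = (\<lambda>T. vvc p R T)"
    by (simp add: vvc_def)
  also have "\<dots> = (\<lambda>T. vvc p (F m) T - (if even m = p then qexp (- m) (T / 4) else 0))"
    unfolding R_def by (simp only: vvc_diff vvc_qexp) simp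
  finally show ?thesis by blast
qed

lemma basis_leads_same:
  assumes "canonical_basis s F" "admissible s m"
    and "\<And>n. plus_cond s n \<Longrightarrow> n > Nw s \<Longrightarrow> even n = p \<Longrightarrow> n \<ge> c" and "even m = p"
  shows "\<exists>\<kappa>. leads (\<lambda>T. vvc p (F m) T - qexp (- m) (T / 4)) c \<kappa>"
proof -
  have "\<exists>\<kappa>. leads (\<lambda>T. vvc p (F m) T - (if even m = p then qexp (- m) (T / 4) else 0)) c \<kappa>"
    by (rule basis_leads[OF assms(1,2)]) (erule (2) assms(3))
  then show ?thesis by (simp only: assms(4) refl if_True)
qed

lemma basis_leads_other:
  assumes "canonical_basis s F" "admissible s m"
    and "\<And>n. plus_cond s n \<Longrightarrow> n > Nw s \<Longrightarrow> even n = p \<Longrightarrow> n \<ge> c" and "even m \<noteq> p"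
  shows "\<exists>\<kappa>. leads (vvc p (F m)) c \<kappa>"
proof -
  have "\<exists>\<kappa>. leads (\<lambda>T. vvc p (F m) T - (if even m = p then qexp (- m) (T / 4) else 0)) c \<kappa>"
    by (rule basis_leads[OF assms(1,2)]) (erule (2) assms(3))
  then show ?thesis using assms(4) by (simp only: if_False diff_0_right)
qed

section \<open>Pairing the bases of dual weights\<close>

definition vv_pair :: "(complex \<Rightarrow> complex) \<Rightarrow> (complex \<Rightarrow> complex) \<Rightarrow> complex \<Rightarrow> complex" where
  "vv_pair f g T = vvc True f T * vvc True g T + vvc False f T * vvc False g T"

lemma vv_pair_parity: "vv_pair f g T = vvc p f T * vvc p g T + vvc (\<not> p) f T * vvc (\<not> p) g T"
  by (cases p) (simp_all add: vv_pair_def)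

text \<open>Normalised to start with 1 / q, which is \<open>qexp (- 4) (T / 4)\<close>; as a
  derivative it has no constant term.\<close>

definition jprime :: "complex \<Rightarrow> complex" where
  "jprime T = - deriv jinv T / (2 * of_real pi * \<i>)"

lemma jprime_leads: "leads (\<lambda>T. qexp (- 4) (T / 4) - jprime T) 0 0"
proof -
  obtain M where M: "M > 0" "\<And>q. norm q \<le> 1 / 2 \<Longrightarrow> norm (deriv j_kappa q) \<le> M"
    using j_kappa_bounds by metis
  show ?thesis
  proof (rule leadsI[of M])
    fix T :: complex assume T: "Im T \<ge> 1"
    then have TH: "T \<in> HH" by (simp add: HH_def)
    have q: "norm (nome T) \<le> 1 / 2" by (rule nome_le_half) (use T in simp)
    have "qexp (- 4) (T / 4) = exp (- (2 * of_real pi * \<i> * T))"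
      unfolding qexp_def by (rule arg_cong[where f = exp]) simp
    then have q4: "qexp (- 4) (T / 4) = 1 / nome T" unfolding exp_minus inverse_eq_divide .
    have "qexp (- 4) (T / 4) - jprime T = nome T * deriv j_kappa (nome T)"
      unfolding q4 jprime_def deriv_jinv[OF TH] by (simp add: field_simps)
    then have "norm (qexp (- 4) (T / 4) - jprime T) \<le> exp (- 2 * pi * Im T) * M"
      using M(2)[OF q] by (simp only: norm_mult norm_nome) (simp add: mult_left_mono)
    also have "\<dots> \<le> exp (- (pi / 2) * real_of_int (0 + 1) * Im T) * M"
      using T M by (intro mult_right_mono) (auto simp: field_simps)
    finally show "norm (qexp (- 4) (T / 4) - jprime T - 0 * qexp 0 (T / 4)) \<le> M * exp (- (pi / 2) * real_of_int (0 + 1) * Im T)"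
      by (simp add: mult.commute)
  qed (use M in simp)
qed

lemma jprime_weight2:
  "jprime holomorphic_on HH" "\<And>T. T \<in> HH \<Longrightarrow> jprime (T + 1) = jprime T" "\<And>T. T \<in> HH \<Longrightarrow> jprime (- 1 / T) = T ^ 2 * jprime T"
proof -
  show "jprime holomorphic_on HH" unfolding jprime_def[abs_def] by (intro holomorphic_intros deriv_jinv_holomorphic) auto
  show "jprime (T + 1) = jprime T" if "T \<in> HH" for T using that by (simp add: jprime_def deriv_jinv_plus_1)
  show "jprime (- 1 / T) = T ^ 2 * jprime T" if "T \<in> HH" for T
    using deriv_jinv_inv[OF that] by (simp only: jprime_def) simp
qed

lemma vv_pair_weight2:
  assumes "wh_mod s f" "wh_mod (1 - s) g"
  shows "vv_pair f g holomorphic_on HH" "\<And>T. T \<in> HH \<Longrightarrow> vv_pair f g (T + 1) = vv_pair f g T"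
    "\<And>T. T \<in> HH \<Longrightarrow> vv_pair f g (- 1 / T) = T ^ 2 * vv_pair f g T"
  using vvmf_pairing[OF wh_mod_vvmf[OF assms(1)] wh_mod_vvmf[OF assms(2)]]
  unfolding vv_pair_def[abs_def] by blast+

lemma vv_pair_zero:
  assumes "wh_mod s f" "wh_mod (1 - s) g" "leads (vv_pair f g) 0 \<kappa>" "Z \<in> HH"
  shows "vv_pair f g Z = 0"
  by (rule weight2_bounded_zero[OF vv_pair_weight2[OF assms(1,2)] assms(3,4)])

lemma vv_pair_jprime:
  assumes "wh_mod s f" "wh_mod (1 - s) g" "leads (\<lambda>T. vv_pair f g T - qexp (- 4) (T / 4)) 0 \<kappa>" "Z \<in> HH"
  shows "vv_pair f g Z = jprime Z"
proof -
  have "vv_pair f g Z - jprime Z = 0"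
  proof (rule weight2_bounded_zero[OF _ _ _ _ assms(4)])
    show "(\<lambda>T. vv_pair f g T - jprime T) holomorphic_on HH"
      by (intro holomorphic_intros vv_pair_weight2(1)[OF assms(1,2)] jprime_weight2)
    show "leads (\<lambda>T. vv_pair f g T - jprime T) 0 (\<kappa> + 0)"
      using leads_add[OF assms(3) jprime_leads] by simp
  qed (simp_all only: vv_pair_weight2[OF assms(1,2)] jprime_weight2 right_diff_distrib)
  then show ?thesis by simp
qed

lemma leads_split:
  assumes "leads (\<lambda>T. x T - qexp n (T / 4)) c \<kappa>" "n < c"
  shows "leads x n 1"
  using leads_add[OF leads_higher[OF assms] leads_qexp[of n]] by simp

text \<open>Both factors are a monomial plus an error four quarter-steps higher, and the monomials
  multiply to the pole term, so the cross terms have order at least 0.\<close>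

lemma leads_pole_product:
  assumes x: "leads (\<lambda>T. x T - qexp n (T / 4)) (n + 4) \<kappa>" and y: "leads (\<lambda>T. y T - qexp (- n - 4) (T / 4)) (- n) \<kappa>'"
  shows "\<exists>\<kappa>. leads (\<lambda>T. x T * y T - qexp (- 4) (T / 4)) 0 \<kappa>"
proof -
  have y1: "leads y (- n - 4) 1" by (rule leads_split[OF y]) simp
  have "leads (\<lambda>T. (x T - qexp n (T / 4)) * y T) (n + 4 + (- n - 4)) (\<kappa> * 1)"
    by (rule leads_mult[OF x y1])
  moreover have "leads (\<lambda>T. qexp n (T / 4) * (y T - qexp (- n - 4) (T / 4))) (n + - n) (1 * \<kappa>')"
    by (rule leads_mult[OF leads_qexp y])
  ultimately have "leads (\<lambda>T. (x T - qexp n (T / 4)) * y T + qexp n (T / 4) * (y T - qexp (- n - 4) (T / 4))) 0 (\<kappa> + \<kappa>')"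
    using leads_add by fastforce
  moreover have "(x T - qexp n (T / 4)) * y T + qexp n (T / 4) * (y T - qexp (- n - 4) (T / 4)) = x T * y T - qexp (- 4) (T / 4)" for T
  proof -
    have "qexp (- 4) (T / 4) = qexp n (T / 4) * qexp (- n - 4) (T / 4)" by (simp flip: qexp_add)
    then show ?thesis by (simp add: algebra_simps)
  qed
  ultimately show ?thesis by auto
qed

text \<open>With p the parity of N, the principal terms of the first form of weight k and the second
  of weight 2 - k sit in component p, those of the other two forms in the opposite component. The
  orders are such that each product is either regular at the cusp or has the single pole term 1 /
  q.\<close>

lemma basis_vvc_leads:
  assumes F: "canonical_basis s F" and G: "canonical_basis (1 - s) G"
  obtains N \<delta> :: int and p :: bool where
    "p = even N" "\<delta> = 1 \<or> \<delta> = - 1" "Nw s = N" "adm0 s = - N" "adm1 s = - N + 2 + \<delta>" "adm0 (1 - s) = N + 2 - \<delta>" "adm1 (1 - s) = N + 4"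
    "wh_mod s (F (adm0 s))" "wh_mod s (F (adm1 s))" "wh_mod (1 - s) (G (adm0 (1 - s)))" "wh_mod (1 - s) (G (adm1 (1 - s)))"
    "\<exists>\<kappa>. leads (\<lambda>T. vvc p (F (adm0 s)) T - qexp N (T / 4)) (N + 4) \<kappa>"
    "\<exists>\<kappa>. leads (vvc (\<not> p) (F (adm0 s))) (N + 2 - \<delta>) \<kappa>"
    "\<exists>\<kappa>. leads (vvc p (F (adm1 s))) (N + 4) \<kappa>"
    "\<exists>\<kappa>. leads (\<lambda>T. vvc (\<not> p) (F (adm1 s)) T - qexp (N - 2 - \<delta>) (T / 4)) (N + 2 - \<delta>) \<kappa>"
    "\<exists>\<kappa>. leads (vvc p (G (adm0 (1 - s)))) (- N) \<kappa>"
    "\<exists>\<kappa>. leads (\<lambda>T. vvc (\<not> p) (G (adm0 (1 - s))) T - qexp (- N - 2 + \<delta>) (T / 4)) (- N + 2 + \<delta>) \<kappa>"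
    "\<exists>\<kappa>. leads (\<lambda>T. vvc p (G (adm1 (1 - s))) T - qexp (- N - 4) (T / 4)) (- N) \<kappa>"
    "\<exists>\<kappa>. leads (vvc (\<not> p) (G (adm1 (1 - s)))) (- N + 2 + \<delta>) \<kappa>"
    "\<And>m p. admissible s m \<Longrightarrow> \<exists>\<kappa>. leads (\<lambda>T. vvc p (F m) T - (if even m = p then qexp (- m) (T / 4) else 0)) (N + 1) \<kappa>"
proof -
  obtain N \<delta> where i: "\<delta> = 1 \<or> \<delta> = - 1" "Nw s = N" "Nw (1 - s) = - N - 2 + \<delta>"
    "admissible s (- N)" "admissible s (- N + 2 + \<delta>)" "admissible (1 - s) (N + 2 - \<delta>)" "admissible (1 - s) (N + 4)"
    "adm0 s = - N" "adm1 s = - N + 2 + \<delta>" "adm0 (1 - s) = N + 2 - \<delta>" "adm1 (1 - s) = N + 4"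
    and l: "\<And>n. plus_cond s n \<Longrightarrow> n > N \<Longrightarrow> even n = even N \<Longrightarrow> n \<ge> N + 4"
    "\<And>n. plus_cond s n \<Longrightarrow> n > N \<Longrightarrow> even n \<noteq> even N \<Longrightarrow> n \<ge> N + 2 - \<delta>"
    "\<And>n. plus_cond (1 - s) n \<Longrightarrow> n > - N - 2 + \<delta> \<Longrightarrow> even n = even N \<Longrightarrow> n \<ge> - N"
    "\<And>n. plus_cond (1 - s) n \<Longrightarrow> n > - N - 2 + \<delta> \<Longrightarrow> even n \<noteq> even N \<Longrightarrow> n \<ge> - N + 2 + \<delta>"
    by (rule index_facts[of s]) blast
  define p where "p = even N"
  have l1: "\<And>n. plus_cond s n \<Longrightarrow> n > Nw s \<Longrightarrow> even n = p \<Longrightarrow> n \<ge> N + 4"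
    and l2: "\<And>n. plus_cond s n \<Longrightarrow> n > Nw s \<Longrightarrow> even n = (\<not> p) \<Longrightarrow> n \<ge> N + 2 - \<delta>"
    and l3: "\<And>n. plus_cond (1 - s) n \<Longrightarrow> n > Nw (1 - s) \<Longrightarrow> even n = p \<Longrightarrow> n \<ge> - N"
    and l4: "\<And>n. plus_cond (1 - s) n \<Longrightarrow> n > Nw (1 - s) \<Longrightarrow> even n = (\<not> p) \<Longrightarrow> n \<ge> - N + 2 + \<delta>"
    using l unfolding p_def i(2,3) by auto
  have d: "odd \<delta>" using i(1) by auto
  have par: "even (- N) = p" "even (- N + 2 + \<delta>) = (\<not> p)" "even (N + 2 - \<delta>) = (\<not> p)" "even (N + 4) = p"
    using d by (auto simp: p_def)
  have n1: "- (- N) = N" "- (- N + 2 + \<delta>) = N - 2 - \<delta>" "- (N + 2 - \<delta>) = - N - 2 + \<delta>" "- (N + 4) = - N - 4" by auto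
  show ?thesis
  proof (rule that[of p N \<delta>])
    show "wh_mod s (F (adm0 s))" "wh_mod s (F (adm1 s))" "wh_mod (1 - s) (G (adm0 (1 - s)))" "wh_mod (1 - s) (G (adm1 (1 - s)))"
      unfolding i(8-11)
      using F[unfolded canonical_basis_def, rule_format, OF i(4)] F[unfolded canonical_basis_def, rule_format, OF i(5)]
        G[unfolded canonical_basis_def, rule_format, OF i(6)] G[unfolded canonical_basis_def, rule_format, OF i(7)]
      by (simp_all only:)
    show "\<exists>\<kappa>. leads (\<lambda>T. vvc p (F (adm0 s)) T - qexp N (T / 4)) (N + 4) \<kappa>"
      unfolding i(8) by (subst n1(1)[symmetric], rule basis_leads_same[OF F i(4) _ par(1)], erule (2) l1)
    show "\<exists>\<kappa>. leads (vvc (\<not> p) (F (adm0 s))) (N + 2 - \<delta>) \<kappa>"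
      unfolding i(8) by (rule basis_leads_other[OF F i(4)], erule (2) l2, use par(1) in auto)
    show "\<exists>\<kappa>. leads (vvc p (F (adm1 s))) (N + 4) \<kappa>"
      unfolding i(9) by (rule basis_leads_other[OF F i(5)], erule (2) l1, use par(2) in auto)
    show "\<exists>\<kappa>. leads (\<lambda>T. vvc (\<not> p) (F (adm1 s)) T - qexp (N - 2 - \<delta>) (T / 4)) (N + 2 - \<delta>) \<kappa>"
      unfolding i(9) by (subst n1(2)[symmetric], rule basis_leads_same[OF F i(5) _ par(2)], erule (2) l2)
    show "\<exists>\<kappa>. leads (vvc p (G (adm0 (1 - s)))) (- N) \<kappa>"
      unfolding i(10) by (rule basis_leads_other[OF G i(6)], erule (2) l3, use par(3) in auto)
    show "\<exists>\<kappa>. leads (\<lambda>T. vvc (\<not> p) (G (adm0 (1 - s))) T - qexp (- N - 2 + \<delta>) (T / 4)) (- N + 2 + \<delta>) \<kappa>"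
      unfolding i(10) by (subst n1(3)[symmetric], rule basis_leads_same[OF G i(6) _ par(3)], erule (2) l4)
    show "\<exists>\<kappa>. leads (\<lambda>T. vvc p (G (adm1 (1 - s))) T - qexp (- N - 4) (T / 4)) (- N) \<kappa>"
      unfolding i(11) by (subst n1(4)[symmetric], rule basis_leads_same[OF G i(7) _ par(4)], erule (2) l3)
    show "\<exists>\<kappa>. leads (vvc (\<not> p) (G (adm1 (1 - s)))) (- N + 2 + \<delta>) \<kappa>"
      unfolding i(11) by (rule basis_leads_other[OF G i(7)], erule (2) l4, use par(4) in auto)
    show "\<exists>\<kappa>. leads (\<lambda>T. vvc p (F m) T - (if even m = p then qexp (- m) (T / 4) else 0)) (N + 1) \<kappa>"
      if "admissible s m" for m p
      by (rule basis_leads[OF F that]) (use i(2) in auto)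
  qed (use p_def i in auto)
qed

text \<open>The leading orders cancel to 0 or leave exactly 1 / q. After subtracting
  \<open>jprime\<close> where necessary, the pairing is a form of weight 2 that is bounded at the
  cusp, hence zero.\<close>

lemma basis_pairing:
  assumes F: "canonical_basis s F" and G: "canonical_basis (1 - s) G" and Z: "Z \<in> HH"
  shows "vv_pair (F (adm0 s)) (G (adm0 (1 - s))) Z = 0" "vv_pair (F (adm0 s)) (G (adm1 (1 - s))) Z = jprime Z"
    "vv_pair (F (adm1 s)) (G (adm0 (1 - s))) Z = jprime Z" "vv_pair (F (adm1 s)) (G (adm1 (1 - s))) Z = 0"
proof -
  obtain N \<delta> :: int and p where d: "\<delta> = 1 \<or> \<delta> = - 1"
    and wh: "wh_mod s (F (adm0 s))" "wh_mod s (F (adm1 s))" "wh_mod (1 - s) (G (adm0 (1 - s)))" "wh_mod (1 - s) (G (adm1 (1 - s)))"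
    and e: "\<exists>\<kappa>. leads (\<lambda>T. vvc p (F (adm0 s)) T - qexp N (T / 4)) (N + 4) \<kappa>"
    "\<exists>\<kappa>. leads (vvc (\<not> p) (F (adm0 s))) (N + 2 - \<delta>) \<kappa>"
    "\<exists>\<kappa>. leads (vvc p (F (adm1 s))) (N + 4) \<kappa>"
    "\<exists>\<kappa>. leads (\<lambda>T. vvc (\<not> p) (F (adm1 s)) T - qexp (N - 2 - \<delta>) (T / 4)) (N + 2 - \<delta>) \<kappa>"
    "\<exists>\<kappa>. leads (vvc p (G (adm0 (1 - s)))) (- N) \<kappa>"
    "\<exists>\<kappa>. leads (\<lambda>T. vvc (\<not> p) (G (adm0 (1 - s))) T - qexp (- N - 2 + \<delta>) (T / 4)) (- N + 2 + \<delta>) \<kappa>"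
    "\<exists>\<kappa>. leads (\<lambda>T. vvc p (G (adm1 (1 - s))) T - qexp (- N - 4) (T / 4)) (- N) \<kappa>"
    "\<exists>\<kappa>. leads (vvc (\<not> p) (G (adm1 (1 - s)))) (- N + 2 + \<delta>) \<kappa>"
    by (rule basis_vvc_leads[OF F G]) blast
  obtain k1 where k1: "leads (\<lambda>T. vvc p (F (adm0 s)) T - qexp N (T / 4)) (N + 4) k1" using e(1) by blast
  obtain k2 where k2: "leads (vvc (\<not> p) (F (adm0 s))) (N + 2 - \<delta>) k2" using e(2) by blast
  obtain k3 where k3: "leads (vvc p (F (adm1 s))) (N + 4) k3" using e(3) by blast
  obtain k4 where k4: "leads (\<lambda>T. vvc (\<not> p) (F (adm1 s)) T - qexp (N - 2 - \<delta>) (T / 4)) (N + 2 - \<delta>) k4" using e(4) by blast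
  obtain k5 where k5: "leads (vvc p (G (adm0 (1 - s)))) (- N) k5" using e(5) by blast
  obtain k6 where k6: "leads (\<lambda>T. vvc (\<not> p) (G (adm0 (1 - s))) T - qexp (- N - 2 + \<delta>) (T / 4)) (- N + 2 + \<delta>) k6" using e(6) by blast
  obtain k7 where k7: "leads (\<lambda>T. vvc p (G (adm1 (1 - s))) T - qexp (- N - 4) (T / 4)) (- N) k7" using e(7) by blast
  obtain k8 where k8: "leads (vvc (\<not> p) (G (adm1 (1 - s)))) (- N + 2 + \<delta>) k8" using e(8) by blast
  have l1: "leads (vvc p (F (adm0 s))) N 1" by (rule leads_split[OF k1]) simp
  have l4: "leads (vvc (\<not> p) (F (adm1 s))) (N - 2 - \<delta>) 1" by (rule leads_split[OF k4]) simp
  have l6: "leads (vvc (\<not> p) (G (adm0 (1 - s)))) (- N - 2 + \<delta>) 1" by (rule leads_split[OF k6]) simp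
  have l7: "leads (vvc p (G (adm1 (1 - s)))) (- N - 4) 1" by (rule leads_split[OF k7]) simp
  have m00: "leads (\<lambda>T. vvc p (F (adm0 s)) T * vvc p (G (adm0 (1 - s))) T) 0 (1 * k5)" using leads_mult[OF l1 k5] by simp
  have n00: "leads (\<lambda>T. vvc (\<not> p) (F (adm0 s)) T * vvc (\<not> p) (G (adm0 (1 - s))) T) 0 (k2 * 1)" using leads_mult[OF k2 l6] by simp
  show "vv_pair (F (adm0 s)) (G (adm0 (1 - s))) Z = 0"
    by (rule vv_pair_zero[OF wh(1,3) _ Z], unfold vv_pair_parity[of _ _ _ p, abs_def], rule leads_add[OF m00 n00])
  have m11: "leads (\<lambda>T. vvc p (F (adm1 s)) T * vvc p (G (adm1 (1 - s))) T) 0 (k3 * 1)" using leads_mult[OF k3 l7] by simp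
  have n11: "leads (\<lambda>T. vvc (\<not> p) (F (adm1 s)) T * vvc (\<not> p) (G (adm1 (1 - s))) T) 0 (1 * k8)" using leads_mult[OF l4 k8] by simp
  show "vv_pair (F (adm1 s)) (G (adm1 (1 - s))) Z = 0"
    by (rule vv_pair_zero[OF wh(2,4) _ Z], unfold vv_pair_parity[of _ _ _ p, abs_def], rule leads_add[OF m11 n11])
  obtain k where m01: "leads (\<lambda>T. vvc p (F (adm0 s)) T * vvc p (G (adm1 (1 - s))) T - qexp (- 4) (T / 4)) 0 k"
    using leads_pole_product[OF k1 k7] by blast
  have "leads (\<lambda>T. vvc (\<not> p) (F (adm0 s)) T * vvc (\<not> p) (G (adm1 (1 - s))) T) 4 (k2 * k8)" using leads_mult[OF k2 k8] by simp
  then have n01: "leads (\<lambda>T. vvc (\<not> p) (F (adm0 s)) T * vvc (\<not> p) (G (adm1 (1 - s))) T) 0 0" by (rule leads_higher) simp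
  show "vv_pair (F (adm0 s)) (G (adm1 (1 - s))) Z = jprime Z"
  proof (rule vv_pair_jprime[OF wh(1,4) _ Z])
    show "leads (\<lambda>T. vv_pair (F (adm0 s)) (G (adm1 (1 - s))) T - qexp (- 4) (T / 4)) 0 (k + 0)"
      using leads_add[OF m01 n01] unfolding vv_pair_parity[of _ _ _ p] by (simp add: algebra_simps)
  qed
  have k4': "leads (\<lambda>T. vvc (\<not> p) (F (adm1 s)) T - qexp (N - 2 - \<delta>) (T / 4)) (N - 2 - \<delta> + 4) k4" using k4 by (simp add: algebra_simps)
  have k6': "leads (\<lambda>T. vvc (\<not> p) (G (adm0 (1 - s))) T - qexp (- (N - 2 - \<delta>) - 4) (T / 4)) (- (N - 2 - \<delta>)) k6" using k6 by (simp add: algebra_simps)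
  obtain k' where m10: "leads (\<lambda>T. vvc (\<not> p) (F (adm1 s)) T * vvc (\<not> p) (G (adm0 (1 - s))) T - qexp (- 4) (T / 4)) 0 k'"
    using leads_pole_product[OF k4' k6'] by blast
  have "leads (\<lambda>T. vvc p (F (adm1 s)) T * vvc p (G (adm0 (1 - s))) T) 4 (k3 * k5)" using leads_mult[OF k3 k5] by simp
  then have n10: "leads (\<lambda>T. vvc p (F (adm1 s)) T * vvc p (G (adm0 (1 - s))) T) 0 0" by (rule leads_higher) simp
  show "vv_pair (F (adm1 s)) (G (adm0 (1 - s))) Z = jprime Z"
  proof (rule vv_pair_jprime[OF wh(2,3) _ Z])
    show "leads (\<lambda>T. vv_pair (F (adm1 s)) (G (adm0 (1 - s))) T - qexp (- 4) (T / 4)) 0 (k' + 0)"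
      using leads_add[OF m10 n10] unfolding vv_pair_parity[of _ _ _ p] by (simp add: algebra_simps)
  qed
qed

text \<open>The pairings say that one product of two \<open>2 \<times> 2\<close> matrices is \<open>j\<close> times the identity; hence so is the
  product in the other order.\<close>
lemma matrix_commute:
  fixes a b c d x y z w j :: complex
  assumes "x * a + y * b = j" "x * c + y * d = 0" "z * a + w * b = 0" "z * c + w * d = j" "j \<noteq> 0"
  shows "a * x + c * z = j" "a * y + c * w = 0" "b * x + d * z = 0" "b * y + d * w = j"
proof -
  define D where "D = x * w - y * z"
  have "D * (a * d - b * c) = (x * a + y * b) * (z * c + w * d) - (x * c + y * d) * (z * a + w * b)"
    unfolding D_def by (simp add: algebra_simps)
  then have "D * (a * d - b * c) = j * j" unfolding assms by simp
  then have D: "D \<noteq> 0" using assms(5) by auto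
  have "D * a = w * (x * a + y * b) - y * (z * a + w * b)" "D * b = x * (z * a + w * b) - z * (x * a + y * b)"
    "D * c = w * (x * c + y * d) - y * (z * c + w * d)" "D * d = x * (z * c + w * d) - z * (x * c + y * d)"
    unfolding D_def by (simp_all add: algebra_simps)
  then have E: "D * a = w * j" "D * b = - z * j" "D * c = - y * j" "D * d = x * j" unfolding assms by simp_all
  have "D * (a * x + c * z) = D * a * x + D * c * z" "D * (a * y + c * w) = D * a * y + D * c * w"
    "D * (b * x + d * z) = D * b * x + D * d * z" "D * (b * y + d * w) = D * b * y + D * d * w"
    by (simp_all add: algebra_simps)
  then have "D * (a * x + c * z) = D * j" "D * (a * y + c * w) = D * 0" "D * (b * x + d * z) = D * 0" "D * (b * y + d * w) = D * j"
    unfolding E by (simp_all add: D_def algebra_simps)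
  then show "a * x + c * z = j" "a * y + c * w = 0" "b * x + d * z = 0" "b * y + d * w = j"
    using D by (metis mult_left_cancel)+
qed

text \<open>A form at Z / 4 is the sum of its two components at Z. Reversing the matrix product of
  \<open>basis_pairing\<close> evaluates the kernel componentwise, where j'(Z) \<noteq> 0 makes the
  matrices invertible; in each component one diagonal entry j' and one zero add up.\<close>

lemma kernel_diagonal:
  assumes F: "canonical_basis s F" and G: "canonical_basis (1 - s) G" and Z: "Z \<in> HH" and j: "deriv jinv Z \<noteq> 0"
  shows "F (adm0 s) (Z / 4) * vvc p (G (adm1 (1 - s))) Z + F (adm1 s) (Z / 4) * vvc p (G (adm0 (1 - s))) Z = jprime Z"
proof -
  have sum: "f (Z / 4) = vvc True f Z + vvc False f Z" for f by (simp add: vvc_def field_simps)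
  have J: "jprime Z \<noteq> 0" using j by (simp add: jprime_def)
  note b = basis_pairing[OF F G Z, unfolded vv_pair_def]
  have c: "vvc True (G (adm1 (1 - s))) Z * vvc True (F (adm0 s)) Z + vvc False (G (adm1 (1 - s))) Z * vvc False (F (adm0 s)) Z = jprime Z"
    "vvc True (G (adm1 (1 - s))) Z * vvc True (F (adm1 s)) Z + vvc False (G (adm1 (1 - s))) Z * vvc False (F (adm1 s)) Z = 0"
    "vvc True (G (adm0 (1 - s))) Z * vvc True (F (adm0 s)) Z + vvc False (G (adm0 (1 - s))) Z * vvc False (F (adm0 s)) Z = 0"
    "vvc True (G (adm0 (1 - s))) Z * vvc True (F (adm1 s)) Z + vvc False (G (adm0 (1 - s))) Z * vvc False (F (adm1 s)) Z = jprime Z"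
    using b by (simp_all add: mult.commute)
  note m = matrix_commute[OF c J]
  show ?thesis
  proof (cases p)
    case True
    show ?thesis unfolding sum using True m(1) m(3) by (simp add: algebra_simps)
  next
    case False
    show ?thesis unfolding sum using False m(2) m(4) by (simp add: algebra_simps)
  qed
qed

section \<open>The kernel\<close>

lemma contour_integral_linepath_div4:
  "contour_integral (linepath (a / 4) (b / 4)) f = contour_integral (linepath a b) (\<lambda>T. f (T / 4)) / 4"
proof -
  have L: "linepath (a / 4) (b / 4) x = linepath a b x / 4" for x
    by (simp add: linepath_def scaleR_conv_of_real field_simps)
  have c: "contour_integral (linepath a b) f = integral {0..1} (\<lambda>x. f (linepath a b x) * (b - a))" for a b and f :: "complex \<Rightarrow> complex"
    by (simp add: contour_integral_integral)
  have "integral {0..1} (\<lambda>x. f (linepath a b x / 4) * ((b - a) / 4)) = integral {0..1} (\<lambda>x. f (linepath a b x / 4) * (b - a)) / 4"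
    unfolding times_divide_eq_right by (rule integral_divide)
  then show ?thesis unfolding c L diff_divide_distrib[symmetric] .
qed

text \<open>At a common zero both functions are replaced by their difference quotients; simplicity
  of the zero of g keeps the new denominator nonzero nearby.\<close>

lemma holomorphic_quotient_simple_zeros:
  assumes N: "N holomorphic_on S" and g: "g holomorphic_on S" and S: "open S"
    and z: "\<And>T. T \<in> S \<Longrightarrow> g T = 0 \<Longrightarrow> N T = 0 \<and> deriv g T \<noteq> 0"
  obtains D where "D holomorphic_on S" "\<And>T. T \<in> S \<Longrightarrow> N T = D T * g T"
proof -
  define D where "D T = (if g T = 0 then deriv N T / deriv g T else N T / g T)" for T
  have "D field_differentiable at a" if a: "a \<in> S" for a
  proof (cases "g a = 0")
    case True
    define N1 where "N1 = (\<lambda>T. if T = a then deriv N a else (N T - N a) / (T - a))"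
    define g1 where "g1 = (\<lambda>T. if T = a then deriv g a else (g T - g a) / (T - a))"
    have h: "N1 holomorphic_on S" "g1 holomorphic_on S"
      unfolding N1_def g1_def by (rule pole_lemma_open[OF N S] pole_lemma_open[OF g S])+
    have g1a: "g1 a \<noteq> 0" using z[OF a True] by (simp add: g1_def)
    have "continuous_on S g1" using h(2) holomorphic_on_imp_continuous_on by blast
    then obtain e1 where e1: "e1 > 0" "\<And>w. w \<in> S \<Longrightarrow> dist a w < e1 \<Longrightarrow> g1 w \<noteq> 0"
      using continuous_on_avoid[of S g1 a 0] a g1a by blast
    obtain e2 where e2: "e2 > 0" "ball a e2 \<subseteq> S" using openE[OF S a] by blast
    define B where "B = ball a (min e1 e2)"
    have B: "open B" "a \<in> B" "B \<subseteq> S" "\<And>w. w \<in> B \<Longrightarrow> g1 w \<noteq> 0" using e1 e2 by (auto simp: B_def)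
    have "(\<lambda>T. N1 T / g1 T) holomorphic_on B"
      using B h by (intro holomorphic_intros) (auto intro: holomorphic_on_subset)
    then have "(\<lambda>T. N1 T / g1 T) field_differentiable at a"
      using B(1,2) holomorphic_on_imp_differentiable_at by blast
    moreover have "N1 w / g1 w = D w" if "w \<in> B" for w
    proof (cases "w = a")
      case False
      have "g1 w \<noteq> 0" using B(4)[OF that] .
      then have "g w \<noteq> 0" using False True by (auto simp: g1_def)
      then show ?thesis using False True z[OF a True] by (simp add: N1_def g1_def D_def)
    qed (use True in \<open>simp add: N1_def g1_def D_def\<close>)
    ultimately show ?thesis
      unfolding field_differentiable_def using has_field_derivative_transform_within_open[OF _ B(1,2)] by blast
  next
    case False
    have "continuous_on S g" using g holomorphic_on_imp_continuous_on by blast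
    then obtain e1 where e1: "e1 > 0" "\<And>w. w \<in> S \<Longrightarrow> dist a w < e1 \<Longrightarrow> g w \<noteq> 0"
      using continuous_on_avoid[of S g a 0] a False by blast
    obtain e2 where e2: "e2 > 0" "ball a e2 \<subseteq> S" using openE[OF S a] by blast
    define B where "B = ball a (min e1 e2)"
    have B: "open B" "a \<in> B" "B \<subseteq> S" "\<And>w. w \<in> B \<Longrightarrow> g w \<noteq> 0" using e1 e2 by (auto simp: B_def)
    have "(\<lambda>T. N T / g T) holomorphic_on B"
      using B N g by (intro holomorphic_intros) (auto intro: holomorphic_on_subset)
    then have "(\<lambda>T. N T / g T) field_differentiable at a"
      using B(1,2) holomorphic_on_imp_differentiable_at by blast
    moreover have "N w / g w = D w" if "w \<in> B" for w using B(4)[OF that] by (simp add: D_def)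
    ultimately show ?thesis
      unfolding field_differentiable_def using has_field_derivative_transform_within_open[OF _ B(1,2)] by blast
  qed
  then have "D holomorphic_on S" using field_differentiable_at_within unfolding holomorphic_on_def by blast
  moreover have "N T = D T * g T" if "T \<in> S" for T using z[OF that] by (simp add: D_def)
  ultimately show ?thesis using that by blast
qed

locale basis_pair =
  fixes s m :: int and F G :: "int \<Rightarrow> complex \<Rightarrow> complex"
  assumes F: "canonical_basis s F" and G: "canonical_basis (1 - s) G" and m: "admissible s m"
begin

text \<open>The parity components in T = 4 \<tau> of the numerator of \<open>Bk\<close>, at z = (cis
  \<theta> - 1) / 4, the point - 1/4 + exp (\<i> \<theta>) / 4.\<close>

definition numer :: "real \<Rightarrow> bool \<Rightarrow> complex \<Rightarrow> complex" where
  "numer \<theta> p T = F (adm0 s) ((cis \<theta> - 1) / 4) * vvc p (G (adm1 (1 - s))) T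
     + F (adm1 s) ((cis \<theta> - 1) / 4) * vvc p (G (adm0 (1 - s))) T"

text \<open>Only the component with the parity of m. It has period 1 in T, which makes unit segments
  available; 4 z = cis \<theta> - 1 has the same j-value as cis \<theta>.\<close>

definition kern :: "real \<Rightarrow> complex \<Rightarrow> complex" where
  "kern \<theta> T = numer \<theta> (even m) T * qexp (- m) (T / 4) / (jinv T - jinv (cis \<theta>))"

lemma wh: "wh_mod s (F (adm0 s))" "wh_mod s (F (adm1 s))" "wh_mod (1 - s) (G (adm0 (1 - s)))" "wh_mod (1 - s) (G (adm1 (1 - s)))"
  by (rule basis_vvc_leads[OF F G], assumption)+

lemma wh_m: "wh_mod s (F m)"
  using F[unfolded canonical_basis_def, rule_format, OF m] by (rule conjunct1)

lemma numer_vvmf: "vvmf (1 - s) (numer \<theta> True) (numer \<theta> False)"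
  unfolding numer_def[abs_def] by (rule vvmf_linear[OF wh_mod_vvmf[OF wh(4)] wh_mod_vvmf[OF wh(3)]])

lemma numer_hol: "numer \<theta> p holomorphic_on HH"
  using numer_vvmf[of \<theta>] by (cases p) (simp_all add: vvmf_def)

lemma numer_T: "T \<in> HH \<Longrightarrow> numer \<theta> True (T + 1) = numer \<theta> True T" "T \<in> HH \<Longrightarrow> numer \<theta> False (T + 1) = - ieps s * numer \<theta> False T"
  using numer_vvmf[of \<theta>] by (simp_all add: vvmf_def ieps_1_minus)

lemma m_plus: "plus_cond s (- m)"
proof -
  have "plus_cond (s - 1) m" using m by (simp add: admissible_def)
  then show ?thesis unfolding plus_cond_iff by (cases "even s") (simp; presburger)+
qed

lemma qexp_m_quarter: "qexp (- m) (1/4) = (if even m then 1 else ieps s)"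
  unfolding qexp_quarter[OF m_plus] qexp_half by (simp add: field_simps)

lemma numer_qexp_shift:
  assumes "T \<in> HH"
  shows "numer \<theta> p (T + 1) * qexp (- m) ((T + 1) / 4) =
     (if p = even m then 1 else if p then ieps s else - ieps s) * (numer \<theta> p T * qexp (- m) (T / 4))"
proof -
  have q: "qexp (- m) ((T + 1) / 4) = qexp (- m) (T / 4) * (if even m then 1 else ieps s)"
    unfolding add_divide_distrib qexp_shift qexp_m_quarter ..
  have ee: "ieps s * (ieps s * x) = - x" for x by (simp add: mult.assoc[symmetric] ieps_sq)
  show ?thesis
    unfolding q using numer_T[OF assms]
    by (cases p; cases "even m") (simp_all add: algebra_simps ee)
qed

lemma kern_T: "T \<in> HH \<Longrightarrow> kern \<theta> (T + 1) = kern \<theta> T"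
  unfolding kern_def by (simp add: numer_qexp_shift jinv_plus_1)

lemma qexp4_hol: "(\<lambda>T. qexp n (T / 4)) holomorphic_on A"
  unfolding qexp_def by (intro holomorphic_intros) auto

lemma kern_hol:
  assumes "A \<subseteq> HH" "\<And>T. T \<in> A \<Longrightarrow> jinv T \<noteq> jinv (cis \<theta>)"
  shows "kern \<theta> holomorphic_on A"
  unfolding kern_def[abs_def]
  by (intro holomorphic_intros holomorphic_on_subset[OF numer_hol assms(1)] qexp4_hol
      holomorphic_on_subset[OF jinv_holomorphic assms(1)]) (use assms(2) in auto)

text \<open>A unit segment in \<tau> is four unit segments in T. Under T + 1 the component with the
  parity of m is invariant, and its four equal integrals compensate d\<tau> = dT / 4. The other
  component is multiplied by c = \<i> or - \<i>, and 1 + c + c^2 + c^3 = 0.\<close>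

lemma Bk_integral:
  assumes z: "z = (cis \<theta> - 1) / 4" and v: "v > 0" and s0: "sin \<theta> > 0"
    and nz: "\<And>T. Im T = 4 * v \<Longrightarrow> jinv T \<noteq> jinv (cis \<theta>)"
  shows "(\<lambda>\<tau>. Bk s F G z \<tau> * qexp (- m) \<tau>) contour_integrable_on linepath (- 1/2 + \<i> * of_real v) (1/2 + \<i> * of_real v)"
    and "contour_integral (linepath (- 1/2 + \<i> * of_real v) (1/2 + \<i> * of_real v)) (\<lambda>\<tau>. Bk s F G z \<tau> * qexp (- m) \<tau>)
       = contour_integral (unit_seg 0 (4 * v)) (kern \<theta>)"
proof -
  define y where "y = 4 * v"
  have y: "y > 0" using v by (simp add: y_def)
  have cH: "cis \<theta> \<in> HH" using s0 by (simp add: HH_def)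
  have jz: "jinv (4 * z) = jinv (cis \<theta>)"
  proof -
    have "cis \<theta> - 1 \<in> HH" using cH by (simp add: HH_def)
    moreover have "4 * z = cis \<theta> - 1" by (simp add: z field_simps)
    ultimately show ?thesis using jinv_plus_1[of "cis \<theta> - 1"] by simp
  qed
  define g where "g T = jinv T - jinv (cis \<theta>)" for T
  define u where "u p T = numer \<theta> p T * qexp (- m) (T / 4) / g T" for p T
  have lineH: "T \<in> HH" if "Im T = y" for T using that y by (simp add: HH_def)
  have uT: "u p (T + 1) = (if p = even m then 1 else if p then ieps s else - ieps s) * u p T" if "Im T = y" for p T
    unfolding u_def using lineH[OF that] numer_qexp_shift[of T \<theta> p] by (simp add: g_def jinv_plus_1)
  have sum4: "vvc True f T + vvc False f T = f (T / 4)" for f T by (simp add: vvc_def field_simps)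
  have BT: "Bk s F G z (T / 4) * qexp (- m) (T / 4) = u True T + u False T" for T
  proof -
    have "numer \<theta> True T + numer \<theta> False T = F (adm0 s) z * G (adm1 (1 - s)) (T / 4) + F (adm1 s) z * G (adm0 (1 - s)) (T / 4)"
      unfolding sum4[symmetric] numer_def z by (simp add: algebra_simps)
    moreover have "4 * (T / 4) = T" by simp
    ultimately show ?thesis
      unfolding Bk_def u_def g_def jz by (simp only: add_divide_distrib[symmetric] distrib_right[symmetric] times_divide_eq_left)
  qed
  have cu: "continuous_on {T. Im T = y} (u p)" for p
    unfolding u_def[abs_def] g_def
    using nz by (intro continuous_intros holomorphic_on_imp_continuous_on holomorphic_on_subset[OF numer_hol] qexp4_hol
        holomorphic_on_subset[OF jinv_holomorphic]) (auto simp: lineH y_def)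
  \<comment> \<open>\<tau> = -1/2 corresponds to T = -2; the unit segment from -2 is moved to start
    at 0 at the end by periodicity.\<close>
  define P :: "real \<Rightarrow> complex" where "P k = Complex (- 2 + k) y" for k
  have Pim: "closed_segment (P a) (P b) \<subseteq> {T. Im T = y}" for a b
    unfolding P_def by (auto simp: closed_segment_same_Im)
  have ui: "u p contour_integrable_on linepath (P a) (P b)" for p a b
    by (intro contour_integrable_continuous_linepath continuous_on_subset[OF cu Pim])
  have e1: "- 1/2 + \<i> * of_real v = P 0 / 4" "1/2 + \<i> * of_real v = P 4 / 4"
    by (simp_all add: P_def complex_eq_iff y_def)
  have segH: "closed_segment (P 0 / 4) (P 4 / 4) \<subseteq> {\<tau>. Im (4 * \<tau>) = y}"
    unfolding P_def by (auto simp: closed_segment_same_Im complex_eq_iff)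
  have Bu: "Bk s F G z \<tau> * qexp (- m) \<tau> = u True (4 * \<tau>) + u False (4 * \<tau>)" for \<tau>
    using BT[of "4 * \<tau>"] by simp
  have "continuous_on {\<tau>. Im (4 * \<tau>) = y} (\<lambda>\<tau>. u True (4 * \<tau>) + u False (4 * \<tau>))"
    by (intro continuous_intros continuous_on_compose2[OF cu]) auto
  then show "(\<lambda>\<tau>. Bk s F G z \<tau> * qexp (- m) \<tau>) contour_integrable_on linepath (- 1/2 + \<i> * of_real v) (1/2 + \<i> * of_real v)"
    unfolding Bu e1 by (intro contour_integrable_continuous_linepath) (rule continuous_on_subset[OF _ segH])
  have "contour_integral (linepath (P 0 / 4) (P 4 / 4)) (\<lambda>\<tau>. Bk s F G z \<tau> * qexp (- m) \<tau>) =
      contour_integral (linepath (P 0) (P 4)) (\<lambda>T. u True T + u False T) / 4"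
    unfolding contour_integral_linepath_div4 BT ..
  also have "contour_integral (linepath (P 0) (P 4)) (\<lambda>T. u True T + u False T) =
      contour_integral (linepath (P 0) (P 4)) (u True) + contour_integral (linepath (P 0) (P 4)) (u False)"
    by (rule contour_integral_add[OF ui ui])
  also have four: "contour_integral (linepath (P 0) (P 4)) (u p) =
      (if p = even m then 4 else 0) * contour_integral (linepath (P 0) (P 1)) (u p)" for p
  proof -
    define c where "c = (if p = even m then 1 else if p then ieps s else - ieps s)"
    have step: "contour_integral (linepath (P (k + 1)) (P (k + 2))) (u p) = c * contour_integral (linepath (P k) (P (k + 1))) (u p)" for k
    proof -
      have "P (k + 1) = P k + 1" "P (k + 2) = P (k + 1) + 1" by (simp_all add: P_def complex_eq_iff)
      then have "contour_integral (linepath (P (k + 1)) (P (k + 2))) (u p) = contour_integral (linepath (P k) (P (k + 1))) (\<lambda>T. u p (T + 1))"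
        using contour_integral_linepath_shift[of "P k" 1 "P (k + 1)" "u p"] by simp
      also have "\<dots> = contour_integral (linepath (P k) (P (k + 1))) (\<lambda>T. c * u p T)"
      proof (rule contour_integral_eq)
        fix T assume "T \<in> path_image (linepath (P k) (P (k + 1)))"
        then have "Im T = y" using Pim by auto
        then show "u p (T + 1) = c * u p T" using uT[of T p] by (simp only: c_def)
      qed
      also have "\<dots> = c * contour_integral (linepath (P k) (P (k + 1))) (u p)"
        by (rule contour_integral_lmul[OF ui])
      finally show ?thesis .
    qed
    have split: "contour_integral (linepath (P a) (P d)) (u p) = contour_integral (linepath (P a) (P b)) (u p) + contour_integral (linepath (P b) (P d)) (u p)"
      if "a \<le> b" "b \<le> d" "a < d" for a b d
    proof (rule contour_integral_split)
      let ?k = "(b - a) / (d - a)"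
      show "continuous_on (closed_segment (P a) (P d)) (u p)" by (rule continuous_on_subset[OF cu Pim])
      show "0 \<le> ?k" "?k \<le> 1" using that by auto
      have "?k * (d - a) = b - a" using that by simp
      then show "P b - P a = ?k *\<^sub>R (P d - P a)" by (simp add: P_def complex_eq_iff)
    qed
    define I0 where "I0 = contour_integral (linepath (P 0) (P 1)) (u p)"
    have i1: "contour_integral (linepath (P 1) (P 2)) (u p) = c * I0" using step[of 0] by (simp add: I0_def)
    have i2: "contour_integral (linepath (P 2) (P 3)) (u p) = c * (c * I0)" using step[of 1] i1 by simp
    have i3: "contour_integral (linepath (P 3) (P 4)) (u p) = c * (c * (c * I0))" using step[of 2] i2 by simp
    have "contour_integral (linepath (P 0) (P 4)) (u p) = I0 + c * I0 + c * (c * I0) + c * (c * (c * I0))"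
      using split[of 0 1 4] split[of 1 2 4] split[of 2 3 4] i1 i2 i3 by (simp add: I0_def)
    also have "\<dots> = (1 + c) * (1 + c * c) * I0" by (simp add: algebra_simps)
    also have "\<dots> = (if p = even m then 4 else 0) * I0"
      using ieps_sq(1)[of s] by (simp add: c_def)
    finally show ?thesis by (simp add: I0_def)
  qed
  have "contour_integral (linepath (P 0) (P 4)) (u True) + contour_integral (linepath (P 0) (P 4)) (u False) =
      4 * contour_integral (linepath (P 0) (P 1)) (u (even m))"
    unfolding four[of True] four[of False] by (cases "even m") simp_all
  also have "u (even m) = kern \<theta>" by (rule ext) (simp add: u_def kern_def g_def)
  also have "contour_integral (linepath (P 0) (P 1)) (kern \<theta>) = contour_integral (unit_seg 0 y) (kern \<theta>)"
  proof -
    have k2: "kern \<theta> (T + 2) = kern \<theta> T" if "Im T = y" for T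
      using kern_T[of "T + 1" \<theta>] kern_T[of T \<theta>] lineH[of T] lineH[of "T + 1"] that by (simp add: add.assoc)
    have "Complex 0 y + 1 = P 1 + 2" "Complex 0 y = P 0 + 2" by (simp_all add: P_def complex_eq_iff)
    then have "contour_integral (unit_seg 0 y) (kern \<theta>) = contour_integral (linepath (P 0) (P 1)) (\<lambda>T. kern \<theta> (T + 2))"
      by (simp only: contour_integral_linepath_shift)
    also have "\<dots> = contour_integral (linepath (P 0) (P 1)) (kern \<theta>)"
    proof (rule contour_integral_eq)
      fix T assume "T \<in> path_image (linepath (P 0) (P 1))"
      then have "Im T = y" using Pim by auto
      then show "kern \<theta> (T + 2) = kern \<theta> T" by (rule k2)
    qed
    finally show ?thesis by simp
  qed
  finally show "contour_integral (linepath (- 1/2 + \<i> * of_real v) (1/2 + \<i> * of_real v)) (\<lambda>\<tau>. Bk s F G z \<tau> * qexp (- m) \<tau>)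
       = contour_integral (unit_seg 0 (4 * v)) (kern \<theta>)"
    unfolding e1 y_def by simp
qed

end

section \<open>Heights of the points with the j-value of an arc point\<close>

lemma arc_bounds:
  assumes "pi / 3 < \<theta>" "\<theta> < 2 * pi / 3"
  shows "sin \<theta> > 0" "\<bar>cos \<theta>\<bar> < 1 / 2" "sin \<theta> > 43 / 50" "cis \<theta> \<in> HH"
proof -
  show s: "sin \<theta> > 0" using assms pi_gt_zero by (intro sin_gt_zero) (auto simp del: pi_gt_zero)
  have "cos \<theta> < cos (pi / 3)" using assms by (intro cos_monotone_0_pi) auto
  moreover have "cos (2 * pi / 3) < cos \<theta>" using assms by (intro cos_monotone_0_pi) auto
  ultimately show c: "\<bar>cos \<theta>\<bar> < 1 / 2" by (simp add: cos_60 cos_120)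
  have "(cos \<theta>)\<^sup>2 < (1 / 2)\<^sup>2" using c by (metis abs_ge_zero power2_abs power_strict_mono zero_less_numeral)
  then have "(43 / 50)\<^sup>2 < (sin \<theta>)\<^sup>2" using sin_cos_squared_add[of \<theta>] by (simp add: power2_eq_square)
  then show "sin \<theta> > 43 / 50" using s by (meson less_imp_le power2_less_imp_less)
  show "cis \<theta> \<in> HH" using s by (simp add: HH_def)
qed

text \<open>The height is tan (\<theta> / 2) / 2. Its square is rational in cos \<theta>, so all
  later comparisons of heights are rational inequalities in one variable.\<close>

lemma cis_plus_1_neg_inverse:
  assumes "sin \<theta> > 0"
  shows "Re (- 1 / (cis \<theta> + 1)) = - 1 / 2" "(Im (- 1 / (cis \<theta> + 1)))\<^sup>2 = (1 - cos \<theta>) / (4 * (1 + cos \<theta>))"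
proof -
  have sc: "(sin \<theta>)\<^sup>2 = (1 - cos \<theta>) * (1 + cos \<theta>)" unfolding sin_squared_eq by (simp add: power2_eq_square algebra_simps)
  have c: "1 + cos \<theta> \<noteq> 0" using sc assms by auto
  have n: "(norm (cis \<theta> + 1))\<^sup>2 = 2 * (1 + cos \<theta>)"
    unfolding cmod_power2 using sc by (simp add: power2_eq_square algebra_simps)
  have "Re (- 1 / (cis \<theta> + 1)) = - ((1 + cos \<theta>) / (norm (cis \<theta> + 1))\<^sup>2)" by (simp add: Re_divide cmod_power2 algebra_simps)
  moreover have "(1 + cos \<theta>) / (2 * (1 + cos \<theta>)) = 1 / 2" using c by simp
  ultimately show "Re (- 1 / (cis \<theta> + 1)) = - 1 / 2" unfolding n by (simp only:)
  have "Im (- 1 / (cis \<theta> + 1)) = sin \<theta> / (2 * (1 + cos \<theta>))" unfolding Im_neg_inverse n by simp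
  then have "(Im (- 1 / (cis \<theta> + 1)))\<^sup>2 = (1 - cos \<theta>) * (1 + cos \<theta>) / (2 * (1 + cos \<theta>))\<^sup>2" by (simp only: power_divide sc)
  moreover have "a * x / (2 * x)\<^sup>2 = a / (4 * x)" if "x \<noteq> 0" for a x :: real using that by (simp add: power2_eq_square)
  ultimately show "(Im (- 1 / (cis \<theta> + 1)))\<^sup>2 = (1 - cos \<theta>) / (4 * (1 + cos \<theta>))" using c by (simp only: not_False_eq_True simp_thms)
qed

lemma cis_minus_1_neg_inverse:
  assumes "sin \<theta> > 0"
  shows "Re (- 1 / (cis \<theta> - 1)) = 1 / 2" "(Im (- 1 / (cis \<theta> - 1)))\<^sup>2 = (1 + cos \<theta>) / (4 * (1 - cos \<theta>))"
proof -
  have sc: "(sin \<theta>)\<^sup>2 = (1 + cos \<theta>) * (1 - cos \<theta>)" unfolding sin_squared_eq by (simp add: power2_eq_square algebra_simps)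
  have c: "1 - cos \<theta> \<noteq> 0" using sc assms by auto
  have n: "(norm (cis \<theta> - 1))\<^sup>2 = 2 * (1 - cos \<theta>)"
    unfolding cmod_power2 using sc by (simp add: power2_eq_square algebra_simps)
  have "Re (- 1 / (cis \<theta> - 1)) = - ((cos \<theta> - 1) / (norm (cis \<theta> - 1))\<^sup>2)" by (simp add: Re_divide cmod_power2 algebra_simps)
  moreover have "(cos \<theta> - 1) / (2 * (1 - cos \<theta>)) = - 1 / 2" using c by (simp add: field_simps)
  ultimately show "Re (- 1 / (cis \<theta> - 1)) = 1 / 2" unfolding n by (simp only:)
  have "Im (- 1 / (cis \<theta> - 1)) = sin \<theta> / (2 * (1 - cos \<theta>))" unfolding Im_neg_inverse n by simp
  then have "(Im (- 1 / (cis \<theta> - 1)))\<^sup>2 = (1 + cos \<theta>) * (1 - cos \<theta>) / (2 * (1 - cos \<theta>))\<^sup>2" by (simp only: power_divide sc)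
  moreover have "a * x / (2 * x)\<^sup>2 = a / (4 * x)" if "x \<noteq> 0" for a x :: real using that by (simp add: power2_eq_square)
  ultimately show "(Im (- 1 / (cis \<theta> - 1)))\<^sup>2 = (1 + cos \<theta>) / (4 * (1 - cos \<theta>))" using c by (simp only: not_False_eq_True simp_thms)
qed

lemma neg_inverse_cis_coords: "Re (- 1 / cis \<theta>) = - cos \<theta>" "Im (- 1 / cis \<theta>) = sin \<theta>"
  unfolding neg_inverse_cis by simp_all

lemma jinv_eq_arc_height:
  assumes th: "pi / 3 < \<theta>" "\<theta> < 2 * pi / 3" and T: "Im T > 1 / 2" and eq: "jinv T = jinv (cis \<theta>)"
  shows "Im T = sin \<theta> \<or> (Im T)\<^sup>2 = (1 - cos \<theta>) / (4 * (1 + cos \<theta>)) \<or> (Im T)\<^sup>2 = (1 + cos \<theta>) / (4 * (1 - cos \<theta>))"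
proof -
  note c = cis_plus_1_neg_inverse(2)[OF arc_bounds(1)[OF th]] cis_minus_1_neg_inverse(2)[OF arc_bounds(1)[OF th]]
  have i: "Im (x + of_int n) = Im x" for x and n :: int by simp
  from jinv_eq_arc_high[OF assms] obtain n :: int where
    "T = cis \<theta> + of_int n \<or> T = - 1 / cis \<theta> + of_int n \<or>
     T = - 1 / (cis \<theta> + 1) + of_int n \<or> T = - 1 / (cis \<theta> - 1) + of_int n" by blast
  then show ?thesis
  proof (elim disjE)
    assume "T = cis \<theta> + of_int n"
    then show ?thesis by simp
  next
    assume "T = - 1 / cis \<theta> + of_int n"
    then have "Im T = sin \<theta>" unfolding neg_inverse_cis by simp
    then show ?thesis by blast
  next
    assume "T = - 1 / (cis \<theta> + 1) + of_int n"
    then have "Im T = Im (- 1 / (cis \<theta> + 1))" by (simp only: i)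
    then show ?thesis using c(1) by (simp only:) blast
  next
    assume "T = - 1 / (cis \<theta> - 1) + of_int n"
    then have "Im T = Im (- 1 / (cis \<theta> - 1))" by (simp only: i)
    then show ?thesis using c(2) by (simp only:) blast
  qed
qed

lemma jinv_ne_arc_high:
  assumes th: "pi / 3 < \<theta>" "\<theta> < 2 * pi / 3" and T: "Im T > 1"
  shows "jinv T \<noteq> jinv (cis \<theta>)"
proof
  assume eq: "jinv T = jinv (cis \<theta>)"
  have sq: "(Im T)\<^sup>2 > 1" using T by (simp add: power2_eq_square less_1_mult)
  have "(1 - cos \<theta>) / (4 * (1 + cos \<theta>)) \<le> 1" "(1 + cos \<theta>) / (4 * (1 - cos \<theta>)) \<le> 1"
    using arc_bounds(2)[OF th] by (auto simp: field_simps abs_less_iff)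
  moreover have "sin \<theta> \<le> 1" by simp
  moreover have "1 / 2 < Im T" using T by simp
  note jinv_eq_arc_height[OF th this eq]
  ultimately show False using T sq by linarith
qed

section \<open>The integral along a high segment\<close>

context basis_pair
begin

lemma numer_diag:
  assumes "cis \<theta> \<in> HH" "deriv jinv (cis \<theta>) \<noteq> 0"
  shows "numer \<theta> p (cis \<theta> - 1) = jprime (cis \<theta>)"
proof -
  have Z: "cis \<theta> - 1 \<in> HH" using assms by (simp add: HH_def)
  have "deriv jinv (cis \<theta> - 1) \<noteq> 0" using deriv_jinv_plus_1[OF Z] assms(2) by simp
  then have "numer \<theta> p (cis \<theta> - 1) = jprime (cis \<theta> - 1)" unfolding numer_def by (rule kernel_diagonal[OF F G Z])
  then show ?thesis using jprime_weight2(2)[OF Z] by simp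
qed

text \<open>The diagonal value makes the left-hand side vanish at cis \<theta> - 1. By modularity it
  vanishes on the whole orbit, which is the full fibre of j by \<open>jinv_arc_injective\<close>,
  and j' \<noteq> 0 makes the zeros of the denominator simple.\<close>

lemma weight2_quotient:
  assumes th: "pi / 3 < \<theta>" "\<theta> < 2 * pi / 3" and dj: "deriv jinv (cis \<theta>) \<noteq> 0"
  obtains D where "D holomorphic_on HH" "\<And>T. T \<in> HH \<Longrightarrow> D (T + 1) = D T" "\<And>T. T \<in> HH \<Longrightarrow> D (- 1 / T) = T ^ 2 * D T"
    "\<And>T. T \<in> HH \<Longrightarrow> vvc True (F m) T * numer \<theta> True T + vvc False (F m) T * numer \<theta> False T
        - F m ((cis \<theta> - 1) / 4) * jprime T = D T * (jinv T - jinv (cis \<theta>))"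
proof -
  define a where "a = F m ((cis \<theta> - 1) / 4)"
  define N where "N T = vvc True (F m) T * numer \<theta> True T + vvc False (F m) T * numer \<theta> False T - a * jprime T" for T
  define g where "g T = jinv T - jinv (cis \<theta>)" for T
  have cH: "cis \<theta> \<in> HH" by (rule arc_bounds[OF th])
  have ZH: "cis \<theta> - 1 \<in> HH" using cH by (simp add: HH_def)
  note v = vvmf_pairing[OF wh_mod_vvmf[OF wh_m] numer_vvmf[of \<theta>]]
  have Nh: "N holomorphic_on HH"
    unfolding N_def[abs_def] by (intro holomorphic_intros v(1) jprime_weight2(1))
  have NT: "N (T + 1) = N T" if "T \<in> HH" for T
    unfolding N_def v(2)[OF that] jprime_weight2(2)[OF that] ..
  have NS: "N (- 1 / T) = T ^ 2 * N T" if "T \<in> HH" for T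
    unfolding N_def v(3)[OF that] jprime_weight2(3)[OF that] by (simp add: algebra_simps)
  \<comment> \<open>N and j' both have weight 2, so vanishing of either is a property of the orbit
    and can be carried from Z to every point of the fibre.\<close>
  define Q where "Q T \<longleftrightarrow> N T = 0 \<and> deriv jinv T \<noteq> 0" for T
  have QT: "Q (T + 1) = Q T" if "T \<in> HH" for T unfolding Q_def NT[OF that] deriv_jinv_plus_1[OF that] ..
  have QS: "Q (- 1 / T) = Q T" if "T \<in> HH" for T
  proof -
    have "T \<noteq> 0" using that by (auto simp: HH_def)
    then show ?thesis unfolding Q_def NS[OF that] deriv_jinv_inv[OF that] by simp
  qed
  have "N (cis \<theta> - 1) = 0"
  proof -
    have "vvc True (F m) (cis \<theta> - 1) + vvc False (F m) (cis \<theta> - 1) = a" by (simp add: vvc_def a_def field_simps)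
    moreover have "jprime (cis \<theta> - 1) = jprime (cis \<theta>)" using jprime_weight2(2)[OF ZH] by simp
    ultimately show ?thesis unfolding N_def numer_diag[OF cH dj] by (simp flip: distrib_right)
  qed
  then have Qc: "Q (cis \<theta>)"
    using QT[OF ZH] dj deriv_jinv_plus_1[OF ZH] unfolding Q_def by simp
  have Qw: "Q T" if T: "T \<in> HH" and e: "jinv T = jinv (cis \<theta>)" for T
  proof -
    obtain w where w: "w \<in> modular_orbit T" "\<bar>Re w\<bar> \<le> 1 / 2" "norm w \<ge> 1" "w \<in> HH"
      using modular_orbit_fundamental[OF T] by blast
    have "jinv w = jinv T" by (rule modular_orbit_invariant[OF w(1) T jinv_plus_1 jinv_inv])
    then have "w = cis \<theta> \<or> w = - 1 / cis \<theta>" by (intro jinv_arc_injective[OF th w(2-4)]) (simp add: e)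
    then have "Q w" using Qc QS[OF cH] by auto
    moreover have "Q w = Q T" by (rule modular_orbit_invariant[OF w(1) T QT QS])
    ultimately show ?thesis by simp
  qed
  have gh: "g holomorphic_on HH" unfolding g_def[abs_def] by (intro holomorphic_intros jinv_holomorphic)
  have dg: "deriv g T = deriv jinv T" if "T \<in> HH" for T
    unfolding g_def[abs_def] by (rule DERIV_imp_deriv) (auto intro!: derivative_eq_intros DERIV_jinv that)
  have zz: "N T = 0 \<and> deriv g T \<noteq> 0" if "T \<in> HH" "g T = 0" for T
    using Qw[of T] that dg[of T] by (simp add: g_def Q_def)
  obtain D where D: "D holomorphic_on HH" "\<And>T. T \<in> HH \<Longrightarrow> N T = D T * g T"
    by (rule holomorphic_quotient_simple_zeros[OF Nh gh open_HH], erule (1) zz, rule that, assumption, simp)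
  obtain b where b: "b \<in> HH" "g b \<noteq> 0"
    using jinv_not_constant unfolding constant_on_def g_def by (metis eq_iff_diff_eq_0)
  have gT: "g (T + 1) = g T" "g (- 1 / T) = g T" if "T \<in> HH" for T
    unfolding g_def jinv_plus_1[OF that] jinv_inv[OF that] by auto
  have T1: "T + 1 \<in> HH" if "T \<in> HH" for T using that by (simp add: HH_def)
  have DT: "D (T + 1) = D T" if T: "T \<in> HH" for T
  proof -
    have "D (T + 1) - D T = 0"
    proof (rule holomorphic_mult_zero_imp_zero[of "\<lambda>T. D (T + 1) - D T" HH g b])
      have "(\<lambda>T. D (T + 1)) holomorphic_on HH"
        by (rule holomorphic_on_compose_gen[OF _ D(1), of "\<lambda>t. t + 1" HH, unfolded o_def])
          (auto intro!: holomorphic_intros T1)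
      then show "(\<lambda>T. D (T + 1) - D T) holomorphic_on HH" by (intro holomorphic_intros D(1))
      show "(D (x + 1) - D x) * g x = 0" if x: "x \<in> HH" for x
        using D(2)[OF T1[OF x]] D(2)[OF x] NT[OF x] gT(1)[OF x] by (simp add: algebra_simps)
    qed (use b T gh open_HH connected_HH in auto)
    then show ?thesis by simp
  qed
  have DS: "D (- 1 / T) = T ^ 2 * D T" if T: "T \<in> HH" for T
  proof -
    have "D (- 1 / T) - T ^ 2 * D T = 0"
    proof (rule holomorphic_mult_zero_imp_zero[of "\<lambda>T. D (- 1 / T) - T ^ 2 * D T" HH g b])
      have "(\<lambda>T. D (- 1 / T)) holomorphic_on HH"
        by (rule holomorphic_on_compose_gen[OF _ D(1), of "\<lambda>t. - 1 / t" HH, unfolded o_def])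
          (use HH_neg_inverse in \<open>auto intro!: holomorphic_intros simp: HH_def\<close>)
      then show "(\<lambda>T. D (- 1 / T) - T ^ 2 * D T) holomorphic_on HH" by (intro holomorphic_intros D(1))
      show "(D (- 1 / x) - x ^ 2 * D x) * g x = 0" if x: "x \<in> HH" for x
        using D(2)[OF HH_neg_inverse[OF x]] D(2)[OF x] NS[OF x] unfolding gT(2)[OF x] by (simp add: left_diff_distrib)
    qed (use b T gh open_HH connected_HH in auto)
    then show ?thesis by simp
  qed
  show ?thesis
    by (rule that[OF D(1) DT DS]) (use D(2) in \<open>simp_all add: N_def a_def g_def\<close>)
qed

text \<open>The two orders add up to -3, one quarter-step better than the order -4 of j: this makes
  the remainder in \<open>contour_integral_kern_high\<close> decay.\<close>

lemma numer_leads: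
  obtains N where "\<And>p. \<exists>\<kappa>. leads (numer \<theta> p) (- N - 4) \<kappa>"
    "\<And>p. \<exists>\<kappa>. leads (\<lambda>T. vvc p (F m) T - (if even m = p then qexp (- m) (T / 4) else 0)) (N + 1) \<kappa>"
proof -
  obtain N \<delta> :: int and p where d: "\<delta> = 1 \<or> \<delta> = - 1"
    and e: "\<exists>\<kappa>. leads (vvc p (G (adm0 (1 - s)))) (- N) \<kappa>"
    "\<exists>\<kappa>. leads (\<lambda>T. vvc (\<not> p) (G (adm0 (1 - s))) T - qexp (- N - 2 + \<delta>) (T / 4)) (- N + 2 + \<delta>) \<kappa>"
    "\<exists>\<kappa>. leads (\<lambda>T. vvc p (G (adm1 (1 - s))) T - qexp (- N - 4) (T / 4)) (- N) \<kappa>"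
    "\<exists>\<kappa>. leads (vvc (\<not> p) (G (adm1 (1 - s)))) (- N + 2 + \<delta>) \<kappa>"
    and r: "\<And>m p. admissible s m \<Longrightarrow> \<exists>\<kappa>. leads (\<lambda>T. vvc p (F m) T - (if even m = p then qexp (- m) (T / 4) else 0)) (N + 1) \<kappa>"
    by (rule basis_vvc_leads[OF F G]) blast
  obtain k5 where k5: "leads (vvc p (G (adm0 (1 - s)))) (- N) k5" using e(1) by blast
  obtain k6 where k6: "leads (\<lambda>T. vvc (\<not> p) (G (adm0 (1 - s))) T - qexp (- N - 2 + \<delta>) (T / 4)) (- N + 2 + \<delta>) k6" using e(2) by blast
  obtain k7 where k7: "leads (\<lambda>T. vvc p (G (adm1 (1 - s))) T - qexp (- N - 4) (T / 4)) (- N) k7" using e(3) by blast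
  obtain k8 where k8: "leads (vvc (\<not> p) (G (adm1 (1 - s)))) (- N + 2 + \<delta>) k8" using e(4) by blast
  have l5: "leads (vvc p (G (adm0 (1 - s)))) (- N - 4) 0" by (rule leads_higher[OF k5]) simp
  have "leads (vvc (\<not> p) (G (adm0 (1 - s)))) (- N - 2 + \<delta>) 1" by (rule leads_split[OF k6]) simp
  then have l6: "leads (vvc (\<not> p) (G (adm0 (1 - s)))) (- N - 4) 0" by (rule leads_higher) (use d in auto)
  have l7: "leads (vvc p (G (adm1 (1 - s)))) (- N - 4) 1" by (rule leads_split[OF k7]) simp
  have l8: "leads (vvc (\<not> p) (G (adm1 (1 - s)))) (- N - 4) 0" by (rule leads_higher[OF k8]) (use d in auto)
  have 1: "\<exists>\<kappa>. leads (numer \<theta> p) (- N - 4) \<kappa>"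
    unfolding numer_def[abs_def] by (rule exI, rule leads_add[OF leads_cmult[OF l7] leads_cmult[OF l5]])
  have 2: "\<exists>\<kappa>. leads (numer \<theta> (\<not> p)) (- N - 4) \<kappa>"
    unfolding numer_def[abs_def] by (rule exI, rule leads_add[OF leads_cmult[OF l8] leads_cmult[OF l6]])
  show ?thesis
  proof (rule that)
    show "\<exists>\<kappa>. leads (numer \<theta> p') (- N - 4) \<kappa>" for p' using 1 2 by (cases "p' = p") (auto simp: HOL.fun_eq_iff)
    show "\<exists>\<kappa>. leads (\<lambda>T. vvc p (F m) T - (if even m = p then qexp (- m) (T / 4) else 0)) (N + 1) \<kappa>" for p by (rule r[OF m])
  qed
qed

text \<open>The kernel is D + a + E / (j - w), where D has weight 2 and mean value zero, a is the
  claimed value, and the last term is O(exp (- (\<pi> / 2) Im T)). The integral does not depend on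
  the height, so the limit shows that it equals a.\<close>

lemma contour_integral_kern_high:
  assumes th: "pi / 3 < \<theta>" "\<theta> < 2 * pi / 3" and dj: "deriv jinv (cis \<theta>) \<noteq> 0" and A: "A > 1"
  shows "contour_integral (unit_seg 0 A) (kern \<theta>) = F m ((cis \<theta> - 1) / 4)"
proof -
  define a where "a = F m ((cis \<theta> - 1) / 4)"
  define w where "w = jinv (cis \<theta>)"
  obtain D where D: "D holomorphic_on HH" "\<And>T. T \<in> HH \<Longrightarrow> D (T + 1) = D T" "\<And>T. T \<in> HH \<Longrightarrow> D (- 1 / T) = T ^ 2 * D T"
    and Dq: "\<And>T. T \<in> HH \<Longrightarrow> vvc True (F m) T * numer \<theta> True T + vvc False (F m) T * numer \<theta> False T
        - a * jprime T = D T * (jinv T - w)"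
    using weight2_quotient[OF th dj] unfolding a_def w_def by blast
  define r where "r p T = vvc p (F m) T - (if even m = p then qexp (- m) (T / 4) else 0)" for p T
  \<comment> \<open>The tail of the basis element beyond q^(-m), and the discrepancy between j - w
    and its derivative \<open>jprime\<close>; both have order at least -3 in quarter powers of the
    nome.\<close>
  define E where "E T = - (r True T * numer \<theta> True T + r False T * numer \<theta> False T)
     + (- a) * (jinv T - w - jprime T)" for T
  have HT: "T \<in> HH" if "Im T > 1" for T using that by (simp add: HH_def)
  have g0: "jinv T - w \<noteq> 0" if "Im T > 1" for T using jinv_ne_arc_high[OF th that] by (simp add: w_def)
  have kE: "kern \<theta> T = D T + a + E T / (jinv T - w)" if T: "Im T > 1" for T
  proof -
    have "numer \<theta> (even m) T * qexp (- m) (T / 4) = vvc True (F m) T * numer \<theta> True T + vvc False (F m) T * numer \<theta> False T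
       - (r True T * numer \<theta> True T + r False T * numer \<theta> False T)"
      by (cases "even m") (simp_all add: r_def algebra_simps)
    also have "\<dots> = (D T + a) * (jinv T - w) + E T"
      using Dq[OF HT[OF T]] unfolding E_def by (simp add: algebra_simps)
    finally show ?thesis unfolding kern_def w_def[symmetric] using g0[OF T] by (simp add: add_divide_distrib)
  qed
  obtain M where M: "M > 0" "\<And>q. norm q \<le> 1 / 2 \<Longrightarrow> norm (j_kappa q) \<le> M" using j_kappa_bounds by metis
  have qle: "norm (nome T) \<le> 1 / 2" if "Im T \<ge> 1" for T by (rule nome_le_half) (use that in simp)
  have q4: "qexp (- 4) (T / 4) = 1 / nome T" for T
  proof -
    have "qexp (- 4) (T / 4) = exp (- (2 * of_real pi * \<i> * T))"
      unfolding qexp_def by (rule arg_cong[where f = exp]) simp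
    then show ?thesis unfolding exp_minus inverse_eq_divide .
  qed
  obtain \<kappa> where k: "leads E (- 3) \<kappa>"
  proof -
    obtain N where N1: "\<And>p. \<exists>\<kappa>. leads (numer \<theta> p) (- N - 4) \<kappa>" and N2: "\<And>p. \<exists>\<kappa>. leads (r p) (N + 1) \<kappa>"
      unfolding r_def[abs_def] by (rule numer_leads[of \<theta>]) blast
    have pr: "\<exists>\<kappa>. leads (\<lambda>T. r p T * numer \<theta> p T) (- 3) \<kappa>" for p
    proof -
      obtain k1 k2 where "leads (numer \<theta> p) (- N - 4) k1" "leads (r p) (N + 1) k2" using N1 N2 by blast
      from leads_mult[OF this(2,1)] show ?thesis by auto
    qed
    obtain k1 k2 where k12: "leads (\<lambda>T. r True T * numer \<theta> True T) (- 3) k1" "leads (\<lambda>T. r False T * numer \<theta> False T) (- 3) k2"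
      using pr by blast
    have "leads (\<lambda>T. j_kappa (nome T) - w) (- 1) 0"
    proof (rule leadsI[of "M + norm w"])
      show "norm (j_kappa (nome T) - w - 0 * qexp (- 1) (T / 4)) \<le> (M + norm w) * exp (- (pi / 2) * real_of_int (- 1 + 1) * Im T)"
        if "Im T \<ge> 1" for T using norm_triangle_ineq4[of "j_kappa (nome T)" w] M(2)[OF qle[OF that]] by simp
    qed (use M in simp)
    then have l1: "leads (\<lambda>T. j_kappa (nome T) - w) (- 3) 0" by (rule leads_higher) simp
    have l2: "leads (\<lambda>T. qexp (- 4) (T / 4) - jprime T) (- 3) 0" by (rule leads_higher[OF jprime_leads]) simp
    have "leads (\<lambda>T. (- 1) * (r True T * numer \<theta> True T + r False T * numer \<theta> False T)
       + (- a) * ((qexp (- 4) (T / 4) - jprime T) + (j_kappa (nome T) - w))) (- 3) ((- 1) * (k1 + k2) + (- a) * (0 + 0))"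
      by (intro leads_add leads_cmult k12 l1 l2)
    then obtain C where C: "C \<ge> 0" "\<And>T. Im T \<ge> 1 \<Longrightarrow> norm ((- 1) * (r True T * numer \<theta> True T + r False T * numer \<theta> False T)
       + (- a) * ((qexp (- 4) (T / 4) - jprime T) + (j_kappa (nome T) - w)) - ((- 1) * (k1 + k2) + (- a) * (0 + 0)) * qexp (- 3) (T / 4)) \<le> C * exp (- (pi / 2) * real_of_int (- 3 + 1) * Im T)"
      unfolding leads_def by blast
    have "leads E (- 3) ((- 1) * (k1 + k2) + (- a) * (0 + 0))"
    proof (rule leadsI[OF C(1)])
      fix T assume T: "Im T \<ge> 1"
      then have TH: "T \<in> HH" by (simp add: HH_def)
      have "E T = (- 1) * (r True T * numer \<theta> True T + r False T * numer \<theta> False T)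
       + (- a) * ((qexp (- 4) (T / 4) - jprime T) + (j_kappa (nome T) - w))"
        unfolding E_def jinv_nome[OF TH] q4 by (simp add: algebra_simps)
      then show "norm (E T - ((- 1) * (k1 + k2) + (- a) * (0 + 0)) * qexp (- 3) (T / 4)) \<le> C * exp (- (pi / 2) * real_of_int (- 3 + 1) * Im T)"
        using C(2)[OF T] by (simp only:)
    qed
    then show ?thesis by (rule that)
  qed
  obtain C where C: "C \<ge> 0" "\<And>T. Im T \<ge> 1 \<Longrightarrow> norm (E T) \<le> C * exp (- (pi / 2) * real_of_int (- 3) * Im T)"
    using leadsD[OF k] by blast
  \<comment> \<open>From this height on |1 / q| is at least 2 (M + |w|), so |j - w| is at least half
    of |1 / q|.\<close>
  define A0 where "A0 = max 2 (M + norm w)"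
  have bd: "norm (E T / (jinv T - w)) \<le> 2 * C * exp (- (pi / 2) * Im T)" if T: "Im T \<ge> A0" for T
  proof -
    have T1: "Im T \<ge> 1" and TM: "Im T \<ge> M + norm w" using T by (auto simp: A0_def)
    then have TH: "T \<in> HH" by (simp add: HH_def)
    define y where "y = Im T"
    have nn: "norm (1 / nome T) = exp (2 * pi * y)"
      unfolding q4[symmetric] norm_qexp by (simp add: y_def)
    have "2 * (M + norm w) \<le> 2 * pi * y"
    proof -
      have "2 * y \<le> 2 * pi * y" using T1 pi_gt3 by (simp add: y_def)
      then show ?thesis using TM by (simp add: y_def)
    qed
    also have "\<dots> \<le> exp (2 * pi * y)" using exp_ge_add_one_self[of "2 * pi * y"] by linarith
    finally have big: "2 * (M + norm w) \<le> exp (2 * pi * y)" .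
    have "norm (1 / nome T) \<le> norm (jinv T - w) + norm (j_kappa (nome T)) + norm w"
    proof -
      have "1 / nome T = (jinv T - w) - j_kappa (nome T) + w" unfolding jinv_nome[OF TH] by simp
      then show ?thesis using norm_triangle_ineq[of "(jinv T - w) - j_kappa (nome T)" w] norm_triangle_ineq4[of "jinv T - w" "j_kappa (nome T)"]
        by simp
    qed
    then have "exp (2 * pi * y) / 2 \<le> norm (jinv T - w)" using nn big M(2)[OF qle[OF T1]] by simp
    moreover have "- (pi / 2) * real_of_int (- 3) * Im T = 3 * pi / 2 * y" by (simp add: y_def)
    then have "norm (E T) \<le> C * exp (3 * pi / 2 * y)" using C(2)[OF T1] by (simp only:)
    ultimately have "norm (E T / (jinv T - w)) \<le> C * exp (3 * pi / 2 * y) / (exp (2 * pi * y) / 2)"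
      unfolding norm_divide by (intro frac_le) (use C in auto)
    also have "\<dots> = 2 * C * (exp (3 * pi / 2 * y) / exp (2 * pi * y))" by simp
    also have "exp (3 * pi / 2 * y) / exp (2 * pi * y) = exp (- (pi / 2) * y)"
      unfolding exp_diff[symmetric] by (rule arg_cong[where f = exp]) (simp add: field_simps)
    finally show ?thesis by (simp add: y_def)
  qed
  have sub: "{T. Im T > 1} \<subseteq> HH" by (auto simp: HH_def)
  have kh: "kern \<theta> holomorphic_on {T. Im T > 1}"
    by (rule kern_hol[OF sub]) (use jinv_ne_arc_high[OF th] in auto)
  have const: "contour_integral (unit_seg 0 A) (kern \<theta>) = contour_integral (unit_seg 0 B) (kern \<theta>)" if "B > 1" for B
    by (rule contour_integral_unit_seg_height[OF kh]) (use kern_T HT A that in auto)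
  define I where "I = contour_integral (unit_seg 0 A) (kern \<theta>)"
  have le: "norm (I - a) \<le> 2 * C * exp (- (pi / 2) * B)" if B: "B \<ge> A0" for B
  proof -
    have B1: "B > 1" using B by (simp add: A0_def)
    have seg: "closed_segment (Complex 0 B) (Complex 0 B + 1) \<subseteq> {T. Im T > 1}"
      using B1 closed_segment_unit_seg[of _ 0 B] by auto
    have i1: "kern \<theta> contour_integrable_on unit_seg 0 B"
      by (intro contour_integrable_continuous_linepath continuous_on_subset[OF _ seg] holomorphic_on_imp_continuous_on kh)
    have i2: "D contour_integrable_on unit_seg 0 B"
      using seg sub by (intro contour_integrable_continuous_linepath holomorphic_on_imp_continuous_on holomorphic_on_subset[OF D(1)]) blast
    have i3: "(\<lambda>T. a) contour_integrable_on unit_seg 0 B"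
      by (intro contour_integrable_continuous_linepath continuous_intros)
    have BH: "Complex 0 B \<in> HH" using B1 by (simp add: HH_def)
    have "contour_integral (unit_seg 0 B) (\<lambda>T. kern \<theta> T - D T - a) = contour_integral (unit_seg 0 B) (kern \<theta>)
       - contour_integral (unit_seg 0 B) D - contour_integral (unit_seg 0 B) (\<lambda>T. a)"
      using i1 i2 i3 by (simp add: contour_integral_diff contour_integrable_diff)
    also have "\<dots> = I - a"
      using weight2_mean_zero[OF D BH] const[OF B1] contour_integral_const_linepath[of "Complex 0 B" "Complex 0 B + 1" a]
      by (simp add: I_def)
    finally have e: "contour_integral (unit_seg 0 B) (\<lambda>T. kern \<theta> T - D T - a) = I - a" .
    have "norm (contour_integral (unit_seg 0 B) (\<lambda>T. kern \<theta> T - D T - a)) \<le> 2 * C * exp (- (pi / 2) * B) * norm (Complex 0 B + 1 - Complex 0 B)"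
    proof (rule contour_integral_bound_linepath)
      show "(\<lambda>T. kern \<theta> T - D T - a) contour_integrable_on unit_seg 0 B"
        by (intro contour_integrable_diff i1 i2 i3)
      show "0 \<le> 2 * C * exp (- (pi / 2) * B)" using C by simp
      fix T assume "T \<in> closed_segment (Complex 0 B) (Complex 0 B + 1)"
      then have "Im T = B" using closed_segment_unit_seg by blast
      then show "norm (kern \<theta> T - D T - a) \<le> 2 * C * exp (- (pi / 2) * B)"
        using kE[of T] bd[of T] B B1 by simp
    qed
    then show ?thesis unfolding e by simp
  qed
  have "norm (I - a) \<le> 0"
  proof (rule tendsto_lowerbound)
    show "((\<lambda>B. 2 * C * exp (- (pi / 2) * B)) \<longlongrightarrow> 0) at_top" by (rule tendsto_exp_neg_0) simp
    show "\<forall>\<^sub>F B in at_top. norm (I - a) \<le> 2 * C * exp (- (pi / 2) * B)"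
      using eventually_ge_at_top[of A0] by eventually_elim (rule le)
  qed simp
  then show ?thesis unfolding I_def a_def by simp
qed

end

section \<open>Residues of the kernel\<close>

lemma qexp_polar: "qexp n T = of_real (exp (- 2 * pi * real_of_int n * Im T)) * cis (2 * pi * real_of_int n * Re T)"
  unfolding qexp_def by (subst exp_eq_polar) simp

lemma polar_mult: "(of_real a * cis b) * (of_real c * cis d) = of_real (a * c) * cis (b + d)"
  unfolding of_real_mult cis_mult[symmetric] by (simp only: mult_ac)

lemma polar_inverse: "1 / (of_real r * cis \<phi>) = of_real (1 / r) * cis (- \<phi>)"
  by (simp add: divide_inverse)

lemma csqrt_polar:
  assumes "r > 0" "- pi < \<phi>" "\<phi> < pi"
  shows "csqrt (of_real r * cis \<phi>) = of_real (sqrt r) * cis (\<phi> / 2)"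
proof (rule csqrt_unique)
  have "(cis (\<phi> / 2))\<^sup>2 = cis \<phi>" by (simp add: power2_eq_square cis_mult)
  moreover have "(complex_of_real (sqrt r))\<^sup>2 = of_real r" using assms by (simp flip: of_real_power)
  ultimately show "(of_real (sqrt r) * cis (\<phi> / 2))\<^sup>2 = of_real r * cis \<phi>" by (simp only: power_mult_distrib)
  have "cos (\<phi> / 2) > 0" using assms by (intro cos_gt_zero_pi) auto
  then show "0 < Re (of_real (sqrt r) * cis (\<phi> / 2)) \<or>
    Re (of_real (sqrt r) * cis (\<phi> / 2)) = 0 \<and> 0 \<le> Im (of_real (sqrt r) * cis (\<phi> / 2))"
    using assms by simp
qed

lemma csqrt_powi_polar:
  assumes "r > 0" "- pi < \<phi>" "\<phi> < pi"
  shows "csqrt (of_real r * cis \<phi>) powi (2 * s + 1) = of_real (r powr wt s) * cis (wt s * \<phi>)"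
proof -
  have c: "cis a powi n = cis (of_int n * a)" for a n
    by (simp add: power_int_def Complex.DeMoivre cis_inverse)
  have "sqrt r powi (2 * s + 1) = sqrt r powr real_of_int (2 * s + 1)"
    by (rule powr_real_of_int'[symmetric]) (use assms in auto)
  also have "\<dots> = r powr (1 / 2 * real_of_int (2 * s + 1))"
    using assms by (simp only: powr_half_sqrt[symmetric] powr_powr less_imp_le)
  also have "1 / 2 * real_of_int (2 * s + 1) = wt s" by (simp add: wt_def)
  finally have "sqrt r powi (2 * s + 1) = r powr wt s" .
  moreover have "real_of_int (2 * s + 1) * (\<phi> / 2) = wt s * \<phi>" by (simp add: wt_def field_simps)
  ultimately show ?thesis
    unfolding csqrt_polar[OF assms] power_int_mult_distrib c of_real_power_int[symmetric] by (simp only:)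
qed

lemma cis_plus_1_polar: "cis \<theta> + 1 = of_real (2 * cos (\<theta> / 2)) * cis (\<theta> / 2)"
  using cos_double_cos[of "\<theta> / 2"] sin_double[of "\<theta> / 2"] by (simp add: complex_eq_iff power2_eq_square)

lemma cis_minus_1_polar: "cis \<theta> - 1 = of_real (2 * sin (\<theta> / 2)) * cis (\<theta> / 2 + pi / 2)"
  using cos_double_sin[of "\<theta> / 2"] sin_double[of "\<theta> / 2"] by (simp add: complex_eq_iff power2_eq_square cos_add sin_add)

lemma two_ii_powr: "(2 * \<i>) powr (- of_real a) = of_real (2 powr - a) * cis (- (a * pi / 2))"
proof -
  have L: "Ln (2 * \<i>) = of_real (ln 2) + \<i> * of_real pi / 2"
    using Ln_times_of_real[of 2 \<i>] Ln_of_real[of 2] by (simp add: Ln_ii)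
  have "(2 * \<i>) powr (- of_real a) = exp (- of_real a * Ln (2 * \<i>))" by (simp add: powr_def)
  also have "- of_real a * Ln (2 * \<i>) = of_real (- a * ln 2) + \<i> * of_real (- (a * pi / 2))"
    unfolding L by (simp add: field_simps)
  also have "exp (of_real (- a * ln 2) + \<i> * of_real (- (a * pi / 2))) = of_real (exp (- a * ln 2)) * cis (- (a * pi / 2))"
    unfolding exp_add cis_conv_exp exp_of_real ..
  finally show ?thesis by (simp add: powr_def)
qed

text \<open>Rational bounds for cos 75 degrees by doubling the angle, since cos 150 degrees is -
  sqrt 3 / 2.\<close>

lemma cos_5pi12_bounds: "1 / 4 \<le> cos (5 * pi / 12)" "cos (5 * pi / 12) \<le> 27 / 100" "cos (7 * pi / 12) = - cos (5 * pi / 12)"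
proof -
  define c where "c = cos (5 * pi / 12)"
  have c0: "c \<ge> 0" unfolding c_def by (intro cos_ge_zero) auto
  have "cos (2 * (5 * pi / 12)) = cos (pi - pi / 6)" by (rule arg_cong[where f = cos]) simp
  also have "\<dots> = - sqrt 3 / 2" unfolding cos_pi_minus cos_30 by simp
  finally have e: "2 * c\<^sup>2 - 1 = - sqrt 3 / 2" unfolding cos_double_cos c_def .
  have s: "sqrt 3 \<le> 1.733" "sqrt 3 \<ge> 1.73" by (rule real_le_lsqrt real_le_rsqrt; simp add: power2_eq_square)+
  have "(1 / 4)\<^sup>2 \<le> c\<^sup>2" "c\<^sup>2 \<le> (27 / 100)\<^sup>2" using e s by (simp_all add: power2_eq_square)
  then show "1 / 4 \<le> cos (5 * pi / 12)" "cos (5 * pi / 12) \<le> 27 / 100"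
    using c0 unfolding c_def[symmetric] by (auto intro: power2_le_imp_le)
  have "cos (7 * pi / 12) = cos (pi - 5 * pi / 12)" by (rule arg_cong[where f = cos]) simp
  then show "cos (7 * pi / 12) = - cos (5 * pi / 12)" by (simp only: cos_pi_minus)
qed

lemma arc_middle_cos:
  assumes "5 * pi / 12 \<le> \<theta>" "\<theta> \<le> 7 * pi / 12"
  shows "\<bar>cos \<theta>\<bar> \<le> 27 / 100"
proof -
  have "cos \<theta> \<le> cos (5 * pi / 12)" "cos (7 * pi / 12) \<le> cos \<theta>"
    using assms by (auto intro!: cos_monotone_0_pi_le)
  then show ?thesis using cos_5pi12_bounds by linarith
qed

lemma arc_left_cos:
  assumes "pi / 3 < \<theta>" "\<theta> < 5 * pi / 12" shows "cos \<theta> > 1 / 4"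
proof -
  have "cos (5 * pi / 12) < cos \<theta>" using assms by (intro cos_monotone_0_pi) auto
  then show ?thesis using cos_5pi12_bounds by linarith
qed

lemma arc_right_cos:
  assumes "7 * pi / 12 < \<theta>" "\<theta> < 2 * pi / 3" shows "cos \<theta> < - (1 / 4)"
proof -
  have "cos \<theta> < cos (7 * pi / 12)" using assms by (intro cos_monotone_0_pi) auto
  then show ?thesis using cos_5pi12_bounds by linarith
qed

text \<open>The strip exceeds [0, 1] by |cos \<theta>| on both sides: enough to surround the
  rectangle, while the excluded bounds are the real parts of the next translates of Z and - 1 / Z.
  The sign of cos \<theta> decides which translate falls inside.\<close>

lemma jinv_poles_strip:
  assumes th: "pi / 3 < \<theta>" "\<theta> < 2 * pi / 3" and c0: "cos \<theta> \<noteq> 0"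
    and T: "Im T > 1 / 2" "- \<bar>cos \<theta>\<bar> < Re T" "Re T < 1 + \<bar>cos \<theta>\<bar>" and eq: "jinv T = jinv (cis \<theta>)"
  shows "T = cis \<theta> + (if cos \<theta> > 0 then 0 else 1) \<or> T = - 1 / cis \<theta> + (if cos \<theta> > 0 then 1 else 0)
     \<or> T = - 1 / (cis \<theta> + 1) + 1 \<or> T = - 1 / (cis \<theta> - 1)"
proof -
  note b = arc_bounds[OF th]
  have re: "Re (x + of_int n) = Re x + of_int n" for x and n :: int by simp
  have int0: "n = 0" if "- 1 < real_of_int n" "real_of_int n < 1" for n :: int using that by linarith
  have int1: "n = 1" if "0 < real_of_int n" "real_of_int n < 2" for n :: int using that by linarith
  from jinv_eq_arc_high[OF th T(1) eq] obtain n :: int where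
    "T = cis \<theta> + of_int n \<or> T = - 1 / cis \<theta> + of_int n \<or>
     T = - 1 / (cis \<theta> + 1) + of_int n \<or> T = - 1 / (cis \<theta> - 1) + of_int n" by blast
  then show ?thesis
  proof (elim disjE)
    assume T1: "T = cis \<theta> + of_int n"
    have r: "Re T = cos \<theta> + of_int n" unfolding T1 by simp
    show ?thesis
    proof (cases "cos \<theta> > 0")
      case True
      have "n = 0" by (rule int0) (use r T b(2) True in linarith)+
      then show ?thesis using T1 True by simp
    next
      case False
      have "n = 1" by (rule int1) (use r T b(2) False c0 in linarith)+
      then show ?thesis using T1 False by simp
    qed
  next
    assume T1: "T = - 1 / cis \<theta> + of_int n"
    have r: "Re T = - cos \<theta> + of_int n" unfolding T1 re neg_inverse_cis_coords ..
    show ?thesis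
    proof (cases "cos \<theta> > 0")
      case True
      have "n = 1" by (rule int1) (use r T b(2) True in linarith)+
      then show ?thesis using T1 True by simp
    next
      case False
      have "n = 0" by (rule int0) (use r T b(2) False c0 in linarith)+
      then show ?thesis using T1 False by simp
    qed
  next
    assume T1: "T = - 1 / (cis \<theta> + 1) + of_int n"
    have r: "Re T = - 1 / 2 + of_int n" unfolding T1 re cis_plus_1_neg_inverse(1)[OF b(1)] ..
    have "n = 1" by (rule int1) (use r T b(2) in linarith)+
    then show ?thesis using T1 by simp
  next
    assume T1: "T = - 1 / (cis \<theta> - 1) + of_int n"
    have r: "Re T = 1 / 2 + of_int n" unfolding T1 re cis_minus_1_neg_inverse(1)[OF b(1)] ..
    have "n = 0" by (rule int0) (use r T b(2) in linarith)+
    then show ?thesis using T1 by simp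
  qed
qed

context basis_pair
begin

text \<open>2 \<pi> \<i> times the residue of \<open>kern \<theta>\<close> at a simple pole
  T.\<close>

definition pres :: "real \<Rightarrow> complex \<Rightarrow> complex" where
  "pres \<theta> T = 2 * of_real pi * \<i> * (numer \<theta> (even m) T * qexp (- m) (T / 4) / deriv jinv T)"

lemma pres_T: "T \<in> HH \<Longrightarrow> pres \<theta> (T + 1) = pres \<theta> T"
  using numer_qexp_shift[of T \<theta> "even m"] deriv_jinv_plus_1[of T] by (simp add: pres_def)

lemma pres_diag:
  assumes "cis \<theta> \<in> HH" "deriv jinv (cis \<theta>) \<noteq> 0"
  shows "pres \<theta> (cis \<theta>) = - qexp (- m) ((cis \<theta> - 1) / 4)"
proof -
  have Z: "cis \<theta> - 1 \<in> HH" using assms by (simp add: HH_def)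
  have "pres \<theta> (cis \<theta>) = pres \<theta> (cis \<theta> - 1)" using pres_T[OF Z, of \<theta>] by simp
  also have "\<dots> = - qexp (- m) ((cis \<theta> - 1) / 4)"
    unfolding pres_def numer_diag[OF assms] jprime_def using assms(2) deriv_jinv_plus_1[OF Z] by simp
  finally show ?thesis .
qed

text \<open>All poles besides the translates of Z have the form - 1 / U, up to translation, with U =
  Z, Z + 1 or Z - 1. There both components of the numerator are known multiples of
  \<open>jprime\<close>, with ratio b, and the inversion formula carries them over; the factors U^2
  and j' cancel.\<close>

lemma pres_neg_inverse:
  assumes U: "U \<in> HH" "deriv jinv U \<noteq> 0" and n: "numer \<theta> True U = jprime U" "numer \<theta> False U = b * jprime U"
  shows "pres \<theta> (- 1 / U) = - ((1 + ieps s) / 2 * (if even m then 1 + b else 1 - b))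
     * (1 / csqrt U powi (2 * s + 1)) * qexp (- m) (- 1 / U / 4)"
proof -
  have U0: "U \<noteq> 0" using U by (auto simp: HH_def)
  have "csqrt U powi (2 * (1 - s) + 1) = csqrt U powi (4 - (2 * s + 1))" by simp
  also have "\<dots> = csqrt U powi 4 / csqrt U powi (2 * s + 1)" using U0 by (intro power_int_diff) simp
  also have "csqrt U powi 4 = csqrt U ^ (2 * 2)" by (simp add: power_int_def)
  also have "csqrt U ^ (2 * 2) = ((csqrt U)\<^sup>2)\<^sup>2" by (rule power_mult)
  finally have k: "csqrt U powi (2 * (1 - s) + 1) = U\<^sup>2 / csqrt U powi (2 * s + 1)" by (simp only: power2_csqrt)
  have S: "numer \<theta> True (- 1 / U) = csqrt U powi (2 * (1 - s) + 1) * ((1 - ieps (1 - s)) / 2) * (numer \<theta> True U + numer \<theta> False U)"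
    "numer \<theta> False (- 1 / U) = csqrt U powi (2 * (1 - s) + 1) * ((1 - ieps (1 - s)) / 2) * (numer \<theta> True U - numer \<theta> False U)"
    using numer_vvmf[of \<theta>] U(1) unfolding vvmf_def by blast+
  have e: "1 - ieps (1 - s) = 1 + ieps s" unfolding ieps_1_minus by simp
  define K where "K = 1 / csqrt U powi (2 * s + 1)"
  have nn: "numer \<theta> (even m) (- 1 / U) = U\<^sup>2 * K * ((1 + ieps s) / 2 * (if even m then 1 + b else 1 - b)) * jprime U"
  proof -
    have "u / x * h * (j + b * j) = u * (1 / x) * (h * (1 + b)) * j" "u / x * h * (j - b * j) = u * (1 / x) * (h * (1 - b)) * j"
      for u x h j :: complex
      unfolding divide_inverse by (simp_all add: algebra_simps)
    then show ?thesis by (cases "even m") (simp_all only: S k n e K_def if_True if_False)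
  qed
  have "pres \<theta> (- 1 / U) = 2 * of_real pi * \<i> * (U\<^sup>2 * K * ((1 + ieps s) / 2 * (if even m then 1 + b else 1 - b)) * jprime U * qexp (- m) (- 1 / U / 4) / (U\<^sup>2 * deriv jinv U))"
    unfolding pres_def nn deriv_jinv_inv[OF U(1)] ..
  also have "jprime U = - deriv jinv U / (2 * of_real pi * \<i>)" by (simp only: jprime_def)
  also have "2 * of_real pi * \<i> * (U\<^sup>2 * K * X * (- deriv jinv U / (2 * of_real pi * \<i>)) * Y / (U\<^sup>2 * deriv jinv U)) = - X * K * Y" for X Y
  proof -
    have "c * (u * K * X * (- d / c) * Y / (u * d)) = - X * K * Y" if "c \<noteq> 0" "u \<noteq> 0" "d \<noteq> 0" for c u d
      using that by simp
    from this[of "2 * of_real pi * \<i>" "U\<^sup>2" "deriv jinv U"] show ?thesis using U0 U(2) by simp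
  qed
  finally show ?thesis by (simp only: K_def)
qed

text \<open>At Z - 1 both components agree, and each unit translation multiplies the odd one by -
  \<open>ieps s\<close>, so b is 1, - \<open>ieps s\<close>, -1 at Z - 1, Z, Z + 1. This is the
  origin of the vanishing cases of \<open>cmk\<close> and \<open>dmk\<close>: one component after
  inversion is a sum, the other a difference.\<close>

lemma pres_values:
  assumes c: "cis \<theta> \<in> HH" "deriv jinv (cis \<theta>) \<noteq> 0"
  shows "pres \<theta> (- 1 / cis \<theta>) = - (if even m then 1 else ieps s) * (1 / csqrt (cis \<theta>) powi (2 * s + 1)) * qexp (- m) (- 1 / cis \<theta> / 4)"
    "pres \<theta> (- 1 / (cis \<theta> + 1)) = - (if even m then 0 else 1 + ieps s) * (1 / csqrt (cis \<theta> + 1) powi (2 * s + 1)) * qexp (- m) (- 1 / (cis \<theta> + 1) / 4)"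
    "pres \<theta> (- 1 / (cis \<theta> - 1)) = - (if even m then 1 + ieps s else 0) * (1 / csqrt (cis \<theta> - 1) powi (2 * s + 1)) * qexp (- m) (- 1 / (cis \<theta> - 1) / 4)"
proof -
  have H: "cis \<theta> - 1 \<in> HH" "cis \<theta> + 1 \<in> HH" using c by (auto simp: HH_def)
  note nd = numer_diag[OF c]
  have j: "jprime (cis \<theta> - 1) = jprime (cis \<theta>)" "jprime (cis \<theta> + 1) = jprime (cis \<theta>)"
    "deriv jinv (cis \<theta> - 1) = deriv jinv (cis \<theta>)" "deriv jinv (cis \<theta> + 1) = deriv jinv (cis \<theta>)"
    using jprime_weight2(2)[OF H(1)] jprime_weight2(2)[OF c(1)] deriv_jinv_plus_1[OF H(1)] deriv_jinv_plus_1[OF c(1)] by simp_all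
  have n0: "numer \<theta> True (cis \<theta>) = jprime (cis \<theta>)" "numer \<theta> False (cis \<theta>) = - ieps s * jprime (cis \<theta>)"
    using numer_T[OF H(1), of \<theta>] nd by simp_all
  have n1: "numer \<theta> True (cis \<theta> + 1) = jprime (cis \<theta>)" "numer \<theta> False (cis \<theta> + 1) = - 1 * jprime (cis \<theta>)"
    using numer_T[OF c(1), of \<theta>] n0 by (simp_all add: mult.assoc[symmetric] ieps_sq)
  have v0: "(1 + ieps s) / 2 * (if even m then 1 + - ieps s else 1 - - ieps s) = (if even m then 1 else ieps s)"
    by (cases "even m") (simp_all add: field_simps ieps_sq)
  show "pres \<theta> (- 1 / cis \<theta>) = - (if even m then 1 else ieps s) * (1 / csqrt (cis \<theta>) powi (2 * s + 1)) * qexp (- m) (- 1 / cis \<theta> / 4)"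
    using pres_neg_inverse[OF c n0] unfolding v0 .
  have v1: "(1 + ieps s) / 2 * (if even m then 1 + - 1 else 1 - - 1) = (if even m then 0 else 1 + ieps s)" by simp
  show "pres \<theta> (- 1 / (cis \<theta> + 1)) = - (if even m then 0 else 1 + ieps s) * (1 / csqrt (cis \<theta> + 1) powi (2 * s + 1)) * qexp (- m) (- 1 / (cis \<theta> + 1) / 4)"
    using pres_neg_inverse[OF H(2), of \<theta> "- 1"] c(2) n1 unfolding j v1 by simp
  have v2: "(1 + ieps s) / 2 * (if even m then 1 + 1 else 1 - 1) = (if even m then 1 + ieps s else 0)" by simp
  show "pres \<theta> (- 1 / (cis \<theta> - 1)) = - (if even m then 1 + ieps s else 0) * (1 / csqrt (cis \<theta> - 1) powi (2 * s + 1)) * qexp (- m) (- 1 / (cis \<theta> - 1) / 4)"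
    using pres_neg_inverse[OF H(1), of \<theta> 1] c(2) nd unfolding j v2 by simp
qed

text \<open>Lowering the segment from height 2 to y crosses exactly the poles in \<open>pts\<close>,
  since no point of the fibre lies above height 1. The level y' < y makes the strip an open
  neighbourhood of the closed rectangle.\<close>

lemma kern_residue_sum:
  assumes th: "pi / 3 < \<theta>" "\<theta> < 2 * pi / 3" and dj: "deriv jinv (cis \<theta>) \<noteq> 0" and c0: "cos \<theta> \<noteq> 0"
    and y: "0 \<le> y'" "y' < y" "y < 2" and fin: "finite pts"
    and pole: "\<And>T. y' < Im T \<Longrightarrow> - \<bar>cos \<theta>\<bar> < Re T \<Longrightarrow> Re T < 1 + \<bar>cos \<theta>\<bar> \<Longrightarrow> jinv T = jinv (cis \<theta>) \<Longrightarrow> T \<in> pts"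
    and pts: "\<And>p. p \<in> pts \<Longrightarrow> 0 < Re p \<and> Re p < 1 \<and> y < Im p \<and> jinv p = jinv (cis \<theta>) \<and> deriv jinv p \<noteq> 0"
  shows "contour_integral (unit_seg 0 y) (kern \<theta>) = F m ((cis \<theta> - 1) / 4) + (\<Sum>p\<in>pts. pres \<theta> p)"
proof -
  define c where "c = \<bar>cos \<theta>\<bar>"
  have c: "c > 0" using c0 by (simp add: c_def)
  define S where "S = {T. - c < Re T} \<inter> {T. Re T < 1 + c} \<inter> {T. y' < Im T}"
  have So: "open S" unfolding S_def by (intro open_Int open_halfspace_Re_gt open_halfspace_Re_lt open_halfspace_Im_gt)
  have Sc: "connected S" unfolding S_def
    by (intro convex_connected convex_Int convex_halfspace_Re_gt convex_halfspace_Re_lt convex_halfspace_Im_gt)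
  have SH: "S \<subseteq> HH" using y by (auto simp: S_def HH_def)
  have pS: "pts \<subseteq> S" using pts y c by (force simp: S_def)
  have nz: "jinv T \<noteq> jinv (cis \<theta>)" if "T \<in> S - pts" for T using that pole[of T] by (auto simp: S_def c_def)
  have hol: "kern \<theta> holomorphic_on S - pts" by (rule kern_hol) (use SH nz in auto)
  have lt2: "Im p < 2" if "p \<in> pts" for p
    using jinv_ne_arc_high[OF th, of p] pts[OF that] by linarith
  have "contour_integral (unit_seg 0 y) (kern \<theta>) - contour_integral (unit_seg 0 2) (kern \<theta>) = 2 * of_real pi * \<i> * (\<Sum>p\<in>pts. residue (kern \<theta>) p)"
  proof (rule rectangle_residues_periodic[OF hol So Sc fin])
    show "cbox (Complex 0 y) (Complex (0 + 1) 2) \<subseteq> S" using y c by (auto simp: S_def in_cbox_complex_iff)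
    show "pts \<subseteq> box (Complex 0 y) (Complex (0 + 1) 2)" using pts lt2 by (auto simp: in_box_complex_iff)
    show "kern \<theta> (t + 1) = kern \<theta> t" if "y \<le> Im t" "Im t \<le> 2" for t
      by (rule kern_T) (use that y in \<open>simp add: HH_def\<close>)
  qed (use y in auto)
  moreover have "contour_integral (unit_seg 0 2) (kern \<theta>) = F m ((cis \<theta> - 1) / 4)"
    by (rule contour_integral_kern_high[OF th dj]) simp
  moreover have "residue (kern \<theta>) p = numer \<theta> (even m) p * qexp (- m) (p / 4) / deriv jinv p" if p: "p \<in> pts" for p
    unfolding kern_def[abs_def]
  proof (rule residue_quotient[of "S - (pts - {p})"])
    have sub: "S - (pts - {p}) \<subseteq> HH" using SH by blast
    show "open (S - (pts - {p}))" using So fin by (simp add: finite_imp_closed open_Diff)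
    show "p \<in> S - (pts - {p})" using pS p by blast
    show "(\<lambda>T. numer \<theta> (even m) T * qexp (- m) (T / 4)) holomorphic_on S - (pts - {p})"
      by (intro holomorphic_intros holomorphic_on_subset[OF numer_hol sub] qexp4_hol)
    show "(\<lambda>T. jinv T - jinv (cis \<theta>)) holomorphic_on S - (pts - {p})"
      by (intro holomorphic_intros holomorphic_on_subset[OF jinv_holomorphic sub])
    show "((\<lambda>T. jinv T - jinv (cis \<theta>)) has_field_derivative deriv jinv p) (at p)"
      using pS p SH by (auto intro!: derivative_eq_intros DERIV_jinv)
    show "jinv w - jinv (cis \<theta>) \<noteq> 0" if "w \<in> S - (pts - {p})" "w \<noteq> p" for w using nz[of w] that by auto
  qed (use pts[OF p] in auto)
  ultimately show ?thesis by (simp add: pres_def sum_distrib_left algebra_simps)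
qed

lemma arc_pole_point:
  assumes cH: "cis \<theta> \<in> HH" and dj: "deriv jinv (cis \<theta>) \<noteq> 0"
  defines "good \<equiv> \<lambda>T x. T \<in> HH \<and> jinv T = jinv (cis \<theta>) \<and> deriv jinv T \<noteq> 0 \<and> pres \<theta> T = x"
  shows "good (cis \<theta> + (if b then 0 else 1)) (- qexp (- m) ((cis \<theta> - 1) / 4))"
    and "good (- 1 / cis \<theta> + (if b then 1 else 0)) (pres \<theta> (- 1 / cis \<theta>))"
    and "good (- 1 / (cis \<theta> + 1) + 1) (pres \<theta> (- 1 / (cis \<theta> + 1)))"
    and "good (- 1 / (cis \<theta> - 1)) (pres \<theta> (- 1 / (cis \<theta> - 1)))"
proof -
  have p1: "good (T + 1) x" if "good T x" for T x
    using that jinv_plus_1[of T] deriv_jinv_plus_1[of T] pres_T[of T \<theta>] unfolding good_def by (simp add: HH_def)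
  have s1: "good (- 1 / T) (pres \<theta> (- 1 / T))" if "good T x" for T x
  proof -
    have T: "T \<in> HH" "T \<noteq> 0" using that by (auto simp: good_def HH_def)
    show ?thesis using that T(2) jinv_inv[OF T(1)] deriv_jinv_inv[OF T(1)] HH_neg_inverse[OF T(1)] unfolding good_def by simp
  qed
  have g0: "good (cis \<theta>) (- qexp (- m) ((cis \<theta> - 1) / 4))" using assms pres_diag unfolding good_def by simp
  have H: "cis \<theta> - 1 \<in> HH" using cH by (simp add: HH_def)
  have gm: "good (cis \<theta> - 1) (pres \<theta> (cis \<theta> - 1))"
    using H jinv_plus_1[OF H] deriv_jinv_plus_1[OF H] dj unfolding good_def by simp
  show "good (cis \<theta> + (if b then 0 else 1)) (- qexp (- m) ((cis \<theta> - 1) / 4))"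
    using g0 p1[OF g0] by (cases b) simp_all
  show "good (- 1 / cis \<theta> + (if b then 1 else 0)) (pres \<theta> (- 1 / cis \<theta>))"
    using s1[OF g0] p1[OF s1[OF g0]] by (cases b) simp_all
  show "good (- 1 / (cis \<theta> + 1) + 1) (pres \<theta> (- 1 / (cis \<theta> + 1)))" by (rule p1[OF s1[OF p1[OF g0]]])
  show "good (- 1 / (cis \<theta> - 1)) (pres \<theta> (- 1 / (cis \<theta> - 1)))" by (rule s1[OF gm])
qed

end

text \<open>17/20 lies below sin \<theta> > 0.86, and 0.7225 exceeds the squared heights of the
  other two families, which stay below 0.49 when |cos \<theta>| \<le> 0.27.\<close>

lemma jinv_ne_arc_middle:
  assumes th: "5 * pi / 12 \<le> \<theta>" "\<theta> \<le> 7 * pi / 12" and T: "Im T = 17 / 20"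
  shows "jinv T \<noteq> jinv (cis \<theta>)"
proof
  assume eq: "jinv T = jinv (cis \<theta>)"
  have th': "pi / 3 < \<theta>" "\<theta> < 2 * pi / 3" using th pi_gt_zero by linarith+
  have "(1 - cos \<theta>) / (4 * (1 + cos \<theta>)) < 49 / 100" "(1 + cos \<theta>) / (4 * (1 - cos \<theta>)) < 49 / 100"
    using arc_middle_cos[OF th] by (auto simp: field_simps abs_le_iff)
  moreover have "(Im T)\<^sup>2 = 289 / 400" unfolding T by (simp add: power2_eq_square)
  moreover have "1 / 2 < Im T" using T by simp
  note jinv_eq_arc_height[OF th' this eq]
  ultimately show False using T arc_bounds(3)[OF th'] by linarith
qed

text \<open>For |cos \<theta>| > 1/4 the two squared heights lie on opposite sides of (11/20)^2 =
  0.3025: one exceeds 5/12, the other is below 0.15.\<close>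

lemma jinv_ne_arc_outer:
  assumes th: "pi / 3 < \<theta>" "\<theta> < 2 * pi / 3" and out: "\<theta> < 5 * pi / 12 \<or> 7 * pi / 12 < \<theta>" and T: "Im T = 11 / 20"
  shows "jinv T \<noteq> jinv (cis \<theta>)"
proof
  assume eq: "jinv T = jinv (cis \<theta>)"
  define c where "c = cos \<theta>"
  have cb: "\<bar>c\<bar> < 1 / 2" unfolding c_def by (rule arc_bounds(2)[OF th])
  have "(Im T)\<^sup>2 = 121 / 400" unfolding T by (simp add: power2_eq_square)
  moreover have "1 / 2 < Im T" using T by simp
  note jinv_eq_arc_height[OF th this eq]
  moreover from out have "c > 1 / 4 \<or> c < - (1 / 4)"
    unfolding c_def using arc_left_cos[OF th(1)] arc_right_cos[OF _ th(2)] by blast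
  then have "(1 - c) / (4 * (1 + c)) \<noteq> 121 / 400 \<and> (1 + c) / (4 * (1 - c)) \<noteq> 121 / 400"
    using cb by (auto simp: field_simps)
  ultimately show False using T arc_bounds(3)[OF th] unfolding c_def by auto
qed

section \<open>Residues as the cosine and the error terms\<close>

context basis_pair
begin

text \<open>The normalising factor in front of the integral. It cancels the modulus of the residues
  at Z and - 1 / Z and makes them complex conjugate.\<close>

definition phase :: "real \<Rightarrow> complex" where
  "phase \<theta> = exp (\<i> * of_real (wt s * \<theta> / 2)) * of_real (exp (- pi * m / 2 * sin \<theta>))"

definition angle :: "real \<Rightarrow> real" where
  "angle \<theta> = wt s * \<theta> / 2 + pi * m / 2 - pi * m * cos \<theta> / 2"

lemma phase_polar: "phase \<theta> = of_real (exp (- pi * m / 2 * sin \<theta>)) * cis (wt s * \<theta> / 2)"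
  unfolding phase_def cis_conv_exp by (simp only: mult.commute)

lemma phase_diag: "phase \<theta> * qexp (- m) ((cis \<theta> - 1) / 4) = cis (angle \<theta>)"
proof -
  have "exp (- pi * m / 2 * sin \<theta>) * exp (- 2 * pi * real_of_int (- m) * Im ((cis \<theta> - 1) / 4)) = 1"
    unfolding exp_add[symmetric] by simp
  moreover have "wt s * \<theta> / 2 + 2 * pi * real_of_int (- m) * Re ((cis \<theta> - 1) / 4) = angle \<theta>"
    by (simp add: angle_def field_simps)
  ultimately show ?thesis unfolding phase_polar qexp_polar polar_mult by (simp only: of_real_1 mult_1)
qed

lemma phase_neg_inverse:
  assumes "0 < \<theta>" "\<theta> < pi"
  shows "phase \<theta> * ((if even m then 1 else ieps s) * (1 / csqrt (cis \<theta>) powi (2 * s + 1)) * qexp (- m) (- 1 / cis \<theta> / 4)) = cis (- angle \<theta>)"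
proof -
  have k: "csqrt (cis \<theta>) powi (2 * s + 1) = of_real 1 * cis (wt s * \<theta>)"
    using csqrt_powi_polar[of 1 \<theta> s] assms by simp
  have e: "(if even m then 1 else ieps s) = of_real 1 * cis (2 * pi * real_of_int (- m) * (1 / 4))"
    unfolding qexp_m_quarter[symmetric] qexp_polar by simp
  have c: "Re (- 1 / cis \<theta> / 4) = - cos \<theta> / 4" "Im (- 1 / cis \<theta> / 4) = sin \<theta> / 4"
    unfolding neg_inverse_cis by simp_all
  have "exp (- pi * m / 2 * sin \<theta>) * (1 * (1 / 1) * exp (- 2 * pi * real_of_int (- m) * (sin \<theta> / 4))) = 1"
    unfolding mult_1 div_by_1 exp_add[symmetric] by simp
  moreover have "wt s * \<theta> / 2 + (2 * pi * real_of_int (- m) * (1 / 4) + - (wt s * \<theta>) + 2 * pi * real_of_int (- m) * (- cos \<theta> / 4)) = - angle \<theta>"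
    by (simp add: angle_def field_simps)
  ultimately show ?thesis unfolding e k polar_inverse phase_polar qexp_polar c polar_mult by (simp only: of_real_1 mult_1)
qed

text \<open>Admissibility leaves m only the residue 0 and one odd residue modulo 4, so the parity of
  m decides the case; likewise for \<open>dmk\<close>.\<close>

lemma cmk_eq: "cmk m s = (if even m then 1 + ieps s else 0)"
proof -
  have "m mod 4 = 0 \<longleftrightarrow> even m"
    using m_plus unfolding plus_cond_iff by (cases "even s") (simp; presburger)+
  then show ?thesis by (simp add: cmk_def ieps_def)
qed

lemma dmk_eq: "dmk m s = (if even m then 0 else 1 + ieps s)"
proof -
  have "m mod 4 = (if even s then 3 else 1) \<longleftrightarrow> odd m" "m mod 4 = (if even s then 1 else 3) \<Longrightarrow> False"
    using m_plus unfolding plus_cond_iff by (cases "even s"; simp; presburger)+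
  then show ?thesis by (cases "even s") (simp_all add: dmk_def ieps_def)
qed

text \<open>In polar form Z + 1 = 2 cos (\<theta> / 2) cis (\<theta> / 2), so the phase k \<theta> /
  2 cancels. Re (- 1 / (Z + 1)) = -1/2 gives the factor exp (\<pi> \<i> m / 4), and the height tan
  (\<theta> / 2) / 2 the real exponential.\<close>

lemma phase_right:
  assumes "0 < \<theta>" "\<theta> < pi"
  shows "phase \<theta> * (- (if even m then 0 else 1 + ieps s) * (1 / csqrt (cis \<theta> + 1) powi (2 * s + 1)) * qexp (- m) (- 1 / (cis \<theta> + 1) / 4)) = DD m s \<theta>"
proof -
  define t where "t = \<theta> / 2"
  have ct: "cos t > 0" using assms unfolding t_def by (intro cos_gt_zero_pi) auto
  have k: "csqrt (cis \<theta> + 1) powi (2 * s + 1) = of_real ((2 * cos t) powr wt s) * cis (wt s * t)"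
    unfolding cis_plus_1_polar t_def[symmetric] by (rule csqrt_powi_polar) (use ct assms in \<open>auto simp: t_def\<close>)
  have p: "- 1 / (cis \<theta> + 1) / 4 = - (of_real (1 / (2 * cos t)) * cis (- t)) / 4"
    unfolding cis_plus_1_polar t_def[symmetric] polar_inverse[symmetric] by simp
  have c: "Re (- 1 / (cis \<theta> + 1) / 4) = - 1 / 8" "Im (- 1 / (cis \<theta> + 1) / 4) = tan t / 8"
    unfolding p using ct by (simp_all add: tan_def)
  define d where "d = (if even m then 0 else 1 + ieps s)"
  have "exp (- pi * m / 2 * sin \<theta>) * ((1 / (2 * cos t) powr wt s) * exp (- 2 * pi * real_of_int (- m) * (tan t / 8)))
      = 2 powr (- wt s) * cos t powr (- wt s) * exp (pi * m / 2 * (tan t / 2 - sin \<theta>))"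
  proof -
    have "1 / (2 * cos t) powr wt s = 2 powr (- wt s) * cos t powr (- wt s)"
      using ct by (simp add: powr_mult powr_minus field_simps)
    moreover have "pi * m / 2 * (tan t / 2 - sin \<theta>) = - pi * m / 2 * sin \<theta> + - 2 * pi * real_of_int (- m) * (tan t / 8)"
      by (simp add: field_simps)
    ultimately show ?thesis by (simp only: exp_add mult_ac)
  qed
  moreover have "wt s * \<theta> / 2 + (- (wt s * t) + 2 * pi * real_of_int (- m) * (- 1 / 8)) = pi * m / 4" by (simp add: t_def field_simps)
  ultimately have main: "phase \<theta> * ((1 / csqrt (cis \<theta> + 1) powi (2 * s + 1)) * qexp (- m) (- 1 / (cis \<theta> + 1) / 4)) =
      of_real (2 powr (- wt s) * cos t powr (- wt s) * exp (pi * m / 2 * (tan t / 2 - sin \<theta>))) * cis (pi * m / 4)"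
    unfolding k polar_inverse phase_polar qexp_polar c polar_mult by (simp only:)
  have fac: "phase \<theta> * (- d * K * q) = - d * (phase \<theta> * (K * q))" for K q by simp
  have cisx: "cis (pi * m / 4) = exp (of_real pi * \<i> * of_int m / 4)"
    unfolding cis_conv_exp by (rule arg_cong[where f = exp]) simp
  show ?thesis
    unfolding DD_def dmk_eq d_def[symmetric] t_def[symmetric] fac main cisx of_real_mult by (simp only: mult_ac)
qed

text \<open>Z - 1 = 2 sin (\<theta> / 2) cis (\<theta> / 2 + \<pi> / 2): the extra quarter turn,
  with 2^(- k), is the principal power (2 \<i>)^(- k). The real part 1/2 gives exp (- \<pi> \<i> m /
  4).\<close>

lemma phase_left:
  assumes "0 < \<theta>" "\<theta> < pi"
  shows "phase \<theta> * (- (if even m then 1 + ieps s else 0) * (1 / csqrt (cis \<theta> - 1) powi (2 * s + 1)) * qexp (- m) (- 1 / (cis \<theta> - 1) / 4)) = CC m s \<theta>"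
proof -
  define t where "t = \<theta> / 2"
  have st: "sin t > 0" using assms unfolding t_def by (intro sin_gt_zero) auto
  have ct: "cos t > 0" using assms unfolding t_def by (intro cos_gt_zero_pi) auto
  have k: "csqrt (cis \<theta> - 1) powi (2 * s + 1) = of_real ((2 * sin t) powr wt s) * cis (wt s * (t + pi / 2))"
    unfolding cis_minus_1_polar t_def[symmetric] by (rule csqrt_powi_polar) (use st assms in \<open>auto simp: t_def\<close>)
  have p: "- 1 / (cis \<theta> - 1) / 4 = - (of_real (1 / (2 * sin t)) * cis (- (t + pi / 2))) / 4"
    unfolding cis_minus_1_polar t_def[symmetric] polar_inverse[symmetric] by simp
  have c: "Re (- 1 / (cis \<theta> - 1) / 4) = 1 / 8" "Im (- 1 / (cis \<theta> - 1) / 4) = 1 / tan t / 8"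
    unfolding p using st ct by (simp_all add: tan_def cos_add sin_add cos_diff sin_diff)
  define d where "d = (if even m then 1 + ieps s else 0)"
  have "exp (- pi * m / 2 * sin \<theta>) * ((1 / (2 * sin t) powr wt s) * exp (- 2 * pi * real_of_int (- m) * (1 / tan t / 8)))
      = 2 powr (- wt s) * sin t powr (- wt s) * exp (pi * m / 2 * (1 / (2 * tan t) - sin \<theta>))"
  proof -
    have "1 / (2 * sin t) powr wt s = 2 powr (- wt s) * sin t powr (- wt s)"
      using st by (simp add: powr_mult powr_minus field_simps)
    moreover have "pi * m / 2 * (1 / (2 * tan t) - sin \<theta>) = - pi * m / 2 * sin \<theta> + - 2 * pi * real_of_int (- m) * (1 / tan t / 8)"
      by (simp add: algebra_simps)
    ultimately show ?thesis by (simp only: exp_add mult_ac)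
  qed
  moreover have "wt s * \<theta> / 2 + (- (wt s * (t + pi / 2)) + 2 * pi * real_of_int (- m) * (1 / 8)) = - (wt s * pi / 2) + - (pi * m / 4)"
    by (simp add: t_def field_simps)
  ultimately have main: "phase \<theta> * ((1 / csqrt (cis \<theta> - 1) powi (2 * s + 1)) * qexp (- m) (- 1 / (cis \<theta> - 1) / 4)) =
      of_real (2 powr (- wt s) * sin t powr (- wt s) * exp (pi * m / 2 * (1 / (2 * tan t) - sin \<theta>))) * cis (- (wt s * pi / 2) + - (pi * m / 4))"
    unfolding k polar_inverse phase_polar qexp_polar c polar_mult by (simp only:)
  have fac: "phase \<theta> * (- d * K * q) = - d * (phase \<theta> * (K * q))" for K q by simp
  have cisx: "cis (- (pi * m / 4)) = exp (- of_real pi * \<i> * of_int m / 4)"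
    unfolding cis_conv_exp by (rule arg_cong[where f = exp]) simp
  show ?thesis
    unfolding CC_def cmk_eq d_def[symmetric] t_def[symmetric] fac main cis_mult[symmetric] two_ii_powr cisx of_real_mult
    by (simp only: mult_ac)
qed

lemma cis_pair: "cis x + cis (- x) = 2 * of_real (cos x)"
  by (simp add: complex_eq_iff)

text \<open>Two poles, translated into (0, 1): Z and - 1 / Z, whose residues give cis (angle) and
  cis (- angle). cos \<theta> \<noteq> 0 keeps them off the vertical sides, and j' \<noteq> 0 makes
  them simple.\<close>

lemma generic_middle:
  assumes th: "5 * pi / 12 \<le> \<theta>" "\<theta> \<le> 7 * pi / 12" and dj: "deriv jinv (cis \<theta>) \<noteq> 0" and c0: "cos \<theta> \<noteq> 0"
  shows "phase \<theta> * contour_integral (unit_seg 0 (17/20)) (kern \<theta>) = phase \<theta> * F m ((cis \<theta> - 1) / 4) - 2 * of_real (cos (angle \<theta>)) + 0"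
proof -
  have th': "pi / 3 < \<theta>" "\<theta> < 2 * pi / 3" "0 < \<theta>" "\<theta> < pi" using th pi_gt_zero by linarith+
  note b = arc_bounds[OF th'(1,2)]
  define p1 where "p1 = cis \<theta> + (if cos \<theta> > 0 then 0 else 1)"
  define p2 where "p2 = - 1 / cis \<theta> + (if cos \<theta> > 0 then 1 else 0)"
  note g = arc_pole_point(1,2)[OF b(4) dj, where b = "cos \<theta> > 0", folded p1_def p2_def]
  have c1: "Re p1 = cos \<theta> + (if cos \<theta> > 0 then 0 else 1)" "Im p1 = sin \<theta>" by (simp_all add: p1_def)
  have c2: "Re p2 = - cos \<theta> + (if cos \<theta> > 0 then 1 else 0)" "Im p2 = sin \<theta>" unfolding p2_def neg_inverse_cis by simp_all
  \<comment> \<open>Puts - 1 / (Z + 1) and - 1 / (Z - 1) below 7/10, the bottom of the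
    strip.\<close>
  have sq: "(1 - cos \<theta>) / (4 * (1 + cos \<theta>)) < 49 / 100" "(1 + cos \<theta>) / (4 * (1 - cos \<theta>)) < 49 / 100"
    using arc_middle_cos[OF th] by (auto simp: field_simps abs_le_iff)
  have "contour_integral (unit_seg 0 (17/20)) (kern \<theta>) = F m ((cis \<theta> - 1) / 4) + (\<Sum>p\<in>{p1, p2}. pres \<theta> p)"
  proof (rule kern_residue_sum[OF th'(1,2) dj c0, of "7/10"])
    fix T assume T: "7 / 10 < Im T" "- \<bar>cos \<theta>\<bar> < Re T" "Re T < 1 + \<bar>cos \<theta>\<bar>" "jinv T = jinv (cis \<theta>)"
    have "(Im T)\<^sup>2 > (7 / 10)\<^sup>2" using T by (intro power_strict_mono) auto
    then have T2: "(Im T)\<^sup>2 > 49 / 100" by (simp add: power2_eq_square)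
    have T': "Im T > 1 / 2" using T by simp
    have "T \<noteq> - 1 / (cis \<theta> + 1) + 1"
    proof
      assume "T = - 1 / (cis \<theta> + 1) + 1"
      then have "Im T = Im (- 1 / (cis \<theta> + 1))" by (simp only: plus_complex.sel one_complex.sel add_0_right)
      then show False using cis_plus_1_neg_inverse(2)[OF b(1)] T2 sq by (simp only:)
    qed
    moreover have "T \<noteq> - 1 / (cis \<theta> - 1)"
    proof
      assume "T = - 1 / (cis \<theta> - 1)"
      then show False using cis_minus_1_neg_inverse(2)[OF b(1)] T2 sq by (simp only:)
    qed
    ultimately show "T \<in> {p1, p2}" using jinv_poles_strip[OF th'(1,2) c0 T' T(2-4)] unfolding p1_def p2_def by blast
  next
    fix p assume "p \<in> {p1, p2}"
    then show "0 < Re p \<and> Re p < 1 \<and> 17 / 20 < Im p \<and> jinv p = jinv (cis \<theta>) \<and> deriv jinv p \<noteq> 0"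
      using c1 c2 g b c0 by (auto split: if_splits)
  qed auto
  moreover have "p1 \<noteq> p2" using c1(1) c2(1) b(2) by (auto split: if_splits)
  ultimately have I: "contour_integral (unit_seg 0 (17/20)) (kern \<theta>) = F m ((cis \<theta> - 1) / 4) - qexp (- m) ((cis \<theta> - 1) / 4)
      - (if even m then 1 else ieps s) * (1 / csqrt (cis \<theta>) powi (2 * s + 1)) * qexp (- m) (- 1 / cis \<theta> / 4)"
    using g pres_values(1)[OF b(4) dj] by simp
  show ?thesis
    unfolding I right_diff_distrib phase_diag phase_neg_inverse[OF th'(3,4)] cis_pair[symmetric] by simp
qed

text \<open>For cos \<theta> > 1/4 the point - 1 / (Z - 1) rises above 11/20 and contributes a third
  residue, while - 1 / (Z + 1) stays below 1/2, the bottom of the strip.\<close>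

lemma generic_left:
  assumes th: "pi / 3 < \<theta>" "\<theta> < 5 * pi / 12" and dj: "deriv jinv (cis \<theta>) \<noteq> 0" and c0: "cos \<theta> \<noteq> 0"
  shows "phase \<theta> * contour_integral (unit_seg 0 (11/20)) (kern \<theta>) = phase \<theta> * F m ((cis \<theta> - 1) / 4) - 2 * of_real (cos (angle \<theta>)) + CC m s \<theta>"
proof -
  have th': "pi / 3 < \<theta>" "\<theta> < 2 * pi / 3" "0 < \<theta>" "\<theta> < pi" using th pi_gt_zero by linarith+
  note b = arc_bounds[OF th'(1,2)]
  have c: "cos \<theta> > 1 / 4" by (rule arc_left_cos[OF th])
  define p1 where "p1 = cis \<theta> + (if True then 0 else 1)"
  define p2 where "p2 = - 1 / cis \<theta> + (if True then 1 else 0)"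
  define p4 where "p4 = - 1 / (cis \<theta> - 1)"
  note g = arc_pole_point(1,2)[OF b(4) dj, where b = True, folded p1_def p2_def] arc_pole_point(4)[OF b(4) dj, folded p4_def]
  have c1: "Re p1 = cos \<theta>" "Im p1 = sin \<theta>" by (simp_all add: p1_def)
  have c2: "Re p2 = 1 - cos \<theta>" "Im p2 = sin \<theta>" unfolding p2_def neg_inverse_cis by simp_all
  note c4 = cis_minus_1_neg_inverse[OF b(1), folded p4_def]
  have sq: "(1 - cos \<theta>) / (4 * (1 + cos \<theta>)) < 1 / 4" "(1 + cos \<theta>) / (4 * (1 - cos \<theta>)) > 121 / 400"
    using c b(2) by (auto simp: field_simps abs_less_iff)
  have i4: "Im p4 > 11 / 20"
  proof -
    have "(11 / 20)\<^sup>2 < (Im p4)\<^sup>2" unfolding c4(2) using sq(2) by (simp add: power2_eq_square)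
    moreover have "Im p4 \<ge> 0" using g(3) by (simp add: HH_def)
    ultimately show ?thesis by (rule power2_less_imp_less)
  qed
  have "contour_integral (unit_seg 0 (11/20)) (kern \<theta>) = F m ((cis \<theta> - 1) / 4) + (\<Sum>p\<in>{p1, p2, p4}. pres \<theta> p)"
  proof (rule kern_residue_sum[OF th'(1,2) dj c0, of "1/2"])
    fix T assume T: "1 / 2 < Im T" "- \<bar>cos \<theta>\<bar> < Re T" "Re T < 1 + \<bar>cos \<theta>\<bar>" "jinv T = jinv (cis \<theta>)"
    have "(Im T)\<^sup>2 > (1 / 2)\<^sup>2" using T by (intro power_strict_mono) auto
    then have T2: "(Im T)\<^sup>2 > 1 / 4" by (simp add: power2_eq_square)
    have "T \<noteq> - 1 / (cis \<theta> + 1) + 1"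
    proof
      assume "T = - 1 / (cis \<theta> + 1) + 1"
      then have "Im T = Im (- 1 / (cis \<theta> + 1))" by (simp only: plus_complex.sel one_complex.sel add_0_right)
      then show False using cis_plus_1_neg_inverse(2)[OF b(1)] T2 sq by (simp only:)
    qed
    then show "T \<in> {p1, p2, p4}" using jinv_poles_strip[OF th'(1,2) c0 T] c unfolding p1_def p2_def p4_def by auto
  next
    fix p assume "p \<in> {p1, p2, p4}"
    then show "0 < Re p \<and> Re p < 1 \<and> 11 / 20 < Im p \<and> jinv p = jinv (cis \<theta>) \<and> deriv jinv p \<noteq> 0"
      using c1 c2 c4(1) i4 c g b by auto
  qed auto
  moreover have "pres \<theta> p4 = - (if even m then 1 + ieps s else 0) * (1 / csqrt (cis \<theta> - 1) powi (2 * s + 1)) * qexp (- m) (- 1 / (cis \<theta> - 1) / 4)"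
    unfolding p4_def by (rule pres_values(3)[OF b(4) dj])
  moreover have "p1 \<noteq> p2" "p1 \<noteq> p4" "p2 \<noteq> p4" using c1(1) c2(1) c4(1) b(2) by auto
  ultimately have I: "contour_integral (unit_seg 0 (11/20)) (kern \<theta>) = F m ((cis \<theta> - 1) / 4) - qexp (- m) ((cis \<theta> - 1) / 4)
      - (if even m then 1 else ieps s) * (1 / csqrt (cis \<theta>) powi (2 * s + 1)) * qexp (- m) (- 1 / cis \<theta> / 4)
      + - (if even m then 1 + ieps s else 0) * (1 / csqrt (cis \<theta> - 1) powi (2 * s + 1)) * qexp (- m) (- 1 / (cis \<theta> - 1) / 4)"
    using g(1,2) pres_values(1)[OF b(4) dj] by simp
  show ?thesis
    unfolding I right_diff_distrib distrib_left phase_diag phase_neg_inverse[OF th'(3,4)] phase_left[OF th'(3,4)] cis_pair[symmetric] by simp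
qed

text \<open>The mirror image: now - 1 / (Z + 1) is high, and it is translated by 1 to real part 1/2,
  while - 1 / (Z - 1) drops below 1/2.\<close>

lemma generic_right:
  assumes th: "7 * pi / 12 < \<theta>" "\<theta> < 2 * pi / 3" and dj: "deriv jinv (cis \<theta>) \<noteq> 0" and c0: "cos \<theta> \<noteq> 0"
  shows "phase \<theta> * contour_integral (unit_seg 0 (11/20)) (kern \<theta>) = phase \<theta> * F m ((cis \<theta> - 1) / 4) - 2 * of_real (cos (angle \<theta>)) + DD m s \<theta>"
proof -
  have th': "pi / 3 < \<theta>" "\<theta> < 2 * pi / 3" "0 < \<theta>" "\<theta> < pi" using th pi_gt_zero by linarith+
  note b = arc_bounds[OF th'(1,2)]
  have c: "cos \<theta> < - (1 / 4)" by (rule arc_right_cos[OF th])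
  define p1 where "p1 = cis \<theta> + (if False then 0 else 1)"
  define p2 where "p2 = - 1 / cis \<theta> + (if False then 1 else 0)"
  define p3 where "p3 = - 1 / (cis \<theta> + 1) + 1"
  note g = arc_pole_point(1,2)[OF b(4) dj, where b = False, folded p1_def p2_def] arc_pole_point(3)[OF b(4) dj, folded p3_def]
  have c1: "Re p1 = cos \<theta> + 1" "Im p1 = sin \<theta>" by (simp_all add: p1_def)
  have c2: "Re p2 = - cos \<theta>" "Im p2 = sin \<theta>" unfolding p2_def neg_inverse_cis by simp_all
  have p3: "Re p3 = Re (- 1 / (cis \<theta> + 1)) + 1" "Im p3 = Im (- 1 / (cis \<theta> + 1))" by (simp_all only: p3_def plus_complex.sel one_complex.sel add_0_right)
  have c3: "Re p3 = 1 / 2" "(Im p3)\<^sup>2 = (1 - cos \<theta>) / (4 * (1 + cos \<theta>))" unfolding p3 cis_plus_1_neg_inverse[OF b(1)] by simp_all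
  have sq: "(1 + cos \<theta>) / (4 * (1 - cos \<theta>)) < 1 / 4" "(1 - cos \<theta>) / (4 * (1 + cos \<theta>)) > 121 / 400"
    using c b(2) by (auto simp: field_simps abs_less_iff)
  have i3: "Im p3 > 11 / 20"
  proof -
    have "(11 / 20)\<^sup>2 < (Im p3)\<^sup>2" unfolding c3(2) using sq(2) by (simp add: power2_eq_square)
    moreover have "Im p3 \<ge> 0" using g(3) by (simp add: HH_def)
    ultimately show ?thesis by (rule power2_less_imp_less)
  qed
  have "contour_integral (unit_seg 0 (11/20)) (kern \<theta>) = F m ((cis \<theta> - 1) / 4) + (\<Sum>p\<in>{p1, p2, p3}. pres \<theta> p)"
  proof (rule kern_residue_sum[OF th'(1,2) dj c0, of "1/2"])
    fix T assume T: "1 / 2 < Im T" "- \<bar>cos \<theta>\<bar> < Re T" "Re T < 1 + \<bar>cos \<theta>\<bar>" "jinv T = jinv (cis \<theta>)"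
    have "(Im T)\<^sup>2 > (1 / 2)\<^sup>2" using T by (intro power_strict_mono) auto
    then have T2: "(Im T)\<^sup>2 > 1 / 4" by (simp add: power2_eq_square)
    have "T \<noteq> - 1 / (cis \<theta> - 1)"
    proof
      assume "T = - 1 / (cis \<theta> - 1)"
      then show False using cis_minus_1_neg_inverse(2)[OF b(1)] T2 sq by (simp only:)
    qed
    then show "T \<in> {p1, p2, p3}" using jinv_poles_strip[OF th'(1,2) c0 T] c unfolding p1_def p2_def p3_def by auto
  next
    fix p assume "p \<in> {p1, p2, p3}"
    then show "0 < Re p \<and> Re p < 1 \<and> 11 / 20 < Im p \<and> jinv p = jinv (cis \<theta>) \<and> deriv jinv p \<noteq> 0"
      using c1 c2 c3(1) i3 c g b by auto
  qed auto
  moreover have "p1 \<noteq> p2" "p1 \<noteq> p3" "p2 \<noteq> p3" using c1(1) c2(1) c3(1) b(2) by auto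
  ultimately have I: "contour_integral (unit_seg 0 (11/20)) (kern \<theta>) = F m ((cis \<theta> - 1) / 4) - qexp (- m) ((cis \<theta> - 1) / 4)
      - (if even m then 1 else ieps s) * (1 / csqrt (cis \<theta>) powi (2 * s + 1)) * qexp (- m) (- 1 / cis \<theta> / 4)
      + - (if even m then 0 else 1 + ieps s) * (1 / csqrt (cis \<theta> + 1) powi (2 * s + 1)) * qexp (- m) (- 1 / (cis \<theta> + 1) / 4)"
    using g pres_values(1)[OF b(4) dj] pres_values(2)[OF b(4) dj] by simp
  show ?thesis
    unfolding I right_diff_distrib distrib_left phase_diag phase_neg_inverse[OF th'(3,4)] phase_right[OF th'(3,4)] cis_pair[symmetric] by simp
qed

end

section \<open>Exceptional angles\<close>

text \<open>j' is not identically zero, so its zeros are isolated, and cis is injective near the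
  angle; cos vanishes only at \<pi> / 2 in the range considered.\<close>

lemma arc_eventually_generic:
  assumes th: "pi / 3 < \<theta>\<^sub>0" "\<theta>\<^sub>0 < 2 * pi / 3"
  shows "\<forall>\<^sub>F \<theta> in at \<theta>\<^sub>0. deriv jinv (cis \<theta>) \<noteq> 0 \<and> cos \<theta> \<noteq> 0"
proof -
  have cH: "cis \<theta>\<^sub>0 \<in> HH" by (rule arc_bounds[OF th])
  have th0: "0 < \<theta>\<^sub>0" "\<theta>\<^sub>0 < pi" using th pi_gt_zero by linarith+
  obtain \<beta> where b: "\<beta> \<in> HH" "deriv jinv \<beta> \<noteq> 0"
  proof (rule ccontr)
    assume "\<not> thesis"
    then have z: "deriv jinv z = 0" if "z \<in> HH" for z using that \<open>\<And>\<beta>. \<beta> \<in> HH \<Longrightarrow> deriv jinv \<beta> \<noteq> 0 \<Longrightarrow> thesis\<close> by blast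
    have "(jinv has_field_derivative 0) (at z within HH)" if "z \<in> HH" for z
      using DERIV_jinv[OF that] z[OF that] by (simp add: has_field_derivative_at_within)
    then have "\<exists>c. \<forall>z\<in>HH. jinv z = c" by (intro has_field_derivative_zero_constant convex_HH) blast
    then show False using jinv_not_constant unfolding constant_on_def by blast
  qed
  have ev: "\<forall>\<^sub>F w in at (cis \<theta>\<^sub>0). deriv jinv w \<noteq> 0"
  proof (cases "deriv jinv (cis \<theta>\<^sub>0) = 0")
    case True
    obtain r where "0 < r" "\<And>z. z \<in> ball (cis \<theta>\<^sub>0) r - {cis \<theta>\<^sub>0} \<Longrightarrow> deriv jinv z \<noteq> 0"
      using isolated_zeros[OF deriv_jinv_holomorphic open_HH connected_HH cH True b] by metis
    then show ?thesis unfolding eventually_at by (intro exI[of _ r]) (auto simp: dist_commute)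
  next
    case False
    have "isCont (deriv jinv) (cis \<theta>\<^sub>0)"
      using holomorphic_on_imp_continuous_on[OF deriv_jinv_holomorphic] open_HH cH continuous_on_eq_continuous_at by blast
    then show ?thesis using False by (intro tendsto_imp_eventually_ne) (auto simp: isCont_def)
  qed
  have rng: "\<forall>\<^sub>F \<theta> in at \<theta>\<^sub>0. \<theta> \<in> {0<..<pi}" by (rule eventually_at_in_open') (use th0 in auto)
  have ne: "\<forall>\<^sub>F \<theta> in at \<theta>\<^sub>0. \<theta> \<noteq> x" for x by (rule eventually_neq_at_within)
  have "filterlim cis (at (cis \<theta>\<^sub>0)) (at \<theta>\<^sub>0)"
  proof (rule filterlim_atI)
    have "isCont (\<lambda>t. exp (\<i> * of_real t)) \<theta>\<^sub>0" by (intro continuous_intros)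
    then have "isCont cis \<theta>\<^sub>0" by (simp add: cis_conv_exp[abs_def])
    then show "(cis \<longlongrightarrow> cis \<theta>\<^sub>0) (at \<theta>\<^sub>0)" by (simp add: isCont_def)
    show "\<forall>\<^sub>F \<theta> in at \<theta>\<^sub>0. cis \<theta> \<noteq> cis \<theta>\<^sub>0"
      using rng ne[of \<theta>\<^sub>0]
    proof eventually_elim
      case (elim \<theta>)
      show ?case
      proof
        assume "cis \<theta> = cis \<theta>\<^sub>0"
        then have "cos \<theta> = cos \<theta>\<^sub>0" by (simp add: complex_eq_iff)
        then have "\<theta> = \<theta>\<^sub>0" using cos_inj_pi[of \<theta> \<theta>\<^sub>0] elim th0 by simp
        then show False using elim by simp
      qed
    qed
  qed
  then have "\<forall>\<^sub>F \<theta> in at \<theta>\<^sub>0. deriv jinv (cis \<theta>) \<noteq> 0" using ev unfolding filterlim_iff by blast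
  then show ?thesis using rng ne[of "pi / 2"]
  proof eventually_elim
    case (elim \<theta>)
    have "cos \<theta> \<noteq> 0"
    proof
      assume "cos \<theta> = 0"
      then have "\<theta> = pi / 2" using cos_inj_pi[of \<theta> "pi / 2"] elim by simp
      then show False using elim by simp
    qed
    then show ?case using elim by blast
  qed
qed

context basis_pair
begin

lemma wh_hol: "wh_mod t f \<Longrightarrow> f holomorphic_on HH"
  by (simp add: wh_mod_def)

lemma vvc_hol: "wh_mod t f \<Longrightarrow> vvc p f holomorphic_on HH"
  using wh_mod_vvmf[of t f] by (cases p) (simp_all add: vvmf_def)

text \<open>No pole meets the segment for any angle in the range, so the integrand is jointly
  continuous in the angle and the parameter, and so is its integral.\<close>

lemma kern_integral_continuous:
  assumes I: "\<And>\<theta>. \<theta> \<in> I \<Longrightarrow> cis \<theta> \<in> HH" and y: "y > 0"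
    and nz: "\<And>\<theta> T. \<theta> \<in> I \<Longrightarrow> Im T = y \<Longrightarrow> jinv T \<noteq> jinv (cis \<theta>)"
  shows "continuous_on I (\<lambda>\<theta>. contour_integral (unit_seg 0 y) (kern \<theta>))"
proof -
  define L where "L x = of_real x + \<i> * of_real y" for x :: real
  have L: "unit_seg 0 y x = L x" for x by (simp add: linepath_def L_def complex_eq_iff algebra_simps)
  have e: "contour_integral (unit_seg 0 y) (kern \<theta>) = integral (cbox 0 1) (\<lambda>x. kern \<theta> (L x))" for \<theta>
    by (simp add: contour_integral_integral L)
  let ?X = "I \<times> cbox 0 (1::real)"
  have LH: "L x \<in> HH" "Im (L x) = y" for x using y by (simp_all add: L_def HH_def)
  have cL: "continuous_on ?X (\<lambda>p. L (snd p))" unfolding L_def by (intro continuous_intros)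
  have cc: "continuous_on ?X (\<lambda>p. cis (fst p))" by (intro continuous_intros)
  have cF: "continuous_on ?X (\<lambda>p. f ((cis (fst p) - 1) / 4))" if "f holomorphic_on HH" for f
    by (rule continuous_on_compose2[OF holomorphic_on_imp_continuous_on[OF that]])
      (use I in \<open>auto intro!: continuous_intros cc simp: HH_def\<close>)
  have cj: "continuous_on ?X (\<lambda>p. jinv (cis (fst p)))"
    by (rule continuous_on_compose2[OF holomorphic_on_imp_continuous_on[OF jinv_holomorphic] cc]) (use I in auto)
  have cG: "continuous_on ?X (\<lambda>p. f (L (snd p)))" if "f holomorphic_on HH" for f
    by (rule continuous_on_compose2[OF holomorphic_on_imp_continuous_on[OF that] cL]) (use LH in auto)
  have c1: "continuous_on ?X (\<lambda>p. F (adm0 s) ((cis (fst p) - 1) / 4))" and c2: "continuous_on ?X (\<lambda>p. F (adm1 s) ((cis (fst p) - 1) / 4))"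
    by (rule cF[OF wh_hol[OF wh(1)]], rule cF[OF wh_hol[OF wh(2)]])
  have c3: "continuous_on ?X (\<lambda>p. vvc q (G (adm1 (1 - s))) (L (snd p)))" and c4: "continuous_on ?X (\<lambda>p. vvc q (G (adm0 (1 - s))) (L (snd p)))" for q
    by (rule cG[OF vvc_hol[OF wh(4)]], rule cG[OF vvc_hol[OF wh(3)]])
  have c5: "continuous_on ?X (\<lambda>p. qexp (- m) (L (snd p) / 4))" by (rule cG[OF qexp4_hol])
  have c6: "continuous_on ?X (\<lambda>p. jinv (L (snd p)))" by (rule cG[OF jinv_holomorphic])
  have "continuous_on ?X (\<lambda>p. kern (fst p) (L (snd p)))"
    unfolding kern_def numer_def
    by (intro continuous_on_divide continuous_on_mult continuous_on_add continuous_on_diff cj c1 c2 c3 c4 c5 c6)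
      (use nz LH(2) in auto)
  then have "continuous_on ?X (\<lambda>(\<theta>, x). kern \<theta> (L x))" by (simp add: case_prod_unfold)
  from integral_continuous_on_param[OF this] show ?thesis unfolding e .
qed

text \<open>Both sides are continuous in the angle and agree near every angle except possibly at the
  angle itself. An interval with more than one point has no isolated points, so they agree there
  too.\<close>

lemma generic_extend:
  assumes I: "connected I" "\<not> (\<exists>x. I = {x})" "\<And>\<theta>. \<theta> \<in> I \<Longrightarrow> pi / 3 < \<theta> \<and> \<theta> < 2 * pi / 3" and y: "y > 0"
    and nz: "\<And>\<theta> T. \<theta> \<in> I \<Longrightarrow> Im T = y \<Longrightarrow> jinv T \<noteq> jinv (cis \<theta>)" and E: "continuous_on I E"
    and gen: "\<And>\<theta>. \<theta> \<in> I \<Longrightarrow> deriv jinv (cis \<theta>) \<noteq> 0 \<Longrightarrow> cos \<theta> \<noteq> 0 \<Longrightarrow>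
      phase \<theta> * contour_integral (unit_seg 0 y) (kern \<theta>) = phase \<theta> * F m ((cis \<theta> - 1) / 4) - 2 * of_real (cos (angle \<theta>)) + E \<theta>"
    and \<theta>: "\<theta> \<in> I"
  shows "phase \<theta> * contour_integral (unit_seg 0 y) (kern \<theta>) = phase \<theta> * F m ((cis \<theta> - 1) / 4) - 2 * of_real (cos (angle \<theta>)) + E \<theta>"
proof -
  define h where "h t = phase t * contour_integral (unit_seg 0 y) (kern t) - (phase t * F m ((cis t - 1) / 4) - 2 * of_real (cos (angle t)) + E t)" for t
  have cH: "cis t \<in> HH" if "t \<in> I" for t using arc_bounds(4) I(3)[OF that] by blast
  have cp: "continuous_on I phase" unfolding phase_def[abs_def] by (intro continuous_intros) auto
  have ca: "continuous_on I angle" unfolding angle_def[abs_def] by (intro continuous_intros) auto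
  have ci: "continuous_on I (\<lambda>t. contour_integral (unit_seg 0 y) (kern t))"
    by (rule kern_integral_continuous[OF cH y]) (use nz in auto)
  have "F m holomorphic_on HH" using wh_m by (simp add: wh_mod_def)
  then have cF: "continuous_on I (\<lambda>t. F m ((cis t - 1) / 4))"
    by (rule continuous_on_compose2[OF holomorphic_on_imp_continuous_on])
      (use cH in \<open>auto intro!: continuous_intros simp: HH_def\<close>)
  have "continuous_on I h" unfolding h_def[abs_def] by (intro continuous_intros cp ca ci cF E)
  then have lim: "(h \<longlongrightarrow> h \<theta>) (at \<theta> within I)" using \<theta> by (simp add: continuous_on_def)
  have "\<forall>\<^sub>F t in at \<theta>. deriv jinv (cis t) \<noteq> 0 \<and> cos t \<noteq> 0"
    by (rule arc_eventually_generic) (use I(3)[OF \<theta>] in auto)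
  then have "\<forall>\<^sub>F t in at \<theta> within I. t \<in> I \<and> deriv jinv (cis t) \<noteq> 0 \<and> cos t \<noteq> 0"
    unfolding eventually_at_filter by (rule eventually_mono) blast
  then have "\<forall>\<^sub>F t in at \<theta> within I. h t = 0"
    by (rule eventually_mono) (simp add: h_def gen)
  then have lim0: "(h \<longlongrightarrow> 0) (at \<theta> within I)" by (rule tendsto_eventually)
  have "\<not> trivial_limit (at \<theta> within I)"
    unfolding trivial_limit_within using connected_imp_perfect[OF I(1) \<theta>] I(2) by blast
  then have "h \<theta> = 0" by (rule tendsto_unique[OF _ lim lim0])
  then show ?thesis by (simp add: h_def)
qed

lemma kern_middle:
  assumes th: "5 * pi / 12 \<le> \<theta>" "\<theta> \<le> 7 * pi / 12"
  shows "phase \<theta> * contour_integral (unit_seg 0 (17/20)) (kern \<theta>) = phase \<theta> * F m ((cis \<theta> - 1) / 4) - 2 * of_real (cos (angle \<theta>)) + 0"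
proof (rule generic_extend[of "{5 * pi / 12..7 * pi / 12}"])
  show "\<not> (\<exists>x. {5 * pi / 12..7 * pi / 12} = {x})"
  proof
    assume "\<exists>x. {5 * pi / 12..7 * pi / 12} = {x}"
    moreover have "5 * pi / 12 \<in> {5 * pi / 12..7 * pi / 12}" "7 * pi / 12 \<in> {5 * pi / 12..7 * pi / 12}" by auto
    ultimately have "5 * pi / 12 = 7 * pi / 12" by (metis singletonD)
    then show False by simp
  qed
  show "pi / 3 < t \<and> t < 2 * pi / 3" if "t \<in> {5 * pi / 12..7 * pi / 12}" for t
  proof -
    have "5 * pi / 12 \<le> t" "t \<le> 7 * pi / 12" using that by auto
    then show ?thesis using pi_gt_zero by linarith
  qed
qed (use th jinv_ne_arc_middle generic_middle in auto)

lemma CC_continuous: "I \<subseteq> {0<..<pi} \<Longrightarrow> continuous_on I (CC m s)"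
proof -
  assume I: "I \<subseteq> {0<..<pi}"
  have nz: "sin (t / 2) \<noteq> 0" "cos (t / 2) \<noteq> 0" "tan (t / 2) \<noteq> 0" if "t \<in> I" for t
  proof -
    have "0 < t / 2" "t / 2 < pi" "- (pi / 2) < t / 2" "t / 2 < pi / 2" using I that by auto
    then have "sin (t / 2) > 0" "cos (t / 2) > 0" by (auto intro: sin_gt_zero cos_gt_zero_pi)
    then show "sin (t / 2) \<noteq> 0" "cos (t / 2) \<noteq> 0" "tan (t / 2) \<noteq> 0" by (auto simp: tan_def)
  qed
  show ?thesis unfolding CC_def[abs_def] by (intro continuous_intros) (use nz in auto)
qed

lemma DD_continuous: "I \<subseteq> {0<..<pi} \<Longrightarrow> continuous_on I (DD m s)"
proof -
  assume I: "I \<subseteq> {0<..<pi}"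
  have nz: "cos (t / 2) \<noteq> 0" if "t \<in> I" for t
    using I that cos_gt_zero_pi[of "t / 2"] by auto
  show ?thesis unfolding DD_def[abs_def] by (intro continuous_intros) (use nz in auto)
qed

lemma kern_left:
  assumes th: "pi / 3 < \<theta>" "\<theta> < 5 * pi / 12"
  shows "phase \<theta> * contour_integral (unit_seg 0 (11/20)) (kern \<theta>) = phase \<theta> * F m ((cis \<theta> - 1) / 4) - 2 * of_real (cos (angle \<theta>)) + CC m s \<theta>"
proof (rule generic_extend[of "{pi / 3<..<5 * pi / 12}"])
  have "infinite {pi / 3<..<5 * pi / 12}" by (rule infinite_Ioo) simp
  then show "\<not> (\<exists>x. {pi / 3<..<5 * pi / 12} = {x})" by (metis finite.emptyI finite.insertI)
  have r: "pi / 3 < t \<and> t < 2 * pi / 3 \<and> 0 < t \<and> t < pi" if "t \<in> {pi / 3<..<5 * pi / 12}" for t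
  proof -
    have "pi / 3 < t" "t < 5 * pi / 12" using that by auto
    then show ?thesis using pi_gt_zero by linarith
  qed
  show "pi / 3 < t \<and> t < 2 * pi / 3" if "t \<in> {pi / 3<..<5 * pi / 12}" for t using r[OF that] by blast
  show "continuous_on {pi / 3<..<5 * pi / 12} (CC m s)" by (rule CC_continuous) (use r in auto)
  show "jinv T \<noteq> jinv (cis t)" if "t \<in> {pi / 3<..<5 * pi / 12}" "Im T = 11 / 20" for t T
    using jinv_ne_arc_outer[of t T] r[OF that(1)] that by auto
qed (use th generic_left in auto)

lemma kern_right:
  assumes th: "7 * pi / 12 < \<theta>" "\<theta> < 2 * pi / 3"
  shows "phase \<theta> * contour_integral (unit_seg 0 (11/20)) (kern \<theta>) = phase \<theta> * F m ((cis \<theta> - 1) / 4) - 2 * of_real (cos (angle \<theta>)) + DD m s \<theta>"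
proof (rule generic_extend[of "{7 * pi / 12<..<2 * pi / 3}"])
  have "infinite {7 * pi / 12<..<2 * pi / 3}" by (rule infinite_Ioo) simp
  then show "\<not> (\<exists>x. {7 * pi / 12<..<2 * pi / 3} = {x})" by (metis finite.emptyI finite.insertI)
  have r: "pi / 3 < t \<and> t < 2 * pi / 3 \<and> 0 < t \<and> t < pi" if "t \<in> {7 * pi / 12<..<2 * pi / 3}" for t
  proof -
    have "7 * pi / 12 < t" "t < 2 * pi / 3" using that by auto
    then show ?thesis using pi_gt_zero by linarith
  qed
  show "pi / 3 < t \<and> t < 2 * pi / 3" if "t \<in> {7 * pi / 12<..<2 * pi / 3}" for t using r[OF that] by blast
  show "continuous_on {7 * pi / 12<..<2 * pi / 3} (DD m s)" by (rule DD_continuous) (use r in auto)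
  show "jinv T \<noteq> jinv (cis t)" if "t \<in> {7 * pi / 12<..<2 * pi / 3}" "Im T = 11 / 20" for t T
    using jinv_ne_arc_outer[of t T] r[OF that(1)] that by auto
qed (use th generic_right in auto)

end

theorem theorem4p1:
  fixes s m :: int and \<theta> :: real
    and F G :: "int \<Rightarrow> complex \<Rightarrow> complex"
  assumes F: "canonical_basis s F"
    and G: "canonical_basis (1 - s) G"
    and m: "admissible s m"
    and th: "pi/3 < \<theta>" "\<theta> < 2*pi/3"
  defines "z \<equiv> - 1/4 + exp (\<i> * of_real \<theta>) / 4"
    and "v \<equiv> (if 5*pi/12 \<le> \<theta> \<and> \<theta> \<le> 7*pi/12 then 0.2125 else 0.1375 :: real)"
    and "E \<equiv> (if 5*pi/12 \<le> \<theta> \<and> \<theta> \<le> 7*pi/12 then 0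
              else if \<theta> < 5*pi/12 then CC m s \<theta> else DD m s \<theta>)"
    and "P \<equiv> exp (\<i> * of_real (wt s * \<theta> / 2)) * of_real (exp (- pi * m / 2 * sin \<theta>))"
  shows "(\<lambda>\<tau>. Bk s F G z \<tau> * qexp (- m) \<tau>) contour_integrable_on
            linepath (- 1/2 + \<i> * of_real v) (1/2 + \<i> * of_real v)
       \<and> P * contour_integral (linepath (- 1/2 + \<i> * of_real v) (1/2 + \<i> * of_real v))
              (\<lambda>\<tau>. Bk s F G z \<tau> * qexp (- m) \<tau>)
         = P * F m z - 2 * of_real (cos (wt s * \<theta> / 2 + pi * m / 2 - pi * m * cos \<theta> / 2)) + E"
proof -
  interpret basis_pair s m F G by unfold_locales (fact F G m)+
  have z: "z = (cis \<theta> - 1) / 4" unfolding z_def cis_conv_exp by (simp add: field_simps)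
  have P: "P = phase \<theta>" unfolding P_def phase_def ..
  have v0: "v > 0" by (simp add: v_def)
  have nz: "jinv T \<noteq> jinv (cis \<theta>)" if "Im T = 4 * v" for T
  proof (cases "5*pi/12 \<le> \<theta> \<and> \<theta> \<le> 7*pi/12")
    case True
    then show ?thesis using jinv_ne_arc_middle[of \<theta> T] that by (simp add: v_def)
  next
    case False
    then show ?thesis using jinv_ne_arc_outer[OF th, of T] that by (auto simp: v_def)
  qed
  note B = Bk_integral[OF z v0 arc_bounds(1)[OF th] nz]
  have "phase \<theta> * contour_integral (unit_seg 0 (4 * v)) (kern \<theta>)
      = phase \<theta> * F m ((cis \<theta> - 1) / 4) - 2 * of_real (cos (angle \<theta>)) + E"
  proof (cases "5*pi/12 \<le> \<theta> \<and> \<theta> \<le> 7*pi/12")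
    case True
    then have v: "4 * v = 17 / 20" and E: "E = 0" by (simp_all add: v_def E_def)
    show ?thesis unfolding v E by (rule kern_middle) (use True in auto)
  next
    case False
    then have v: "4 * v = 11 / 20" by (auto simp: v_def)
    show ?thesis
    proof (cases "\<theta> < 5*pi/12")
      case True
      then have E: "E = CC m s \<theta>" by (simp add: E_def)
      show ?thesis unfolding v E by (rule kern_left[OF th(1) True])
    next
      case not_left: False
      then have E: "E = DD m s \<theta>" and "7 * pi / 12 < \<theta>" using False by (auto simp: E_def)
      then show ?thesis unfolding v E by (intro kern_right[OF _ th(2)])
    qed
  qed
  then show ?thesis using B unfolding P z angle_def by simp
qed

end
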